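(* Let $N\ge 1$ and let $H\in C^2(\mathbf{R}^N\times\mathbf{R}^N;\mathbf{R})$ satisfy the following: there exist $\kappa>0$ and a function $h\in C(\mathbf{R};\mathbf{R}_+)$ with $h(r)/r\to 0$ as $r\to+\infty$ such that for all $(x,\xi)\in\mathbf{R}^N\times\mathbf{R}^N$, $$|\nabla_\xi H(x,\xi)|\le \kappa(1+|\xi|),\qquad |\nabla_x H(x,\xi)|\le h(|x|)+\kappa|\xi|,\qquad |\nabla^2 H(x,\xi)|\le\kappa .$$ Let $\Phi_t(x,\xi)=(X_t(x,\xi),\Xi_t(x,\xi))$ be the (global) Hamiltonian flow of $H$, i.e. $\frac{d}{dt}X_t=\nabla_\xi H(X_t,\Xi_t)$, $\frac{d}{dt}\Xi_t=-\nabla_x H(X_t,\Xi_t)$, $\Phi_0=\mathrm{Id}$. Let $U^{in}$ be a continuous vector field on $\mathbf{R}^N$ with $|U^{in}(y)|/|y|\to 0$ as $|y|\to\infty$, and set $F_t(y):=X_t(y,U^{in}(y))$. (a) For each $t\in\mathbf{R}$, the map $F_t:\mathbf{R}^N\to\mathbf{R}^N$ is proper and onto, and for each $T>0$, $\sup_{|t|\le T}|F_t(y)-y|=o(|y|)$ as $|y|\to\infty$. Assume moreover that for every bounded open set $\Omega\subset\mathbf{R}^N$ and all $k,l=1,\dots,N$, the distributional derivative $\partial_l U^{in}_k$ restricted to $\Omega$ belongs to the Lorentz space $L^{N,1}(\Omega)$. Then $U^{in}$ is differentiable outside the Lebesgue-negligible set $E$ of its non-differentiability points, and with the notation of the context: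 (b) for each $t\in\mathbf{R}$, $J_t\in L^1_{loc}(\mathbf{R}^N)$; (c) for each $t\in\mathbf{R}$, the set $F_t^{-1}(\{x\})$ is finite for a.e. $x\in\mathbf{R}^N$; (d) for each $t\in\mathbf{R}$, each $R>0$ and each $n\in\mathbf{N}$ (with $n\ge1$), $$\mathcal{L}^N(\{x\in\mathbf{R}^N:\ \mathcal{N}_R(t,x)\ge n\})\le \frac1n e^{N\kappa|t|}\,\big\|1+|DU^{in}|\big\|_{L^N(B(0,R))}^N;$$ (e) for each $t\in\mathbf{R}$, $\mathcal{L}^N(C_t)=0$; (f) for each $T>0$, $\mathcal{H}^1(\{(t,y)\in[-T,T]\times\mathbf{R}^N:\ F_t(y)=x\})<+\infty$ for a.e. $x\in\mathbf{R}^N$.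
   Context: $\mathcal{L}^N$ is Lebesgue measure and $\mathcal{H}^1$ is one-dimensional Hausdorff measure. A measurable $f:\Omega\to\mathbf{R}$ belongs to $L^{N,1}(\Omega)$ if $\int_0^\infty \big(\mathcal{L}^N(\{x\in\Omega: |f(x)|\ge\lambda\})\big)^{1/N}d\lambda<\infty$. $E:=\{y\in\mathbf{R}^N: U^{in}\text{ is not differentiable at }y\}$. For $y\in\mathbf{R}^N\setminus E$, $J_t(y):=|\det DF_t(y)|$. $Z_t:=\{y\in\mathbf{R}^N\setminus E: J_t(y)=0\}$. The caustic fiber is $C_t:=\{x\in\mathbf{R}^N: F_t^{-1}(\{x\})\cap(Z_t\cup E)\neq\emptyset\}$. For $R>0$, $\mathcal{N}_R(t,x):=\#\big(F_t^{-1}(\{x\})\cap\overline{B(0,R)}\big)$ (set to $+\infty$ if this set is infinite). $|DU^{in}|$ denotes the (a.e. defined) norm of the Jacobian matrix of $U^{in}$. *)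

theory Defs
  imports "HOL-Analysis.Analysis"
begin

definition partial_deriv :: "'n::finite \<Rightarrow> (real^'n \<Rightarrow> real) \<Rightarrow> real^'n \<Rightarrow> real" where
  "partial_deriv l f x = frechet_derivative f (at x) (axis l 1)"

fun Ck :: "nat \<Rightarrow> (real^'n::finite \<Rightarrow> real) \<Rightarrow> bool" where
  "Ck 0 f = continuous_on UNIV f"
| "Ck (Suc k) f = ((\<forall>x. f differentiable (at x)) \<and> (\<forall>l. Ck k (partial_deriv l f)))"

definition smooth_fun :: "(real^'n::finite \<Rightarrow> real) \<Rightarrow> bool" where
  "smooth_fun f \<longleftrightarrow> (\<forall>k. Ck k f)"

definition test_fun :: "(real^'n::finite) set \<Rightarrow> (real^'n \<Rightarrow> real) \<Rightarrow> bool" where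
  "test_fun \<Omega> \<phi> \<longleftrightarrow> smooth_fun \<phi> \<and> compact (closure {x. \<phi> x \<noteq> 0}) \<and> closure {x. \<phi> x \<noteq> 0} \<subseteq> \<Omega>"

definition lorentz_N1 :: "(real^'n::finite) set \<Rightarrow> (real^'n \<Rightarrow> real) \<Rightarrow> bool" where
  "lorentz_N1 \<Omega> f \<longleftrightarrow>
     f \<in> borel_measurable (restrict_space lebesgue \<Omega>) \<and>
     (\<integral>\<^sup>+ s\<in>{0..}. ennreal ((measure lebesgue {x\<in>\<Omega>. \<bar>f x\<bar> \<ge> s}) powr (1 / real CARD('n))) \<partial>lborel) < \<infinity>"

definition weak_deriv_in_lorentz :: "(real^'n::finite \<Rightarrow> real^'n) \<Rightarrow> 'n \<Rightarrow> 'n \<Rightarrow> (real^'n) set \<Rightarrow> bool" where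
  "weak_deriv_in_lorentz U k l \<Omega> \<longleftrightarrow>
     (\<exists>g. lorentz_N1 \<Omega> g \<and>
        (\<forall>\<phi>. test_fun \<Omega> \<phi> \<longrightarrow>
           (\<integral>y. U y $ k * partial_deriv l \<phi> y \<partial>lebesgue) = - (\<integral>y. g y * \<phi> y \<partial>lebesgue)))"

definition hausdorff1 :: "'a::metric_space set \<Rightarrow> ennreal" where
  "hausdorff1 A = (SUP \<delta>\<in>{0<..}. INF S\<in>{S :: nat \<Rightarrow> 'a set.
        A \<subseteq> (\<Union>i. S i) \<and> (\<forall>i. bounded (S i) \<and> diameter (S i) \<le> \<delta>)}.
        (\<Sum>i. ennreal (diameter (S i))))"

definition nondiff_set :: "(real^'n::finite \<Rightarrow> real^'n) \<Rightarrow> (real^'n) set" where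
  "nondiff_set U = {y. \<not> U differentiable (at y)}"

text \<open>J_t(y) = |det DF_t(y)| for y outside E (set to 0 on E, where it is not defined).\<close>
definition jac_det :: "(real^'n::finite \<Rightarrow> real^'n) \<Rightarrow> (real \<Rightarrow> real^'n \<Rightarrow> real^'n) \<Rightarrow> real \<Rightarrow> real^'n \<Rightarrow> real" where
  "jac_det U F t y = (if y \<in> nondiff_set U then 0 else \<bar>det (jacobian (F t) (at y))\<bar>)"

definition zero_jac_set :: "(real^'n::finite \<Rightarrow> real^'n) \<Rightarrow> (real \<Rightarrow> real^'n \<Rightarrow> real^'n) \<Rightarrow> real \<Rightarrow> (real^'n) set" where
  "zero_jac_set U F t = {y. y \<notin> nondiff_set U \<and> jac_det U F t y = 0}"

definition caustic :: "(real^'n::finite \<Rightarrow> real^'n) \<Rightarrow> (real \<Rightarrow> real^'n \<Rightarrow> real^'n) \<Rightarrow> real \<Rightarrow> (real^'n) set" where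
  "caustic U F t = {x. F t -` {x} \<inter> (zero_jac_set U F t \<union> nondiff_set U) \<noteq> {}}"

definition count_R :: "(real \<Rightarrow> real^'n::finite \<Rightarrow> real^'n) \<Rightarrow> real \<Rightarrow> real \<Rightarrow> real^'n \<Rightarrow> enat" where
  "count_R F R t x = (let S = F t -` {x} \<inter> cball 0 R in if finite S then enat (card S) else \<infinity>)"

end

theory Submission
  imports Defs
begin

text \<open>
By Gronwall's inequality the flow is \<open>C\<^sup>1\<close> with Lipschitz constant \<open>e^(\<kappa>|t|)\<close>, hence
\<open>|F t y - F t z| \<le> e^(\<kappa>|t|) (|y - z| + |U y - U z|)\<close>, and the sublinear growth of \<open>h\<close> and \<open>U\<close> gives \<open>F t y - y = o(|y|)\<close>;
properness is then immediate and surjectivity follows from Brouwer's theorem.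

If the weak gradient of \<open>U\<close> is in \<open>L\<^sup>N\<^sup>,\<^sup>1\<close>, comparing averages of \<open>U\<close> over shrinking cubes bounds the oscillation of \<open>U\<close> on
a cube by the Lorentz norm of the gradient there, and a weight built from the distribution function of the gradient turns
this into a Rado--Reichelderfer estimate: the \<open>N\<close>-th power of the oscillation on a cube is at most the integral over that
cube of a fixed integrable \<open>\<Theta>\<close>. Applied to \<open>U\<close> minus affine maps it yields differentiability almost everywhere. It passes to
\<open>F t\<close>, where it gives Lusin's property (N) and with it the area inequality and the Sard-type statement on the caustic.
Finally, space-time boxes of side \<open>\<delta>\<close> have images of measure at most the integral of \<open>\<Theta>\<close> over the spatial cube, and there are
about \<open>1/\<delta>\<close> time steps, so the mean total diameter of the boxes meeting a fibre stays bounded as \<open>\<delta> \<rightarrow> 0\<close>.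
\<close>

section \<open>Gronwall's inequality and differentiability of flows\<close>

text \<open>For N \<ge> 2 a gradient in L^N gives neither continuity nor Lusin's property (N); the
  second Lorentz exponent 1 is what bounds an oscillation. A Lorentz norm is not a measure, though,
  and outer regularity, Lebesgue differentiation and sums over grids all want one. This is why the
  norm on a cube is traded for the integral of a density. The constants of that trade are large and
  depend on N, so the Rado--Reichelderfer estimate is used qualitatively: null sets have null
  images, |DU|^N is locally integrable, fibre lengths are finite. The constant e^(N \<kappa> |t|) of
  (d) has another source. Where U is differentiable, F t has local Lipschitz constant at most
  e^(\<kappa>|t|) (1 + |DU|); disjoint Vitali balls lose no factor, and what they miss is null and
  has a null image. Hence 1 + |DU|, and not the Jacobian determinant, stands in (d). Multiplicities
  are counted through the cells of a grid, which makes them measurable. For (f) a single density has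
  to serve all times in [-T, T]. It does, because a time step as long as the side of a cube moves
  points by a multiple of that side, and the N-th power of the side is the volume of the
  cube.\<close>

lemma has_real_derivative_sqrt_of_pos:
  fixes f :: "real \<Rightarrow> real"
  assumes "(f has_real_derivative D) (at x)" "f x > 0"
  shows "((\<lambda>x. sqrt (f x)) has_real_derivative D / (2 * sqrt (f x))) (at x)"
proof (rule DERIV_cong)
  show "((\<lambda>x. sqrt (f x)) has_real_derivative (inverse (sqrt (f x)) / 2) * D) (at x)"
    by (rule DERIV_chain2[where f = sqrt and g = f]) (rule DERIV_real_sqrt assms)+
qed (simp only: divide_inverse inverse_mult_distrib mult_ac)

text \<open>The norm is not differentiable at 0, so the argument runs with the smooth majorant sqrt
  (|w|^2 + d^2), called \<open>f\<close>: the function exp (- L s) f(s) - b s is nonincreasing on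
  [0, T], and d is made small at the end. Estimating exp (- L s) b by b loses sharpness but keeps
  the bound meaningful for L = 0.\<close>

lemma gronwall_norm:
  fixes w :: "real \<Rightarrow> 'a::real_inner"
  assumes w: "\<And>t. (w has_vector_derivative w' t) (at t)"
    and bd: "\<And>t. 0 \<le> t \<Longrightarrow> t \<le> T \<Longrightarrow> norm (w' t) \<le> L * norm (w t) + b"
    and "0 \<le> L" "0 \<le> b" "0 \<le> T"
  shows "norm (w T) \<le> exp (L * T) * (norm (w 0) + b * T)"
proof -
  have main: "norm (w T) \<le> exp (L * T) * (norm (w 0) + b * T) + e" if "e > 0" for e
  proof -
    \<comment> \<open>With this choice the error exp (L T) d is exactly e.\<close>
    define d where "d = e * exp (- (L * T))"
    have d: "d > 0" using that by (simp add: d_def)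
    define f where "f s = sqrt (w s \<bullet> w s + d\<^sup>2)" for s
    have pos: "w s \<bullet> w s + d\<^sup>2 > 0" for s
      using d by (simp add: add_nonneg_pos)
    have fpos: "f s > 0" for s using pos by (simp add: f_def)
    have nf: "norm (w s) \<le> f s" for s
      unfolding f_def norm_eq_sqrt_inner by (intro real_sqrt_le_mono) auto
    have f0: "f 0 \<le> norm (w 0) + d"
    proof -
      have "f 0 \<le> sqrt (w 0 \<bullet> w 0) + sqrt (d\<^sup>2)"
        unfolding f_def by (rule sqrt_add_le_add_sqrt) auto
      then show ?thesis using d by (simp add: norm_eq_sqrt_inner)
    qed
    have df: "(f has_real_derivative (w s \<bullet> w' s) / f s) (at s)" for s
    proof -
      have w1: "(w has_derivative (\<lambda>h. h *\<^sub>R w' s)) (at s)"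
        using w[of s] by (simp add: has_vector_derivative_def)
      have "((\<lambda>s. w s \<bullet> w s + d\<^sup>2) has_derivative (\<lambda>h. w s \<bullet> (h *\<^sub>R w' s) + (h *\<^sub>R w' s) \<bullet> w s)) (at s)"
        using has_derivative_add[OF has_derivative_inner[OF w1 w1] has_derivative_const] by simp
      then have h2: "((\<lambda>s. w s \<bullet> w s + d\<^sup>2) has_real_derivative 2 * (w s \<bullet> w' s)) (at s)"
        unfolding has_field_derivative_def
        by (rule has_derivative_eq_rhs) (auto simp: inner_commute algebra_simps)
      from has_real_derivative_sqrt_of_pos[OF h2 pos]
      have "((\<lambda>s. sqrt (w s \<bullet> w s + d\<^sup>2)) has_real_derivative (w s \<bullet> w' s) / f s) (at s)"
        by (simp add: f_def)
      moreover have "(\<lambda>s. sqrt (w s \<bullet> w s + d\<^sup>2)) = f" by (simp add: f_def fun_eq_iff)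
      ultimately show ?thesis by simp
    qed
    define g where "g s = exp (- (L * s)) * f s - b * s" for s
    have dg: "(g has_real_derivative exp (- (L * s)) * ((w s \<bullet> w' s) / f s - L * f s) - b) (at s)" for s
    proof -
      have "((\<lambda>s. exp (- (L * s))) has_real_derivative exp (- (L * s)) * (- L)) (at s)"
        by (auto intro!: derivative_eq_intros)
      from DERIV_diff[OF DERIV_mult[OF this df] DERIV_cmult_Id[of b]]
      show ?thesis unfolding g_def by (rule DERIV_cong) (simp add: algebra_simps)
    qed
    have "g T \<le> g 0"
    proof (rule DERIV_nonpos_imp_nonincreasing[OF \<open>0 \<le> T\<close>])
      fix s assume s: "0 \<le> s" "s \<le> T"
      have "w s \<bullet> w' s \<le> norm (w s) * norm (w' s)" by (rule norm_cauchy_schwarz)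
      also have "\<dots> \<le> f s * (L * f s + b)"
      proof (rule mult_mono[OF nf])
        show "norm (w' s) \<le> L * f s + b"
          using bd[OF s] mult_left_mono[OF nf[of s] \<open>0 \<le> L\<close>] by linarith
      qed (use fpos less_imp_le in auto)
      finally have "(w s \<bullet> w' s) / f s \<le> L * f s + b"
        using fpos[of s] by (simp add: pos_divide_le_eq mult.commute)
      then have "exp (- (L * s)) * ((w s \<bullet> w' s) / f s - L * f s) \<le> exp (- (L * s)) * b"
        by (intro mult_left_mono) auto
      also have "\<dots> \<le> 1 * b"
        using s \<open>0 \<le> L\<close> \<open>0 \<le> b\<close> by (intro mult_right_mono) auto
      finally show "\<exists>y. (g has_real_derivative y) (at s) \<and> y \<le> 0"
        using dg[of s] by (intro exI[of _ "exp (- (L * s)) * ((w s \<bullet> w' s) / f s - L * f s) - b"]) auto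
    qed
    then have "exp (- (L * T)) * f T \<le> norm (w 0) + d + b * T"
      using f0 by (simp add: g_def)
    then have "exp (L * T) * (exp (- (L * T)) * f T) \<le> exp (L * T) * (norm (w 0) + d + b * T)"
      by (intro mult_left_mono) auto
    moreover have "exp (L * T) * (exp (- (L * T)) * f T) = f T"
      by (simp add: exp_minus)
    ultimately have "f T \<le> exp (L * T) * (norm (w 0) + d + b * T)" by linarith
    also have "\<dots> = exp (L * T) * (norm (w 0) + b * T) + exp (L * T) * d" by (simp add: algebra_simps)
    also have "exp (L * T) * d = e" by (simp add: d_def exp_minus)
    finally show ?thesis using nf[of T] by linarith
  qed
  then show ?thesis by (rule field_le_epsilon)
qed

text \<open>Negative times are reduced to positive ones by running \<open>w\<close> backwards; the
  differential inequality involves norms only and is unchanged.\<close>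

lemma gronwall_norm_abs:
  fixes w :: "real \<Rightarrow> 'a::real_inner"
  assumes w: "\<And>t. (w has_vector_derivative w' t) (at t)"
    and bd: "\<And>s. \<bar>s\<bar> \<le> \<bar>t\<bar> \<Longrightarrow> norm (w' s) \<le> L * norm (w s) + b"
    and "0 \<le> L" "0 \<le> b"
  shows "norm (w t) \<le> exp (L * \<bar>t\<bar>) * (norm (w 0) + b * \<bar>t\<bar>)"
proof (cases "0 \<le> t")
  case True
  then have "norm (w t) \<le> exp (L * t) * (norm (w 0) + b * t)"
    by (intro gronwall_norm[OF w] bd assms(3,4)) auto
  then show ?thesis using True by simp
next
  case False
  have "((\<lambda>s. w (- s)) has_vector_derivative - w' (- s)) (at s)" for s
    using vector_diff_chain_at[OF has_vector_derivative_minus[OF has_vector_derivative_id] w] by (simp add: o_def)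
  then have "norm (w (- (- t))) \<le> exp (L * - t) * (norm (w (- 0)) + b * - t)"
    by (rule gronwall_norm) (use False in \<open>auto intro!: bd assms(3,4)\<close>)
  then show ?thesis using False by simp
qed

text \<open>A criterion that does not name the derivative: at every small scale h, \<open>f\<close>
  is almost the linear interpolation of its own values at the h-multiples of the basis vectors. It
  suits flows, where such a comparison is an estimate between solutions of one linear equation, and
  the variational equation itself need not be solved.\<close>

lemma differentiable_at_zero_of_approx_linear:
  fixes f :: "'a::euclidean_space \<Rightarrow> 'b::banach"
  assumes f0: "f 0 = 0"
    and lin: "\<And>e. e > 0 \<Longrightarrow> \<exists>d>0. \<forall>v h. norm v < d \<and> 0 < h \<and> h < d \<longrightarrow>
      norm (f v - (\<Sum>i\<in>Basis. ((v \<bullet> i) / h) *\<^sub>R f (h *\<^sub>R i))) \<le> e * norm v"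
  shows "f differentiable (at 0)"
proof -
  define h where "h n = 1 / real (Suc n)" for n
  have h: "h n > 0" for n by (simp add: h_def)
  have hlim: "h \<longlonglongrightarrow> 0"
    unfolding h_def using LIMSEQ_inverse_real_of_nat by (simp add: inverse_eq_divide)
  have hev: "\<forall>\<^sub>F n in sequentially. h n < d" if "d > 0" for d
    using order_tendstoD(2)[OF hlim that] .
  have "\<exists>l. (\<lambda>n. f (h n *\<^sub>R i) /\<^sub>R h n) \<longlonglongrightarrow> l" if i: "i \<in> Basis" for i
  proof -
    have "Cauchy (\<lambda>n. f (h n *\<^sub>R i) /\<^sub>R h n)"
    proof (rule metric_CauchyI)
      fix e :: real assume "e > 0"
      then obtain d where d: "d > 0" and D: "\<And>v h. norm v < d \<Longrightarrow> 0 < h \<Longrightarrow> h < d \<Longrightarrow>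
          norm (f v - (\<Sum>i\<in>Basis. ((v \<bullet> i) / h) *\<^sub>R f (h *\<^sub>R i))) \<le> e / 2 * norm v"
        using lin[of "e/2"] by auto
      obtain M where M: "\<And>n. n \<ge> M \<Longrightarrow> h n < d"
        using hev[OF d] by (auto simp: eventually_sequentially)
      show "\<exists>M. \<forall>m\<ge>M. \<forall>n\<ge>M. dist (f (h m *\<^sub>R i) /\<^sub>R h m) (f (h n *\<^sub>R i) /\<^sub>R h n) < e"
      proof (intro exI allI impI)
        fix m n assume mn: "m \<ge> M" "n \<ge> M"
        \<comment> \<open>For v = h m times a basis vector one term of the sum survives, so the
          hypothesis compares the difference quotients at the two scales \<open>h m\<close> and
          \<open>h n\<close>; they form a Cauchy sequence.\<close>
        have "norm (f (h m *\<^sub>R i) - (\<Sum>j\<in>Basis. (((h m *\<^sub>R i) \<bullet> j) / h n) *\<^sub>R f (h n *\<^sub>R j))) \<le> e/2 * norm (h m *\<^sub>R i)"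
          using M[OF mn(1)] M[OF mn(2)] h[of m] h[of n] i by (intro D) auto
        also have "(\<Sum>j\<in>Basis. (((h m *\<^sub>R i) \<bullet> j) / h n) *\<^sub>R f (h n *\<^sub>R j)) =
            (\<Sum>j\<in>Basis. if j = i then (h m / h n) *\<^sub>R f (h n *\<^sub>R i) else 0)"
          by (intro sum.cong) (use i in \<open>auto simp: inner_Basis\<close>)
        also have "\<dots> = (h m / h n) *\<^sub>R f (h n *\<^sub>R i)" using i by simp
        finally have *: "norm (f (h m *\<^sub>R i) - (h m / h n) *\<^sub>R f (h n *\<^sub>R i)) \<le> e/2 * h m"
          using i h[of m] by simp
        have "norm (f (h m *\<^sub>R i) /\<^sub>R h m - f (h n *\<^sub>R i) /\<^sub>R h n)
            = norm ((1 / h m) *\<^sub>R (f (h m *\<^sub>R i) - (h m / h n) *\<^sub>R f (h n *\<^sub>R i)))"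
          using h[of m] h[of n] by (intro arg_cong[of _ _ norm]) (simp add: scaleR_diff_right field_simps)
        also have "\<dots> = norm (f (h m *\<^sub>R i) - (h m / h n) *\<^sub>R f (h n *\<^sub>R i)) / h m"
          using h[of m] by simp
        also have "\<dots> \<le> e/2" using * h[of m] by (simp add: field_simps)
        finally show "dist (f (h m *\<^sub>R i) /\<^sub>R h m) (f (h n *\<^sub>R i) /\<^sub>R h n) < e"
          using \<open>e > 0\<close> by (simp add: dist_norm)
      qed
    qed
    then show ?thesis using Cauchy_convergent_iff convergent_def by blast
  qed
  then obtain M where M: "\<And>i. i \<in> Basis \<Longrightarrow> (\<lambda>n. f (h n *\<^sub>R i) /\<^sub>R h n) \<longlonglongrightarrow> M i"
    by metis
  have "(f has_derivative (\<lambda>v. \<Sum>i\<in>Basis. (v \<bullet> i) *\<^sub>R M i)) (at 0)"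
    unfolding has_derivative_at_alt
  proof (intro conjI allI impI)
    show "bounded_linear (\<lambda>v. \<Sum>i\<in>Basis. (v \<bullet> i) *\<^sub>R M i)"
      by (intro bounded_linear_sum bounded_linear_scaleR_const bounded_linear_inner_left)
    fix e :: real assume "e > 0"
    then obtain d where d: "d > 0" and D: "\<And>v h. norm v < d \<Longrightarrow> 0 < h \<Longrightarrow> h < d \<Longrightarrow>
        norm (f v - (\<Sum>i\<in>Basis. ((v \<bullet> i) / h) *\<^sub>R f (h *\<^sub>R i))) \<le> e * norm v"
      using lin[of e] by auto
    \<comment> \<open>Now \<open>v\<close> is fixed and the scale tends to 0. The threshold
      \<open>d\<close> bounds \<open>v\<close> and the scale independently of each other, which is
      what allows this limit.\<close>
    have "norm (f v - (\<Sum>i\<in>Basis. (v \<bullet> i) *\<^sub>R M i)) \<le> e * norm v" if v: "norm v < d" for v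
    proof (rule LIMSEQ_le_const2)
      show "(\<lambda>n. norm (f v - (\<Sum>i\<in>Basis. (v \<bullet> i) *\<^sub>R (f (h n *\<^sub>R i) /\<^sub>R h n))))
          \<longlonglongrightarrow> norm (f v - (\<Sum>i\<in>Basis. (v \<bullet> i) *\<^sub>R M i))"
        by (intro tendsto_intros M)
      obtain n0 where n0: "\<And>n. n \<ge> n0 \<Longrightarrow> h n < d"
        using hev[OF d] by (auto simp: eventually_sequentially)
      show "\<exists>N. \<forall>n\<ge>N. norm (f v - (\<Sum>i\<in>Basis. (v \<bullet> i) *\<^sub>R (f (h n *\<^sub>R i) /\<^sub>R h n))) \<le> e * norm v"
        using D[OF v h n0] by (intro exI[of _ n0]) (auto simp: divide_inverse)
    qed
    then show "\<exists>d>0. \<forall>y. norm (y - 0) < d \<longrightarrow>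
        norm (f y - f 0 - (\<Sum>i\<in>Basis. ((y - 0) \<bullet> i) *\<^sub>R M i)) \<le> e * norm (y - 0)"
      using d f0 by auto
  qed
  then show ?thesis by (auto simp: differentiable_def)
qed

text \<open>The segment from x to x + z may leave \<open>K\<close>, hence the compact unit
  neighbourhood \<open>K1\<close>, on which \<open>Dg\<close> is uniformly continuous. The mean
  value inequality for \<open>g\<close> minus its linear part at x then gives the claim.\<close>

lemma locally_uniform_linearization:
  fixes g :: "'a::euclidean_space \<Rightarrow> 'b::euclidean_space"
  assumes deriv: "\<And>p. (g has_derivative blinfun_apply (Dg p)) (at p)"
    and cont: "continuous_on UNIV Dg" and K: "compact K" and "e > 0"
  shows "\<exists>d>0. \<forall>x\<in>K. \<forall>z. norm z < d \<longrightarrow> norm (g (x + z) - g x - Dg x z) \<le> e * norm z"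
proof -
  define K1 where "K1 = {x + z |x z. x \<in> K \<and> z \<in> cball (0::'a) 1}"
  have K1: "compact K1" unfolding K1_def by (intro compact_sums K compact_cball)
  have "uniformly_continuous_on K1 Dg"
    by (intro compact_uniformly_continuous K1 continuous_on_subset[OF cont]) auto
  then obtain d where d: "d > 0" and D: "\<And>x y. x \<in> K1 \<Longrightarrow> y \<in> K1 \<Longrightarrow> dist y x < d \<Longrightarrow> dist (Dg y) (Dg x) < e"
    unfolding uniformly_continuous_on_def using \<open>e > 0\<close> by meson
  have "norm (g (x + z) - g x - Dg x z) \<le> e * norm z" if x: "x \<in> K" and z: "norm z < min d 1" for x z
  proof -
    have "norm (g (x + z) - g x - Dg x (x + z - x)) \<le> norm (x + z - x) * e"
    proof (rule differentiable_bound_linearization[where S = "ball x (min d 1)"])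
      fix t :: real assume t: "t \<in> {0..1}"
      have "norm (t *\<^sub>R z) \<le> norm z" using t by (simp add: mult_left_le_one_le)
      then show "x + t *\<^sub>R (x + z - x) \<in> ball x (min d 1)" using z by (auto simp: dist_norm)
    next
      fix y assume y: "y \<in> ball x (min d 1)"
      show "(g has_derivative Dg y) (at y within ball x (min d 1))"
        using deriv has_derivative_at_withinI by blast
      have "y \<in> K1" unfolding K1_def using x y
        by (intro CollectI exI[of _ x] exI[of _ "y - x"]) (auto simp: dist_norm norm_minus_commute)
      moreover have "x \<in> K1" unfolding K1_def using x
        by (intro CollectI exI[of _ x] exI[of _ 0]) auto
      ultimately have "norm (Dg y - Dg x) < e" using D[of x y] y by (auto simp: dist_norm norm_minus_commute)
      then show "onorm (blinfun_apply (Dg y) - blinfun_apply (Dg x)) \<le> e"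
        by (simp add: norm_blinfun.rep_eq minus_blinfun.rep_eq fun_diff_def)
    qed (use d in auto)
    then show ?thesis by (simp add: mult.commute)
  qed
  then show ?thesis using d by (intro exI[of _ "min d 1"]) auto
qed

text \<open>The flow is a given family of global solutions; its regularity in the initial point is
  derived from Gronwall's inequality.\<close>

locale bounded_C1_flow =
  fixes g :: "'a::euclidean_space \<Rightarrow> 'a" and Dg :: "'a \<Rightarrow> 'a \<Rightarrow>\<^sub>L 'a"
    and \<kappa> :: real and \<Phi> :: "real \<Rightarrow> 'a \<Rightarrow> 'a"
  assumes deriv: "\<And>p. (g has_derivative blinfun_apply (Dg p)) (at p)"
    and cont_deriv: "continuous_on UNIV Dg"
    and bound_deriv: "\<And>p. norm (Dg p) \<le> \<kappa>"
    and flow_zero: "\<And>p. \<Phi> 0 p = p"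
    and flow_deriv: "\<And>p t. ((\<lambda>s. \<Phi> s p) has_vector_derivative g (\<Phi> t p)) (at t)"
begin

lemma kappa_nonneg: "0 \<le> \<kappa>"
  by (rule order_trans[OF norm_ge_zero bound_deriv])

lemma g_lipschitz: "norm (g p - g q) \<le> \<kappa> * norm (p - q)"
  by (rule differentiable_bound[of UNIV g "\<lambda>p. blinfun_apply (Dg p)"])
    (use deriv bound_deriv in \<open>auto simp: norm_blinfun.rep_eq\<close>)

lemma flow_lipschitz: "norm (\<Phi> t p - \<Phi> t q) \<le> exp (\<kappa> * \<bar>t\<bar>) * norm (p - q)"
proof -
  have "norm (\<Phi> t p - \<Phi> t q) \<le> exp (\<kappa> * \<bar>t\<bar>) * (norm (\<Phi> 0 p - \<Phi> 0 q) + 0 * \<bar>t\<bar>)"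
    by (rule gronwall_norm_abs[where w' = "\<lambda>t. g (\<Phi> t p) - g (\<Phi> t q)"])
      (use g_lipschitz kappa_nonneg in \<open>auto intro!: has_vector_derivative_diff flow_deriv\<close>)
  then show ?thesis by (simp add: flow_zero)
qed

lemma flow_time_continuous: "continuous_on S (\<lambda>t. \<Phi> t p)"
  using flow_deriv has_vector_derivative_continuous continuous_at_imp_continuous_on by blast

text \<open>The increments \<delta> solve the linearised equation up to an error o(|v|), uniformly
  for |s| \<le> T because the trajectory stays in a compact set. The combination \<open>w\<close> of
  the increment along v and of those along small basis vectors vanishes at time 0, by the basis
  expansion of v, and solves the same linear equation with a small forcing. Gronwall's inequality
  keeps it small, which is the approximate linearity required above.\<close>

lemma flow_differentiable: "\<Phi> t differentiable (at p)"
proof -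
  \<comment> \<open>The extra 1 keeps \<open>T\<close> positive at t = 0, where the quotient
    defining \<open>e'\<close> would otherwise degenerate.\<close>
  define T where "T = \<bar>t\<bar> + 1"
  define E where "E = exp (\<kappa> * T)"
  define K where "K = (\<lambda>s. \<Phi> s p) ` {-T..T}"
  have T: "T > 0" "\<bar>t\<bar> \<le> T" by (auto simp: T_def)
  have E: "E \<ge> 1" using kappa_nonneg T by (simp add: E_def)
  have K: "compact K" unfolding K_def by (intro compact_continuous_image flow_time_continuous) auto
  define \<delta> where "\<delta> s v = \<Phi> s (p + v) - \<Phi> s p" for s v
  have \<delta>_le: "norm (\<delta> s v) \<le> E * norm v" if "\<bar>s\<bar> \<le> T" for s v
  proof -
    have "norm (\<delta> s v) \<le> exp (\<kappa> * \<bar>s\<bar>) * norm v"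
      using flow_lipschitz[of s "p + v" p] by (simp add: \<delta>_def)
    also have "\<dots> \<le> E * norm v"
      unfolding E_def using that kappa_nonneg by (intro mult_right_mono) (auto intro: mult_left_mono)
    finally show ?thesis .
  qed
  have "\<delta> t differentiable (at 0)"
  proof (rule differentiable_at_zero_of_approx_linear)
    show "\<delta> t 0 = 0" by (simp add: \<delta>_def)
    fix e :: real assume e: "e > 0"
    \<comment> \<open>Chosen so that the final Gronwall bound \<open>E * (b * T)\<close> equals e
      |v|.\<close>
    define e' where "e' = e / (E * T * E * (1 + real DIM('a)))"
    have e': "e' > 0" using e E T by (simp add: e'_def)
    obtain d where d: "d > 0" and
      D: "\<And>x z. x \<in> K \<Longrightarrow> norm z < d \<Longrightarrow> norm (g (x + z) - g x - Dg x z) \<le> e' * norm z"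
      using locally_uniform_linearization[OF deriv cont_deriv K e'] by blast
    show "\<exists>d>0. \<forall>v h. norm v < d \<and> 0 < h \<and> h < d \<longrightarrow>
      norm (\<delta> t v - (\<Sum>i\<in>Basis. ((v \<bullet> i) / h) *\<^sub>R \<delta> t (h *\<^sub>R i))) \<le> e * norm v"
    proof (intro exI conjI allI impI)
      \<comment> \<open>The flow stretches increments by at most \<open>E\<close>, so |v| < d / E
        keeps them within the range of the linearisation.\<close>
      show "d / E > 0" using d E by simp
      fix v :: 'a and h :: real assume vh: "norm v < d / E \<and> 0 < h \<and> h < d / E"
      define r where "r s v = g (\<Phi> s (p + v)) - g (\<Phi> s p) - Dg (\<Phi> s p) (\<delta> s v)" for s v
      have r: "norm (r s v) \<le> e' * (E * norm v)" if s: "\<bar>s\<bar> \<le> T" and v: "norm v < d / E" for s v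
      proof -
        have "norm (\<delta> s v) < d"
          using \<delta>_le[OF s, of v] v E by (simp add: field_simps)
        moreover have "\<Phi> s p \<in> K" using s unfolding K_def by (intro imageI) auto
        ultimately have "norm (r s v) \<le> e' * norm (\<delta> s v)"
          using D[of "\<Phi> s p" "\<delta> s v"] by (simp add: r_def \<delta>_def)
        also have "\<dots> \<le> e' * (E * norm v)" using \<delta>_le[OF s] e' by (intro mult_left_mono) auto
        finally show ?thesis .
      qed
      have d\<delta>: "((\<lambda>s. \<delta> s v) has_vector_derivative Dg (\<Phi> s p) (\<delta> s v) + r s v) (at s)" for s v
        unfolding \<delta>_def r_def using has_vector_derivative_diff[OF flow_deriv flow_deriv] by simp
      define c where "c i = (v \<bullet> i) / h" for i
      define w where "w s = \<delta> s v - (\<Sum>i\<in>Basis. c i *\<^sub>R \<delta> s (h *\<^sub>R i))" for s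
      define \<rho> where "\<rho> s = r s v - (\<Sum>i\<in>Basis. c i *\<^sub>R r s (h *\<^sub>R i))" for s
      define b where "b = e' * E * (1 + real DIM('a)) * norm v"
      have dw: "(w has_vector_derivative Dg (\<Phi> s p) (w s) + \<rho> s) (at s)" for s
      proof -
        have "(w has_vector_derivative (Dg (\<Phi> s p) (\<delta> s v) + r s v) -
            (\<Sum>i\<in>Basis. c i *\<^sub>R (Dg (\<Phi> s p) (\<delta> s (h *\<^sub>R i)) + r s (h *\<^sub>R i)))) (at s)"
          unfolding w_def
          by (intro has_vector_derivative_diff has_vector_derivative_sum d\<delta>
              bounded_linear.has_vector_derivative[OF bounded_linear_scaleR_right])
        moreover have "(Dg (\<Phi> s p) (\<delta> s v) + r s v) -
            (\<Sum>i\<in>Basis. c i *\<^sub>R (Dg (\<Phi> s p) (\<delta> s (h *\<^sub>R i)) + r s (h *\<^sub>R i))) = Dg (\<Phi> s p) (w s) + \<rho> s"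
          unfolding w_def \<rho>_def
          by (simp add: blinfun.diff_right blinfun.sum_right blinfun.scaleR_right scaleR_add_right sum.distrib)
        ultimately show ?thesis by simp
      qed
      have \<rho>: "norm (\<rho> s) \<le> b" if s: "\<bar>s\<bar> \<le> T" for s
      proof -
        have "norm (c i *\<^sub>R r s (h *\<^sub>R i)) \<le> e' * E * norm v" if i: "i \<in> Basis" for i
        proof -
          have "norm (r s (h *\<^sub>R i)) \<le> e' * (E * h)"
            using r[OF s, of "h *\<^sub>R i"] vh i by simp
          then have "norm (c i *\<^sub>R r s (h *\<^sub>R i)) \<le> \<bar>c i\<bar> * (e' * (E * h))"
            by (simp add: mult_left_mono)
          also have "\<dots> = e' * E * \<bar>v \<bullet> i\<bar>" using vh by (simp add: c_def abs_divide)
          also have "\<dots> \<le> e' * E * norm v"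
            using e' E i by (intro mult_left_mono Basis_le_norm) auto
          finally show ?thesis .
        qed
        then have "norm (\<Sum>i\<in>Basis. c i *\<^sub>R r s (h *\<^sub>R i)) \<le> (\<Sum>i\<in>(Basis::'a set). e' * E * norm v)"
          by (intro sum_norm_le)
        moreover have "norm (r s v) \<le> e' * E * norm v" using r[OF s, of v] vh by (simp add: mult.assoc)
        ultimately show ?thesis
          unfolding \<rho>_def b_def using norm_triangle_ineq4[of "r s v" "\<Sum>i\<in>Basis. c i *\<^sub>R r s (h *\<^sub>R i)"]
          by (simp add: algebra_simps)
      qed
      have "norm (w t) \<le> exp (\<kappa> * \<bar>t\<bar>) * (norm (w 0) + b * \<bar>t\<bar>)"
      proof (rule gronwall_norm_abs[OF dw])
        fix s assume s: "\<bar>s\<bar> \<le> \<bar>t\<bar>"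
        have "norm (Dg (\<Phi> s p) (w s)) \<le> \<kappa> * norm (w s)"
          using norm_blinfun[of "Dg (\<Phi> s p)" "w s"] mult_right_mono[OF bound_deriv[of "\<Phi> s p"] norm_ge_zero[of "w s"]]
          by linarith
        then show "norm (Dg (\<Phi> s p) (w s) + \<rho> s) \<le> \<kappa> * norm (w s) + b"
          using \<rho>[of s] s T norm_triangle_ineq[of "Dg (\<Phi> s p) (w s)" "\<rho> s"] by linarith
      qed (use kappa_nonneg e' E in \<open>auto simp: b_def\<close>)
      moreover have "w 0 = 0"
      proof -
        have "w 0 = v - (\<Sum>i\<in>Basis. c i *\<^sub>R (h *\<^sub>R i))" by (simp add: w_def \<delta>_def flow_zero)
        also have "(\<Sum>i\<in>Basis. c i *\<^sub>R (h *\<^sub>R i)) = (\<Sum>i\<in>Basis. (v \<bullet> i) *\<^sub>R i)"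
          using vh by (intro sum.cong) (auto simp: c_def)
        finally show ?thesis by (simp add: euclidean_representation)
      qed
      ultimately have "norm (w t) \<le> exp (\<kappa> * \<bar>t\<bar>) * (b * \<bar>t\<bar>)" by simp
      also have "\<dots> \<le> E * (b * T)"
        unfolding E_def using T kappa_nonneg e' E
        by (intro mult_mono) (auto simp: b_def intro!: mult_left_mono)
      also have "\<dots> = e' * (E * T * E * (1 + real DIM('a))) * norm v" by (simp add: b_def mult_ac)
      also have "e' * (E * T * E * (1 + real DIM('a))) = e" unfolding e'_def using E T by simp
      finally show "norm (\<delta> t v - (\<Sum>i\<in>Basis. ((v \<bullet> i) / h) *\<^sub>R \<delta> t (h *\<^sub>R i))) \<le> e * norm v"
        by (simp add: w_def c_def)
    qed
  qed
  then obtain D where D: "(\<delta> t has_derivative D) (at 0)" by (auto simp: differentiable_def)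
  then have "((\<lambda>x. \<delta> t (x - p) + \<Phi> t p) has_derivative D) (at p)"
  proof -
    have "((\<lambda>x. x - p) has_derivative (\<lambda>x. x)) (at p)" by (auto intro!: derivative_eq_intros)
    from has_derivative_compose[OF this, of "\<delta> t" D] D
    have "((\<lambda>x. \<delta> t (x - p)) has_derivative D) (at p)" by simp
    from has_derivative_add[OF this has_derivative_const[of "\<Phi> t p"]] show ?thesis by simp
  qed
  then show ?thesis by (auto simp: differentiable_def \<delta>_def)
qed

end

section \<open>Transport along a Hamiltonian flow\<close>

lemma sublinear_growth_bound:
  fixes f :: "'a::euclidean_space \<Rightarrow> real"
  assumes cont: "continuous_on UNIV f" and lim: "((\<lambda>y. f y / norm y) \<longlongrightarrow> 0) at_infinity" and e: "e > 0"
  shows "\<exists>C\<ge>0. \<forall>y. f y \<le> C + e * norm y"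
proof -
  obtain b where b: "\<And>y. norm y \<ge> b \<Longrightarrow> \<bar>f y / norm y\<bar> < e"
    using tendstoD[OF lim e] by (auto simp: eventually_at_infinity)
  have "bounded (f ` cball 0 (max b 0))"
    by (intro compact_imp_bounded compact_continuous_image continuous_on_subset[OF cont]) auto
  then obtain C where C: "C > 0" "\<And>y. norm y \<le> max b 0 \<Longrightarrow> norm (f y) \<le> C"
    by (auto simp: bounded_pos)
  have "f y \<le> C + e * norm y" for y
  proof (cases "norm y \<le> max b 0")
    case True
    have "0 \<le> e * norm y" using e by simp
    then show ?thesis using C(2)[OF True] by simp
  next
    case False
    then have y: "\<bar>f y / norm y\<bar> < e" "norm y > 0" using b by auto
    then have "f y / norm y \<le> e" by linarith
    then have "f y \<le> e * norm y" using y(2) by (simp add: pos_divide_le_eq)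
    then show ?thesis using C by simp
  qed
  then show ?thesis using C by (intro exI[of _ C]) auto
qed

text \<open>Outside a large ball |f y| \<ge> |y| / 2, so preimages of bounded sets are
  bounded.\<close>

lemma near_identity_proper:
  fixes f :: "'a::euclidean_space \<Rightarrow> 'a"
  assumes cont: "continuous_on UNIV f" and near: "\<And>y. norm y \<ge> R \<Longrightarrow> norm (f y - y) \<le> norm y / 2"
    and K: "compact K"
  shows "compact (f -` K)"
proof -
  have "closed (f -` K)" using continuous_closed_vimage[of K f] cont K
    by (simp add: compact_imp_closed continuous_on_eq_continuous_at)
  moreover obtain B where B: "\<And>x. x \<in> K \<Longrightarrow> norm x \<le> B"
    using compact_imp_bounded[OF K] by (auto simp: bounded_iff)
  have "norm y \<le> max R (2 * B)" if "y \<in> f -` K" for y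
  proof (cases "norm y \<ge> R")
    case True
    then show ?thesis using near[OF True] B[of "f y"] that norm_triangle_ineq2[of y "y - f y"]
      by (simp add: norm_minus_commute)
  qed auto
  then have "bounded (f -` K)" by (auto simp: bounded_iff)
  ultimately show ?thesis by (simp add: compact_eq_bounded_closed)
qed

text \<open>A solution of f y = x is a fixed point of y - f y + x, and this map sends a large ball
  to itself since f y - y grows at most like |y| / 2.\<close>

lemma near_identity_surj:
  fixes f :: "'a::euclidean_space \<Rightarrow> 'a"
  assumes cont: "continuous_on UNIV f" and near: "\<And>y. norm y \<ge> R \<Longrightarrow> norm (f y - y) \<le> norm y / 2"
  shows "surj f"
proof -
  have "bounded ((\<lambda>y. f y - y) ` cball 0 R)"
    by (intro compact_imp_bounded compact_continuous_image continuous_intros continuous_on_subset[OF cont]) auto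
  then obtain M where M: "M > 0" "\<And>y. norm y \<le> R \<Longrightarrow> norm (f y - y) \<le> M"
    by (auto simp: bounded_pos)
  have "\<exists>y. x = f y" for x
  proof -
    \<comment> \<open>Large enough that both M + |x| and B / 2 + |x| are at most B: the two bounds
      on the displacement, inside and outside the ball of radius \<open>R\<close>.\<close>
    define B where "B = 2 * (M + norm x) + 1"
    have B: "B > 0" using M by (simp add: B_def add_pos_nonneg)
    have "\<exists>y\<in>cball 0 B. y - f y + x = y"
    proof (rule brouwer[of "cball 0 B" "\<lambda>y. y - f y + x"])
      show "continuous_on (cball 0 B) (\<lambda>y. y - f y + x)"
        by (intro continuous_intros continuous_on_subset[OF cont]) auto
      show "(\<lambda>y. y - f y + x) \<in> cball 0 B \<rightarrow> cball 0 B"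
      proof
        fix y :: 'a assume y: "y \<in> cball 0 B"
        have "norm (y - f y) \<le> max M (norm y / 2)"
          using M(2)[of y] near[of y] by (cases "norm y \<le> R") (auto simp: norm_minus_commute)
        moreover have "max M (norm y / 2) + norm x \<le> B"
          using y M norm_ge_zero[of x] by (auto simp: B_def max_def)
        ultimately show "y - f y + x \<in> cball 0 B"
          using norm_triangle_ineq[of "y - f y" x] by simp
      qed
    qed (use B in auto)
    then show ?thesis by (auto simp: algebra_simps)
  qed
  then show ?thesis by (auto simp: surj_def)
qed

section \<open>Growth and regularity of the transported map\<close>

lemma norm_fst_le_norm: "norm (fst p) \<le> norm p" and norm_snd_le_norm: "norm (snd p) \<le> norm p"
  by (metis norm_fst_le prod.collapse) (metis norm_snd_le prod.collapse)

locale hamiltonian_transport =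
  fixes G :: "(real^'n) \<times> (real^'n) \<Rightarrow> (real^'n) \<times> (real^'n)"
    and DG :: "(real^'n) \<times> (real^'n) \<Rightarrow> ((real^'n) \<times> (real^'n)) \<Rightarrow>\<^sub>L ((real^'n) \<times> (real^'n))"
    and \<kappa> :: real and h :: "real \<Rightarrow> real"
    and \<Phi> :: "real \<Rightarrow> (real^'n) \<times> (real^'n) \<Rightarrow> (real^'n) \<times> (real^'n)"
    and U :: "real^'n \<Rightarrow> real^'n"
    and F :: "real \<Rightarrow> real^'n \<Rightarrow> real^'n"
  assumes H_hess: "\<And>p. (G has_derivative blinfun_apply (DG p)) (at p)"
    and H_C2: "continuous_on UNIV DG"
    and kappa_pos: "\<kappa> > 0"
    and h_cont: "continuous_on UNIV h" and h_nonneg: "\<And>r. h r \<ge> 0"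
    and h_sublin: "((\<lambda>r. h r / r) \<longlongrightarrow> 0) at_top"
    and bound_xi: "\<And>x \<xi>. norm (snd (G (x, \<xi>))) \<le> \<kappa> * (1 + norm \<xi>)"
    and bound_x: "\<And>x \<xi>. norm (fst (G (x, \<xi>))) \<le> h (norm x) + \<kappa> * norm \<xi>"
    and bound_hess: "\<And>p. norm (DG p) \<le> \<kappa>"
    and flow_0: "\<And>p. \<Phi> 0 p = p"
    and flow_ode: "\<And>p t. ((\<lambda>s. \<Phi> s p) has_vector_derivative
                     (snd (G (\<Phi> t p)), - fst (G (\<Phi> t p)))) (at t)"
    and U_cont: "continuous_on UNIV U"
    and U_sublin: "((\<lambda>y. norm (U y) / norm y) \<longlongrightarrow> 0) at_infinity"
    and F_def: "\<And>t y. F t y = fst (\<Phi> t (y, U y))"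
begin

text \<open>The standard symplectic map, turning the gradient into the Hamiltonian vector field. It
  is an isometry, so the bound \<kappa> on the Hessian is also the Lipschitz constant of the
  field.\<close>

definition symp :: "((real^'n) \<times> (real^'n)) \<Rightarrow>\<^sub>L ((real^'n) \<times> (real^'n))"
  where "symp = Blinfun (\<lambda>p. (snd p, - fst p))"

lemma symp_apply: "symp p = (snd p, - fst p)"
proof -
  have "bounded_linear (\<lambda>p::(real^'n) \<times> (real^'n). (snd p, - fst p))"
    by (intro bounded_linear_Pair bounded_linear_snd bounded_linear_minus bounded_linear_fst)
  then show ?thesis by (simp add: symp_def bounded_linear_Blinfun_apply)
qed

sublocale flow: bounded_C1_flow "\<lambda>p. symp (G p)" "\<lambda>p. symp o\<^sub>L DG p" \<kappa> \<Phi>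
proof
  fix p
  show "((\<lambda>p. symp (G p)) has_derivative (symp o\<^sub>L DG p)) (at p)"
    using bounded_linear.has_derivative[OF blinfun.bounded_linear_right H_hess]
    by (rule has_derivative_eq_rhs) (auto simp: fun_eq_iff)
  have "norm (symp (DG p v)) \<le> \<kappa> * norm v" for v
  proof -
    have "norm (symp (DG p v)) = norm (DG p v)" by (simp add: symp_apply norm_prod_def add.commute)
    also have "\<dots> \<le> norm (DG p) * norm v" by (rule norm_blinfun)
    also have "\<dots> \<le> \<kappa> * norm v" by (intro mult_right_mono bound_hess) auto
    finally show ?thesis .
  qed
  then show "norm (symp o\<^sub>L DG p) \<le> \<kappa>"
    by (intro norm_blinfun_bound) (use kappa_pos in auto)
  show "continuous_on UNIV (\<lambda>p. symp o\<^sub>L DG p)"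
    by (intro bounded_bilinear.continuous_on[OF bounded_bilinear_blinfun_compose] continuous_on_const H_C2)
  show "\<Phi> 0 p = p" by (rule flow_0)
  show "((\<lambda>s. \<Phi> s p) has_vector_derivative symp (G (\<Phi> t p))) (at t)" for t
    unfolding symp_apply by (rule flow_ode)
qed

lemma U_growth: "e > 0 \<Longrightarrow> \<exists>C\<ge>0. \<forall>y. norm (U y) \<le> C + e * norm y"
  by (rule sublinear_growth_bound) (use U_cont U_sublin in \<open>auto intro!: continuous_intros\<close>)

lemma h_growth:
  assumes "e > 0" shows "\<exists>C\<ge>0. \<forall>r\<ge>0. h r \<le> C + e * r"
proof -
  have "((\<lambda>r. h \<bar>r\<bar> / norm r) \<longlongrightarrow> 0) at_infinity"
  proof (rule tendstoI)
    fix d :: real assume "d > 0"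
    then obtain N where N: "\<And>r. r \<ge> N \<Longrightarrow> dist (h r / r) 0 < d"
      using tendstoD[OF h_sublin] by (auto simp: eventually_at_top_linorder)
    show "\<forall>\<^sub>F r in at_infinity. dist (h \<bar>r\<bar> / norm r) 0 < d"
      unfolding eventually_at_infinity
    proof (intro exI allI impI)
      show "dist (h \<bar>r\<bar> / norm r) 0 < d" if "N \<le> norm r" for r using N[of "\<bar>r\<bar>"] that by simp
    qed
  qed
  moreover have "continuous_on UNIV (\<lambda>r. h \<bar>r\<bar>)"
    by (intro continuous_on_compose2[OF h_cont] continuous_intros) auto
  ultimately obtain C where "C \<ge> 0" "\<And>r. h \<bar>r\<bar> \<le> C + e * norm r"
    using sublinear_growth_bound[of "\<lambda>r. h \<bar>r\<bar>" e] assms by auto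
  then show ?thesis by (intro exI[of _ C]) (metis abs_of_nonneg real_norm_def)
qed

text \<open>Gronwall's inequality is applied to the distance from the point (y, 0), not to the
  solution itself. Then |y| enters only with the small factor e, which is what makes the
  displacement o(|y|). The rate 2 \<kappa> + e collects \<kappa> |\<xi>| from each component of the
  field and e |x - y| from \<open>h\<close>.\<close>

lemma flow_growth:
  assumes C: "\<And>r. r \<ge> 0 \<Longrightarrow> h r \<le> C + e * r" and "0 \<le> C" "0 \<le> e"
  shows "norm (\<Phi> t (y, \<eta>) - (y, 0)) \<le>
    exp ((2 * \<kappa> + e) * \<bar>t\<bar>) * (norm \<eta> + (\<kappa> + C + e * norm y) * \<bar>t\<bar>)"
proof -
  define w where "w s = \<Phi> s (y, \<eta>) - (y, 0)" for s
  have "norm (w t) \<le> exp ((2 * \<kappa> + e) * \<bar>t\<bar>) * (norm (w 0) + (\<kappa> + C + e * norm y) * \<bar>t\<bar>)"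
  proof (rule gronwall_norm_abs)
    show "(w has_vector_derivative symp (G (\<Phi> s (y, \<eta>)))) (at s)" for s
      unfolding w_def using has_vector_derivative_diff[OF flow.flow_deriv has_vector_derivative_const] by simp
    fix s
    obtain x \<xi> where p: "\<Phi> s (y, \<eta>) = (x, \<xi>)" by fastforce
    have w: "w s = (x - y, \<xi>)" by (simp add: w_def p)
    have "norm \<xi> \<le> norm (w s)" "norm (x - y) \<le> norm (w s)"
      unfolding w by (rule norm_snd_le norm_fst_le)+
    moreover have "norm x \<le> norm y + norm (x - y)" by (metis add.commute norm_triangle_sub)
    moreover have "norm (symp (G (x, \<xi>))) \<le> norm (snd (G (x, \<xi>))) + norm (fst (G (x, \<xi>)))"
      unfolding symp_apply using norm_Pair_le[of "snd (G (x, \<xi>))" "- fst (G (x, \<xi>))"] by simp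
    moreover have "h (norm x) \<le> C + e * norm x" by (rule C) simp
    moreover have "e * norm x \<le> e * (norm y + norm (w s))"
      using calculation \<open>0 \<le> e\<close> by (intro mult_left_mono) auto
    moreover have "\<kappa> * norm \<xi> \<le> \<kappa> * norm (w s)"
      using calculation kappa_pos by (intro mult_left_mono) auto
    ultimately show "norm (symp (G (\<Phi> s (y, \<eta>)))) \<le> (2 * \<kappa> + e) * norm (w s) + (\<kappa> + C + e * norm y)"
      using bound_xi[of x \<xi>] bound_x[of x \<xi>] unfolding p by (simp add: algebra_simps)
  qed (use assms kappa_pos in auto)
  then show ?thesis by (simp add: w_def flow_0 norm_Pair)
qed

lemma F_near_identity:
  assumes "T > 0" "\<epsilon> > 0"
  shows "\<exists>R. \<forall>y t. norm y \<ge> R \<and> \<bar>t\<bar> \<le> T \<longrightarrow> norm (F t y - y) \<le> \<epsilon> * norm y"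
proof -
  define A where "A = exp ((2 * \<kappa> + 1) * T)"
  \<comment> \<open>The cap 1 lets the growth factor be bounded by \<open>A\<close> before e is
    fixed; the other entry makes the coefficient of |y| at most \<epsilon> / 2.\<close>
  define e where "e = min 1 (\<epsilon> / (2 * A * (1 + T)))"
  have A: "A > 0" by (simp add: A_def)
  have e: "e > 0" "e \<le> 1" using assms A by (auto simp: e_def)
  have eA: "A * (e * (1 + T)) \<le> \<epsilon> / 2"
  proof -
    have "A * (e * (1 + T)) \<le> A * (\<epsilon> / (2 * A * (1 + T)) * (1 + T))"
      using A assms by (intro mult_left_mono mult_right_mono) (auto simp: e_def)
    also have "\<dots> = \<epsilon> / 2"
    proof -
      have "A * (\<epsilon> / (2 * A * s) * s) = \<epsilon> / 2" if "s > 0" for s using that A by (simp add: field_simps)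
      from this[of "1 + T"] show ?thesis using assms by simp
    qed
    finally show ?thesis .
  qed
  obtain C where C: "C \<ge> 0" "\<And>r. r \<ge> 0 \<Longrightarrow> h r \<le> C + e * r" using h_growth[OF e(1)] by auto
  obtain C' where C': "C' \<ge> 0" "\<And>y. norm (U y) \<le> C' + e * norm y" using U_growth[OF e(1)] by auto
  define B where "B = A * (C' + (\<kappa> + C) * T)"
  have main: "norm (F t y - y) \<le> B + \<epsilon> / 2 * norm y" if t: "\<bar>t\<bar> \<le> T" for t y
  proof -
    have "norm (F t y - y) = norm (fst (\<Phi> t (y, U y) - (y, 0)))" by (simp add: F_def)
    also have "\<dots> \<le> norm (\<Phi> t (y, U y) - (y, 0))" by (rule norm_fst_le_norm)
    also have "\<dots> \<le> exp ((2 * \<kappa> + e) * \<bar>t\<bar>) * (norm (U y) + (\<kappa> + C + e * norm y) * \<bar>t\<bar>)"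
      by (rule flow_growth) (use C e in auto)
    also have "\<dots> \<le> A * ((C' + e * norm y) + (\<kappa> + C + e * norm y) * T)"
      unfolding A_def using t C C' e kappa_pos assms
      by (intro mult_mono add_mono iffD2[OF exp_le_cancel_iff]) (auto intro!: mult_nonneg_nonneg add_nonneg_nonneg)
    also have "\<dots> = B + A * (e * (1 + T)) * norm y" by (simp add: B_def algebra_simps)
    also have "\<dots> \<le> B + \<epsilon> / 2 * norm y" using mult_right_mono[OF eA norm_ge_zero] by simp
    finally show ?thesis .
  qed
  \<comment> \<open>Beyond this radius the constant \<open>B\<close> is absorbed by the other half
    of \<epsilon> |y|.\<close>
  have "norm (F t y - y) \<le> \<epsilon> * norm y" if "norm y \<ge> 2 * B / \<epsilon>" "\<bar>t\<bar> \<le> T" for t y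
  proof -
    have "B \<le> \<epsilon> / 2 * norm y" using that(1) assms by (simp add: field_simps)
    then show ?thesis using main[OF that(2), of y] by simp
  qed
  then show ?thesis by blast
qed

text \<open>The origin of the factor e^(\<kappa>|t|) in the multiplicity bound: the projection to
  positions does not increase norms, and the norm of a pair is at most the sum of the norms, so no
  further constant appears.\<close>

lemma F_diff_le: "norm (F t y - F t z) \<le> exp (\<kappa> * \<bar>t\<bar>) * (norm (y - z) + norm (U y - U z))"
proof -
  have "norm (F t y - F t z) = norm (fst (\<Phi> t (y, U y) - \<Phi> t (z, U z)))" by (simp add: F_def)
  also have "\<dots> \<le> norm (\<Phi> t (y, U y) - \<Phi> t (z, U z))" by (rule norm_fst_le_norm)
  also have "\<dots> \<le> exp (\<kappa> * \<bar>t\<bar>) * norm ((y, U y) - (z, U z))" by (rule flow.flow_lipschitz)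
  also have "\<dots> \<le> exp (\<kappa> * \<bar>t\<bar>) * (norm (y - z) + norm (U y - U z))"
    using norm_Pair_le[of "y - z" "U y - U z"] by (intro mult_left_mono) auto
  finally show ?thesis .
qed

lemma F_continuous: "continuous_on UNIV (F t)"
proof -
  have "continuous_on UNIV (\<Phi> t)"
    by (rule continuous_at_imp_continuous_on)
      (intro ballI differentiable_imp_continuous_within flow.flow_differentiable)
  then have "continuous_on UNIV (\<lambda>y. \<Phi> t (y, U y))"
    by (rule continuous_on_compose2) (intro continuous_on_Pair continuous_on_id U_cont, rule subset_UNIV)
  then have "continuous_on UNIV (\<lambda>y. fst (\<Phi> t (y, U y)))" by (rule continuous_on_fst)
  then show ?thesis by (simp add: F_def[abs_def])
qed

lemma F_near_identity_half: "\<exists>R. \<forall>y. norm y \<ge> R \<longrightarrow> norm (F t y - y) \<le> norm y / 2"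
proof -
  obtain R where "\<forall>y s. norm y \<ge> R \<and> \<bar>s\<bar> \<le> \<bar>t\<bar> + 1 \<longrightarrow> norm (F s y - y) \<le> 1/2 * norm y"
    using F_near_identity[of "\<bar>t\<bar> + 1" "1/2"] abs_ge_zero[of t] by (meson add_nonneg_pos half_gt_zero zero_less_one)
  then show ?thesis by (intro exI[of _ R]) auto
qed

lemma F_proper: "compact K \<Longrightarrow> compact (F t -` K)"
  using F_near_identity_half[of t] near_identity_proper[OF F_continuous] by blast

lemma F_surj: "surj (F t)"
  using F_near_identity_half[of t] near_identity_surj[OF F_continuous] by blast

lemma F_differentiable:
  assumes "U differentiable (at y)" shows "F t differentiable (at y)"
proof -
  have "(\<lambda>y. (y, U y)) differentiable (at y)"
    using assms by (auto simp: differentiable_def intro!: has_derivative_Pair has_derivative_ident)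
  then have "(\<Phi> t \<circ> (\<lambda>y. (y, U y))) differentiable (at y)"
    by (intro differentiable_chain_at flow.flow_differentiable)
  then show ?thesis
    unfolding differentiable_def o_def F_def[abs_def] using has_derivative_fst by blast
qed

text \<open>The speed is at most \<kappa> (1 + |\<Xi>|), and the momentum is bounded for bounded
  times and initial positions. The constant is built with |B| because it has to be nonnegative even
  for negative \<open>T\<close> or \<open>R\<close>, where the claim is vacuous and \<open>B\<close>
  may be negative.\<close>

lemma F_time_lipschitz:
  "\<exists>V\<ge>0. \<forall>s t y. \<bar>s\<bar> \<le> T \<and> \<bar>t\<bar> \<le> T \<and> norm y \<le> R \<longrightarrow> norm (F t y - F s y) \<le> V * \<bar>t - s\<bar>"
proof -
  obtain C where C: "C \<ge> 0" "\<And>r. r \<ge> 0 \<Longrightarrow> h r \<le> C + 1 * r" using h_growth[of 1] by auto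
  have "bounded (U ` cball 0 R)"
    by (intro compact_imp_bounded compact_continuous_image continuous_on_subset[OF U_cont]) auto
  then obtain M where M: "M > 0" "\<And>y. norm y \<le> R \<Longrightarrow> norm (U y) \<le> M" by (auto simp: bounded_pos)
  define B where "B = exp ((2 * \<kappa> + 1) * T) * (M + (\<kappa> + C + 1 * R) * T)"
  have sp: "norm (snd (G (\<Phi> t (y, U y)))) \<le> \<kappa> * (1 + B)" if t: "\<bar>t\<bar> \<le> T" and y: "norm y \<le> R" for t y
  proof -
    have TR: "0 \<le> T" "0 \<le> R" using t y norm_ge_zero[of y] by linarith+
    have "norm (snd (\<Phi> t (y, U y))) = norm (snd (\<Phi> t (y, U y) - (y, 0)))" by simp
    also have "\<dots> \<le> norm (\<Phi> t (y, U y) - (y, 0))" by (rule norm_snd_le_norm)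
    also have "\<dots> \<le> exp ((2 * \<kappa> + 1) * \<bar>t\<bar>) * (norm (U y) + (\<kappa> + C + 1 * norm y) * \<bar>t\<bar>)"
      by (rule flow_growth) (use C in auto)
    also have "\<dots> \<le> B"
      unfolding B_def using t y C M(2)[OF y] M(1) kappa_pos TR
      by (intro mult_mono add_mono iffD2[OF exp_le_cancel_iff]) (auto intro!: mult_nonneg_nonneg add_nonneg_nonneg)
    finally have "\<kappa> * (1 + norm (snd (\<Phi> t (y, U y)))) \<le> \<kappa> * (1 + B)" using kappa_pos by simp
    then show ?thesis using bound_xi[of "fst (\<Phi> t (y, U y))" "snd (\<Phi> t (y, U y))"] by simp
  qed
  have lip: "norm (F t y - F s y) \<le> norm (t - s) * (\<kappa> * (1 + B))"
    if "\<bar>s\<bar> \<le> T" "\<bar>t\<bar> \<le> T" "norm y \<le> R" for s t y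
  proof -
    have "norm (F t y - F s y) \<le> (\<kappa> * (1 + B)) * norm (t - s)"
    proof (rule differentiable_bound[of "{-T..T}"])
      fix r assume r: "r \<in> {-T..T}"
      have "((\<lambda>t. fst (\<Phi> t (y, U y))) has_vector_derivative snd (G (\<Phi> r (y, U y)))) (at r)"
        using bounded_linear.has_vector_derivative[OF bounded_linear_fst flow_ode] by simp
      then show "((\<lambda>t. F t y) has_derivative (\<lambda>a. a *\<^sub>R snd (G (\<Phi> r (y, U y))))) (at r within {-T..T})"
        unfolding F_def has_vector_derivative_def by (rule has_derivative_at_withinI)
      show "onorm (\<lambda>a. a *\<^sub>R snd (G (\<Phi> r (y, U y)))) \<le> \<kappa> * (1 + B)"
      proof (rule onorm_bound)
        have sp': "norm (snd (G (\<Phi> r (y, U y)))) \<le> \<kappa> * (1 + B)" using sp[of r y] r that by auto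
        then show "0 \<le> \<kappa> * (1 + B)" using norm_ge_zero order_trans by blast
        show "norm (a *\<^sub>R snd (G (\<Phi> r (y, U y)))) \<le> \<kappa> * (1 + B) * norm a" for a
          using mult_left_mono[OF sp', of "norm a"] by (simp add: mult.commute)
      qed
    qed (use that in auto)
    then show ?thesis by (simp add: mult.commute)
  qed
  have "0 \<le> \<kappa> * (1 + \<bar>B\<bar>)" using kappa_pos by simp
  moreover have "norm (F t y - F s y) \<le> \<kappa> * (1 + \<bar>B\<bar>) * \<bar>t - s\<bar>"
    if "\<bar>s\<bar> \<le> T" "\<bar>t\<bar> \<le> T" "norm y \<le> R" for s t y
  proof -
    have "norm (t - s) * (\<kappa> * (1 + B)) \<le> norm (t - s) * (\<kappa> * (1 + \<bar>B\<bar>))"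
      using kappa_pos by (intro mult_left_mono) auto
    then show ?thesis using lip[OF that] by (simp add: mult.commute)
  qed
  ultimately show ?thesis by blast
qed

end

section \<open>Smooth bump functions\<close>

lemma has_derivative_partial_deriv:
  fixes f :: "real^'n \<Rightarrow> real"
  assumes "f differentiable (at x)"
  shows "(f has_derivative (\<lambda>v. \<Sum>l\<in>UNIV. v $ l * partial_deriv l f x)) (at x)"
proof -
  let ?D = "frechet_derivative f (at x)"
  have D: "(f has_derivative ?D) (at x)" using assms by (simp add: frechet_derivative_works)
  then have lin: "linear ?D" by (rule has_derivative_linear)
  have "?D v = (\<Sum>l\<in>UNIV. v $ l * partial_deriv l f x)" for v
  proof -
    have "?D v = ?D (\<Sum>l\<in>UNIV. v $ l *\<^sub>R axis l 1)"
      using basis_expansion[of v] by (simp add: scalar_mult_eq_scaleR)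
    also have "\<dots> = (\<Sum>l\<in>UNIV. ?D (v $ l *\<^sub>R axis l 1))" by (rule linear_sum[OF lin])
    also have "\<dots> = (\<Sum>l\<in>UNIV. v $ l * partial_deriv l f x)"
      by (intro sum.cong) (simp_all add: linear_scale[OF lin] partial_deriv_def)
    finally show ?thesis .
  qed
  then have "?D = (\<lambda>v. \<Sum>l\<in>UNIV. v $ l * partial_deriv l f x)" by (rule ext)
  then show ?thesis using D by metis
qed

lemma partial_deriv_eq:
  "(f has_derivative f') (at x) \<Longrightarrow> partial_deriv l f x = f' (axis l 1)"
  unfolding partial_deriv_def using frechet_derivative_at by metis

lemma Ck_SucI:
  fixes f :: "real^'n \<Rightarrow> real"
  assumes "\<And>x. (f has_derivative f' x) (at x)" "\<And>l. Ck k (\<lambda>x. f' x (axis l 1))"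
  shows "Ck (Suc k) f"
proof -
  have "partial_deriv l f = (\<lambda>x. f' x (axis l 1))" for l using partial_deriv_eq[OF assms(1)] by auto
  then show ?thesis using assms by (auto simp: differentiable_def)
qed

lemma Ck_SucD: "Ck (Suc k) f \<Longrightarrow> Ck k f"
proof (induction k arbitrary: f)
  case 0
  then show ?case by (auto intro!: continuous_at_imp_continuous_on differentiable_imp_continuous_within)
qed auto

lemma Ck_const: "Ck k (\<lambda>x. c)"
proof (induction k arbitrary: c)
  case (Suc k)
  show ?case by (rule Ck_SucI[of _ "\<lambda>x v. 0"]) (auto intro: Suc)
qed auto

lemma Ck_cmult: "Ck k f \<Longrightarrow> Ck k (\<lambda>x. c * f x)"
proof (induction k arbitrary: f)
  case 0
  then show ?case by (auto intro!: continuous_intros)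
next
  case (Suc k)
  then have "((\<lambda>x. c * f x) has_derivative (\<lambda>v. c * frechet_derivative f (at x) v)) (at x)" for x
    by (auto intro!: has_derivative_mult_right simp: frechet_derivative_works)
  then show ?case
    by (rule Ck_SucI) (use Suc in \<open>simp add: partial_deriv_def[symmetric]\<close>)
qed

lemma Ck_add: "Ck k f \<Longrightarrow> Ck k g \<Longrightarrow> Ck k (\<lambda>x. f x + g x)"
proof (induction k arbitrary: f g)
  case 0
  then show ?case by (auto intro!: continuous_intros)
next
  case (Suc k)
  then have "((\<lambda>x. f x + g x) has_derivative
      (\<lambda>v. frechet_derivative f (at x) v + frechet_derivative g (at x) v)) (at x)" for x
    by (auto intro!: has_derivative_add simp: frechet_derivative_works)
  then show ?case
    by (rule Ck_SucI) (use Suc in \<open>simp add: partial_deriv_def[symmetric]\<close>)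
qed

lemma Ck_mult: "Ck k f \<Longrightarrow> Ck k g \<Longrightarrow> Ck k (\<lambda>x. f x * g x)"
proof (induction k arbitrary: f g)
  case 0
  then show ?case by (auto intro!: continuous_intros)
next
  case (Suc k)
  then have "((\<lambda>x. f x * g x) has_derivative
      (\<lambda>v. f x * frechet_derivative g (at x) v + frechet_derivative f (at x) v * g x)) (at x)" for x
    by (auto intro!: has_derivative_mult simp: frechet_derivative_works)
  then show ?case
  proof (rule Ck_SucI)
    fix l
    have "Ck k (partial_deriv l f)" "Ck k (partial_deriv l g)" "Ck k f" "Ck k g"
      using Suc.prems Ck_SucD by auto
    then show "Ck k (\<lambda>x. f x * frechet_derivative g (at x) (axis l 1) + frechet_derivative f (at x) (axis l 1) * g x)"
      unfolding partial_deriv_def[symmetric] by (intro Ck_add Suc.IH)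
  qed
qed

lemma Ck_prod: "finite I \<Longrightarrow> (\<And>i. i \<in> I \<Longrightarrow> Ck k (f i)) \<Longrightarrow> Ck k (\<lambda>x. \<Prod>i\<in>I. f i x)"
  by (induction I rule: finite_induct) (auto intro: Ck_mult Ck_const)

lemma Ck_component: "Ck k (\<lambda>x::real^'n. x $ i)"
proof (cases k)
  case (Suc k')
  show ?thesis unfolding Suc
    by (rule Ck_SucI[of _ "\<lambda>x v. v $ i"])
      (auto intro: Ck_const bounded_linear_imp_has_derivative bounded_linear_vec_nth)
qed (auto intro!: continuous_intros)

text \<open>The derivatives of \<open>exp (-1/x)\<close> are combinations of the functions \<open>x^(-n) exp (-1/x)\<close>.\<close>

definition flat_exp :: "nat \<Rightarrow> real \<Rightarrow> real" where
  "flat_exp n x = (if x > 0 then (1/x) ^ n * exp (- (1/x)) else 0)"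

lemma flat_exp_deriv:
  "(flat_exp n has_real_derivative (- real n * flat_exp (Suc n) x + flat_exp (Suc (Suc n)) x)) (at x)"
proof (cases x "0::real" rule: linorder_cases)
  case less
  have "((\<lambda>x. 0) has_real_derivative 0) (at x)" by simp
  then have "(flat_exp n has_real_derivative 0) (at x)"
    by (rule has_field_derivative_transform_within_open[where S = "{..<0}"])
      (use less in \<open>auto simp: flat_exp_def\<close>)
  then show ?thesis using less by (simp add: flat_exp_def)
next
  case greater
  have "((\<lambda>x. (1/x) ^ n * exp (- (1/x))) has_real_derivative
      (- real n * flat_exp (Suc n) x + flat_exp (Suc (Suc n)) x)) (at x)"
  proof -
    have 1: "((\<lambda>x. 1/x) has_real_derivative - ((1/x)^2)) (at x)"
      using greater by (auto intro!: derivative_eq_intros simp: power2_eq_square)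
    have 2: "((\<lambda>x. (1/x)^n) has_real_derivative real n * (1/x)^(n - 1) * - ((1/x)^2)) (at x)"
      using DERIV_power[OF 1, of n] by (simp add: mult_ac)
    have 3: "((\<lambda>x. exp (- (1/x))) has_real_derivative exp (- (1/x)) * (1/x)^2) (at x)"
      using DERIV_chain2[OF DERIV_exp DERIV_minus[OF 1]] by simp
    from DERIV_mult[OF 2 3] show ?thesis
    proof (rule DERIV_cong)
      have "real n * (1/x)^(n - 1) * (1/x)^2 = real n * (1/x)^(Suc n)"
        by (cases n) (auto simp: power2_eq_square)
      then show "real n * (1/x)^(n - 1) * - ((1/x)^2) * exp (- (1/x)) + exp (- (1/x)) * (1/x)^2 * (1/x)^n
          = - real n * flat_exp (Suc n) x + flat_exp (Suc (Suc n)) x"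
        using greater by (simp add: flat_exp_def power2_eq_square mult_ac)
    qed
  qed
  then show ?thesis
    by (rule has_field_derivative_transform_within_open[where S = "{0<..}"])
      (use greater in \<open>auto simp: flat_exp_def\<close>)
next
  case equal
  have lim: "((\<lambda>h. flat_exp (Suc n) h) \<longlongrightarrow> 0) (at_right 0)"
  proof -
    have "((\<lambda>h. (inverse h) ^ Suc n / exp (inverse h)) \<longlongrightarrow> 0) (at_right (0::real))"
      by (rule filterlim_compose[OF tendsto_power_div_exp_0 filterlim_inverse_at_top_right])
    then show ?thesis
    proof (rule Lim_transform_eventually)
      show "\<forall>\<^sub>F h in at_right 0. inverse h ^ Suc n / exp (inverse h) = flat_exp (Suc n) (h::real)"
        by (rule eventually_at_right_less[THEN eventually_mono])
          (simp add: flat_exp_def exp_minus divide_inverse)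
    qed
  qed
  \<comment> \<open>The difference quotient at 0 is again a member of the family, so
    differentiability at 0 amounts to its tending to 0 from both sides.\<close>
  have q: "(flat_exp n (0 + h) - flat_exp n 0) / h = flat_exp (Suc n) h" for h
    by (simp add: flat_exp_def)
  have "((\<lambda>h. flat_exp (Suc n) h) \<longlongrightarrow> 0) (at_left 0)"
    by (rule Lim_transform_eventually[OF tendsto_const])
      (auto simp: flat_exp_def eventually_at_filter)
  with lim have "((\<lambda>h. flat_exp (Suc n) h) \<longlongrightarrow> 0) (at 0)"
    by (simp add: filterlim_split_at)
  then show ?thesis unfolding equal DERIV_def q by (simp add: flat_exp_def)
qed

lemma Ck_flat_exp_affine: "Ck k (\<lambda>x::real^'n. flat_exp n (a + b * x $ i))"
proof (induction k arbitrary: n)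
  case 0
  have "continuous_on UNIV (flat_exp n)"
    by (intro continuous_at_imp_continuous_on ballI DERIV_isCont[OF flat_exp_deriv])
  then have "continuous_on UNIV (\<lambda>x::real^'n. flat_exp n (a + b * x $ i))"
    by (rule continuous_on_compose2) (auto intro!: continuous_intros)
  then show ?case by simp
next
  case (Suc k)
  define d where "d x = - real n * flat_exp (Suc n) x + flat_exp (Suc (Suc n)) x" for x
  have "((\<lambda>x::real^'n. flat_exp n (a + b * x $ i)) has_derivative (\<lambda>v. (b * v $ i) * d (a + b * x $ i))) (at x)" for x
  proof -
    have "((\<lambda>x::real^'n. a + b * x $ i) has_derivative (\<lambda>v. 0 + b * v $ i)) (at x)"
      by (intro has_derivative_add has_derivative_const has_derivative_mult_right
          bounded_linear_imp_has_derivative bounded_linear_vec_nth)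
    then have 1: "((\<lambda>x::real^'n. a + b * x $ i) has_derivative (\<lambda>v. b * v $ i)) (at x)" by simp
    have 2: "(flat_exp n has_derivative (*) (d (a + b * x $ i))) (at (a + b * x $ i))"
      using flat_exp_deriv[of n "a + b * x $ i"] by (simp add: has_field_derivative_def d_def)
    show ?thesis using has_derivative_compose[OF 1 2] by (simp add: mult.commute)
  qed
  then show ?case
  proof (rule Ck_SucI)
    fix l :: 'n
    have "Ck k (\<lambda>x::real^'n. (b * axis l 1 $ i) *
        (- real n * flat_exp (Suc n) (a + b * x $ i) + flat_exp (Suc (Suc n)) (a + b * x $ i)))"
      by (intro Ck_cmult Ck_add Suc.IH)
    then show "Ck k (\<lambda>x::real^'n. (b * axis l 1 $ i) * d (a + b * x $ i))" by (simp add: d_def)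
  qed
qed

definition bump1 :: "real \<Rightarrow> real" where "bump1 t = flat_exp 0 (1 + t) * flat_exp 0 (1 - t)"

text \<open>A product of one-dimensional bumps is supported in the unit cube, which matches the
  cubes used throughout, and its smoothness reduces to that of functions of one coordinate.\<close>

definition bump :: "real^'n \<Rightarrow> real" where "bump w = (\<Prod>i\<in>UNIV. bump1 (w $ i))"

lemma flat_exp_0_bounds: "0 \<le> flat_exp 0 t" "flat_exp 0 t \<le> 1"
  by (auto simp: flat_exp_def)

lemma bump1_bounds: "0 \<le> bump1 t" "bump1 t \<le> 1" "bump1 t \<noteq> 0 \<Longrightarrow> \<bar>t\<bar> \<le> 1" "bump1 0 > 0"
  by (auto simp: bump1_def flat_exp_0_bounds intro!: mult_le_one)
    (auto simp: flat_exp_def split: if_splits)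

lemma bump_bounds:
  fixes w :: "real^'n"
  shows "0 \<le> bump w" "bump w \<le> 1" "bump w \<noteq> 0 \<Longrightarrow> \<bar>w $ i\<bar> \<le> 1" "bump (0::real^'n) > 0"
  using bump1_bounds by (auto simp: bump_def intro!: prod_nonneg prod_le_1 prod_pos)

lemma smooth_fun_bump_affine: "smooth_fun (\<lambda>y::real^'n. bump ((y - c) /\<^sub>R r))"
proof -
  have eq: "(\<lambda>y::real^'n. bump ((y - c) /\<^sub>R r)) = (\<lambda>y. \<Prod>i\<in>UNIV.
      flat_exp 0 ((1 - c $ i / r) + (1/r) * y $ i) * flat_exp 0 ((1 + c $ i / r) + (- 1/r) * y $ i))"
    by (simp add: bump_def bump1_def divide_inverse algebra_simps)
  show ?thesis unfolding smooth_fun_def eq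
    by (intro allI Ck_prod Ck_mult Ck_flat_exp_affine finite)
qed

lemma smooth_fun_bump: "smooth_fun (bump :: real^'n \<Rightarrow> real)"
  using smooth_fun_bump_affine[where c = 0 and r = 1] by simp

lemma smooth_fun_differentiable: "smooth_fun f \<Longrightarrow> f differentiable (at x)"
  unfolding smooth_fun_def by (metis Ck.simps(2))

lemma smooth_fun_continuous_partial: "smooth_fun f \<Longrightarrow> continuous_on UNIV (partial_deriv l f)"
  unfolding smooth_fun_def by (metis Ck.simps)

lemma smooth_fun_continuous: "smooth_fun f \<Longrightarrow> continuous_on UNIV f"
  unfolding smooth_fun_def by (metis Ck.simps(1))

section \<open>Averages over moving cubes\<close>

text \<open>\<open>R\<close> is half the side. Cubes are preferred to Euclidean balls because dyadic
  and grid decompositions produce cubes, and their volumes enter as exact powers.\<close>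

definition cube :: "real^'n \<Rightarrow> real \<Rightarrow> (real^'n) set" where
  "cube m R = {y. \<forall>i. \<bar>y $ i - m $ i\<bar> \<le> R}"

lemma cube_eq_cbox: "cube m R = cbox (m - (\<chi> i. R)) (m + (\<chi> i. R))"
  by (auto simp: cube_def mem_box_cart abs_le_iff algebra_simps)

lemma compact_cube: "compact (cube m R)" and closed_cube: "closed (cube m R)" and borel_cube [measurable]: "cube m R \<in> sets borel"
  by (auto simp: cube_eq_cbox closed_cbox)

lemma emeasure_cube:
  fixes m :: "real^'n"
  assumes "0 \<le> R" shows "emeasure lborel (cube m R) = ennreal ((2 * R) ^ CARD('n))"
proof -
  have ne: "cbox (m - (\<chi> i. R)) (m + (\<chi> i. R)) \<noteq> {}" using assms by (auto simp: interval_ne_empty_cart)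
  have "measure lborel (cube m R) = (2 * R) ^ CARD('n)"
    unfolding cube_eq_cbox using content_cbox_cart[OF ne] by simp
  moreover have "emeasure lborel (cube m R) \<noteq> \<infinity>"
    using emeasure_lborel_cbox_finite[of "m - (\<chi> i. R)" "m + (\<chi> i. R)"] by (simp add: cube_eq_cbox)
  ultimately show ?thesis using emeasure_eq_ennreal_measure[of lborel "cube m R"] by simp
qed

lemma abs_integral_le_nn_integral: "ennreal \<bar>\<integral>x. f x \<partial>M\<bar> \<le> (\<integral>\<^sup>+x. ennreal \<bar>f x\<bar> \<partial>M)"
  for f :: "'a \<Rightarrow> real"
proof (cases "integrable M f")
  case True
  from integral_norm_bound_ennreal[OF this] show ?thesis by simp
qed (simp add: not_integrable_integral_eq)

lemma lborel_integral_compact_support: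
  fixes f :: "'a::euclidean_space \<Rightarrow> real"
  assumes "compact S" "continuous_on S f" "\<And>y. y \<notin> S \<Longrightarrow> f y = 0"
  shows "integrable lborel f" "(\<integral>y. f y \<partial>lborel) = integral S f"
proof -
  have f: "(\<lambda>y. indicator S y *\<^sub>R f y) = f" 
  proof (rule ext)
    show "indicator S y *\<^sub>R f y = f y" for y using assms(3)[of y] by (cases "y \<in> S") auto
  qed
  show 1: "integrable lborel f" using borel_integrable_compact[OF assms(1,2)] unfolding f .
  have "set_lebesgue_integral lborel S f = integral S f"
    by (rule set_borel_integral_eq_integral(2)) (unfold set_integrable_def f, rule 1)
  then show "(\<integral>y. f y \<partial>lborel) = integral S f" unfolding set_lebesgue_integral_def f .
qed

definition weak_gradient :: "(real^'n) set \<Rightarrow> (real^'n \<Rightarrow> real) \<Rightarrow> ('n \<Rightarrow> real^'n \<Rightarrow> real) \<Rightarrow> bool" where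
  "weak_gradient \<Omega> u g \<longleftrightarrow> (\<forall>l \<phi>. test_fun \<Omega> \<phi> \<longrightarrow>
     (\<integral>y. u y * partial_deriv l \<phi> y \<partial>lborel) = - (\<integral>y. g l y * \<phi> y \<partial>lborel))"

lemma bump_support: "bump ((y - c) /\<^sub>R r) \<noteq> 0 \<Longrightarrow> r > 0 \<Longrightarrow> y \<in> cube c r"
  using bump_bounds(3)[of "(y - c) /\<^sub>R r"] by (auto simp: cube_def abs_mult field_simps)

lemma partial_deriv_bump_outside:
  fixes w :: "real^'n"
  assumes "\<bar>w $ i\<bar> > 1" shows "partial_deriv l bump w = 0"
proof -
  have "(bump has_derivative (\<lambda>v. 0)) (at w)"
  proof (rule has_derivative_transform_within_open[OF has_derivative_const])
    show "open {w::real^'n. 1 < \<bar>w $ i\<bar>}" by (intro open_Collect_less continuous_intros)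
    show "0 = bump x" if "x \<in> {w::real^'n. 1 < \<bar>w $ i\<bar>}" for x using that bump_bounds(3)[of x i] by force
  qed (use assms in auto)
  then show ?thesis by (simp add: partial_deriv_eq)
qed

lemma test_fun_mult_bump:
  fixes A :: "real^'n \<Rightarrow> real"
  assumes A: "smooth_fun A" and r: "r > 0" "cube c r \<subseteq> \<Omega>"
  shows "test_fun \<Omega> (\<lambda>y. A y * bump ((y - c) /\<^sub>R r))"
proof -
  have sub: "closure {y. A y * bump ((y - c) /\<^sub>R r) \<noteq> 0} \<subseteq> cube c r"
    by (rule closure_minimal[OF _ closed_cube]) (use bump_support r in auto)
  then have "compact (closure {y. A y * bump ((y - c) /\<^sub>R r) \<noteq> 0})"
    by (meson bounded_subset closure_subset compact_closure compact_cube compact_imp_bounded subset_trans)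
  moreover have "smooth_fun (\<lambda>y. A y * bump ((y - c) /\<^sub>R r))"
    using A smooth_fun_bump_affine[where c = c and r = r] unfolding smooth_fun_def by (intro allI Ck_mult) auto
  ultimately show ?thesis unfolding test_fun_def using sub r by auto
qed

text \<open>The mollification \<open>h s\<close> of \<open>u\<close> along a segment of centres and radii: the divergence theorem
  turns its derivative in \<open>s\<close> into an average of the weak gradient.\<close>

locale mollifier_path =
  fixes p0 p1 :: "real^'n" and r0 r1 :: real and m :: "real^'n" and R :: real and \<Omega> :: "(real^'n) set"
    and u :: "real^'n \<Rightarrow> real" and g :: "'n \<Rightarrow> real^'n \<Rightarrow> real"
  assumes r0: "r0 > 0" and r1: "r1 > 0"
    and in0: "\<And>i. \<bar>p0 $ i - m $ i\<bar> \<le> R - r0" and in1: "\<And>i. \<bar>p1 $ i - m $ i\<bar> \<le> R - r1"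
    and sub: "cube m R \<subseteq> \<Omega>"
    and u: "continuous_on UNIV u" and wg: "weak_gradient \<Omega> u g"
begin

definition c :: "real \<Rightarrow> real^'n" where "c s = p0 + s *\<^sub>R (p1 - p0)"
definition r :: "real \<Rightarrow> real" where "r s = r0 + s * (r1 - r0)"
definition w :: "real \<Rightarrow> real^'n \<Rightarrow> real^'n" where "w s y = (y - c s) /\<^sub>R r s"
definition \<Psi> :: "real \<Rightarrow> real^'n \<Rightarrow> real" where "\<Psi> s y = bump (w s y) / r s ^ CARD('n)"
text \<open>The velocity of the moving kernel: mass at relative position w in the cube travels with
  velocity c' + r' w. The kernel \<Psi> therefore obeys the continuity equation with flux \<phi> = a
  \<Psi>, and \<open>D\<close> below is minus the divergence of this flux.\<close>

definition a :: "'n \<Rightarrow> real \<Rightarrow> real^'n \<Rightarrow> real" where "a l s y = (p1 - p0) $ l + (r1 - r0) * w s y $ l"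
definition \<phi> :: "'n \<Rightarrow> real \<Rightarrow> real^'n \<Rightarrow> real" where "\<phi> l s y = a l s y * \<Psi> s y"
definition h :: "real \<Rightarrow> real" where "h s = (\<integral>y. u y * \<Psi> s y \<partial>lborel)"
definition D :: "real \<Rightarrow> real^'n \<Rightarrow> real" where
  "D s y = - (\<Sum>l\<in>UNIV. (r1 - r0) / r s * \<Psi> s y + a l s y * (partial_deriv l bump (w s y) / r s) / r s ^ CARD('n))"

lemma r_pos: "s \<in> {0..1} \<Longrightarrow> r s > 0"
proof -
  assume s: "s \<in> {0..1}"
  have "r s = (1 - s) * r0 + s * r1" by (simp add: r_def algebra_simps)
  also have "\<dots> > 0" using s r0 r1
    by (cases "s = 0") (auto intro!: add_nonneg_pos mult_nonneg_nonneg)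
  finally show ?thesis .
qed

text \<open>The condition |c - m| \<le> R - r is convex in centre and radius, so it passes from the
  two ends to the whole segment.\<close>

lemma cube_path: assumes s: "s \<in> {0..1}" shows "cube (c s) (r s) \<subseteq> cube m R"
proof
  fix y assume y: "y \<in> cube (c s) (r s)"
  have "\<bar>y $ i - m $ i\<bar> \<le> R" for i
  proof -
    have "y $ i - m $ i = (y $ i - c s $ i) + ((1 - s) * (p0 $ i - m $ i) + s * (p1 $ i - m $ i))"
      by (simp add: c_def algebra_simps)
    also have "\<bar>\<dots>\<bar> \<le> \<bar>y $ i - c s $ i\<bar> + ((1 - s) * \<bar>p0 $ i - m $ i\<bar> + s * \<bar>p1 $ i - m $ i\<bar>)"
      using s by (auto simp: abs_mult intro!: order.trans[OF abs_triangle_ineq] add_mono)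
    also have "\<dots> \<le> r s + ((1 - s) * (R - r0) + s * (R - r1))"
      using s y in0[of i] in1[of i] by (intro add_mono mult_left_mono) (auto simp: cube_def)
    also have "\<dots> = R" by (simp add: r_def algebra_simps)
    finally show ?thesis .
  qed
  then show "y \<in> cube m R" by (simp add: cube_def)
qed

lemma \<Psi>_outside: "s \<in> {0..1} \<Longrightarrow> y \<notin> cube (c s) (r s) \<Longrightarrow> \<Psi> s y = 0"
  using bump_support[where y = y and c = "c s" and r = "r s"] r_pos[of s] by (auto simp: \<Psi>_def w_def)

lemma D_outside: assumes s: "s \<in> {0..1}" and y: "y \<notin> cube (c s) (r s)" shows "D s y = 0"
proof -
  obtain i where "\<bar>y $ i - c s $ i\<bar> > r s" using y by (auto simp: cube_def not_le)
  then have "\<bar>w s y $ i\<bar> > 1" using r_pos[OF s] by (simp add: w_def abs_mult field_simps)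
  from partial_deriv_bump_outside[OF this] show ?thesis by (simp add: D_def \<Psi>_outside[OF s y])
qed

lemma partial_deriv_\<phi>:
  assumes s: "s \<in> {0..1}"
  shows "partial_deriv l (\<phi> l s) y =
    (r1 - r0) / r s * \<Psi> s y + a l s y * (partial_deriv l bump (w s y) / r s) / r s ^ CARD('n)"
proof -
  have rs: "r s > 0" by (rule r_pos[OF s])
  have "bounded_linear (\<lambda>v::real^'n. v /\<^sub>R r s)" by (rule bounded_linear_scaleR_right)
  from bounded_linear.has_derivative[OF this has_derivative_diff[OF has_derivative_ident has_derivative_const[of "c s"]]]
  have dw: "(w s has_derivative (\<lambda>v. v /\<^sub>R r s)) (at y)" by (simp add: w_def[abs_def])
  have db: "((\<lambda>y. bump (w s y)) has_derivative (\<lambda>v. \<Sum>k\<in>UNIV. (v /\<^sub>R r s) $ k * partial_deriv k bump (w s y))) (at y)"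
    by (rule has_derivative_compose[OF dw has_derivative_partial_deriv])
      (rule smooth_fun_differentiable[OF smooth_fun_bump])
  have da: "(a l s has_derivative (\<lambda>v. (r1 - r0) * (v /\<^sub>R r s) $ l)) (at y)"
    unfolding a_def[abs_def]
    using has_derivative_add[OF has_derivative_const[of "(p1 - p0) $ l"]
        has_derivative_mult_right[OF bounded_linear.has_derivative[OF bounded_linear_vec_nth dw]]] by simp
  have "((\<lambda>y. a l s y * (bump (w s y) / r s ^ CARD('n))) has_derivative
     (\<lambda>v. a l s y * ((\<Sum>k\<in>UNIV. (v /\<^sub>R r s) $ k * partial_deriv k bump (w s y)) / r s ^ CARD('n))
       + ((r1 - r0) * (v /\<^sub>R r s) $ l) * (bump (w s y) / r s ^ CARD('n)))) (at y)"
    by (intro has_derivative_mult da bounded_linear.has_derivative[OF bounded_linear_divide db])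
  then have "partial_deriv l (\<phi> l s) y = a l s y * ((\<Sum>k\<in>UNIV. (axis l 1 /\<^sub>R r s) $ k * partial_deriv k bump (w s y)) / r s ^ CARD('n))
       + ((r1 - r0) * (axis l 1 /\<^sub>R r s) $ l) * (bump (w s y) / r s ^ CARD('n))"
    unfolding \<phi>_def[abs_def] \<Psi>_def by (rule partial_deriv_eq)
  also have "(\<Sum>k\<in>UNIV. (axis l 1 /\<^sub>R r s) $ k * partial_deriv k bump (w s y)) =
      (\<Sum>k\<in>UNIV. if k = l then partial_deriv l bump (w s y) / r s else 0)"
    by (intro sum.cong) (auto simp: axis_def divide_inverse)
  finally show ?thesis by (simp add: \<Psi>_def axis_def divide_inverse algebra_simps)
qed

lemma D_eq: "s \<in> {0..1} \<Longrightarrow> D s y = - (\<Sum>l\<in>UNIV. partial_deriv l (\<phi> l s) y)"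
  by (simp add: D_def partial_deriv_\<phi>)

text \<open>Together with \<open>D_eq\<close> this is the continuity equation of the kernel.
  Differentiating the normalisation r^(-N) yields the term N r' / r, the divergence of the velocity
  field.\<close>

lemma \<Psi>_deriv:
  assumes s: "s \<in> {0..1}"
  shows "((\<lambda>s. \<Psi> s y) has_real_derivative D s y) (at s within {0..1})"
proof -
  have rs: "r s > 0" by (rule r_pos[OF s])
  have dr: "(r has_real_derivative (r1 - r0)) (at s within {0..1})"
    unfolding r_def[abs_def] by (auto intro!: derivative_eq_intros)
  have dc: "((\<lambda>s. y - c s) has_vector_derivative - (p1 - p0)) (at s within {0..1})"
    unfolding c_def by (auto intro!: derivative_eq_intros)
  have dri: "((\<lambda>s. inverse (r s)) has_real_derivative - ((r1 - r0) / (r s)\<^sup>2)) (at s within {0..1})"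
    using DERIV_inverse'[OF dr] rs by (simp add: power2_eq_square divide_inverse mult_ac)
  have "((\<lambda>s. w s y) has_vector_derivative
      inverse (r s) *\<^sub>R (- (p1 - p0)) + (- ((r1 - r0) / (r s)\<^sup>2)) *\<^sub>R (y - c s)) (at s within {0..1})"
    unfolding w_def by (rule has_vector_derivative_scaleR[OF dri dc])
  also have "inverse (r s) *\<^sub>R (- (p1 - p0)) + (- ((r1 - r0) / (r s)\<^sup>2)) *\<^sub>R (y - c s) = (\<chi> l. - a l s y / r s)"
    using rs by (simp add: vec_eq_iff a_def w_def power2_eq_square field_simps)
  finally have dw: "((\<lambda>s. w s y) has_derivative (\<lambda>t. t *\<^sub>R (\<chi> l. - a l s y / r s))) (at s within {0..1})"
    by (simp add: has_vector_derivative_def)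
  have "((\<lambda>s. bump (w s y)) has_derivative
      (\<lambda>t. \<Sum>k\<in>UNIV. (t *\<^sub>R (\<chi> l. - a l s y / r s)) $ k * partial_deriv k bump (w s y))) (at s within {0..1})"
    by (rule has_derivative_compose[OF dw has_derivative_partial_deriv])
      (rule smooth_fun_differentiable[OF smooth_fun_bump])
  then have db: "((\<lambda>s. bump (w s y)) has_real_derivative
      (\<Sum>k\<in>UNIV. - a k s y / r s * partial_deriv k bump (w s y))) (at s within {0..1})"
    unfolding has_field_derivative_def
    by (rule has_derivative_eq_rhs) (simp add: fun_eq_iff sum_distrib_left sum_distrib_right mult_ac)
  have dp: "((\<lambda>s. r s ^ CARD('n)) has_real_derivative (real CARD('n) * r s ^ (CARD('n) - 1) * (r1 - r0))) (at s within {0..1})"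
    using DERIV_power[OF dr, of "CARD('n)"] by (simp add: mult_ac)
  have "((\<lambda>s. bump (w s y) / r s ^ CARD('n)) has_real_derivative
     ((\<Sum>k\<in>UNIV. - a k s y / r s * partial_deriv k bump (w s y)) * r s ^ CARD('n)
      - bump (w s y) * (real CARD('n) * r s ^ (CARD('n) - 1) * (r1 - r0))) / (r s ^ CARD('n) * r s ^ CARD('n))) (at s within {0..1})"
    using rs by (intro DERIV_divide[OF db dp]) auto
  moreover have "((\<Sum>k\<in>UNIV. - a k s y / r s * partial_deriv k bump (w s y)) * r s ^ CARD('n)
      - bump (w s y) * (real CARD('n) * r s ^ (CARD('n) - 1) * (r1 - r0))) / (r s ^ CARD('n) * r s ^ CARD('n)) = D s y"
    (is "(?S * ?p - ?b * (?N * ?q * ?d)) / (?p * ?p) = _")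
  proof -
    have p: "?p = r s * ?q" using power_Suc[of "r s" "CARD('n) - 1"] by simp
    have "(?S * ?p - ?b * (?N * ?q * ?d)) / (?p * ?p) = ?S / ?p - ?N * (?d / r s * (?b / ?p))"
      using rs unfolding p by (simp add: field_simps)
    also have "?S / ?p = - (\<Sum>l\<in>UNIV. a l s y * (partial_deriv l bump (w s y) / r s) / ?p)"
      by (simp add: sum_divide_distrib sum_negf[symmetric] mult_ac)
    finally show ?thesis by (simp add: D_def \<Psi>_def sum.distrib)
  qed
  ultimately show ?thesis by (simp add: \<Psi>_def)
qed

lemma cont_w: "continuous_on ({0..1} \<times> S) (\<lambda>p. w (fst p) (snd p))"
  unfolding w_def c_def r_def using r_pos
  by (intro continuous_intros) (auto simp: r_def[symmetric] dest!: r_pos)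

lemma cont_bump_w: "continuous_on ({0..1} \<times> S) (\<lambda>p. bump (w (fst p) (snd p)))"
  by (rule continuous_on_compose2[OF smooth_fun_continuous[OF smooth_fun_bump] cont_w]) auto

lemma cont_pd_w: "continuous_on ({0..1} \<times> S) (\<lambda>p. partial_deriv l bump (w (fst p) (snd p)))"
  by (rule continuous_on_compose2[OF smooth_fun_continuous_partial[OF smooth_fun_bump] cont_w]) auto

lemma cont_r: "continuous_on ({0..1} \<times> S) (\<lambda>p. r (fst p))"
  unfolding r_def by (intro continuous_intros)

lemma cont_\<Psi>: "continuous_on ({0..1} \<times> S) (\<lambda>p. \<Psi> (fst p) (snd p))"
  unfolding \<Psi>_def by (intro continuous_intros cont_bump_w cont_r) (auto dest!: r_pos)

lemma cont_D: "continuous_on ({0..1} \<times> S) (\<lambda>p. D (fst p) (snd p))"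
  unfolding D_def a_def
  by (intro continuous_intros cont_\<Psi> cont_r cont_pd_w cont_w) (auto dest!: r_pos)

lemma cont_slice:
  assumes "continuous_on ({0..1} \<times> S) (\<lambda>p. f (fst p) (snd p))" "s \<in> {0..1::real}"
  shows "continuous_on S (f s)"
proof -
  have "continuous_on S (\<lambda>y. f (fst (s, y)) (snd (s, y)))"
    by (rule continuous_on_compose2[OF assms(1)])
      (use assms(2) in \<open>auto intro!: continuous_on_Pair continuous_on_const continuous_on_id\<close>)
  then show ?thesis by simp
qed

lemma u_on: "continuous_on S u"
  by (rule continuous_on_subset[OF u]) simp

lemma h_eq: assumes s: "s \<in> {0..1}" shows "h s = integral (cube m R) (\<lambda>y. u y * \<Psi> s y)"
  unfolding h_def
  by (rule lborel_integral_compact_support(2)[OF compact_cube])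
    (use cube_path[OF s] \<Psi>_outside[OF s] in \<open>auto intro!: continuous_intros u_on cont_slice[OF cont_\<Psi> s]\<close>)

lemma test_fun_\<phi>: assumes s: "s \<in> {0..1}" shows "test_fun \<Omega> (\<phi> l s)"
proof -
  have eq: "\<phi> l s = (\<lambda>y. ((1 / r s ^ CARD('n)) * (((p1 - p0) $ l - (r1 - r0) * c s $ l / r s) + (r1 - r0) / r s * y $ l)) * bump ((y - c s) /\<^sub>R r s))"
    using r_pos[OF s] by (simp add: fun_eq_iff \<phi>_def a_def \<Psi>_def w_def field_simps)
  show ?thesis unfolding eq
  proof (rule test_fun_mult_bump)
    show "smooth_fun (\<lambda>y. (1 / r s ^ CARD('n)) * (((p1 - p0) $ l - (r1 - r0) * c s $ l / r s) + (r1 - r0) / r s * y $ l))"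
      unfolding smooth_fun_def by (intro allI Ck_add Ck_cmult Ck_const Ck_component)
  qed (use r_pos[OF s] cube_path[OF s] sub in auto)
qed

definition h' :: "real \<Rightarrow> real" where "h' s = integral (cube m R) (\<lambda>y. u y * D s y)"

text \<open>Each component \<phi> of the flux is a test function, so the definition of the weak
  gradient moves the divergence from the kernel to \<open>u\<close>; the two minus signs
  cancel.\<close>

lemma h'_eq: assumes s: "s \<in> {0..1}" shows "h' s = (\<Sum>l\<in>UNIV. \<integral>y. g l y * \<phi> l s y \<partial>lborel)"
proof -
  have "h' s = (\<integral>y. u y * D s y \<partial>lborel)"
    unfolding h'_def
    by (rule lborel_integral_compact_support(2)[OF compact_cube, symmetric])
      (use cube_path[OF s] D_outside[OF s] in \<open>auto intro!: continuous_intros u_on cont_slice[OF cont_D s]\<close>)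
  also have "\<dots> = (\<integral>y. (\<Sum>l\<in>UNIV. - (u y * partial_deriv l (\<phi> l s) y)) \<partial>lborel)"
    by (simp add: D_eq[OF s] sum_distrib_left sum_negf)
  also have "\<dots> = (\<Sum>l\<in>UNIV. \<integral>y. - (u y * partial_deriv l (\<phi> l s) y) \<partial>lborel)"
  proof (rule Bochner_Integration.integral_sum)
    fix l :: 'n
    have "continuous_on (cube m R) (partial_deriv l (\<phi> l s))"
      using smooth_fun_continuous_partial test_fun_\<phi>[OF s, of l] continuous_on_subset
      unfolding test_fun_def by blast
    moreover have "partial_deriv l (\<phi> l s) y = 0" if "y \<notin> cube m R" for y
    proof -
      have y: "y \<notin> cube (c s) (r s)" using that cube_path[OF s] by auto
      then obtain i where "\<bar>y $ i - c s $ i\<bar> > r s" by (auto simp: cube_def not_le)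
      then have "\<bar>w s y $ i\<bar> > 1" using r_pos[OF s] by (simp add: w_def abs_mult field_simps)
      from partial_deriv_bump_outside[OF this] show ?thesis
        by (simp add: partial_deriv_\<phi>[OF s] \<Psi>_outside[OF s y])
    qed
    ultimately show "integrable lborel (\<lambda>y. - (u y * partial_deriv l (\<phi> l s) y))"
      by (intro lborel_integral_compact_support(1)[OF compact_cube[of m R]])
        (auto intro!: continuous_intros u_on)
  qed
  also have "\<dots> = (\<Sum>l\<in>UNIV. \<integral>y. g l y * \<phi> l s y \<partial>lborel)"
    using wg test_fun_\<phi>[OF s] by (intro sum.cong) (auto simp: weak_gradient_def)
  finally show ?thesis .
qed

lemma cont_h': "continuous_on {0..1} h'"
  unfolding h'_def cube_eq_cbox
  by (rule integral_continuous_on_param)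
    (auto simp: case_prod_beta intro!: continuous_intros cont_D continuous_on_compose2[OF u])

lemma h_deriv: assumes s: "s \<in> {0..1}" shows "(h has_real_derivative h' s) (at s within {0..1})"
proof -
  have "((\<lambda>s. integral (cube m R) (\<lambda>y. u y * \<Psi> s y)) has_real_derivative h' s) (at s within {0..1})"
    unfolding h'_def cube_eq_cbox
  proof (rule leibniz_rule_field_derivative)
    show "((\<lambda>s. u y * \<Psi> s y) has_real_derivative u y * D s y) (at s within {0..1})" if "s \<in> {0..1}" for s y
      by (rule DERIV_cmult[OF \<Psi>_deriv[OF that]])
    show "(\<lambda>y. u y * \<Psi> s y) integrable_on cbox (m - (\<chi> i. R)) (m + (\<chi> i. R))" if "s \<in> {0..1}" for s
      by (intro integrable_continuous continuous_intros u_on cont_slice[OF cont_\<Psi> that])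
    show "continuous_on ({0..1} \<times> cbox (m - (\<chi> i. R)) (m + (\<chi> i. R))) (\<lambda>(s, y). u y * D s y)"
      by (auto simp: case_prod_beta intro!: continuous_intros cont_D continuous_on_compose2[OF u])
  qed (use s in auto)
  then show ?thesis
    by (rule has_field_derivative_transform_within[where d = 1]) (use s in \<open>auto simp: h_eq\<close>)
qed

lemma h_diff_le: "ennreal \<bar>h 1 - h 0\<bar> \<le> (\<integral>\<^sup>+s. ennreal \<bar>h' s\<bar> * indicator {0..1} s \<partial>lborel)"
proof -
  have "(h' has_integral h 1 - h 0) {0..1}"
    by (rule fundamental_theorem_of_calculus)
      (use h_deriv in \<open>auto simp: has_real_derivative_iff_has_vector_derivative\<close>)
  then have "h 1 - h 0 = integral {0..1} h'" by (simp add: integral_unique)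
  also have "\<dots> = (\<integral>s. indicator {0..1} s *\<^sub>R h' s \<partial>lborel)"
    using set_borel_integral_eq_integral(2)[of "{0..1}" h'] borel_integrable_compact[OF compact_Icc cont_h']
    by (simp add: set_lebesgue_integral_def set_integrable_def)
  finally have "ennreal \<bar>h 1 - h 0\<bar> \<le> (\<integral>\<^sup>+s. ennreal \<bar>indicator {0..1} s *\<^sub>R h' s\<bar> \<partial>lborel)"
    using abs_integral_le_nn_integral by metis
  also have "\<dots> = (\<integral>\<^sup>+s. ennreal \<bar>h' s\<bar> * indicator {0..1} s \<partial>lborel)"
    by (intro nn_integral_cong) (auto simp: indicator_def)
  finally show ?thesis .
qed

lemma h'_le:
  assumes s: "s \<in> {0..1}"
  shows "ennreal \<bar>h' s\<bar> \<le> (\<Sum>l\<in>UNIV. \<integral>\<^sup>+y. ennreal \<bar>g l y * \<phi> l s y\<bar> \<partial>lborel)"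
proof -
  have "ennreal \<bar>h' s\<bar> \<le> ennreal (\<Sum>l\<in>UNIV. \<bar>\<integral>y. g l y * \<phi> l s y \<partial>lborel\<bar>)"
    unfolding h'_eq[OF s] by (intro ennreal_leI sum_abs)
  also have "\<dots> = (\<Sum>l\<in>UNIV. ennreal \<bar>\<integral>y. g l y * \<phi> l s y \<partial>lborel\<bar>)" by simp
  also have "\<dots> \<le> (\<Sum>l\<in>UNIV. \<integral>\<^sup>+y. ennreal \<bar>g l y * \<phi> l s y\<bar> \<partial>lborel)"
    by (intro sum_mono abs_integral_le_nn_integral)
  finally show ?thesis .
qed

lemma \<Psi>_bounds:
  assumes s: "s \<in> {0..1}"
  shows "0 \<le> \<Psi> s y" "\<Psi> s y \<le> indicator (cube (c s) (r s)) y / r s ^ CARD('n)"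
proof -
  show "0 \<le> \<Psi> s y" 
    unfolding \<Psi>_def using r_pos[OF s] by (intro divide_nonneg_nonneg bump_bounds(1)) auto
  show "\<Psi> s y \<le> indicator (cube (c s) (r s)) y / r s ^ CARD('n)"
    using \<Psi>_outside[OF s, of y] r_pos[OF s] bump_bounds(2)[of "w s y"]
    by (auto simp: indicator_def \<Psi>_def intro!: divide_right_mono)
qed

lemma \<phi>_le:
  assumes s: "s \<in> {0..1}"
  shows "\<bar>\<phi> l s y\<bar> \<le> (\<bar>(p1 - p0) $ l\<bar> + \<bar>r1 - r0\<bar>) / r s ^ CARD('n) * indicator (cube (c s) (r s)) y"
proof (cases "y \<in> cube (c s) (r s)")
  case True
  then have "\<bar>w s y $ l\<bar> \<le> 1" using r_pos[OF s] by (simp add: cube_def w_def abs_mult field_simps)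
  then have "\<bar>r1 - r0\<bar> * \<bar>w s y $ l\<bar> \<le> \<bar>r1 - r0\<bar> * 1" by (intro mult_left_mono) auto
  then have "\<bar>a l s y\<bar> \<le> \<bar>(p1 - p0) $ l\<bar> + \<bar>r1 - r0\<bar>"
    unfolding a_def using abs_triangle_ineq[of "(p1 - p0) $ l" "(r1 - r0) * w s y $ l"]
    by (simp add: abs_mult)
  then have "\<bar>a l s y\<bar> * \<bar>\<Psi> s y\<bar> \<le> (\<bar>(p1 - p0) $ l\<bar> + \<bar>r1 - r0\<bar>) * (1 / r s ^ CARD('n))"
    using \<Psi>_bounds[OF s, of y] True by (intro mult_mono) auto
  then show ?thesis using True by (simp add: \<phi>_def abs_mult)
qed (simp add: \<phi>_def \<Psi>_outside[OF s])

end

section \<open>Oscillation and the Lorentz norm\<close>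

definition superlevel_measure :: "('a::euclidean_space \<Rightarrow> real) \<Rightarrow> 'a set \<Rightarrow> real \<Rightarrow> real" where
  "superlevel_measure g A \<tau> = measure lborel {y\<in>A. \<tau> \<le> \<bar>g y\<bar>}"

text \<open>Up to normalisation the usual L^(N,1) norm. Its values are in \<open>ennreal\<close>, so
  that monotonicity and limits carry no finiteness conditions.\<close>

definition lorentz_norm :: "(real^'n) set \<Rightarrow> (real^'n \<Rightarrow> real) \<Rightarrow> ennreal" where
  "lorentz_norm A g = (\<integral>\<^sup>+\<tau>. ennreal (superlevel_measure g A \<tau> powr (1 / real CARD('n))) * indicator {0..} \<tau> \<partial>lborel)"

lemma superlevel_measure_sets:
  fixes g :: "'a::euclidean_space \<Rightarrow> real"
  shows "g \<in> borel_measurable borel \<Longrightarrow> A \<in> sets borel \<Longrightarrow> {y\<in>A. \<tau> \<le> \<bar>g y\<bar>} \<in> sets borel"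
proof -
  assume [measurable]: "g \<in> borel_measurable borel" "A \<in> sets borel"
  have "{y\<in>space borel. \<tau> \<le> \<bar>g y\<bar>} \<inter> A \<in> sets borel" by measurable
  also have "{y\<in>space borel. \<tau> \<le> \<bar>g y\<bar>} \<inter> A = {y\<in>A. \<tau> \<le> \<bar>g y\<bar>}" by auto
  finally show ?thesis .
qed

lemma emeasure_superlevel_measure:
  assumes "g \<in> borel_measurable borel" "A \<in> sets borel" "emeasure lborel A < \<infinity>"
  shows "emeasure lborel {y\<in>A. \<tau> \<le> \<bar>g y\<bar>} = ennreal (superlevel_measure g A \<tau>)"
proof -
  have "emeasure lborel {y\<in>A. \<tau> \<le> \<bar>g y\<bar>} \<le> emeasure lborel A"
    by (rule emeasure_mono) (use assms in auto)
  then show ?thesis unfolding superlevel_measure_def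
    using assms(3) by (intro emeasure_eq_ennreal_measure) (auto simp: top_unique)
qed

lemma superlevel_measure_nonneg [simp]: "0 \<le> superlevel_measure g A \<tau>" by (simp add: superlevel_measure_def)

lemma superlevel_measure_mono:
  assumes "g \<in> borel_measurable borel" "A \<in> sets borel" "B \<in> sets borel" "emeasure lborel B < \<infinity>" "A \<subseteq> B" "\<sigma> \<le> \<tau>"
  shows "superlevel_measure g A \<tau> \<le> superlevel_measure g B \<sigma>"
proof -
  have "emeasure lborel A < \<infinity>" using emeasure_mono[OF assms(5), of lborel] assms(3,4) by auto
  then have "ennreal (superlevel_measure g A \<tau>) \<le> ennreal (superlevel_measure g B \<sigma>)"
    using emeasure_mono[of "{y\<in>A. \<tau> \<le> \<bar>g y\<bar>}" "{y\<in>B. \<sigma> \<le> \<bar>g y\<bar>}" lborel] assms superlevel_measure_sets[OF assms(1,3)]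
    by (simp add: emeasure_superlevel_measure[symmetric]) force
  then show ?thesis by simp
qed

lemma borel_measurable_superlevel_measure:
  assumes "g \<in> borel_measurable borel" "A \<in> sets borel" "emeasure lborel A < \<infinity>"
  shows "superlevel_measure g A \<in> borel_measurable borel"
proof -
  have "mono (\<lambda>\<tau>. - superlevel_measure g A \<tau>)"
    using superlevel_measure_mono[OF assms(1,2,2,3) subset_refl] by (intro monoI) simp
  from borel_measurable_mono[OF this] have "(\<lambda>\<tau>. - (- superlevel_measure g A \<tau>)) \<in> borel_measurable borel"
    by (rule borel_measurable_uminus)
  then show ?thesis by simp
qed

text \<open>Tonelli's theorem on the region below the graph of |g|. The weight \<open>k\<close> is 1
  in the ordinary layer cake formula and a negative power of a distribution function in the
  construction of \<theta>.\<close>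

lemma layer_cake_weighted:
  fixes g :: "'a::euclidean_space \<Rightarrow> real" and k :: "real \<Rightarrow> ennreal"
  assumes [measurable]: "g \<in> borel_measurable borel" "A \<in> sets borel" "k \<in> borel_measurable borel"
  shows "(\<integral>\<^sup>+y. (\<integral>\<^sup>+\<tau>. k \<tau> * indicator {0..\<bar>g y\<bar>} \<tau> \<partial>lborel) * indicator A y \<partial>lborel)
    = (\<integral>\<^sup>+\<tau>. k \<tau> * emeasure lborel {y\<in>A. \<tau> \<le> \<bar>g y\<bar>} * indicator {0..} \<tau> \<partial>lborel)"
proof -
  have [measurable]: "{p. snd p \<le> \<bar>g (fst p)\<bar> \<and> fst p \<in> A} \<in> sets (borel \<Otimes>\<^sub>M (borel :: real measure))"
  proof -
    have "{p \<in> space (borel \<Otimes>\<^sub>M (borel :: real measure)). snd p \<le> \<bar>g (fst p)\<bar> \<and> fst p \<in> A} \<in> sets (borel \<Otimes>\<^sub>M borel)"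
      by measurable
    then show ?thesis by (simp add: space_pair_measure)
  qed
  define f where "f p = k (snd p) * indicator {0..} (snd p) * indicator {p. snd p \<le> \<bar>g (fst p)\<bar> \<and> fst p \<in> A} p"
    for p :: "'a \<times> real"
  have [measurable]: "f \<in> borel_measurable (lborel \<Otimes>\<^sub>M lborel)" unfolding f_def by measurable
  have "(\<integral>\<^sup>+y. (\<integral>\<^sup>+\<tau>. k \<tau> * indicator {0..\<bar>g y\<bar>} \<tau> \<partial>lborel) * indicator A y \<partial>lborel)
      = (\<integral>\<^sup>+y. \<integral>\<^sup>+\<tau>. f (y, \<tau>) \<partial>lborel \<partial>lborel)"
    by (intro nn_integral_cong, subst nn_integral_multc[symmetric])
      (auto simp: f_def indicator_def intro!: nn_integral_cong)
  also have "\<dots> = (\<integral>\<^sup>+\<tau>. \<integral>\<^sup>+y. f (y, \<tau>) \<partial>lborel \<partial>lborel)"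
    by (rule lborel_pair.Fubini'[symmetric]) simp
  also have "\<dots> = (\<integral>\<^sup>+\<tau>. k \<tau> * emeasure lborel {y\<in>A. \<tau> \<le> \<bar>g y\<bar>} * indicator {0..} \<tau> \<partial>lborel)"
  proof (intro nn_integral_cong)
    fix \<tau> :: real
    have "(\<integral>\<^sup>+y. f (y, \<tau>) \<partial>lborel) = (\<integral>\<^sup>+y. (k \<tau> * indicator {0..} \<tau>) * indicator {y\<in>A. \<tau> \<le> \<bar>g y\<bar>} y \<partial>lborel)"
      by (intro nn_integral_cong) (auto simp: f_def indicator_def)
    also have "\<dots> = (k \<tau> * indicator {0..} \<tau>) * emeasure lborel {y\<in>A. \<tau> \<le> \<bar>g y\<bar>}"
      by (rule nn_integral_cmult_indicator) (simp add: superlevel_measure_sets)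
    finally show "(\<integral>\<^sup>+y. f (y, \<tau>) \<partial>lborel) = k \<tau> * emeasure lborel {y\<in>A. \<tau> \<le> \<bar>g y\<bar>} * indicator {0..} \<tau>"
      by (simp add: mult_ac)
  qed
  finally show ?thesis .
qed

lemma layer_cake:
  fixes g :: "'a::euclidean_space \<Rightarrow> real"
  assumes [measurable]: "g \<in> borel_measurable borel" "A \<in> sets borel"
  shows "(\<integral>\<^sup>+y. ennreal \<bar>g y\<bar> * indicator A y \<partial>lborel)
    = (\<integral>\<^sup>+\<tau>. emeasure lborel {y\<in>A. \<tau> \<le> \<bar>g y\<bar>} * indicator {0..} \<tau> \<partial>lborel)"
  using layer_cake_weighted[of g A "\<lambda>_. 1"] by simp

text \<open>Two regimes meet at s = \<rho>, where the volume M equals (s R)^n. Below, the quotient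
  is at most 2^n; above, it is at most (\<rho> / s)^n \<le> (\<rho> / s)^2 because n \<ge> 2. The
  right-hand side dominates both and has an elementary primitive in s.\<close>

lemma min_power_bound:
  fixes M R s r :: real
  assumes "0 \<le> M" "0 < R" "0 \<le> s" "0 < r" "s * R \<le> r" "2 \<le> (n::nat)"
  defines "\<rho> \<equiv> M powr (1 / real n) / R"
  shows "min ((2 * r) ^ n) M / r ^ n \<le> 4 * 2 ^ n * (\<rho> / (\<rho> + s))\<^sup>2"
proof (cases "M = 0")
  case True
  then show ?thesis using assms by (simp add: min_absorb2)
next
  case False
  then have M: "M > 0" using assms by simp
  then have \<rho>: "\<rho> > 0" using assms by (simp add: \<rho>_def)
  have Mr: "M = (\<rho> * R) ^ n"
    using M assms by (simp add: \<rho>_def powr_realpow[symmetric] powr_powr)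
  have pos: "2 ^ n \<ge> (1::real)" by simp
  show ?thesis
  proof (cases "\<rho> \<le> s")
    case True
    then have s: "s > 0" using \<rho> by simp
    have "min ((2 * r) ^ n) M / r ^ n \<le> M / r ^ n" using assms(1-6) by (intro divide_right_mono) auto
    also have "\<dots> \<le> M / (s * R) ^ n" using assms(1-6) M s by (intro divide_left_mono power_mono) auto
    also have "\<dots> = (\<rho> / s) ^ n" unfolding Mr using assms(2) s by (simp add: power_mult_distrib power_divide)
    also have "\<dots> \<le> (\<rho> / s)\<^sup>2" using True \<rho> s assms(1-6) by (intro power_decreasing) auto
    also have "\<dots> \<le> (2 * (\<rho> / (\<rho> + s)))\<^sup>2"
    proof (rule power_mono)
      have "\<rho> * (\<rho> + s) \<le> \<rho> * (2 * s)" using True \<rho> by (intro mult_left_mono) auto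
      then show "\<rho> / s \<le> 2 * (\<rho> / (\<rho> + s))" using \<rho> s by (simp add: field_simps)
    qed (use \<rho> s in auto)
    also have "\<dots> = 4 * 1 * (\<rho> / (\<rho> + s))\<^sup>2" by (simp add: power_mult_distrib power_divide)
    also have "\<dots> \<le> 4 * 2 ^ n * (\<rho> / (\<rho> + s))\<^sup>2" by (intro mult_right_mono mult_left_mono pos) auto
    finally show ?thesis .
  next
    case False
    have "min ((2 * r) ^ n) M / r ^ n \<le> (2 * r) ^ n / r ^ n" using assms(1-6) by (intro divide_right_mono) auto
    also have "\<dots> = 4 * 2 ^ n * (1 / 2)\<^sup>2" using assms(1-6) by (simp add: power_mult_distrib power2_eq_square)
    also have "\<dots> \<le> 4 * 2 ^ n * (\<rho> / (\<rho> + s))\<^sup>2"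
      using False \<rho> assms(1-6) by (intro mult_left_mono power_mono) (auto simp: field_simps)
    finally show ?thesis .
  qed
qed

text \<open>The integral is \<rho> / (\<rho> + 1) for positive \<rho>. The bound linear in \<rho>,
  that is in M^(1/n), is what assembles the Lorentz norm after integration over the levels.\<close>

lemma nn_integral_sq_ratio:
  assumes "0 \<le> \<rho>"
  shows "(\<integral>\<^sup>+s. ennreal ((\<rho> / (\<rho> + s))\<^sup>2) * indicator {0..1} s \<partial>lborel) \<le> ennreal \<rho>"
proof (cases "\<rho> = 0")
  case False
  with assms have \<rho>: "\<rho> > 0" by simp
  have "(\<integral>\<^sup>+s. ennreal ((\<rho> / (\<rho> + s))\<^sup>2) * indicator {0..1} s \<partial>lborel) = ennreal (- \<rho>\<^sup>2 / (\<rho> + 1) - (- \<rho>\<^sup>2 / (\<rho> + 0)))"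
  proof (rule nn_integral_FTC_Icc)
    fix s :: real assume "s \<in> {0..1}"
    then have "\<rho> + s \<noteq> 0" using \<rho> by simp
    then show "((\<lambda>s. - \<rho>\<^sup>2 / (\<rho> + s)) has_real_derivative (\<rho> / (\<rho> + s))\<^sup>2) (at s)"
      by (auto intro!: derivative_eq_intros simp: power2_eq_square)
  qed auto
  also have "\<dots> \<le> ennreal \<rho>"
    using \<rho> by (intro ennreal_leI) (simp add: power2_eq_square)
  finally show ?thesis .
qed simp

lemma finite_emeasure_cube: "emeasure lborel (cube m R) < \<infinity>"
  using emeasure_lborel_cbox_finite by (simp add: cube_eq_cbox)

text \<open>The cubes form a cone with vertex \<open>p0\<close>. By the layer cake formula it suffices to treat the indicator of
  a set of measure \<open>M\<close>, whose average over the cube of half-side \<open>r\<close> is at most \<open>min ((2 r)^n) M / r^n\<close>;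
  integrating along the cone produces the power \<open>M^(1/n)\<close> because \<open>n \<ge> 2\<close>.\<close>

lemma (in mollifier_path) cone_bound:
  assumes N: "2 \<le> CARD('n)" and p1: "p1 = m" and r1: "r1 = R" "r0 \<le> R"
    and g [measurable]: "\<And>l. g l \<in> borel_measurable borel"
  shows "ennreal \<bar>h 1 - h 0\<bar> \<le> ennreal (8 * 2 ^ CARD('n)) * (\<Sum>l\<in>UNIV. lorentz_norm (cube m R) (g l))"
proof -
  define n where "n = CARD('n)"
  have R: "R > 0" using mollifier_path_axioms r1 by (simp add: mollifier_path_def)
  \<comment> \<open>The side of a cube with the volume of the superlevel set, in units of
    \<open>R\<close>.\<close>
  define \<rho> where "\<rho> l \<tau> = superlevel_measure (g l) (cube m R) \<tau> powr (1 / real n) / R" for l \<tau>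
  have \<rho>_nonneg: "0 \<le> \<rho> l \<tau>" for l \<tau> using R by (simp add: \<rho>_def)
  have [measurable]: "(\<lambda>\<tau>. \<rho> l \<tau>) \<in> borel_measurable borel" for l
    unfolding \<rho>_def using borel_measurable_superlevel_measure[OF g borel_cube finite_emeasure_cube] by measurable
  have h'_bound: "ennreal \<bar>h' s\<bar> \<le> (\<Sum>l\<in>UNIV. \<integral>\<^sup>+\<tau>. ennreal (8 * 2 ^ n * R) * ennreal ((\<rho> l \<tau> / (\<rho> l \<tau> + s))\<^sup>2) * indicator {0..} \<tau> \<partial>lborel)"
    if s: "s \<in> {0..1}" for s
  proof -
    have rs: "r s > 0" by (rule r_pos[OF s])
    have "r s = s * r1 + (1 - s) * r0" by (simp add: r_def algebra_simps)
    then have sR: "s * R \<le> r s" using s r0 r1 by simp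
    \<comment> \<open>Both the shift of the centre and the growth of the radius are at most R - r0,
      as the initial cube lies in the final one.\<close>
    have coef: "\<bar>(p1 - p0) $ l\<bar> + \<bar>r1 - r0\<bar> \<le> 2 * R" for l
      using in0[of l] r0 r1 p1 by (simp add: abs_minus_commute)
    have "(\<integral>\<^sup>+y. ennreal \<bar>g l y * \<phi> l s y\<bar> \<partial>lborel)
        \<le> (\<integral>\<^sup>+\<tau>. ennreal (8 * 2 ^ n * R) * ennreal ((\<rho> l \<tau> / (\<rho> l \<tau> + s))\<^sup>2) * indicator {0..} \<tau> \<partial>lborel)" for l
    proof -
      have "(\<integral>\<^sup>+y. ennreal \<bar>g l y * \<phi> l s y\<bar> \<partial>lborel)
          \<le> (\<integral>\<^sup>+y. ennreal (2 * R / r s ^ n) * (ennreal \<bar>g l y\<bar> * indicator (cube (c s) (r s)) y) \<partial>lborel)"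
      proof (rule nn_integral_mono)
        fix y
        have "\<bar>g l y * \<phi> l s y\<bar> \<le> \<bar>g l y\<bar> * ((2 * R) / r s ^ n * indicator (cube (c s) (r s)) y)"
          unfolding abs_mult n_def
          by (intro mult_left_mono order.trans[OF \<phi>_le[OF s]] mult_right_mono divide_right_mono coef) (use rs in auto)
        then have "ennreal \<bar>g l y * \<phi> l s y\<bar> \<le> ennreal (\<bar>g l y\<bar> * ((2 * R) / r s ^ n * indicator (cube (c s) (r s)) y))"
          by (rule ennreal_leI)
        also have "\<dots> = ennreal (2 * R / r s ^ n) * (ennreal \<bar>g l y\<bar> * indicator (cube (c s) (r s)) y)"
          using rs R by (auto simp: indicator_def ennreal_mult[symmetric] mult.commute)
        finally show "ennreal \<bar>g l y * \<phi> l s y\<bar> \<le> ennreal (2 * R / r s ^ n) * (ennreal \<bar>g l y\<bar> * indicator (cube (c s) (r s)) y)" .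
      qed
      also have "\<dots> = ennreal (2 * R / r s ^ n) * (\<integral>\<^sup>+y. ennreal \<bar>g l y\<bar> * indicator (cube (c s) (r s)) y \<partial>lborel)"
        by (rule nn_integral_cmult) measurable
      also have "\<dots> = (\<integral>\<^sup>+\<tau>. ennreal (2 * R / r s ^ n) * (emeasure lborel {y\<in>cube (c s) (r s). \<tau> \<le> \<bar>g l y\<bar>} * indicator {0..} \<tau>) \<partial>lborel)"
        unfolding layer_cake[OF g borel_cube]
      proof (rule nn_integral_cmult[symmetric])
        have "(\<lambda>\<tau>. emeasure lborel {y\<in>cube (c s) (r s). \<tau> \<le> \<bar>g l y\<bar>}) = (\<lambda>\<tau>. ennreal (superlevel_measure (g l) (cube (c s) (r s)) \<tau>))"
          using emeasure_superlevel_measure[OF g borel_cube finite_emeasure_cube] by blast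
        then show "(\<lambda>\<tau>. emeasure lborel {y\<in>cube (c s) (r s). \<tau> \<le> \<bar>g l y\<bar>} * indicator {0..} \<tau>) \<in> borel_measurable lborel"
          using borel_measurable_superlevel_measure[OF g borel_cube finite_emeasure_cube] by simp
      qed
      also have "\<dots> \<le> (\<integral>\<^sup>+\<tau>. ennreal (8 * 2 ^ n * R) * ennreal ((\<rho> l \<tau> / (\<rho> l \<tau> + s))\<^sup>2) * indicator {0..} \<tau> \<partial>lborel)"
      proof (rule nn_integral_mono)
        fix \<tau> :: real
        let ?M = "superlevel_measure (g l) (cube m R) \<tau>" and ?e = "superlevel_measure (g l) (cube (c s) (r s)) \<tau>"
        have e1: "?e \<le> ?M"
          by (rule superlevel_measure_mono[OF g borel_cube borel_cube finite_emeasure_cube cube_path[OF s] order_refl])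
        have "ennreal ?e \<le> ennreal ((2 * r s) ^ n)"
          unfolding emeasure_superlevel_measure[OF g borel_cube finite_emeasure_cube, symmetric] n_def
            emeasure_cube[OF less_imp_le[OF rs], of "c s", symmetric]
          by (rule emeasure_mono) auto
        then have e2: "?e \<le> (2 * r s) ^ n" using rs by simp
        have "2 * R / r s ^ n * ?e \<le> 2 * R * (min ((2 * r s) ^ n) ?M / r s ^ n)"
          using e1 e2 rs R by (simp add: field_simps mult_left_mono)
        also have "\<dots> \<le> 2 * R * (4 * 2 ^ n * (\<rho> l \<tau> / (\<rho> l \<tau> + s))\<^sup>2)"
          unfolding \<rho>_def using s rs R sR N
          by (intro mult_left_mono min_power_bound) (auto simp: n_def)
        finally have "2 * R / r s ^ n * ?e \<le> 8 * 2 ^ n * R * (\<rho> l \<tau> / (\<rho> l \<tau> + s))\<^sup>2" by (simp add: mult_ac)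
        then have "ennreal (2 * R / r s ^ n * ?e) \<le> ennreal (8 * 2 ^ n * R * (\<rho> l \<tau> / (\<rho> l \<tau> + s))\<^sup>2)"
          by (rule ennreal_leI)
        also have "ennreal (2 * R / r s ^ n * ?e) = ennreal (2 * R / r s ^ n) * ennreal ?e"
          by (rule ennreal_mult) (use rs R in auto)
        also have "ennreal (8 * 2 ^ n * R * (\<rho> l \<tau> / (\<rho> l \<tau> + s))\<^sup>2) =
            ennreal (8 * 2 ^ n * R) * ennreal ((\<rho> l \<tau> / (\<rho> l \<tau> + s))\<^sup>2)"
          by (rule ennreal_mult) (use R in auto)
        finally have "ennreal (2 * R / r s ^ n) * ennreal ?e
            \<le> ennreal (8 * 2 ^ n * R) * ennreal ((\<rho> l \<tau> / (\<rho> l \<tau> + s))\<^sup>2)" .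
        then show "ennreal (2 * R / r s ^ n) * (emeasure lborel {y\<in>cube (c s) (r s). \<tau> \<le> \<bar>g l y\<bar>} * indicator {0..} \<tau>)
          \<le> ennreal (8 * 2 ^ n * R) * ennreal ((\<rho> l \<tau> / (\<rho> l \<tau> + s))\<^sup>2) * indicator {0..} \<tau>"
          unfolding emeasure_superlevel_measure[OF g borel_cube finite_emeasure_cube]
          by (auto simp: indicator_def)
      qed
      finally show ?thesis .
    qed
    then show ?thesis by (intro order.trans[OF h'_le[OF s]] sum_mono)
  qed
  have "ennreal \<bar>h 1 - h 0\<bar> \<le> (\<integral>\<^sup>+s. ennreal \<bar>h' s\<bar> * indicator {0..1} s \<partial>lborel)" by (rule h_diff_le)
  also have "\<dots> \<le> (\<integral>\<^sup>+s. (\<Sum>l\<in>UNIV. \<integral>\<^sup>+\<tau>. ennreal (8 * 2 ^ n * R) * ennreal ((\<rho> l \<tau> / (\<rho> l \<tau> + s))\<^sup>2) * indicator {0..} \<tau> * indicator {0..1} s \<partial>lborel) \<partial>lborel)"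
  proof (rule nn_integral_mono)
    fix s :: real
    show "ennreal \<bar>h' s\<bar> * indicator {0..1} s \<le> (\<Sum>l\<in>UNIV. \<integral>\<^sup>+\<tau>. ennreal (8 * 2 ^ n * R) * ennreal ((\<rho> l \<tau> / (\<rho> l \<tau> + s))\<^sup>2) * indicator {0..} \<tau> * indicator {0..1} s \<partial>lborel)"
      using h'_bound[of s] by (cases "s \<in> {0..1}") auto
  qed
  also have "\<dots> = (\<Sum>l\<in>UNIV. \<integral>\<^sup>+s. \<integral>\<^sup>+\<tau>. ennreal (8 * 2 ^ n * R) * ennreal ((\<rho> l \<tau> / (\<rho> l \<tau> + s))\<^sup>2) * indicator {0..} \<tau> * indicator {0..1} s \<partial>lborel \<partial>lborel)"
    by (rule nn_integral_sum) measurable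
  \<comment> \<open>The level \<tau> is now held fixed while the time s along the cone is integrated
    out.\<close>
  also have "\<dots> = (\<Sum>l\<in>UNIV. \<integral>\<^sup>+\<tau>. \<integral>\<^sup>+s. ennreal (8 * 2 ^ n * R) * ennreal ((\<rho> l \<tau> / (\<rho> l \<tau> + s))\<^sup>2) * indicator {0..} \<tau> * indicator {0..1} s \<partial>lborel \<partial>lborel)"
    by (intro sum.cong refl lborel_pair.Fubini') measurable
  also have "\<dots> \<le> (\<Sum>l\<in>UNIV. ennreal (8 * 2 ^ n) * lorentz_norm (cube m R) (g l))"
  proof (rule sum_mono)
    fix l :: 'n
    have [measurable]: "superlevel_measure (g l) (cube m R) \<in> borel_measurable borel"
      by (rule borel_measurable_superlevel_measure[OF g borel_cube finite_emeasure_cube])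
    have "(\<integral>\<^sup>+s. ennreal (8 * 2 ^ n * R) * ennreal ((\<rho> l \<tau> / (\<rho> l \<tau> + s))\<^sup>2) * indicator {0..} \<tau> * indicator {0..1} s \<partial>lborel)
        \<le> ennreal (8 * 2 ^ n) * (ennreal (superlevel_measure (g l) (cube m R) \<tau> powr (1 / real n)) * indicator {0..} \<tau>)" for \<tau>
    proof -
      have "(\<integral>\<^sup>+s. ennreal (8 * 2 ^ n * R) * ennreal ((\<rho> l \<tau> / (\<rho> l \<tau> + s))\<^sup>2) * indicator {0..} \<tau> * indicator {0..1} s \<partial>lborel)
        = (\<integral>\<^sup>+s. (ennreal (8 * 2 ^ n * R) * indicator {0..} \<tau>) * (ennreal ((\<rho> l \<tau> / (\<rho> l \<tau> + s))\<^sup>2) * indicator {0..1} s) \<partial>lborel)"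
        by (intro nn_integral_cong) (simp add: mult_ac)
      also have "\<dots> = (ennreal (8 * 2 ^ n * R) * indicator {0..} \<tau>) * (\<integral>\<^sup>+s. ennreal ((\<rho> l \<tau> / (\<rho> l \<tau> + s))\<^sup>2) * indicator {0..1} s \<partial>lborel)"
        by (rule nn_integral_cmult) measurable
      also have "\<dots> \<le> (ennreal (8 * 2 ^ n * R) * indicator {0..} \<tau>) * ennreal (\<rho> l \<tau>)"
        by (intro mult_left_mono nn_integral_sq_ratio \<rho>_nonneg) auto
      also have "\<dots> = (ennreal (8 * 2 ^ n * R) * ennreal (\<rho> l \<tau>)) * indicator {0..} \<tau>" by (simp add: mult_ac)
      also have "ennreal (8 * 2 ^ n * R) * ennreal (\<rho> l \<tau>) = ennreal (8 * 2 ^ n) * ennreal (superlevel_measure (g l) (cube m R) \<tau> powr (1 / real n))"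
        using R by (simp add: ennreal_mult[symmetric] \<rho>_def)
      finally show ?thesis by (simp add: mult_ac)
    qed
    then have "(\<integral>\<^sup>+\<tau>. \<integral>\<^sup>+s. ennreal (8 * 2 ^ n * R) * ennreal ((\<rho> l \<tau> / (\<rho> l \<tau> + s))\<^sup>2) * indicator {0..} \<tau> * indicator {0..1} s \<partial>lborel \<partial>lborel)
        \<le> (\<integral>\<^sup>+\<tau>. ennreal (8 * 2 ^ n) * (ennreal (superlevel_measure (g l) (cube m R) \<tau> powr (1 / real n)) * indicator {0..} \<tau>) \<partial>lborel)"
      by (rule nn_integral_mono)
    also have "\<dots> = ennreal (8 * 2 ^ n) * lorentz_norm (cube m R) (g l)"
      unfolding lorentz_norm_def n_def
      by (intro nn_integral_cmult) measurable
    finally show "(\<integral>\<^sup>+\<tau>. \<integral>\<^sup>+s. ennreal (8 * 2 ^ n * R) * ennreal ((\<rho> l \<tau> / (\<rho> l \<tau> + s))\<^sup>2) * indicator {0..} \<tau> * indicator {0..1} s \<partial>lborel \<partial>lborel)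
        \<le> ennreal (8 * 2 ^ n) * lorentz_norm (cube m R) (g l)" .
  qed
  finally show ?thesis by (simp add: sum_distrib_left n_def)
qed

text \<open>In dimension one the cone estimate diverges, and one translates an interval of fixed length instead.\<close>

lemma (in mollifier_path) line_bound:
  assumes N: "CARD('n) = 1" and rr: "r1 = r0" and g [measurable]: "\<And>l. g l \<in> borel_measurable borel"
  shows "ennreal \<bar>h 1 - h 0\<bar> \<le> ennreal 2 * (\<Sum>l\<in>UNIV. lorentz_norm (cube m R) (g l))"
proof -
  define \<beta> where "\<beta> l = (p1 - p0) $ l" for l
  \<comment> \<open>A majorant of |\<phi>| that is visibly measurable in s and y jointly, as
    Tonelli's theorem requires.\<close>
  define k :: "'n \<Rightarrow> real \<Rightarrow> real^'n \<Rightarrow> real" where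
    "k l s y = \<bar>\<beta> l\<bar> / r0 * (indicator {y. \<bar>y $ l - p0 $ l - s * \<beta> l\<bar> \<le> r0} y * indicator (cube m R) y)" for l s y
  have rs: "r s = r0" for s by (subst r_def) (simp add: rr)
  have meas: "(\<lambda>p. ennreal \<bar>g l (snd p)\<bar> * ennreal (k l (fst p) (snd p)) * indicator {0..1} (fst p))
      \<in> borel_measurable (lborel \<Otimes>\<^sub>M lborel)" for l
  proof -
    have [measurable]: "(\<lambda>y::real^'n. y $ l) \<in> borel_measurable borel"
      by (intro borel_measurable_continuous_onI continuous_intros)
    show ?thesis unfolding k_def indicator_def by measurable
  qed
  have h'_bound: "ennreal \<bar>h' s\<bar> \<le> (\<Sum>l\<in>UNIV. \<integral>\<^sup>+y. ennreal \<bar>g l y\<bar> * ennreal (k l s y) \<partial>lborel)"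
    if s: "s \<in> {0..1}" for s
  proof (intro order.trans[OF h'_le[OF s]] sum_mono nn_integral_mono)
    fix l :: 'n and y :: "real^'n"
    have "\<bar>\<phi> l s y\<bar> \<le> \<bar>\<beta> l\<bar> / r0 * indicator (cube (c s) r0) y"
      using \<phi>_le[OF s, of l y] unfolding rs N by (simp add: rr \<beta>_def)
    also have "\<dots> \<le> k l s y"
      using cube_path[OF s] r0 unfolding k_def rs
      by (intro mult_left_mono) (auto simp: indicator_def cube_def c_def \<beta>_def algebra_simps)
    finally have "\<bar>g l y * \<phi> l s y\<bar> \<le> \<bar>g l y\<bar> * k l s y" by (simp add: abs_mult mult_left_mono)
    then show "ennreal \<bar>g l y * \<phi> l s y\<bar> \<le> ennreal \<bar>g l y\<bar> * ennreal (k l s y)"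
      using ennreal_leI by (fastforce simp: ennreal_mult'[symmetric])
  qed
  \<comment> \<open>A point y is covered by the moving interval during a time at most 2 r0 /
    |\<beta>|, and meanwhile the density is |\<beta>| / r0. The product is 2, whatever the length of
    the interval and the distance travelled.\<close>
  have k_int: "(\<integral>\<^sup>+s. ennreal \<bar>g l y\<bar> * ennreal (k l s y) * indicator {0..1} s \<partial>lborel)
      \<le> ennreal 2 * (ennreal \<bar>g l y\<bar> * indicator (cube m R) y)" for l y
  proof (cases "\<beta> l = 0 \<or> y \<notin> cube m R")
    case False
    define a where "a = (y $ l - p0 $ l) / \<beta> l"
    define d where "d = r0 / \<bar>\<beta> l\<bar>"
    have d: "d > 0" using False r0 by (simp add: d_def)
    have sub: "s \<in> {a - d..a + d}" if "\<bar>y $ l - p0 $ l - s * \<beta> l\<bar> \<le> r0" for s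
    proof -
      have "a * \<beta> l = y $ l - p0 $ l" using False by (simp add: a_def)
      then have "(a - s) * \<beta> l = y $ l - p0 $ l - s * \<beta> l" by (simp add: left_diff_distrib)
      then have "\<bar>a - s\<bar> * \<bar>\<beta> l\<bar> = \<bar>y $ l - p0 $ l - s * \<beta> l\<bar>" by (metis abs_mult)
      then have "\<bar>a - s\<bar> \<le> d" using that False by (simp add: d_def pos_le_divide_eq)
      then show ?thesis by auto
    qed
    have "(\<integral>\<^sup>+s. ennreal \<bar>g l y\<bar> * ennreal (k l s y) * indicator {0..1} s \<partial>lborel)
        \<le> (\<integral>\<^sup>+s. (ennreal \<bar>g l y\<bar> * ennreal (1 / d)) * indicator {a - d..a + d} s \<partial>lborel)"
    proof (rule nn_integral_mono)
      fix s
      show "ennreal \<bar>g l y\<bar> * ennreal (k l s y) * indicator {0..1} s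
          \<le> (ennreal \<bar>g l y\<bar> * ennreal (1 / d)) * indicator {a - d..a + d} s"
        using sub[of s] by (auto simp: k_def indicator_def d_def)
    qed
    also have "\<dots> = ennreal \<bar>g l y\<bar> * ennreal (1 / d) * ennreal (2 * d)"
      using d by (simp add: nn_integral_cmult_indicator)
    also have "\<dots> = ennreal \<bar>g l y\<bar> * ennreal (1 / d * (2 * d))"
    proof -
      have "ennreal (1 / d) * ennreal (2 * d) = ennreal (1 / d * (2 * d))"
        by (rule ennreal_mult[symmetric]) (use d in auto)
      then show ?thesis by (simp only: mult.assoc)
    qed
    also have "1 / d * (2 * d) = 2" using d by simp
    finally show ?thesis using False by (simp add: mult.commute)
  qed (auto simp: k_def)
  have "ennreal \<bar>h 1 - h 0\<bar> \<le> (\<integral>\<^sup>+s. ennreal \<bar>h' s\<bar> * indicator {0..1} s \<partial>lborel)" by (rule h_diff_le)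
  also have "\<dots> \<le> (\<integral>\<^sup>+s. (\<Sum>l\<in>UNIV. \<integral>\<^sup>+y. ennreal \<bar>g l y\<bar> * ennreal (k l s y) * indicator {0..1} s \<partial>lborel) \<partial>lborel)"
  proof (rule nn_integral_mono)
    fix s :: real
    show "ennreal \<bar>h' s\<bar> * indicator {0..1} s \<le> (\<Sum>l\<in>UNIV. \<integral>\<^sup>+y. ennreal \<bar>g l y\<bar> * ennreal (k l s y) * indicator {0..1} s \<partial>lborel)"
      using h'_bound[of s] by (cases "s \<in> {0..1}") auto
  qed
  also have "\<dots> = (\<Sum>l\<in>UNIV. \<integral>\<^sup>+s. \<integral>\<^sup>+y. ennreal \<bar>g l y\<bar> * ennreal (k l s y) * indicator {0..1} s \<partial>lborel \<partial>lborel)"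
    using lborel.borel_measurable_nn_integral_fst[OF meas] by (intro nn_integral_sum) simp
  also have "\<dots> = (\<Sum>l\<in>UNIV. \<integral>\<^sup>+y. \<integral>\<^sup>+s. ennreal \<bar>g l y\<bar> * ennreal (k l s y) * indicator {0..1} s \<partial>lborel \<partial>lborel)"
    by (intro sum.cong refl lborel_pair.Fubini'[symmetric]) (use meas in \<open>simp add: case_prod_beta\<close>)
  also have "\<dots> \<le> (\<Sum>l\<in>UNIV. \<integral>\<^sup>+y. ennreal 2 * (ennreal \<bar>g l y\<bar> * indicator (cube m R) y) \<partial>lborel)"
    by (intro sum_mono nn_integral_mono k_int)
  also have "\<dots> = (\<Sum>l\<in>UNIV. ennreal 2 * lorentz_norm (cube m R) (g l))"
  proof (intro sum.cong refl)
    fix l :: 'n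
    have "(\<integral>\<^sup>+y. ennreal 2 * (ennreal \<bar>g l y\<bar> * indicator (cube m R) y) \<partial>lborel)
        = ennreal 2 * (\<integral>\<^sup>+y. ennreal \<bar>g l y\<bar> * indicator (cube m R) y \<partial>lborel)"
      by (rule nn_integral_cmult) measurable
    then show "(\<integral>\<^sup>+y. ennreal 2 * (ennreal \<bar>g l y\<bar> * indicator (cube m R) y) \<partial>lborel) = ennreal 2 * lorentz_norm (cube m R) (g l)"
      by (simp add: layer_cake[OF g borel_cube] emeasure_superlevel_measure[OF g borel_cube finite_emeasure_cube] lorentz_norm_def N)
  qed
  finally show ?thesis by (simp add: sum_distrib_left)
qed

section \<open>From mollified values to point values\<close>

definition mollify :: "real \<Rightarrow> (real^'n \<Rightarrow> real) \<Rightarrow> real^'n \<Rightarrow> real" where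
  "mollify \<epsilon> u x = (\<integral>y. u y * (bump ((y - x) /\<^sub>R \<epsilon>) / \<epsilon> ^ CARD('n)) \<partial>lborel)"

text \<open>The kernel is left unnormalised, so mollifications converge to \<open>bump_mass\<close>
  times the function; this factor reappears as the denominator of \<open>osc_const\<close>.\<close>

definition bump_mass :: "'n::finite itself \<Rightarrow> real" where
  "bump_mass _ = (\<integral>y. bump (y::real^'n) \<partial>lborel)"

lemma (in mollifier_path) h_ends: "h 0 = mollify r0 u p0" "h 1 = mollify r1 u p1"
  by (simp_all add: h_def mollify_def \<Psi>_def w_def c_def r_def)

lemma bump_zero_outside: "y \<notin> cube 0 1 \<Longrightarrow> bump y = 0"
  using bump_bounds(3)[of y] by (force simp: cube_def)

lemma borel_bump [measurable]: "bump \<in> borel_measurable borel"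
  by (intro borel_measurable_continuous_onI smooth_fun_continuous smooth_fun_bump)

lemma integrable_mult_bump:
  fixes v :: "real^'n \<Rightarrow> real"
  assumes "continuous_on UNIV v"
  shows "integrable lborel (\<lambda>y. v y * bump y)"
  by (rule lborel_integral_compact_support(1)[OF compact_cube[of 0 1]])
    (use assms in \<open>auto simp: bump_zero_outside intro!: continuous_intros continuous_on_subset[OF assms]
      continuous_on_subset[OF smooth_fun_continuous[OF smooth_fun_bump]]\<close>)

lemma continuous_AE_lborel_zero:
  fixes f :: "'a::euclidean_space \<Rightarrow> real"
  assumes f: "continuous_on UNIV f" and ae: "AE x in lborel. f x = 0"
  shows "f x = 0"
proof (rule ccontr)
  assume "f x \<noteq> 0"
  have op: "open {x. f x \<noteq> 0}" using f by (intro open_Collect_neq continuous_on_const)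
  then have "{x. f x \<noteq> 0} \<in> null_sets lborel"
    using ae by (subst (asm) AE_iff_null) auto
  then have "negligible {x. f x \<noteq> 0}" by (simp add: negligible_iff_null_sets null_sets_completionI)
  then show False using open_not_negligible[OF op] \<open>f x \<noteq> 0\<close> by auto
qed

lemma bump_mass_pos: "bump_mass TYPE('n::finite) > 0"
proof -
  have int: "integrable lborel (bump :: real^'n \<Rightarrow> real)" using integrable_mult_bump[of "\<lambda>_. 1"] by simp
  have "bump_mass TYPE('n) \<ge> 0" unfolding bump_mass_def by (intro Bochner_Integration.integral_nonneg bump_bounds(1))
  moreover have "bump_mass TYPE('n) \<noteq> 0"
  proof
    assume "bump_mass TYPE('n) = 0"
    then have "AE x in lborel. bump (x::real^'n) = 0"
      unfolding bump_mass_def by (subst (asm) integral_nonneg_eq_0_iff_AE[OF int]) (auto simp: bump_bounds(1))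
    then have "bump (x::real^'n) = 0" for x
      using continuous_AE_lborel_zero[OF smooth_fun_continuous[OF smooth_fun_bump]] by blast
    then show False using bump_bounds(4)[where 'n = 'n] by simp
  qed
  ultimately show ?thesis by simp
qed

lemma mollify_eq:
  fixes u :: "real^'n \<Rightarrow> real"
  assumes u: "continuous_on UNIV u" and "\<epsilon> > 0"
  shows "mollify \<epsilon> u x = (\<integral>y. u (x + \<epsilon> *\<^sub>R y) * bump y \<partial>lborel)"
proof -
  have [measurable]: "u \<in> borel_measurable borel" using u by (rule borel_measurable_continuous_onI)
  have aff: "lborel = density (distr lborel borel (\<lambda>y. x + \<epsilon> *\<^sub>R y)) (\<lambda>_. ennreal (\<epsilon> ^ CARD('n)))"
    using lborel_affine[of \<epsilon> x] \<open>\<epsilon> > 0\<close> by (simp add: ennreal_power)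
  have "mollify \<epsilon> u x = (\<integral>y. \<epsilon> ^ CARD('n) *\<^sub>R (u y * (bump ((y - x) /\<^sub>R \<epsilon>) / \<epsilon> ^ CARD('n))) \<partial>distr lborel borel (\<lambda>y. x + \<epsilon> *\<^sub>R y))"
    unfolding mollify_def by (subst aff, subst integral_density) (use \<open>\<epsilon> > 0\<close> in auto)
  also have "\<dots> = (\<integral>y. \<epsilon> ^ CARD('n) *\<^sub>R (u (x + \<epsilon> *\<^sub>R y) * (bump (((x + \<epsilon> *\<^sub>R y) - x) /\<^sub>R \<epsilon>) / \<epsilon> ^ CARD('n))) \<partial>lborel)"
    by (subst integral_distr) measurable
  also have "\<dots> = (\<integral>y. u (x + \<epsilon> *\<^sub>R y) * bump y \<partial>lborel)"
    using \<open>\<epsilon> > 0\<close> by (intro Bochner_Integration.integral_cong) auto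
  finally show ?thesis .
qed

lemma mollify_tendsto:
  fixes u :: "real^'n \<Rightarrow> real"
  assumes u: "continuous_on UNIV u"
  shows "((\<lambda>\<epsilon>. mollify \<epsilon> u x) \<longlongrightarrow> bump_mass TYPE('n) * u x) (at_right 0)"
proof (rule tendstoI)
  fix e :: real assume e: "e > 0"
  define c0 where "c0 = bump_mass TYPE('n)"
  have c0: "c0 > 0" by (simp add: c0_def bump_mass_pos)
  define e' where "e' = e / (2 * c0)"
  have e': "e' > 0" using e c0 by (simp add: e'_def)
  have "isCont u x" using u by (simp add: continuous_on_eq_continuous_at)
  then obtain d where d: "d > 0" "\<And>y. dist y x < d \<Longrightarrow> dist (u y) (u x) < e'"
    using e' by (auto simp: continuous_at_eps_delta dist_commute)
  obtain M where M: "M > 0" "\<And>y::real^'n. y \<in> cube 0 1 \<Longrightarrow> norm y \<le> M"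
    using compact_imp_bounded[OF compact_cube[of "0::real^'n" 1]] unfolding bounded_pos by blast
  have main: "dist (mollify \<epsilon> u x) (c0 * u x) < e" if \<epsilon>: "0 < \<epsilon>" "\<epsilon> < d / M" for \<epsilon>
  proof -
    have cont: "continuous_on UNIV (\<lambda>y. u (x + \<epsilon> *\<^sub>R y) - u x)"
      by (intro continuous_intros continuous_on_compose2[OF u]) auto
    have "mollify \<epsilon> u x - c0 * u x = (\<integral>y. u (x + \<epsilon> *\<^sub>R y) * bump y \<partial>lborel) - (\<integral>y. u x * bump (y::real^'n) \<partial>lborel)"
      using \<epsilon> by (simp add: mollify_eq[OF u] c0_def bump_mass_def mult.commute)
    also have "\<dots> = (\<integral>y. (u (x + \<epsilon> *\<^sub>R y) - u x) * bump y \<partial>lborel)"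
    proof -
      have "integrable lborel (\<lambda>y. u (x + \<epsilon> *\<^sub>R y) * bump y)"
        by (intro integrable_mult_bump continuous_on_compose2[OF u] continuous_intros) auto
      moreover have "integrable lborel (\<lambda>y::real^'n. u x * bump y)"
        by (intro integrable_mult_bump continuous_on_const)
      ultimately show ?thesis
        by (simp add: Bochner_Integration.integral_diff[symmetric] left_diff_distrib del: integrable_mult_right_iff)
    qed
    also have "\<bar>\<dots>\<bar> \<le> (\<integral>y. \<bar>(u (x + \<epsilon> *\<^sub>R y) - u x) * bump y\<bar> \<partial>lborel)"
      using integral_norm_bound[of lborel "\<lambda>y. (u (x + \<epsilon> *\<^sub>R y) - u x) * bump y"] by (simp only: real_norm_def)
    also have "\<dots> \<le> (\<integral>y. e' * bump (y::real^'n) \<partial>lborel)"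
    proof (rule Bochner_Integration.integral_mono)
      show "integrable lborel (\<lambda>y. \<bar>(u (x + \<epsilon> *\<^sub>R y) - u x) * bump y\<bar>)"
        by (intro integrable_abs integrable_mult_bump cont)
      show "integrable lborel (\<lambda>y::real^'n. e' * bump y)" by (intro integrable_mult_bump continuous_on_const)
      fix y :: "real^'n"
      show "\<bar>(u (x + \<epsilon> *\<^sub>R y) - u x) * bump y\<bar> \<le> e' * bump y"
      proof (cases "y \<in> cube 0 1")
        case True
        have "\<epsilon> * norm y \<le> \<epsilon> * M" using M(2)[OF True] \<epsilon> by (intro mult_left_mono) auto
        also have "\<dots> < d" using \<epsilon> M by (simp add: field_simps)
        finally have "dist (x + \<epsilon> *\<^sub>R y) x < d" using \<epsilon> by (simp add: dist_norm)
        from d(2)[OF this] show ?thesis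
          using bump_bounds(1)[of y] by (simp add: abs_mult dist_real_def mult_right_mono)
      qed (simp add: bump_zero_outside)
    qed
    also have "\<dots> = e' * c0" by (simp add: c0_def bump_mass_def)
    also have "\<dots> < e" using c0 e by (simp add: e'_def)
    finally show ?thesis by (simp add: dist_real_def)
  qed
  have "d / M > 0" using d M by simp
  then show "\<forall>\<^sub>F \<epsilon> in at_right 0. dist (mollify \<epsilon> u x) (bump_mass TYPE('n) * u x) < e"
    using main unfolding c0_def eventually_at_right_field by blast
qed

lemma eventually_at_right_pos_less:
  fixes b :: real assumes "b > 0" shows "\<forall>\<^sub>F \<epsilon> in at_right 0. 0 < \<epsilon> \<and> \<epsilon> < b"
  using assms eventually_at_right_field by blast

text \<open>Twice the cone constant 8 * 2^N, since both points are joined to the centre of the cube,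
  divided by the mass of the kernel.\<close>

definition osc_const :: "'n::finite itself \<Rightarrow> real" where
  "osc_const _ = 16 * 2 ^ CARD('n) / bump_mass TYPE('n)"

lemma osc_const_pos: "osc_const TYPE('n::finite) > 0"
  by (simp add: osc_const_def bump_mass_pos)

text \<open>The mollified values at two points are compared by two cones with a common base, the
  whole cube, or in dimension one by a single translation. The bound does not depend on the radius
  \<epsilon>, so letting \<epsilon> tend to 0 turns mollified values into point values.\<close>

lemma oscillation_le_lorentz_norm:
  fixes u :: "real^'n \<Rightarrow> real"
  assumes u: "continuous_on UNIV u" and wg: "weak_gradient \<Omega> u g" and g: "\<And>l. g l \<in> borel_measurable borel"
    and sub: "cube m R \<subseteq> \<Omega>" and R: "R > 0" and x: "x \<in> cube m R" and z: "z \<in> cube m R"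
  shows "ennreal \<bar>u x - u z\<bar> \<le> ennreal (osc_const TYPE('n)) * (\<Sum>l\<in>UNIV. lorentz_norm (cube m R) (g l))"
proof -
  define c0 where "c0 = bump_mass TYPE('n)"
  have c0: "c0 > 0" by (simp add: c0_def bump_mass_pos)
  define K :: real where "K = 16 * 2 ^ CARD('n)"
  have K: "K > 0" by (simp add: K_def)
  have "ennreal \<bar>u x - u z\<bar> \<le> ennreal (K / c0) * (\<Sum>l\<in>UNIV. lorentz_norm (cube m R) (g l))"
  proof (cases "(\<Sum>l\<in>UNIV. lorentz_norm (cube m R) (g l)) = \<infinity>")
    case True
    then show ?thesis unfolding True using K c0 by (simp add: ennreal_mult_top)
  next
    case False
    define S where "S = enn2real (\<Sum>l\<in>UNIV. lorentz_norm (cube m R) (g l))"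
    have S: "ennreal S = (\<Sum>l\<in>UNIV. lorentz_norm (cube m R) (g l))" "S \<ge> 0"
      using False by (auto simp: S_def less_top)
    have moll: "\<bar>mollify \<epsilon> u x - mollify \<epsilon> u z\<bar> \<le> K * S"
      if \<epsilon>: "0 < \<epsilon>" "\<epsilon> \<le> R" and x: "\<And>i. \<bar>x $ i - m $ i\<bar> \<le> R - \<epsilon>" and z: "\<And>i. \<bar>z $ i - m $ i\<bar> \<le> R - \<epsilon>" for \<epsilon> x z
    proof (cases "CARD('n) = 1")
      case True
      interpret mollifier_path z x \<epsilon> \<epsilon> m R \<Omega> u g
        by standard (use \<epsilon> x z sub u wg in auto)
      have "ennreal \<bar>h 1 - h 0\<bar> \<le> ennreal 2 * ennreal S" unfolding S(1) by (rule line_bound[OF True refl g])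
      also have "ennreal 2 * ennreal S = ennreal (2 * S)" by (rule ennreal_mult[symmetric]) (use S in auto)
      finally have "\<bar>h 1 - h 0\<bar> \<le> 2 * S" using S(2) by simp
      also have "\<dots> \<le> K * S" using S(2) by (intro mult_right_mono) (auto simp: K_def True)
      finally show ?thesis by (simp add: h_ends)
    next
      case False
      then have N: "2 \<le> CARD('n)" using zero_less_card_finite[where 'a = 'n] by linarith
      have one: "\<bar>mollify R u m - mollify \<epsilon> u x\<bar> \<le> 8 * 2 ^ CARD('n) * S" if x: "\<And>i. \<bar>x $ i - m $ i\<bar> \<le> R - \<epsilon>" for x
      proof -
        interpret mollifier_path x m \<epsilon> R m R \<Omega> u g
          by standard (use \<epsilon> x sub u wg R in auto)
        have "ennreal \<bar>h 1 - h 0\<bar> \<le> ennreal (8 * 2 ^ CARD('n)) * ennreal S"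
          unfolding S(1) by (rule cone_bound[OF N refl refl \<epsilon>(2) g])
        also have "\<dots> = ennreal (8 * 2 ^ CARD('n) * S)" using S(2) by (simp add: ennreal_mult)
        finally show ?thesis using S(2) by (simp add: h_ends)
      qed
      show ?thesis using one[OF x] one[OF z] unfolding K_def by (simp add: algebra_simps)
    qed
    \<comment> \<open>Points at distance \<open>d\<close> from the boundary: kernels of radius
      \<epsilon> < d around them fit into the cube.\<close>
    have inner: "c0 * \<bar>u x - u z\<bar> \<le> K * S"
      if x: "\<And>i. \<bar>x $ i - m $ i\<bar> \<le> R - d" and z: "\<And>i. \<bar>z $ i - m $ i\<bar> \<le> R - d" and d: "0 < d" "d \<le> R" for x z d
    proof (rule tendsto_upperbound)
      show "((\<lambda>\<epsilon>. \<bar>mollify \<epsilon> u x - mollify \<epsilon> u z\<bar>) \<longlongrightarrow> c0 * \<bar>u x - u z\<bar>) (at_right 0)"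
      proof -
        have "((\<lambda>\<epsilon>. \<bar>mollify \<epsilon> u x - mollify \<epsilon> u z\<bar>) \<longlongrightarrow> \<bar>c0 * u x - c0 * u z\<bar>) (at_right 0)"
          unfolding c0_def by (intro tendsto_intros mollify_tendsto u)
        also have "\<bar>c0 * u x - c0 * u z\<bar> = c0 * \<bar>u x - u z\<bar>"
          using c0 by (simp add: right_diff_distrib[symmetric] abs_mult)
        finally show ?thesis .
      qed
      show "\<forall>\<^sub>F \<epsilon> in at_right 0. \<bar>mollify \<epsilon> u x - mollify \<epsilon> u z\<bar> \<le> K * S"
        using eventually_at_right_pos_less[OF d(1)]
      proof eventually_elim
        case (elim \<epsilon>)
        show ?case
          by (rule moll) (use elim d x z in \<open>auto intro: order.trans[OF x] order.trans[OF z]\<close>)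
      qed
    qed simp
    \<comment> \<open>Arbitrary points of the closed cube are contracted towards the centre by 1 -
      t, which leaves a margin t R, and continuity of \<open>u\<close> lets t tend to 0.\<close>
    have "c0 * \<bar>u x - u z\<bar> \<le> K * S"
    proof (rule tendsto_upperbound)
      have lim: "((\<lambda>t. u (m + (1 - t) *\<^sub>R (x - m))) \<longlongrightarrow> u x) (at_right 0)" for x
      proof -
        have "isCont u x" using u by (simp add: continuous_on_eq_continuous_at)
        moreover have "((\<lambda>t::real. m + (1 - t) *\<^sub>R (x - m)) \<longlongrightarrow> m + (1 - 0) *\<^sub>R (x - m)) (at_right 0)"
          by (intro tendsto_intros)
        ultimately show ?thesis by (intro isCont_tendsto_compose[of _ u]) auto
      qed
      show "((\<lambda>t. c0 * \<bar>u (m + (1 - t) *\<^sub>R (x - m)) - u (m + (1 - t) *\<^sub>R (z - m))\<bar>) \<longlongrightarrow> c0 * \<bar>u x - u z\<bar>) (at_right 0)"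
        by (intro tendsto_intros lim)
      show "\<forall>\<^sub>F t in at_right 0. c0 * \<bar>u (m + (1 - t) *\<^sub>R (x - m)) - u (m + (1 - t) *\<^sub>R (z - m))\<bar> \<le> K * S"
        using eventually_at_right_pos_less[OF zero_less_one]
      proof eventually_elim
        case (elim t)
        have *: "\<bar>(m + (1 - t) *\<^sub>R (x - m)) $ i - m $ i\<bar> \<le> R - t * R" if "x \<in> cube m R" for x i
        proof -
          have "\<bar>(m + (1 - t) *\<^sub>R (x - m)) $ i - m $ i\<bar> = (1 - t) * \<bar>x $ i - m $ i\<bar>"
            using elim by (simp add: abs_mult)
          also have "\<dots> \<le> (1 - t) * R" using that elim by (intro mult_left_mono) (auto simp: cube_def)
          finally show ?thesis by (simp add: algebra_simps)
        qed
        show ?case by (rule inner[OF *[OF x] *[OF z]]) (use elim R in auto)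
      qed
    qed simp
    then have "\<bar>u x - u z\<bar> \<le> K / c0 * S" using c0 by (simp add: field_simps)
    then have "ennreal \<bar>u x - u z\<bar> \<le> ennreal (K / c0 * S)" by (rule ennreal_leI)
    also have "\<dots> = ennreal (K / c0) * ennreal S" using K c0 S(2) by (intro ennreal_mult) auto
    finally show ?thesis unfolding S(1) .
  qed
  then show ?thesis by (simp add: osc_const_def K_def c0_def)
qed

section \<open>The Rado--Reichelderfer estimate\<close>

text \<open>The mass 1 of this tail is the summand 1 in the constants \<Lambda> + 1 below.\<close>

lemma nn_integral_inverse_square: "(\<integral>\<^sup>+s. ennreal (1 / (1 + \<bar>s\<bar>)\<^sup>2) * indicator {0..} s \<partial>lborel) = 1"
proof -
  have "(\<integral>\<^sup>+s. ennreal (1 / (1 + \<bar>s\<bar>)\<^sup>2) * indicator {0..} s \<partial>lborel)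
      = (\<integral>\<^sup>+s. ennreal (1 / (1 + s)\<^sup>2) * indicator {0..} s \<partial>lborel)"
    by (intro nn_integral_cong) (auto simp: indicator_def)
  also have "\<dots> = ennreal (0 - (- 1 / (1 + 0)))"
  proof (rule nn_integral_FTC_atLeast)
    show "((\<lambda>s. - 1 / (1 + s)) has_real_derivative 1 / (1 + s)\<^sup>2) (at s)" if "0 \<le> s" for s :: real
      using that by (auto intro!: derivative_eq_intros simp: power2_eq_square)
    have "((\<lambda>s::real. inverse (1 + s)) \<longlongrightarrow> 0) at_top"
      by (rule tendsto_inverse_0_at_top) (rule filterlim_tendsto_add_at_top[OF tendsto_const filterlim_ident])
    from tendsto_minus[OF this] show "((\<lambda>s::real. - 1 / (1 + s)) \<longlongrightarrow> 0) at_top" by (simp add: divide_inverse)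
  qed auto
  finally show ?thesis by simp
qed

text \<open>An elementary form of Young's inequality: either a \<le> p / \<alpha>, or multiplying a
  by (a \<alpha> / p)^(n-1) \<ge> 1 can only increase it.\<close>

lemma young_split:
  fixes a p \<alpha> :: real and n :: nat
  assumes "0 \<le> a" "0 < p" "0 < \<alpha>" "0 < n"
  shows "a \<le> \<alpha> ^ (n - 1) * (a ^ n / p ^ (n - 1)) + p / \<alpha>"
proof (cases "a \<le> p / \<alpha>")
  case True
  have "0 \<le> \<alpha> ^ (n - 1) * (a ^ n / p ^ (n - 1))" using assms by (intro mult_nonneg_nonneg divide_nonneg_nonneg) auto
  then show ?thesis using True by linarith
next
  case False
  then have "1 \<le> a * \<alpha> / p" using assms by (simp add: field_simps)
  then have "1 \<le> (a * \<alpha> / p) ^ (n - 1)" by (rule one_le_power)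
  then have "a * 1 \<le> a * (a * \<alpha> / p) ^ (n - 1)" using assms by (intro mult_left_mono) auto
  also have "\<dots> = \<alpha> ^ (n - 1) * (a * a ^ (n - 1) / p ^ (n - 1))" by (simp add: power_mult_distrib power_divide)
  also have "a * a ^ (n - 1) = a ^ n" using power_minus_mult[of n a] assms by (simp add: mult.commute)
  finally have "a \<le> \<alpha> ^ (n - 1) * (a ^ n / p ^ (n - 1))" by simp
  moreover have "0 \<le> p / \<alpha>" using assms by simp
  ultimately show ?thesis by linarith
qed

text \<open>With \<open>p s = max (M s powr (1/n)) ((1 + s)^-2)\<close>, where \<open>M\<close> is the distribution function of \<open>g\<close> on \<open>\<Omega>\<close>, the weight
  \<open>\<theta> x\<close> is the integral of \<open>p powr (1 - n)\<close> over \<open>[0, |g x|]\<close>; the estimate is Young's inequality with parameter \<open>\<alpha>\<close> under the integral.\<close>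

lemma lorentz_weight:
  fixes g :: "real^'n \<Rightarrow> real"
  assumes g [measurable]: "g \<in> borel_measurable borel" and \<Omega> [measurable]: "\<Omega> \<in> sets borel"
    and fin: "emeasure lborel \<Omega> < \<infinity>" and L: "lorentz_norm \<Omega> g \<le> ennreal \<Lambda>" "0 \<le> \<Lambda>"
  shows "\<exists>\<theta>. \<theta> \<in> borel_measurable borel \<and> (\<integral>\<^sup>+x. \<theta> x * indicator \<Omega> x \<partial>lborel) \<le> ennreal (\<Lambda> + 1)
    \<and> (\<forall>x. \<theta> x \<le> ennreal (\<bar>g x\<bar> * (1 + \<bar>g x\<bar>) ^ (2 * CARD('n))))
    \<and> (\<forall>A \<alpha>. A \<in> sets borel \<longrightarrow> A \<subseteq> \<Omega> \<longrightarrow> 0 < \<alpha> \<longrightarrow> lorentz_norm A g \<le>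
        ennreal (\<alpha> ^ (CARD('n) - 1)) * (\<integral>\<^sup>+x. \<theta> x * indicator A x \<partial>lborel) + ennreal ((\<Lambda> + 1) / \<alpha>))"
proof -
  define n where "n = CARD('n)"
  have n: "0 < n" by (simp add: n_def)
  \<comment> \<open>The second entry keeps \<open>p\<close> positive where the distribution function
    vanishes, and it bounds 1 / p polynomially, whence the pointwise bound on \<theta>. In the
    integral of \<open>p\<close> it costs only 1.\<close>
  define p where "p s = max (superlevel_measure g \<Omega> s powr (1 / real n)) (1 / (1 + \<bar>s\<bar>)\<^sup>2)" for s
  have p_pos: "0 < p s" for s
  proof -
    have "0 < 1 / (1 + \<bar>s\<bar>)\<^sup>2" by (intro divide_pos_pos zero_less_power) (auto simp: add_pos_nonneg)
    then show ?thesis unfolding p_def by (rule less_le_trans) (rule max.cobounded2)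
  qed
  have [measurable]: "superlevel_measure g \<Omega> \<in> borel_measurable borel" by (rule borel_measurable_superlevel_measure[OF g \<Omega> fin])
  have [measurable]: "p \<in> borel_measurable borel" unfolding p_def[abs_def] by measurable
  have powr_pow: "(x powr (1 / real n)) ^ n = x" if "0 \<le> x" for x
    using that n by (cases "x = 0") (auto simp: powr_realpow[symmetric] powr_powr)
  have int_p: "(\<integral>\<^sup>+s. ennreal (p s) * indicator {0..} s \<partial>lborel) \<le> ennreal (\<Lambda> + 1)"
  proof -
    have "(\<integral>\<^sup>+s. ennreal (p s) * indicator {0..} s \<partial>lborel) \<le>
        (\<integral>\<^sup>+s. ennreal (superlevel_measure g \<Omega> s powr (1 / real n)) * indicator {0..} s + ennreal (1 / (1 + \<bar>s\<bar>)\<^sup>2) * indicator {0..} s \<partial>lborel)"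
      by (intro nn_integral_mono) (auto simp: indicator_def p_def ennreal_plus[symmetric] simp del: ennreal_plus intro!: ennreal_leI)
    also have "\<dots> = lorentz_norm \<Omega> g + 1"
      by (subst nn_integral_add) (auto simp: nn_integral_inverse_square lorentz_norm_def n_def)
    also have "\<dots> \<le> ennreal \<Lambda> + ennreal 1" using L by (simp add: add_right_mono)
    also have "\<dots> = ennreal (\<Lambda> + 1)" using L by (simp add: ennreal_plus)
    finally show ?thesis .
  qed
  define k where "k s = ennreal (1 / p s ^ (n - 1))" for s
  have [measurable]: "k \<in> borel_measurable borel" unfolding k_def[abs_def] by measurable
  define \<theta> where "\<theta> x = (\<integral>\<^sup>+s. k s * indicator {0..\<bar>g x\<bar>} s \<partial>lborel)" for x
  have \<theta>_meas: "\<theta> \<in> borel_measurable borel"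
  proof -
    have "(\<lambda>z. k (snd z) * indicator {z::(real^'n) \<times> real. 0 \<le> snd z \<and> snd z \<le> \<bar>g (fst z)\<bar>} z)
        \<in> borel_measurable (lborel \<Otimes>\<^sub>M lborel)"
    proof -
      have "{z \<in> space (lborel \<Otimes>\<^sub>M lborel). 0 \<le> snd z \<and> snd z \<le> \<bar>g (fst z)\<bar>} \<in> sets (lborel \<Otimes>\<^sub>M (lborel :: real measure))"
        by measurable
      then have [measurable]: "{z::(real^'n) \<times> real. 0 \<le> snd z \<and> snd z \<le> \<bar>g (fst z)\<bar>} \<in> sets (lborel \<Otimes>\<^sub>M lborel)"
        by (simp add: space_pair_measure)
      show ?thesis by measurable
    qed
    from lborel.borel_measurable_nn_integral_fst[OF this]
    have "(\<lambda>x. \<integral>\<^sup>+s. k s * indicator {z::(real^'n) \<times> real. 0 \<le> snd z \<and> snd z \<le> \<bar>g (fst z)\<bar>} (x, s) \<partial>lborel) \<in> borel_measurable borel"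
      by simp
    also have "(\<lambda>x. \<integral>\<^sup>+s. k s * indicator {z::(real^'n) \<times> real. 0 \<le> snd z \<and> snd z \<le> \<bar>g (fst z)\<bar>} (x, s) \<partial>lborel) = \<theta>"
      by (auto simp: \<theta>_def indicator_def fun_eq_iff intro!: nn_integral_cong)
    finally show ?thesis .
  qed
  have int_\<theta>: "(\<integral>\<^sup>+x. \<theta> x * indicator A x \<partial>lborel) = (\<integral>\<^sup>+s. ennreal (superlevel_measure g A s / p s ^ (n - 1)) * indicator {0..} s \<partial>lborel)"
    if A: "A \<in> sets borel" "A \<subseteq> \<Omega>" for A
  proof -
    have finA: "emeasure lborel A < \<infinity>" using emeasure_mono[OF A(2), of lborel] fin by auto
    have eq: "k s * ennreal (superlevel_measure g A s) = ennreal (superlevel_measure g A s / p s ^ (n - 1))" for s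
      unfolding k_def using p_pos[of s] by (subst ennreal_mult[symmetric]) (auto simp: less_imp_le)
    show ?thesis
      unfolding \<theta>_def layer_cake_weighted[OF g A(1) \<open>k \<in> borel_measurable borel\<close>] emeasure_superlevel_measure[OF g A(1) finA] eq ..
  qed
  \<comment> \<open>By the choice of \<open>p\<close> the distribution function is at most p^n, so
    dividing it by p^(n-1) leaves at most the integrable function \<open>p\<close>.\<close>
  have c2: "(\<integral>\<^sup>+x. \<theta> x * indicator \<Omega> x \<partial>lborel) \<le> ennreal (\<Lambda> + 1)"
    unfolding int_\<theta>[OF \<Omega> subset_refl]
  proof (rule order.trans[OF nn_integral_mono int_p])
    fix s
    have "superlevel_measure g \<Omega> s = (superlevel_measure g \<Omega> s powr (1 / real n)) ^ n" by (simp add: powr_pow)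
    also have "\<dots> \<le> p s ^ n" by (intro power_mono) (auto simp: p_def)
    also have "\<dots> = p s * p s ^ (n - 1)" using power_minus_mult[of n "p s"] n by (simp add: mult.commute)
    finally have "superlevel_measure g \<Omega> s / p s ^ (n - 1) \<le> p s" using p_pos[of s] by (simp add: pos_divide_le_eq)
    then show "ennreal (superlevel_measure g \<Omega> s / p s ^ (n - 1)) * indicator {0..} s \<le> ennreal (p s) * indicator {0..} s"
      by (intro mult_right_mono ennreal_leI) auto
  qed
  \<comment> \<open>The bound vanishes with g x. After a slope q is subtracted from the gradient, it
    makes the weight small at the points where the gradient is close to q.\<close>
  have c3: "\<theta> x \<le> ennreal (\<bar>g x\<bar> * (1 + \<bar>g x\<bar>) ^ (2 * n))" for x
  proof -
    have "\<theta> x \<le> (\<integral>\<^sup>+s. ennreal ((1 + \<bar>g x\<bar>) ^ (2 * n)) * indicator {0..\<bar>g x\<bar>} s \<partial>lborel)"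
      unfolding \<theta>_def
    proof (rule nn_integral_mono)
      fix s :: real
      have "1 / p s ^ (n - 1) \<le> (1 + \<bar>g x\<bar>) ^ (2 * n)" if s: "0 \<le> s" "s \<le> \<bar>g x\<bar>"
      proof -
        have "1 / (1 + \<bar>g x\<bar>)\<^sup>2 \<le> 1 / (1 + \<bar>s\<bar>)\<^sup>2" using s by (intro divide_left_mono power_mono) auto
        also have "\<dots> \<le> p s" by (simp add: p_def)
        finally have "(1 / (1 + \<bar>g x\<bar>)\<^sup>2) ^ (n - 1) \<le> p s ^ (n - 1)" by (intro power_mono) auto
        then have "1 / p s ^ (n - 1) \<le> 1 / (1 / (1 + \<bar>g x\<bar>)\<^sup>2) ^ (n - 1)"
          using p_pos[of s] by (intro divide_left_mono) (auto intro!: mult_pos_pos add_pos_nonneg)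
        also have "\<dots> = (1 + \<bar>g x\<bar>) ^ (2 * (n - 1))" by (simp add: power_divide power_mult)
        also have "\<dots> \<le> (1 + \<bar>g x\<bar>) ^ (2 * n)" by (intro power_increasing) auto
        finally show ?thesis .
      qed
      then show "k s * indicator {0..\<bar>g x\<bar>} s \<le> ennreal ((1 + \<bar>g x\<bar>) ^ (2 * n)) * indicator {0..\<bar>g x\<bar>} s"
        by (auto simp: k_def indicator_def intro!: ennreal_leI)
    qed
    also have "\<dots> = ennreal ((1 + \<bar>g x\<bar>) ^ (2 * n)) * ennreal \<bar>g x\<bar>" by (subst nn_integral_cmult_indicator) auto
    also have "\<dots> = ennreal ((1 + \<bar>g x\<bar>) ^ (2 * n) * \<bar>g x\<bar>)" by (rule ennreal_mult[symmetric]) auto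
    finally show ?thesis by (simp add: mult.commute)
  qed
  have c4: "lorentz_norm A g \<le> ennreal (\<alpha> ^ (n - 1)) * (\<integral>\<^sup>+x. \<theta> x * indicator A x \<partial>lborel) + ennreal ((\<Lambda> + 1) / \<alpha>)"
    if A: "A \<in> sets borel" "A \<subseteq> \<Omega>" and \<alpha>: "0 < \<alpha>" for A \<alpha>
  proof -
    have finA: "emeasure lborel A < \<infinity>" using emeasure_mono[OF A(2), of lborel] fin by auto
    have [measurable]: "superlevel_measure g A \<in> borel_measurable borel" by (rule borel_measurable_superlevel_measure[OF g A(1) finA])
    have "lorentz_norm A g \<le> (\<integral>\<^sup>+s. ennreal (\<alpha> ^ (n - 1)) * (ennreal (superlevel_measure g A s / p s ^ (n - 1)) * indicator {0..} s)
        + ennreal (1 / \<alpha>) * (ennreal (p s) * indicator {0..} s) \<partial>lborel)"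
      unfolding lorentz_norm_def
    proof (rule nn_integral_mono)
      fix s
      have "superlevel_measure g A s powr (1 / real n) \<le> \<alpha> ^ (n - 1) * (superlevel_measure g A s / p s ^ (n - 1)) + p s / \<alpha>"
        using young_split[of "superlevel_measure g A s powr (1 / real n)" "p s" \<alpha> n] p_pos[of s] \<alpha> n by (simp add: powr_pow)
      then have "ennreal (superlevel_measure g A s powr (1 / real n)) \<le> ennreal (\<alpha> ^ (n - 1) * (superlevel_measure g A s / p s ^ (n - 1)) + 1 / \<alpha> * p s)"
        by (intro ennreal_leI) simp
      also have "\<dots> = ennreal (\<alpha> ^ (n - 1) * (superlevel_measure g A s / p s ^ (n - 1))) + ennreal (1 / \<alpha> * p s)"
        using p_pos[of s] \<alpha> by (intro ennreal_plus) (auto simp: less_imp_le)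
      also have "ennreal (\<alpha> ^ (n - 1) * (superlevel_measure g A s / p s ^ (n - 1))) = ennreal (\<alpha> ^ (n - 1)) * ennreal (superlevel_measure g A s / p s ^ (n - 1))"
        using p_pos[of s] \<alpha> by (intro ennreal_mult) (auto simp: less_imp_le)
      also have "ennreal (1 / \<alpha> * p s) = ennreal (1 / \<alpha>) * ennreal (p s)"
        using p_pos[of s] \<alpha> by (intro ennreal_mult) (auto simp: less_imp_le)
      finally show "ennreal (superlevel_measure g A s powr (1 / real CARD('n))) * indicator {0..} s
          \<le> ennreal (\<alpha> ^ (n - 1)) * (ennreal (superlevel_measure g A s / p s ^ (n - 1)) * indicator {0..} s)
            + ennreal (1 / \<alpha>) * (ennreal (p s) * indicator {0..} s)"
        by (auto simp: indicator_def n_def)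
    qed
    also have "\<dots> = (\<integral>\<^sup>+s. ennreal (\<alpha> ^ (n - 1)) * (ennreal (superlevel_measure g A s / p s ^ (n - 1)) * indicator {0..} s) \<partial>lborel)
        + (\<integral>\<^sup>+s. ennreal (1 / \<alpha>) * (ennreal (p s) * indicator {0..} s) \<partial>lborel)"
      by (rule nn_integral_add) measurable
    also have "(\<integral>\<^sup>+s. ennreal (\<alpha> ^ (n - 1)) * (ennreal (superlevel_measure g A s / p s ^ (n - 1)) * indicator {0..} s) \<partial>lborel)
        = ennreal (\<alpha> ^ (n - 1)) * (\<integral>\<^sup>+x. \<theta> x * indicator A x \<partial>lborel)"
      unfolding int_\<theta>[OF A] by (rule nn_integral_cmult) measurable
    also have "(\<integral>\<^sup>+s. ennreal (1 / \<alpha>) * (ennreal (p s) * indicator {0..} s) \<partial>lborel)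
        = ennreal (1 / \<alpha>) * (\<integral>\<^sup>+s. ennreal (p s) * indicator {0..} s \<partial>lborel)"
      by (rule nn_integral_cmult) measurable
    also have "ennreal (\<alpha> ^ (n - 1)) * (\<integral>\<^sup>+x. \<theta> x * indicator A x \<partial>lborel) + \<dots>
       \<le> ennreal (\<alpha> ^ (n - 1)) * (\<integral>\<^sup>+x. \<theta> x * indicator A x \<partial>lborel) + ennreal (1 / \<alpha>) * ennreal (\<Lambda> + 1)"
      by (intro add_left_mono mult_left_mono int_p) auto
    also have "ennreal (1 / \<alpha>) * ennreal (\<Lambda> + 1) = ennreal ((\<Lambda> + 1) / \<alpha>)"
      using \<alpha> L by (subst ennreal_mult[symmetric]) auto
    finally show ?thesis .
  qed
  show ?thesis using \<theta>_meas c2 c3 c4 unfolding n_def by blast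
qed

text \<open>The two terms balance at \<alpha>^n = W / I, which gives the bound; for I = 0 large
  values of \<alpha> show that L vanishes.\<close>

lemma power_le_of_young_family:
  fixes L I W :: real and n :: nat
  assumes "0 \<le> L" "0 \<le> I" "0 < W" "0 < n"
    and le: "\<And>\<alpha>. 0 < \<alpha> \<Longrightarrow> L \<le> \<alpha> ^ (n - 1) * I + W / \<alpha>"
  shows "L ^ n \<le> 2 ^ n * W ^ (n - 1) * I"
proof (cases "I = 0")
  case True
  have "L \<le> 0"
  proof (rule field_le_epsilon)
    fix e :: real assume "e > 0"
    then show "L \<le> 0 + e" using le[of "W / e"] True assms by simp
  qed
  then show ?thesis using True assms by (simp add: zero_power)
next
  case False
  then have I: "I > 0" using assms by simp
  define \<mu> where "\<mu> = root n (W / I)"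
  have \<mu>: "\<mu> > 0" "\<mu> ^ n = W / I" using I assms by (auto simp: \<mu>_def)
  have "\<mu> ^ (n - 1) * I = (\<mu> ^ (n - 1) * \<mu>) * I / \<mu>" using \<mu>(1) by simp
  also have "\<dots> = \<mu> ^ n * I / \<mu>" using assms by (simp only: power_minus_mult)
  also have "\<dots> = W / \<mu>" using \<mu>(2) I by simp
  finally have "L \<le> 2 * W / \<mu>" using le[OF \<mu>(1)] by simp
  then have "L ^ n \<le> (2 * W / \<mu>) ^ n" using assms by (intro power_mono) auto
  also have "\<dots> = 2 ^ n * W ^ n / (W / I)" by (simp add: power_divide power_mult_distrib \<mu>(2))
  also have "W ^ n = W ^ (n - 1) * W" using assms by (simp only: power_minus_mult)
  also have "2 ^ n * (W ^ (n - 1) * W) / (W / I) = 2 ^ n * W ^ (n - 1) * I" using assms I by simp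
  finally show ?thesis .
qed

lemma sum_power_le:
  fixes a :: "'i \<Rightarrow> real"
  assumes "finite I" "\<And>i. i \<in> I \<Longrightarrow> 0 \<le> a i" "0 < n"
  shows "(\<Sum>i\<in>I. a i) ^ n \<le> real (card I) ^ n * (\<Sum>i\<in>I. a i ^ n)"
proof (cases "I = {}")
  case True
  then show ?thesis using assms(3) by (simp add: zero_power)
next
  case False
  define M where "M = Max (a ` I)"
  have M: "a i \<le> M" if "i \<in> I" for i using that assms by (simp add: M_def)
  have "M \<in> a ` I" unfolding M_def using assms False by (intro Max_in) auto
  then obtain j where j: "j \<in> I" "a j = M" by blast
  have "(\<Sum>i\<in>I. a i) \<le> real (card I) * M" using sum_bounded_above[of I a M] M by simp
  then have "(\<Sum>i\<in>I. a i) ^ n \<le> (real (card I) * M) ^ n" using assms by (intro power_mono sum_nonneg) auto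
  also have "\<dots> = real (card I) ^ n * a j ^ n" by (simp add: j power_mult_distrib)
  also have "a j ^ n \<le> (\<Sum>i\<in>I. a i ^ n)" using assms j by (intro member_le_sum) auto
  finally show ?thesis by (simp add: mult_left_mono)
qed

definition lorentz_gradient :: "(real^'n) set \<Rightarrow> (real^'n \<Rightarrow> real) \<Rightarrow> ('n \<Rightarrow> real^'n \<Rightarrow> real) \<Rightarrow> bool" where
  "lorentz_gradient \<Omega> u g \<longleftrightarrow> weak_gradient \<Omega> u g \<and> (\<forall>l. g l \<in> borel_measurable borel \<and> lorentz_norm \<Omega> (g l) < \<infinity>)"

lemma lorentz_norm_mono:
  assumes "g \<in> borel_measurable borel" "A \<in> sets borel" "B \<in> sets borel" "emeasure lborel B < \<infinity>" "A \<subseteq> B"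
  shows "lorentz_norm A g \<le> lorentz_norm B g"
  unfolding lorentz_norm_def
  by (intro nn_integral_mono mult_right_mono ennreal_leI powr_mono2 superlevel_measure_mono[OF assms order_refl]) auto

text \<open>Optimising \<alpha> separately on each cube replaces the N-th power of a Lorentz norm by
  the integral of a fixed density. The bound thereby becomes the value of a measure, which can be
  summed over disjoint cubes, is outer regular, and can be differentiated.\<close>

lemma rado_reichelderfer_scalar:
  fixes u :: "real^'n \<Rightarrow> real"
  assumes u: "continuous_on UNIV u" and lg: "lorentz_gradient \<Omega> u g"
    and \<Omega> [measurable]: "\<Omega> \<in> sets borel" and fin: "emeasure lborel \<Omega> < \<infinity>"
  shows "\<exists>\<Theta>. \<Theta> \<in> borel_measurable borel \<and> (\<integral>\<^sup>+x. \<Theta> x * indicator \<Omega> x \<partial>lborel) < \<infinity>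
    \<and> (\<forall>m R x z. cube m R \<subseteq> \<Omega> \<longrightarrow> 0 < R \<longrightarrow> x \<in> cube m R \<longrightarrow> z \<in> cube m R \<longrightarrow>
        ennreal (\<bar>u x - u z\<bar> ^ CARD('n)) \<le> (\<integral>\<^sup>+y. \<Theta> y * indicator (cube m R) y \<partial>lborel))"
proof -
  define n where "n = CARD('n)"
  have n: "0 < n" by (simp add: n_def)
  have wg: "weak_gradient \<Omega> u g" and g [measurable]: "\<And>l. g l \<in> borel_measurable borel"
    and Lf: "\<And>l. lorentz_norm \<Omega> (g l) < \<infinity>" using lg by (auto simp: lorentz_gradient_def)
  define C where "C = osc_const TYPE('n)"
  have C: "C > 0" by (simp add: C_def osc_const_pos)
  note osc = oscillation_le_lorentz_norm[OF u wg g, folded C_def]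
  define W where "W l = enn2real (lorentz_norm \<Omega> (g l)) + 1" for l
  have W: "W l > 0" for l by (simp add: W_def add_nonneg_pos)
  define P where "P l \<theta> \<longleftrightarrow> \<theta> \<in> borel_measurable borel \<and> (\<integral>\<^sup>+x. \<theta> x * indicator \<Omega> x \<partial>lborel) \<le> ennreal (W l)
    \<and> (\<forall>A \<alpha>. A \<in> sets borel \<longrightarrow> A \<subseteq> \<Omega> \<longrightarrow> 0 < \<alpha> \<longrightarrow> lorentz_norm A (g l) \<le>
        ennreal (\<alpha> ^ (n - 1)) * (\<integral>\<^sup>+x. \<theta> x * indicator A x \<partial>lborel) + ennreal (W l / \<alpha>))" for l \<theta>
  have "\<exists>\<theta>. P l \<theta>" for l
  proof -
    have "lorentz_norm \<Omega> (g l) \<le> ennreal (enn2real (lorentz_norm \<Omega> (g l)))"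
      using Lf[of l] by (simp add: less_top)
    from lorentz_weight[OF g \<Omega> fin this enn2real_nonneg]
    show ?thesis unfolding P_def W_def n_def by blast
  qed
  then obtain \<theta> where P: "\<And>l. P l (\<theta> l)" by metis
  have \<theta> [measurable]: "\<theta> l \<in> borel_measurable borel"
    and \<theta>_int: "(\<integral>\<^sup>+x. \<theta> l x * indicator \<Omega> x \<partial>lborel) \<le> ennreal (W l)" for l
    using P[of l] by (simp_all add: P_def)
  have \<theta>_le: "lorentz_norm A (g l) \<le>
      ennreal (\<alpha> ^ (n - 1)) * (\<integral>\<^sup>+x. \<theta> l x * indicator A x \<partial>lborel) + ennreal (W l / \<alpha>)"
    if "A \<in> sets borel" "A \<subseteq> \<Omega>" "0 < \<alpha>" for l A \<alpha>
    using P[of l] that unfolding P_def by blast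
  \<comment> \<open>C n comes from the oscillation bound and the sum over the n partial derivatives,
    the factor 2^n W^(n-1) from the optimised Young inequality.\<close>
  define c where "c l = (C * real n) ^ n * (2 ^ n * W l ^ (n - 1))" for l
  have c: "c l \<ge> 0" for l using C W[of l] by (simp add: c_def)
  define \<Theta> where "\<Theta> y = (\<Sum>l\<in>UNIV. ennreal (c l) * \<theta> l y)" for y
  have \<Theta>_meas [measurable]: "\<Theta> \<in> borel_measurable borel" unfolding \<Theta>_def[abs_def] by measurable
  have \<Theta>_int: "(\<integral>\<^sup>+y. \<Theta> y * indicator A y \<partial>lborel) = (\<Sum>l\<in>UNIV. ennreal (c l) * (\<integral>\<^sup>+y. \<theta> l y * indicator A y \<partial>lborel))"
    if [measurable]: "A \<in> sets borel" for A
  proof -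
    have "(\<integral>\<^sup>+y. \<Theta> y * indicator A y \<partial>lborel) = (\<integral>\<^sup>+y. (\<Sum>l\<in>UNIV. ennreal (c l) * (\<theta> l y * indicator A y)) \<partial>lborel)"
      by (simp add: \<Theta>_def sum_distrib_right mult.assoc)
    also have "\<dots> = (\<Sum>l\<in>UNIV. \<integral>\<^sup>+y. ennreal (c l) * (\<theta> l y * indicator A y) \<partial>lborel)"
      by (rule nn_integral_sum) measurable
    also have "\<dots> = (\<Sum>l\<in>UNIV. ennreal (c l) * (\<integral>\<^sup>+y. \<theta> l y * indicator A y \<partial>lborel))"
      by (intro sum.cong refl nn_integral_cmult) measurable
    finally show ?thesis .
  qed
  have fin\<Theta>: "(\<integral>\<^sup>+x. \<Theta> x * indicator \<Omega> x \<partial>lborel) < \<infinity>"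
  proof -
    have "(\<integral>\<^sup>+x. \<theta> l x * indicator \<Omega> x \<partial>lborel) < \<infinity>" for l
      using \<theta>_int[of l] by (rule order.strict_trans1) simp
    then show ?thesis unfolding \<Theta>_int[OF \<Omega>] by (simp add: ennreal_mult_eq_top_iff less_top[symmetric])
  qed
  have main: "ennreal (\<bar>u x - u z\<bar> ^ n) \<le> (\<integral>\<^sup>+y. \<Theta> y * indicator (cube m R) y \<partial>lborel)"
    if sub: "cube m R \<subseteq> \<Omega>" and R: "0 < R" and x: "x \<in> cube m R" and z: "z \<in> cube m R" for m R x z
  proof -
    define I where "I l = enn2real (\<integral>\<^sup>+y. \<theta> l y * indicator (cube m R) y \<partial>lborel)" for l
    define L where "L l = enn2real (lorentz_norm (cube m R) (g l))" for l
    have I: "(\<integral>\<^sup>+y. \<theta> l y * indicator (cube m R) y \<partial>lborel) = ennreal (I l)" for l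
    proof -
      have "(\<integral>\<^sup>+y. \<theta> l y * indicator (cube m R) y \<partial>lborel) \<le> (\<integral>\<^sup>+y. \<theta> l y * indicator \<Omega> y \<partial>lborel)"
        using sub by (intro nn_integral_mono) (auto simp: indicator_def)
      also have "\<dots> < \<infinity>" using \<theta>_int[of l] by (rule order.strict_trans1) simp
      finally show ?thesis by (simp add: I_def less_top)
    qed
    have L: "lorentz_norm (cube m R) (g l) = ennreal (L l)" for l
      using order.strict_trans1[OF lorentz_norm_mono[OF g borel_cube \<Omega> fin sub] Lf] by (simp add: L_def less_top)
    have L0: "0 \<le> L l" "0 \<le> I l" for l by (simp_all add: L_def I_def)
    have LI: "L l ^ n \<le> 2 ^ n * W l ^ (n - 1) * I l" for l
    proof (rule power_le_of_young_family)
      fix \<alpha> :: real assume \<alpha>: "0 < \<alpha>"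
      have "ennreal (L l) \<le> ennreal (\<alpha> ^ (n - 1)) * ennreal (I l) + ennreal (W l / \<alpha>)"
        using \<theta>_le[OF borel_cube sub \<alpha>, of l] by (simp only: I L)
      also have "\<dots> = ennreal (\<alpha> ^ (n - 1) * I l + W l / \<alpha>)"
        using \<alpha> W[of l] L0 by (simp add: ennreal_mult ennreal_plus)
      finally show "L l \<le> \<alpha> ^ (n - 1) * I l + W l / \<alpha>"
        by (subst (asm) ennreal_le_iff) (use \<alpha> W[of l] L0 in auto)
    qed (use L0 W n in auto)
    have "ennreal \<bar>u x - u z\<bar> \<le> ennreal C * (\<Sum>l\<in>UNIV. ennreal (L l))"
      using osc[OF sub R x z] by (simp only: L)
    also have "\<dots> = ennreal (C * (\<Sum>l\<in>UNIV. L l))"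
      using C L0 by (simp add: ennreal_mult sum_nonneg)
    finally have "\<bar>u x - u z\<bar> \<le> C * (\<Sum>l\<in>UNIV. L l)" using C L0 by (simp add: sum_nonneg)
    then have "\<bar>u x - u z\<bar> ^ n \<le> (C * (\<Sum>l\<in>UNIV. L l)) ^ n" by (intro power_mono) auto
    also have "\<dots> = C ^ n * (\<Sum>l\<in>UNIV. L l) ^ n" by (simp add: power_mult_distrib)
    also have "\<dots> \<le> C ^ n * (real n ^ n * (\<Sum>l\<in>UNIV. L l ^ n))"
      using sum_power_le[of UNIV L n] C L0 n by (intro mult_left_mono) (auto simp: n_def)
    also have "\<dots> \<le> C ^ n * (real n ^ n * (\<Sum>l\<in>UNIV. 2 ^ n * W l ^ (n - 1) * I l))"
      using C by (intro mult_left_mono sum_mono LI) auto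
    also have "\<dots> = (\<Sum>l\<in>UNIV. c l * I l)"
      by (simp add: c_def sum_distrib_left power_mult_distrib mult_ac)
    finally have "ennreal (\<bar>u x - u z\<bar> ^ n) \<le> ennreal (\<Sum>l\<in>UNIV. c l * I l)" by (rule ennreal_leI)
    also have "\<dots> = (\<Sum>l\<in>UNIV. ennreal (c l) * ennreal (I l))"
      using c L0 by (simp add: sum_ennreal[symmetric] ennreal_mult)
    also have "\<dots> = (\<integral>\<^sup>+y. \<Theta> y * indicator (cube m R) y \<partial>lborel)" by (simp add: \<Theta>_int[OF borel_cube] I)
    finally show ?thesis .
  qed
  show ?thesis using \<Theta>_meas fin\<Theta> main unfolding n_def by blast
qed

lemma rado_reichelderfer:
  fixes U :: "real^'n \<Rightarrow> real^'n"
  assumes U: "continuous_on UNIV U" and lg: "\<And>k. \<exists>g. lorentz_gradient \<Omega> (\<lambda>y. U y $ k) g"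
    and \<Omega> [measurable]: "\<Omega> \<in> sets borel" and fin: "emeasure lborel \<Omega> < \<infinity>"
  shows "\<exists>\<Theta>. \<Theta> \<in> borel_measurable borel \<and> (\<integral>\<^sup>+x. \<Theta> x * indicator \<Omega> x \<partial>lborel) < \<infinity>
    \<and> (\<forall>m R x z. cube m R \<subseteq> \<Omega> \<longrightarrow> 0 < R \<longrightarrow> x \<in> cube m R \<longrightarrow> z \<in> cube m R \<longrightarrow>
        ennreal (norm (U x - U z) ^ CARD('n)) \<le> (\<integral>\<^sup>+y. \<Theta> y * indicator (cube m R) y \<partial>lborel))"
proof -
  define n where "n = CARD('n)"
  define P where "P k \<theta> \<longleftrightarrow> \<theta> \<in> borel_measurable borel \<and> (\<integral>\<^sup>+x. \<theta> x * indicator \<Omega> x \<partial>lborel) < \<infinity>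
    \<and> (\<forall>m R x z. cube m R \<subseteq> \<Omega> \<longrightarrow> 0 < R \<longrightarrow> x \<in> cube m R \<longrightarrow> z \<in> cube m R \<longrightarrow>
        ennreal (\<bar>U x $ k - U z $ k\<bar> ^ n) \<le> (\<integral>\<^sup>+y. \<theta> y * indicator (cube m R) y \<partial>lborel))" for k \<theta>
  have "\<exists>\<theta>. P k \<theta>" for k
  proof -
    obtain g where g: "lorentz_gradient \<Omega> (\<lambda>y. U y $ k) g" using lg by blast
    have "continuous_on UNIV (\<lambda>y. U y $ k)" by (intro continuous_intros U)
    from rado_reichelderfer_scalar[OF this g \<Omega> fin] show ?thesis unfolding P_def n_def .
  qed
  then obtain \<theta> where P: "\<And>k. P k (\<theta> k)" by metis
  have \<theta> [measurable]: "\<theta> k \<in> borel_measurable borel"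
    and fin\<theta>: "(\<integral>\<^sup>+x. \<theta> k x * indicator \<Omega> x \<partial>lborel) < \<infinity>" for k
    using P[of k] by (simp_all add: P_def)
  have \<theta>_le: "ennreal (\<bar>U x $ k - U z $ k\<bar> ^ n) \<le> (\<integral>\<^sup>+y. \<theta> k y * indicator (cube m R) y \<partial>lborel)"
    if "cube m R \<subseteq> \<Omega>" "0 < R" "x \<in> cube m R" "z \<in> cube m R" for k m R x z
    using P[of k] that unfolding P_def by blast
  define \<Theta> where "\<Theta> y = (\<Sum>k\<in>UNIV. ennreal (real n ^ n) * \<theta> k y)" for y
  have \<Theta>_meas: "\<Theta> \<in> borel_measurable borel" unfolding \<Theta>_def[abs_def] by measurable
  have \<Theta>_int: "(\<integral>\<^sup>+y. \<Theta> y * indicator A y \<partial>lborel) = (\<Sum>k\<in>UNIV. ennreal (real n ^ n) * (\<integral>\<^sup>+y. \<theta> k y * indicator A y \<partial>lborel))"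
    if [measurable]: "A \<in> sets borel" for A
  proof -
    have "(\<integral>\<^sup>+y. \<Theta> y * indicator A y \<partial>lborel) = (\<integral>\<^sup>+y. (\<Sum>k\<in>UNIV. ennreal (real n ^ n) * (\<theta> k y * indicator A y)) \<partial>lborel)"
      by (simp add: \<Theta>_def sum_distrib_right mult.assoc)
    also have "\<dots> = (\<Sum>k\<in>UNIV. \<integral>\<^sup>+y. ennreal (real n ^ n) * (\<theta> k y * indicator A y) \<partial>lborel)"
      by (rule nn_integral_sum) measurable
    also have "\<dots> = (\<Sum>k\<in>UNIV. ennreal (real n ^ n) * (\<integral>\<^sup>+y. \<theta> k y * indicator A y \<partial>lborel))"
      by (intro sum.cong refl nn_integral_cmult) measurable
    finally show ?thesis .
  qed
  have fin\<Theta>: "(\<integral>\<^sup>+x. \<Theta> x * indicator \<Omega> x \<partial>lborel) < \<infinity>"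
    using fin\<theta> unfolding \<Theta>_int[OF \<Omega>] by (simp add: ennreal_mult_eq_top_iff less_top[symmetric])
  have main: "ennreal (norm (U x - U z) ^ n) \<le> (\<integral>\<^sup>+y. \<Theta> y * indicator (cube m R) y \<partial>lborel)"
    if *: "cube m R \<subseteq> \<Omega>" "0 < R" "x \<in> cube m R" "z \<in> cube m R" for m R x z
  proof -
    have "norm (U x - U z) \<le> (\<Sum>k\<in>UNIV. \<bar>U x $ k - U z $ k\<bar>)"
      using norm_le_l1_cart[of "U x - U z"] by simp
    then have "norm (U x - U z) ^ n \<le> (\<Sum>k\<in>UNIV. \<bar>U x $ k - U z $ k\<bar>) ^ n" by (intro power_mono) auto
    also have "\<dots> \<le> real n ^ n * (\<Sum>k\<in>UNIV. \<bar>U x $ k - U z $ k\<bar> ^ n)"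
      using sum_power_le[of UNIV "\<lambda>k. \<bar>U x $ k - U z $ k\<bar>" n] by (simp add: n_def)
    finally have "ennreal (norm (U x - U z) ^ n) \<le> ennreal (real n ^ n * (\<Sum>k\<in>UNIV. \<bar>U x $ k - U z $ k\<bar> ^ n))"
      by (rule ennreal_leI)
    also have "\<dots> = (\<Sum>k\<in>UNIV. ennreal (real n ^ n) * ennreal (\<bar>U x $ k - U z $ k\<bar> ^ n))"
      by (simp add: ennreal_mult sum_nonneg sum_ennreal[symmetric] sum_distrib_left del: sum_ennreal)
    also have "\<dots> \<le> (\<Sum>k\<in>UNIV. ennreal (real n ^ n) * (\<integral>\<^sup>+y. \<theta> k y * indicator (cube m R) y \<partial>lborel))"
      by (intro sum_mono mult_left_mono \<theta>_le *) auto
    finally show ?thesis by (simp add: \<Theta>_int[OF borel_cube])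
  qed
  show ?thesis using \<Theta>_meas fin\<Theta> main unfolding n_def by blast
qed

section \<open>Upper Lebesgue differentiation\<close>

text \<open>By continuity from below a slightly smaller concentric ball already has too much mass.
  Every nearby ball of the original radius contains it, and translation does not change the volume.
  Openness makes the exceptional sets of the next lemma measurable.\<close>

lemma open_mass_superlevel:
  fixes \<theta> :: "'a::euclidean_space \<Rightarrow> ennreal"
  assumes [measurable]: "\<theta> \<in> borel_measurable borel"
  shows "open {x. \<exists>r. 0 < r \<and> r < d \<and> c * emeasure lborel (ball x r) < (\<integral>\<^sup>+y. \<theta> y * indicator (ball x r) y \<partial>lborel)}"
  unfolding open_dist
proof (intro ballI, clarify)
  fix x r assume r: "0 < r" "r < d" and gt: "c * emeasure lborel (ball x r) < (\<integral>\<^sup>+y. \<theta> y * indicator (ball x r) y \<partial>lborel)"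
  define B where "B k = ball x (r - r / (real k + 1))" for k :: nat
  have B: "(\<Union>k. B k) = ball x r"
  proof
    show "(\<Union>k. B k) \<subseteq> ball x r" using r by (auto simp: B_def) (smt (verit) divide_pos_pos of_nat_0_le_iff)
    show "ball x r \<subseteq> (\<Union>k. B k)"
    proof
      fix y assume y: "y \<in> ball x r"
      then have pos: "0 < (r - dist x y) / r" using r by simp
      obtain k where k: "1 / (real k + 1) < (r - dist x y) / r"
        using reals_Archimedean[OF pos] by (auto simp: inverse_eq_divide add.commute)
      then have "r * (1 / (real k + 1)) < r - dist x y" using r by (simp add: pos_less_divide_eq mult.commute)
      then show "y \<in> (\<Union>k. B k)" by (auto simp: B_def intro!: exI[of _ k])
    qed
  qed
  define M where "M = density lborel \<theta>"
  have M: "emeasure M A = (\<integral>\<^sup>+y. \<theta> y * indicator A y \<partial>lborel)" if "A \<in> sets borel" for A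
    unfolding M_def using that by (subst emeasure_density) auto
  have "(SUP k. emeasure M (B k)) = emeasure M (\<Union>k. B k)"
  proof (rule SUP_emeasure_incseq)
    show "range B \<subseteq> sets M" by (auto simp: M_def B_def)
    show "incseq B"
    proof (rule incseq_SucI)
      fix k
      have "r / (real (Suc k) + 1) \<le> r / (real k + 1)" using r by (intro divide_left_mono) auto
      then show "B k \<subseteq> B (Suc k)" unfolding B_def by (intro subset_ball) simp
    qed
  qed
  then have "c * emeasure lborel (ball x r) < (SUP k. emeasure M (B k))" using gt by (simp add: B M)
  then obtain k where k: "c * emeasure lborel (ball x r) < emeasure M (B k)" by (auto simp: less_SUP_iff)
  define e where "e = r / (real k + 1)"
  have e: "e > 0" using r by (simp add: e_def)
  show "\<exists>e>0. \<forall>y. dist y x < e \<longrightarrow> y \<in> {x. \<exists>r. 0 < r \<and> r < d \<and>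
      c * emeasure lborel (ball x r) < (\<integral>\<^sup>+y. \<theta> y * indicator (ball x r) y \<partial>lborel)}"
  proof (intro exI conjI allI impI, rule e, clarify, intro exI conjI)
    fix y assume y: "dist y x < e"
    have sub: "B k \<subseteq> ball y r"
      unfolding B_def e_def[symmetric] using y by (auto simp: dist_commute) (smt (verit) dist_triangle)
    have "emeasure lborel (ball y r) = emeasure lborel (ball x r)"
      using r by (simp add: emeasure_ball)
    then have "c * emeasure lborel (ball y r) < emeasure M (B k)" using k by simp
    also have "\<dots> \<le> emeasure M (ball y r)" by (rule emeasure_mono[OF sub]) (simp add: M_def)
    finally show "c * emeasure lborel (ball y r) < (\<integral>\<^sup>+z. \<theta> z * indicator (ball y r) z \<partial>lborel)" by (simp add: M)
  qed (use r in auto)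
qed

text \<open>Let m be the measure of the exceptional set. Since \<theta> < c there, its mass is at
  most c m, and some open neighbourhood has mass at most c m + e. Vitali fills almost all of the set
  with disjoint balls inside this neighbourhood, each of mass at least c' times its volume. So c' m
  \<le> c m + e for every e, which forces m = 0.\<close>

lemma negligible_density_gap:
  fixes \<theta> :: "'a::euclidean_space \<Rightarrow> ennreal"
  assumes [measurable]: "\<theta> \<in> borel_measurable borel" and \<Omega>: "open \<Omega>" "emeasure lborel \<Omega> < \<infinity>"
    and fin: "(\<integral>\<^sup>+y. \<theta> y * indicator \<Omega> y \<partial>lborel) < \<infinity>" and c: "0 \<le> c" "c < (c'::real)"
  shows "negligible {x\<in>\<Omega>. \<theta> x < ennreal c \<and> (\<forall>d>0. \<exists>r. 0 < r \<and> r < d \<and>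
     ennreal c' * emeasure lborel (ball x r) < (\<integral>\<^sup>+y. \<theta> y * indicator (ball x r) y \<partial>lborel))}" (is "negligible ?E")
proof -
  define V where "V n = {x. \<exists>r. 0 < r \<and> r < 1 / real (Suc n) \<and>
     ennreal c' * emeasure lborel (ball x r) < (\<integral>\<^sup>+y. \<theta> y * indicator (ball x r) y \<partial>lborel)}" for n
  have E: "?E = {x\<in>\<Omega>. \<theta> x < ennreal c} \<inter> (\<Inter>n. V n)"
  proof -
    have "(\<forall>d>0. \<exists>r. 0 < r \<and> r < d \<and> P r) \<longleftrightarrow> (\<forall>n. \<exists>r. 0 < r \<and> r < 1 / real (Suc n) \<and> P r)" for P :: "real \<Rightarrow> bool"
    proof safe
      fix d :: real assume P: "\<forall>n. \<exists>r. 0 < r \<and> r < 1 / real (Suc n) \<and> P r" and "0 < d"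
      then obtain n where "1 / real (Suc n) < d" using reals_Archimedean[of d] by (auto simp: inverse_eq_divide)
      then show "\<exists>r>0. r < d \<and> P r" using P by (meson less_trans)
    qed (simp add: divide_pos_pos)
    from this[of "\<lambda>r. ennreal c' * emeasure lborel (ball x r) < (\<integral>\<^sup>+y. \<theta> y * indicator (ball x r) y \<partial>lborel)" for x]
    show ?thesis unfolding V_def by auto
  qed
  have V: "open (V n)" for n unfolding V_def by (rule open_mass_superlevel) simp
  have \<Omega>b [measurable]: "\<Omega> \<in> sets borel" using \<Omega> by simp
  have Eb [measurable]: "?E \<in> sets borel"
  proof -
    have "{x\<in>space borel. \<theta> x < ennreal c} \<inter> \<Omega> \<inter> (\<Inter>n. V n) \<in> sets borel"
      using V by (intro sets.Int sets.countable_INT'') (auto simp: borel_open)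
    then show ?thesis unfolding E by (simp add: Int_def conj_commute conj_left_commute)
  qed
  \<comment> \<open>The cut-off to \<Omega> makes the measure finite, as its outer regularity
    requires.\<close>
  define M where "M = density lborel (\<lambda>y. \<theta> y * indicator \<Omega> y)"
  have M: "emeasure M A = (\<integral>\<^sup>+y. \<theta> y * indicator \<Omega> y * indicator A y \<partial>lborel)" if "A \<in> sets borel" for A
    unfolding M_def using that by (subst emeasure_density) auto
  have Mfin: "emeasure M (space M) \<noteq> \<infinity>"
    using fin M[of UNIV] by (simp add: M_def space_density)
  have finE: "emeasure lborel ?E < \<infinity>"
    using emeasure_mono[of ?E \<Omega> lborel] \<Omega> by (auto intro: order.strict_trans1)
  define m where "m = measure lborel ?E"
  have m: "emeasure lborel ?E = ennreal m" "0 \<le> m"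
    using finE by (auto simp: m_def emeasure_eq_ennreal_measure)
  have ME: "emeasure M ?E \<le> ennreal (c * m)"
  proof -
    have "emeasure M ?E \<le> (\<integral>\<^sup>+y. ennreal c * indicator ?E y \<partial>lborel)"
      unfolding M[OF Eb] by (intro nn_integral_mono) (auto simp: indicator_def less_imp_le)
    also have "\<dots> = ennreal c * ennreal m" by (simp add: nn_integral_cmult_indicator m)
    finally show ?thesis using c m by (simp add: ennreal_mult)
  qed
  have step: "c' * m \<le> c * m + e" if e: "e > 0" for e
  proof -
    have "emeasure M ?E < emeasure M ?E + ennreal e"
    proof -
      have "emeasure M ?E < \<infinity>" using ME by (rule order.strict_trans1) simp
      then obtain v where "emeasure M ?E = ennreal v" "0 \<le> v"
        by (cases "emeasure M ?E" rule: ennreal_cases) auto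
      then show ?thesis using e by (simp add: ennreal_plus[symmetric] ennreal_less_iff del: ennreal_plus)
    qed
    moreover have "emeasure M ?E = (INF S\<in>{S. ?E \<subseteq> S \<and> open S}. emeasure M S)"
      by (rule outer_regular) (use Mfin in \<open>auto simp: M_def\<close>)
    ultimately obtain O' where O': "?E \<subseteq> O'" "open O'" "emeasure M O' < emeasure M ?E + ennreal e"
      by (auto simp: INF_less_iff)
    define W where "W = O' \<inter> \<Omega>"
    have W: "open W" "?E \<subseteq> W" "W \<subseteq> \<Omega>" "emeasure M W \<le> ennreal (c * m + e)"
    proof -
      have "emeasure M W \<le> emeasure M O'" unfolding W_def using O' by (intro emeasure_mono) (auto simp: M_def)
      also have "\<dots> \<le> ennreal (c * m) + ennreal e" using O'(3) ME by (meson add_right_mono less_imp_le order_trans)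
      finally show "emeasure M W \<le> ennreal (c * m + e)" using c m e by (simp add: ennreal_plus)
    qed (use O' \<Omega> in \<open>auto simp: W_def\<close>)
    define K where "K = {(x, r). 0 < r \<and> ball x r \<subseteq> W \<and>
      ennreal c' * emeasure lborel (ball x r) < (\<integral>\<^sup>+y. \<theta> y * indicator (ball x r) y \<partial>lborel)}"
    have "\<exists>i. i \<in> K \<and> x \<in> ball (fst i) (snd i) \<and> snd i < d" if x: "x \<in> ?E" and d: "d > 0" for x d
    proof -
      obtain d' where d': "d' > 0" "ball x d' \<subseteq> W" using W x by (meson open_contains_ball subsetD)
      obtain r where r: "0 < r" "r < min d d'"
        "ennreal c' * emeasure lborel (ball x r) < (\<integral>\<^sup>+y. \<theta> y * indicator (ball x r) y \<partial>lborel)"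
        using x d d'(1) by (auto dest: spec[of _ "min d d'"])
      then have "ball x r \<subseteq> W" using d' by (meson min.strict_boundedE less_imp_le order_trans subset_ball)
      then show ?thesis using r by (intro exI[of _ "(x, r)"]) (auto simp: K_def)
    qed
    then obtain C where C: "countable C" "C \<subseteq> K"
      "pairwise (\<lambda>i j. disjnt (ball (fst i) (snd i)) (ball (fst j) (snd j))) C"
      "negligible (?E - (\<Union>i\<in>C. ball (fst i) (snd i)))"
      using Vitali_covering_theorem_balls[of ?E K fst snd] by blast
    define B where "B i = ball (fst i) (snd i)" for i :: "'a \<times> real"
    have disj: "disjoint_family_on B C" using C(3) by (auto simp: disjoint_family_on_def pairwise_def disjnt_def B_def)
    have "ennreal m \<le> emeasure lborel (\<Union>i\<in>C. B i)"
    proof -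
      have UB: "(\<Union>i\<in>C. B i) \<in> sets borel" using C(1) by (intro sets.countable_UN') (auto simp: B_def)
      have "?E - (\<Union>i\<in>C. B i) \<in> null_sets lborel"
      proof -
        have "?E - (\<Union>i\<in>C. B i) \<in> sets borel" using C(1) by (intro sets.Diff Eb sets.countable_UN') (auto simp: B_def)
        then show ?thesis using C(4)
          by (simp add: B_def negligible_iff_null_sets null_sets_def null_sets_completion_iff emeasure_completion)
      qed
      then have "emeasure lborel (?E \<union> (\<Union>i\<in>C. B i)) = emeasure lborel (\<Union>i\<in>C. B i)"
        using UB emeasure_Un_null_set[of "\<Union>i\<in>C. B i" lborel "?E - (\<Union>i\<in>C. B i)"]
        by (simp add: Un_commute)
      moreover have "emeasure lborel ?E \<le> emeasure lborel (?E \<union> (\<Union>i\<in>C. B i))"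
        using C(1) by (intro emeasure_mono sets.Un) (auto simp: B_def intro!: sets.countable_UN')
      ultimately show ?thesis using m by simp
    qed
    also have "\<dots> = (\<integral>\<^sup>+i. emeasure lborel (B i) \<partial>count_space C)"
      by (intro emeasure_UN_countable disj C(1)) (simp add: B_def)
    finally have "ennreal c' * ennreal m \<le> ennreal c' * (\<integral>\<^sup>+i. emeasure lborel (B i) \<partial>count_space C)"
      by (intro mult_left_mono) auto
    also have "\<dots> = (\<integral>\<^sup>+i. ennreal c' * emeasure lborel (B i) \<partial>count_space C)"
      by (rule nn_integral_cmult[symmetric]) simp
    also have "\<dots> \<le> (\<integral>\<^sup>+i. emeasure M (B i) \<partial>count_space C)"
    proof (rule nn_integral_mono)
      fix i assume "i \<in> space (count_space C)"
      then have i: "i \<in> K" using C(2) by auto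
      then have "ennreal c' * emeasure lborel (B i) \<le> (\<integral>\<^sup>+y. \<theta> y * indicator (B i) y \<partial>lborel)"
        by (auto simp: K_def B_def)
      also have "\<dots> = emeasure M (B i)"
      proof -
        have "B i \<subseteq> \<Omega>" using i W(3) unfolding K_def B_def by fastforce
        moreover have "B i \<in> sets borel" by (simp add: B_def)
        ultimately show ?thesis by (subst M) (auto simp: indicator_def intro!: nn_integral_cong)
      qed
      finally show "ennreal c' * emeasure lborel (B i) \<le> emeasure M (B i)" .
    qed
    also have "\<dots> = emeasure M (\<Union>i\<in>C. B i)"
      by (intro emeasure_UN_countable[symmetric] disj C(1)) (simp add: B_def M_def)
    also have "\<dots> \<le> emeasure M W"
      using C(2) W(1) by (intro emeasure_mono) (auto simp: M_def K_def B_def subset_iff)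
    also have "\<dots> \<le> ennreal (c * m + e)" by (rule W(4))
    finally have "ennreal c' * ennreal m \<le> ennreal (c * m + e)" .
    then have "ennreal (c' * m) \<le> ennreal (c * m + e)" by (subst ennreal_mult) (use c m(2) in auto)
    then show ?thesis by (subst (asm) ennreal_le_iff) (use c m(2) e in auto)
  qed
  have "c' * m \<le> c * m" by (rule field_le_epsilon) (use step in auto)
  then have "m = 0" using c m by (simp add: mult_le_cancel_right)
  then have "?E \<in> null_sets lborel" using m by auto
  then show ?thesis by (simp add: negligible_iff_null_sets null_sets_completionI)
qed

text \<open>The upper half of Lebesgue's theorem: almost everywhere the upper density is at most
  \<theta> x. Between \<theta> x and c there is room for two rationals, so countably many gaps
  suffice.\<close>

lemma upper_lebesgue_differentiation:
  fixes \<theta> :: "'a::euclidean_space \<Rightarrow> ennreal"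
  assumes \<theta>: "\<theta> \<in> borel_measurable borel" and \<Omega>: "open \<Omega>" "emeasure lborel \<Omega> < \<infinity>"
    and fin: "(\<integral>\<^sup>+y. \<theta> y * indicator \<Omega> y \<partial>lborel) < \<infinity>"
  shows "negligible {x\<in>\<Omega>. \<exists>c>0. \<theta> x < ennreal c \<and> (\<forall>d>0. \<exists>r. 0 < r \<and> r < d \<and>
     ennreal c * emeasure lborel (ball x r) < (\<integral>\<^sup>+y. \<theta> y * indicator (ball x r) y \<partial>lborel))}" (is "negligible ?E")
proof -
  define N where "N c c' = {x\<in>\<Omega>. \<theta> x < ennreal c \<and> (\<forall>d>0. \<exists>r. 0 < r \<and> r < d \<and>
     ennreal c' * emeasure lborel (ball x r) < (\<integral>\<^sup>+y. \<theta> y * indicator (ball x r) y \<partial>lborel))}" for c c'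
  define Q where "Q = {(p::rat, q::rat). 0 \<le> p \<and> p < q}"
  have "negligible (\<Union>(p, q)\<in>Q. N (of_rat p) (of_rat q))"
  proof (rule negligible_countable_Union)
    show "countable ((\<lambda>(p, q). N (real_of_rat p) (real_of_rat q)) ` Q)" by (intro countable_image) simp
  next
    fix s assume "s \<in> (\<lambda>(p, q). N (real_of_rat p) (real_of_rat q)) ` Q"
    then obtain p q where s: "s = N (of_rat p) (of_rat q)" "0 \<le> p" "p < q" by (auto simp: Q_def)
    show "negligible s" unfolding s(1) N_def
      by (rule negligible_density_gap[OF \<theta> \<Omega> fin]) (use s in \<open>auto simp: of_rat_less\<close>)
  qed
  moreover have "?E \<subseteq> (\<Union>(p, q)\<in>Q. N (of_rat p) (of_rat q))"
  proof
    fix x assume "x \<in> ?E"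
    then obtain c where x: "x \<in> \<Omega>" and c: "c > 0" "\<theta> x < ennreal c" and
      lim: "\<And>d. d > 0 \<Longrightarrow> \<exists>r. 0 < r \<and> r < d \<and> ennreal c * emeasure lborel (ball x r) < (\<integral>\<^sup>+y. \<theta> y * indicator (ball x r) y \<partial>lborel)"
      by blast
    define t where "t = enn2real (\<theta> x)"
    have t: "\<theta> x = ennreal t" "0 \<le> t" "t < c"
    proof -
      have "\<theta> x < \<infinity>" using c(2) by (rule less_trans) simp
      then show 1: "\<theta> x = ennreal t" by (simp add: t_def less_top)
      show "0 \<le> t" by (simp add: t_def)
      then show "t < c" using c(2) 1 by (simp add: ennreal_less_iff)
    qed
    obtain p where p: "t < real_of_rat p" "real_of_rat p < c" using of_rat_dense[OF t(3)] by blast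
    obtain q where q: "real_of_rat p < real_of_rat q" "real_of_rat q < c" using of_rat_dense[OF p(2)] by blast
    have pq: "(p, q) \<in> Q"
    proof -
      have "0 \<le> real_of_rat p" using t p by linarith
      then have "0 \<le> p" by (simp add: zero_le_of_rat_iff)
      then show ?thesis using q by (simp add: Q_def of_rat_less)
    qed
    have "x \<in> N (of_rat p) (of_rat q)" unfolding N_def
    proof (intro CollectI conjI allI impI x)
      show "\<theta> x < ennreal (real_of_rat p)" using t p by (simp add: ennreal_less_iff)
      fix d :: real assume "d > 0"
      then obtain r where r: "0 < r" "r < d" "ennreal c * emeasure lborel (ball x r) < (\<integral>\<^sup>+y. \<theta> y * indicator (ball x r) y \<partial>lborel)"
        using lim by blast
      have "ennreal (of_rat q) * emeasure lborel (ball x r) \<le> ennreal c * emeasure lborel (ball x r)"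
        using q by (intro mult_right_mono ennreal_leI) auto
      then show "\<exists>r>0. r < d \<and> ennreal (of_rat q) * emeasure lborel (ball x r) < (\<integral>\<^sup>+y. \<theta> y * indicator (ball x r) y \<partial>lborel)"
        using r by (intro exI[of _ r]) (auto intro: le_less_trans)
    qed
    then show "x \<in> (\<Union>(p, q)\<in>Q. N (of_rat p) (of_rat q))" using pq by blast
  qed
  ultimately show ?thesis by (rule negligible_subset)
qed

section \<open>Differentiability almost everywhere\<close>

lemma lborel_integral_translate:
  fixes f :: "'a::euclidean_space \<Rightarrow> real"
  assumes [measurable]: "f \<in> borel_measurable borel"
  shows "(\<integral>y. f (a + y) \<partial>lborel) = (\<integral>y. f y \<partial>lborel)"
proof -
  have "(\<integral>y. f y \<partial>lborel) = (\<integral>y. f y \<partial>distr lborel borel ((+) a))" by (simp add: lborel_distr_plus)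
  also have "\<dots> = (\<integral>y. f (a + y) \<partial>lborel)" by (rule integral_distr) measurable
  finally show ?thesis by simp
qed

text \<open>The integral of \<phi> (y + t e_l) does not depend on t by translation invariance; its
  derivative at t = 0, taken under the integral, is the integral of the partial derivative.\<close>

lemma integral_partial_deriv_eq_0:
  fixes \<phi> :: "real^'n \<Rightarrow> real"
  assumes \<phi>: "test_fun \<Omega> \<phi>"
  shows "(\<integral>y. partial_deriv l \<phi> y \<partial>lborel) = 0"
proof -
  have sm: "smooth_fun \<phi>" using \<phi> by (simp add: test_fun_def)
  obtain M where M: "M > 0" "\<And>y. y \<in> closure {y. \<phi> y \<noteq> 0} \<Longrightarrow> norm y \<le> M"
  proof -
    have "compact (closure {y. \<phi> y \<noteq> 0})" using \<phi> by (simp add: test_fun_def)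
    from compact_imp_bounded[OF this] show ?thesis using that unfolding bounded_pos by blast
  qed
  have zero: "\<phi> y = 0" if "norm y > M" for y
  proof (rule ccontr)
    assume "\<phi> y \<noteq> 0"
    then have "y \<in> closure {y. \<phi> y \<noteq> 0}" by (intro subsetD[OF closure_subset]) simp
    then show False using M(2)[of y] that by simp
  qed
  have zero': "partial_deriv l \<phi> y = 0" if "norm y > M" for y
  proof -
    have "(\<phi> has_derivative (\<lambda>v. 0)) (at y)"
    proof (rule has_derivative_transform_within_open[OF has_derivative_const])
      show "open {y::real^'n. M < norm y}" by (intro open_Collect_less continuous_intros)
    qed (use that zero in auto)
    then show ?thesis by (simp add: partial_deriv_eq)
  qed
  \<comment> \<open>The margin 1 keeps the translated supports inside for |t| \<le> 1, so all
    integrals are over one fixed box.\<close>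
  define S where "S = cube (0::real^'n) (M + 1)"
  have out: "norm (y + t *\<^sub>R axis l 1) > M" if y: "y \<notin> S" and t: "\<bar>t\<bar> \<le> 1" for y and t :: real
  proof -
    obtain i where "\<bar>y $ i\<bar> > M + 1" using y by (auto simp: S_def cube_def not_le)
    then have "norm y > M + 1" using component_le_norm_cart[of y i] by linarith
    moreover have "norm y \<le> norm (y + t *\<^sub>R axis l 1) + norm (t *\<^sub>R axis l (1::real))"
      by (metis add_diff_cancel_right' norm_triangle_ineq4)
    moreover have "norm (t *\<^sub>R axis l (1::real)) \<le> 1" using t by simp
    ultimately show ?thesis by linarith
  qed
  have cont: "continuous_on A (\<lambda>y. \<phi> (y + t *\<^sub>R axis l 1))" for A and t :: real
    by (intro continuous_on_compose2[OF smooth_fun_continuous[OF sm]] continuous_intros) auto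
  define h where "h t = integral S (\<lambda>y. \<phi> (y + t *\<^sub>R axis l 1))" for t :: real
  have h: "h t = (\<integral>y. \<phi> y \<partial>lborel)" if t: "t \<in> {-1..1}" for t
  proof -
    have "h t = (\<integral>y. \<phi> (y + t *\<^sub>R axis l 1) \<partial>lborel)"
      unfolding h_def S_def
      by (rule lborel_integral_compact_support(2)[symmetric, OF compact_cube cont])
        (use zero out t in \<open>auto simp: S_def\<close>)
    also have "\<dots> = (\<integral>y. \<phi> y \<partial>lborel)"
      using lborel_integral_translate[of \<phi> "t *\<^sub>R axis l 1"] smooth_fun_continuous[OF sm]
      by (simp add: add.commute borel_measurable_continuous_onI)
    finally show ?thesis .
  qed
  have d1: "(h has_real_derivative integral S (\<lambda>y. partial_deriv l \<phi> (y + 0 *\<^sub>R axis l 1))) (at 0 within {-1..1})"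
    unfolding h_def S_def cube_eq_cbox
  proof (rule leibniz_rule_field_derivative[where fx = "\<lambda>t y. partial_deriv l \<phi> (y + t *\<^sub>R axis l 1)"])
    fix t :: real and y :: "real^'n"
    have 1: "((\<lambda>t. y + t *\<^sub>R axis l 1) has_derivative (\<lambda>s. s *\<^sub>R axis l 1)) (at t within {-1..1})"
      by (auto intro!: derivative_eq_intros)
    have 2: "(\<phi> has_derivative (\<lambda>v. \<Sum>k\<in>UNIV. v $ k * partial_deriv k \<phi> (y + t *\<^sub>R axis l 1))) (at (y + t *\<^sub>R axis l 1))"
      by (rule has_derivative_partial_deriv[OF smooth_fun_differentiable[OF sm]])
    have "((\<lambda>t. \<phi> (y + t *\<^sub>R axis l 1)) has_derivative
        (\<lambda>s. \<Sum>k\<in>UNIV. (s *\<^sub>R axis l 1) $ k * partial_deriv k \<phi> (y + t *\<^sub>R axis l 1))) (at t within {-1..1})"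
      by (rule has_derivative_compose[OF 1 2])
    moreover have "(\<Sum>k\<in>UNIV. (s *\<^sub>R axis l 1) $ k * partial_deriv k \<phi> (y + t *\<^sub>R axis l 1))
        = partial_deriv l \<phi> (y + t *\<^sub>R axis l 1) * s" for s
    proof -
      have "(\<Sum>k\<in>UNIV. (s *\<^sub>R axis l 1) $ k * partial_deriv k \<phi> (y + t *\<^sub>R axis l 1)) =
          (\<Sum>k\<in>UNIV. if k = l then partial_deriv l \<phi> (y + t *\<^sub>R axis l 1) * s else 0)"
        by (intro sum.cong) (auto simp: axis_def)
      then show ?thesis by simp
    qed
    ultimately show "((\<lambda>t. \<phi> (y + t *\<^sub>R axis l 1)) has_real_derivative partial_deriv l \<phi> (y + t *\<^sub>R axis l 1)) (at t within {-1..1})"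
      by (simp add: has_field_derivative_def)
  next
    show "(\<lambda>y. \<phi> (y + t *\<^sub>R axis l 1)) integrable_on cbox (0 - (\<chi> i. M + 1)) (0 + (\<chi> i. M + 1))" for t :: real
      by (rule integrable_continuous[OF cont])
    show "continuous_on ({-1..1} \<times> cbox (0 - (\<chi> i. M + 1)) (0 + (\<chi> i. M + 1))) (\<lambda>(t, y). partial_deriv l \<phi> (y + t *\<^sub>R axis l 1))"
      unfolding case_prod_beta
      by (intro continuous_on_compose2[OF smooth_fun_continuous_partial[OF sm]] continuous_intros) auto
  qed auto
  have d2: "(h has_real_derivative 0) (at 0 within {-1..1})"
    by (rule has_field_derivative_transform_within[where f = "\<lambda>_. \<integral>y. \<phi> y \<partial>lborel" and d = 1]) (use h in auto)
  have at: "at (0::real) within {-1..1} = at 0" by (rule at_within_interior) (simp add: interior_atLeastAtMost_real)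
  have "integral S (partial_deriv l \<phi>) = 0"
    using DERIV_unique[OF d1[unfolded at] d2[unfolded at]] by simp
  moreover have "(\<integral>y. partial_deriv l \<phi> y \<partial>lborel) = integral S (partial_deriv l \<phi>)"
    unfolding S_def
  proof (rule lborel_integral_compact_support(2)[OF compact_cube])
    show "continuous_on (cube 0 (M + 1)) (partial_deriv l \<phi>)"
      by (rule continuous_on_subset[OF smooth_fun_continuous_partial[OF sm]]) simp
    show "partial_deriv l \<phi> y = 0" if "y \<notin> cube 0 (M + 1)" for y
      using out[of y 0] that zero'[of y] by (simp add: S_def)
  qed
  ultimately show ?thesis by simp
qed

lemma test_fun_integrable:
  fixes v :: "real^'n \<Rightarrow> real"
  assumes \<phi>: "test_fun \<Omega> \<phi>" and v: "continuous_on UNIV v"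
  shows "integrable lborel (\<lambda>y. v y * \<phi> y)" "integrable lborel (\<lambda>y. v y * partial_deriv l \<phi> y)"
proof -
  have sm: "smooth_fun \<phi>" using \<phi> by (simp add: test_fun_def)
  define S where "S = closure {y. \<phi> y \<noteq> 0}"
  have S: "compact S" using \<phi> by (simp add: test_fun_def S_def)
  have zero: "\<phi> y = 0" if "y \<notin> S" for y
    using that closure_subset[of "{y. \<phi> y \<noteq> 0}"] by (auto simp: S_def)
  have zero': "partial_deriv l \<phi> y = 0" if "y \<notin> S" for y
  proof -
    have "(\<phi> has_derivative (\<lambda>v. 0)) (at y)"
    proof (rule has_derivative_transform_within_open[OF has_derivative_const])
      show "open (- S)" unfolding S_def by (intro open_Compl closed_closure)
    qed (use that zero in auto)
    then show ?thesis by (simp add: partial_deriv_eq)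
  qed
  show "integrable lborel (\<lambda>y. v y * \<phi> y)"
    by (rule lborel_integral_compact_support(1)[OF S])
      (auto simp: zero intro!: continuous_intros continuous_on_subset[OF v] continuous_on_subset[OF smooth_fun_continuous[OF sm]])
  show "integrable lborel (\<lambda>y. v y * partial_deriv l \<phi> y)"
    by (rule lborel_integral_compact_support(1)[OF S])
      (auto simp: zero' intro!: continuous_intros continuous_on_subset[OF v] continuous_on_subset[OF smooth_fun_continuous_partial[OF sm]])
qed

text \<open>The previous lemma applied to the test function y_m \<phi>: the weak gradient of a
  coordinate function is a constant vector.\<close>

lemma integral_component_partial_deriv:
  fixes \<phi> :: "real^'n \<Rightarrow> real"
  assumes \<phi>: "test_fun \<Omega> \<phi>"
  shows "(\<integral>y. y $ m * partial_deriv l \<phi> y \<partial>lborel) = - (if l = m then \<integral>y. \<phi> y \<partial>lborel else 0)"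
proof -
  have sm: "smooth_fun \<phi>" using \<phi> by (simp add: test_fun_def)
  have sub: "closure {y. y $ m * \<phi> y \<noteq> 0} \<subseteq> closure {y. \<phi> y \<noteq> 0}" by (rule closure_mono) auto
  have "test_fun \<Omega> (\<lambda>y. y $ m * \<phi> y)"
    unfolding test_fun_def
  proof (intro conjI)
    show "smooth_fun (\<lambda>y. y $ m * \<phi> y)" using sm unfolding smooth_fun_def by (intro allI Ck_mult Ck_component) auto
    show "compact (closure {y. y $ m * \<phi> y \<noteq> 0})"
      using \<phi> sub unfolding test_fun_def by (meson bounded_subset closed_closure compact_eq_bounded_closed)
    show "closure {y. y $ m * \<phi> y \<noteq> 0} \<subseteq> \<Omega>" using \<phi> sub by (auto simp: test_fun_def)
  qed
  then have "(\<integral>y. partial_deriv l (\<lambda>y. y $ m * \<phi> y) y \<partial>lborel) = 0" by (rule integral_partial_deriv_eq_0)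
  moreover have "partial_deriv l (\<lambda>y. y $ m * \<phi> y) y = y $ m * partial_deriv l \<phi> y + (if l = m then \<phi> y else 0)" for y
  proof -
    have 1: "((\<lambda>y. y $ m) has_derivative (\<lambda>v. v $ m)) (at y)"
      by (rule bounded_linear_imp_has_derivative[OF bounded_linear_vec_nth])
    have "(\<phi> has_derivative frechet_derivative \<phi> (at y)) (at y)"
      using smooth_fun_differentiable[OF sm] by (simp add: frechet_derivative_works)
    from has_derivative_mult[OF 1 this] have "partial_deriv l (\<lambda>y. y $ m * \<phi> y) y
        = y $ m * frechet_derivative \<phi> (at y) (axis l 1) + axis l 1 $ m * \<phi> y" by (rule partial_deriv_eq)
    then show ?thesis by (simp add: partial_deriv_def axis_def)
  qed
  moreover have "integrable lborel (\<lambda>y. y $ m * partial_deriv l \<phi> y)"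
    by (rule test_fun_integrable(2)[OF \<phi>]) (intro continuous_intros)
  moreover have "integrable lborel (\<lambda>y. if l = m then \<phi> y else 0)"
    using test_fun_integrable(1)[OF \<phi>, of "\<lambda>_. 1"] by (cases "l = m") auto
  ultimately have "(\<integral>y. y $ m * partial_deriv l \<phi> y \<partial>lborel) + (\<integral>y. (if l = m then \<phi> y else 0) \<partial>lborel) = 0"
    by (simp add: Bochner_Integration.integral_add)
  then show ?thesis by (cases "l = m") auto
qed

text \<open>On a set of finite measure V the distribution function M satisfies M \<le> V^(1 - 1/n)
  M^(1/n). Integrability matters because a Bochner integral is 0 by convention for a non-integrable
  function, and then would not split into sums.\<close>

lemma lorentz_norm_finite_imp_nn_integral:
  fixes g :: "real^'n \<Rightarrow> real"
  assumes g [measurable]: "g \<in> borel_measurable borel" and \<Omega> [measurable]: "\<Omega> \<in> sets borel"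
    and fin: "emeasure lborel \<Omega> < \<infinity>" and L: "lorentz_norm \<Omega> g < \<infinity>"
  shows "(\<integral>\<^sup>+y. ennreal \<bar>g y\<bar> * indicator \<Omega> y \<partial>lborel) < \<infinity>"
proof -
  define n where "n = CARD('n)"
  define V where "V = measure lborel \<Omega> powr (1 - 1 / real n)"
  have [measurable]: "superlevel_measure g \<Omega> \<in> borel_measurable borel" by (rule borel_measurable_superlevel_measure[OF g \<Omega> fin])
  have n: "n \<ge> 1" unfolding n_def using zero_less_card_finite[where 'a = 'n] by linarith
  have lev_le: "superlevel_measure g \<Omega> s \<le> measure lborel \<Omega>" for s
    unfolding superlevel_measure_def using fin by (intro measure_mono_fmeasurable superlevel_measure_sets) (auto simp: fmeasurable_def)
  have "superlevel_measure g \<Omega> s \<le> V * superlevel_measure g \<Omega> s powr (1 / real n)" for s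
  proof -
    have "superlevel_measure g \<Omega> s = superlevel_measure g \<Omega> s powr (1 - 1 / real n) * superlevel_measure g \<Omega> s powr (1 / real n)"
      by (simp add: powr_add[symmetric])
    also have "\<dots> \<le> V * superlevel_measure g \<Omega> s powr (1 / real n)"
      unfolding V_def using n lev_le by (intro mult_right_mono powr_mono2) auto
    finally show ?thesis .
  qed
  then have "(\<integral>\<^sup>+y. ennreal \<bar>g y\<bar> * indicator \<Omega> y \<partial>lborel)
      \<le> (\<integral>\<^sup>+s. ennreal V * (ennreal (superlevel_measure g \<Omega> s powr (1 / real n)) * indicator {0..} s) \<partial>lborel)"
    unfolding layer_cake[OF g \<Omega>] emeasure_superlevel_measure[OF g \<Omega> fin]
    by (intro nn_integral_mono) (auto simp: indicator_def V_def ennreal_mult[symmetric] intro!: ennreal_leI)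
  also have "\<dots> = ennreal V * lorentz_norm \<Omega> g"
    unfolding lorentz_norm_def n_def by (rule nn_integral_cmult) measurable
  also have "\<dots> < \<infinity>" using L by (simp add: ennreal_mult_less_top)
  finally show ?thesis .
qed

text \<open>Where |g - q| \<ge> s one has |g| \<ge> s - |q|, so the distribution function is shifted
  by |q|; on the levels up to |q| the measure of \<Omega> serves as bound.\<close>

lemma lorentz_norm_minus_const:
  fixes g :: "real^'n \<Rightarrow> real"
  assumes g [measurable]: "g \<in> borel_measurable borel" and \<Omega> [measurable]: "\<Omega> \<in> sets borel"
    and fin: "emeasure lborel \<Omega> < \<infinity>"
  shows "lorentz_norm \<Omega> (\<lambda>y. g y - q) \<le>
    ennreal (\<bar>q\<bar> * measure lborel \<Omega> powr (1 / real CARD('n))) + lorentz_norm \<Omega> g"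
proof -
  define n where "n = CARD('n)"
  define V where "V = measure lborel \<Omega> powr (1 / real n)"
  have [measurable]: "superlevel_measure g \<Omega> \<in> borel_measurable borel" by (rule borel_measurable_superlevel_measure[OF g \<Omega> fin])
  define f where "f s = ennreal (superlevel_measure g \<Omega> s powr (1 / real n)) * indicator {0..} s" for s
  have f [measurable]: "f \<in> borel_measurable borel" unfolding f_def[abs_def] by measurable
  have gq: "(\<lambda>y. g y - q) \<in> borel_measurable borel" by measurable
  have lev_le: "superlevel_measure (\<lambda>y. g y - q) \<Omega> s \<le> measure lborel \<Omega>" for s
    unfolding superlevel_measure_def using fin superlevel_measure_sets[OF gq \<Omega>] by (intro measure_mono_fmeasurable) (auto simp: fmeasurable_def)
  have "lorentz_norm \<Omega> (\<lambda>y. g y - q) \<le> (\<integral>\<^sup>+s. ennreal V * indicator {0..\<bar>q\<bar>} s + f (- \<bar>q\<bar> + 1 * s) \<partial>lborel)"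
    unfolding lorentz_norm_def
  proof (rule nn_integral_mono)
    fix s :: real
    consider "s < 0" | "0 \<le> s" "s \<le> \<bar>q\<bar>" | "\<bar>q\<bar> < s" by linarith
    then show "ennreal (superlevel_measure (\<lambda>y. g y - q) \<Omega> s powr (1 / real CARD('n))) * indicator {0..} s
        \<le> ennreal V * indicator {0..\<bar>q\<bar>} s + f (- \<bar>q\<bar> + 1 * s)"
    proof cases
      case 2
      have "ennreal (superlevel_measure (\<lambda>y. g y - q) \<Omega> s powr (1 / real n)) \<le> ennreal V"
        unfolding V_def by (intro ennreal_leI powr_mono2 lev_le) auto
      then show ?thesis using 2 by (simp add: n_def add_increasing2)
    next
      case 3
      have "superlevel_measure (\<lambda>y. g y - q) \<Omega> s \<le> superlevel_measure g \<Omega> (s - \<bar>q\<bar>)"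
        unfolding superlevel_measure_def
      proof (rule measure_mono_fmeasurable)
        show "{y \<in> \<Omega>. s \<le> \<bar>g y - q\<bar>} \<in> sets lborel" using superlevel_measure_sets[OF gq \<Omega>] by simp
        have "emeasure lborel {y \<in> \<Omega>. s - \<bar>q\<bar> \<le> \<bar>g y\<bar>} < \<infinity>"
          using emeasure_superlevel_measure[OF g \<Omega> fin] by simp
        then show "{y \<in> \<Omega>. s - \<bar>q\<bar> \<le> \<bar>g y\<bar>} \<in> fmeasurable lborel"
          using superlevel_measure_sets[OF g \<Omega>] by (simp add: fmeasurable_def)
      qed auto
      then have "ennreal (superlevel_measure (\<lambda>y. g y - q) \<Omega> s powr (1 / real n)) \<le> ennreal (superlevel_measure g \<Omega> (s - \<bar>q\<bar>) powr (1 / real n))"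
        by (intro ennreal_leI powr_mono2) auto
      then show ?thesis using 3 by (simp add: f_def n_def)
    qed auto
  qed
  also have "\<dots> = (\<integral>\<^sup>+s. ennreal V * indicator {0..\<bar>q\<bar>} s \<partial>lborel) + (\<integral>\<^sup>+s. f (- \<bar>q\<bar> + 1 * s) \<partial>lborel)"
    by (rule nn_integral_add) measurable
  also have "(\<integral>\<^sup>+s. f (- \<bar>q\<bar> + 1 * s) \<partial>lborel) = lorentz_norm \<Omega> g"
    using nn_integral_real_affine[OF f, of 1 "- \<bar>q\<bar>"] by (simp add: lorentz_norm_def f_def n_def)
  also have "(\<integral>\<^sup>+s. ennreal V * indicator {0..\<bar>q\<bar>} s \<partial>lborel) = ennreal (\<bar>q\<bar> * V)"
    by (subst nn_integral_cmult_indicator) (auto simp: V_def ennreal_mult mult.commute)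
  finally show ?thesis by (simp add: V_def n_def)
qed

text \<open>This turns the bound on the oscillation of a function into a bound on its deviation from
  a linear one.\<close>

lemma lorentz_gradient_minus_linear:
  fixes u :: "real^'n \<Rightarrow> real"
  assumes u: "continuous_on UNIV u" and lg: "lorentz_gradient \<Omega> u g"
    and \<Omega> [measurable]: "\<Omega> \<in> sets borel" and fin: "emeasure lborel \<Omega> < \<infinity>"
  shows "lorentz_gradient \<Omega> (\<lambda>y. u y - (\<Sum>m\<in>UNIV. q m * y $ m)) (\<lambda>l y. g l y - q l)"
proof -
  have wg: "weak_gradient \<Omega> u g" and g [measurable]: "\<And>l. g l \<in> borel_measurable borel"
    and Lf: "\<And>l. lorentz_norm \<Omega> (g l) < \<infinity>" using lg by (auto simp: lorentz_gradient_def)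
  have "lorentz_norm \<Omega> (\<lambda>y. g l y - q l) < \<infinity>" for l
    by (rule order.strict_trans1[OF lorentz_norm_minus_const[OF g \<Omega> fin]]) (use Lf[of l] in simp)
  moreover have "weak_gradient \<Omega> (\<lambda>y. u y - (\<Sum>m\<in>UNIV. q m * y $ m)) (\<lambda>l y. g l y - q l)"
    unfolding weak_gradient_def
  proof (intro allI impI)
    fix l \<phi> assume \<phi>: "test_fun \<Omega> \<phi>"
    have cont: "continuous_on UNIV \<phi>" using \<phi> by (simp add: test_fun_def smooth_fun_continuous)
    have i1: "integrable lborel (\<lambda>y. u y * partial_deriv l \<phi> y)" by (rule test_fun_integrable(2)[OF \<phi> u])
    have i2: "integrable lborel (\<lambda>y. y $ m * partial_deriv l \<phi> y)" for m
      by (rule test_fun_integrable(2)[OF \<phi>]) (intro continuous_intros)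
    have i3: "integrable lborel \<phi>" using test_fun_integrable(1)[OF \<phi>, of "\<lambda>_. 1"] by simp
    have i4: "integrable lborel (\<lambda>y. g l y * \<phi> y)"
    proof -
      have "bounded (range \<phi>)"
      proof -
        define S where "S = closure {y. \<phi> y \<noteq> 0}"
        have "bounded (\<phi> ` S)"
          using \<phi> by (intro compact_imp_bounded compact_continuous_image continuous_on_subset[OF cont])
            (auto simp: test_fun_def S_def)
        moreover have "range \<phi> \<subseteq> insert 0 (\<phi> ` S)" using closure_subset by (fastforce simp: S_def)
        ultimately show ?thesis by (meson bounded_insert bounded_subset)
      qed
      then obtain B where B: "B > 0" "\<And>y. \<bar>\<phi> y\<bar> \<le> B" by (auto simp: bounded_pos)
      have [measurable]: "\<phi> \<in> borel_measurable borel" using cont by (rule borel_measurable_continuous_onI)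
      have "(\<integral>\<^sup>+y. ennreal (norm (g l y * \<phi> y)) \<partial>lborel) \<le> (\<integral>\<^sup>+y. ennreal B * (ennreal \<bar>g l y\<bar> * indicator \<Omega> y) \<partial>lborel)"
      proof (rule nn_integral_mono)
        fix y
        have "y \<in> \<Omega>" if "\<phi> y \<noteq> 0" using \<phi> that closure_subset unfolding test_fun_def by fastforce
        moreover have "\<bar>g l y * \<phi> y\<bar> \<le> B * \<bar>g l y\<bar>" using B(2)[of y] by (simp add: abs_mult mult.commute mult_right_mono)
        then have "ennreal \<bar>g l y * \<phi> y\<bar> \<le> ennreal B * ennreal \<bar>g l y\<bar>"
          using B by (subst ennreal_mult[symmetric]) (auto intro: ennreal_leI)
        ultimately show "ennreal (norm (g l y * \<phi> y)) \<le> ennreal B * (ennreal \<bar>g l y\<bar> * indicator \<Omega> y)"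
          by (cases "\<phi> y = 0") auto
      qed
      also have "\<dots> = ennreal B * (\<integral>\<^sup>+y. ennreal \<bar>g l y\<bar> * indicator \<Omega> y \<partial>lborel)"
        by (intro nn_integral_cmult) measurable
      also have "\<dots> < \<infinity>" using lorentz_norm_finite_imp_nn_integral[OF g \<Omega> fin Lf] by (simp add: ennreal_mult_less_top)
      finally show ?thesis by (intro integrableI_bounded) auto
    qed
    have "(\<integral>y. (u y - (\<Sum>m\<in>UNIV. q m * y $ m)) * partial_deriv l \<phi> y \<partial>lborel)
        = (\<integral>y. u y * partial_deriv l \<phi> y - (\<Sum>m\<in>UNIV. q m * (y $ m * partial_deriv l \<phi> y)) \<partial>lborel)"
      by (simp add: left_diff_distrib sum_distrib_right mult.assoc)
    also have "\<dots> = (\<integral>y. u y * partial_deriv l \<phi> y \<partial>lborel) - (\<Sum>m\<in>UNIV. q m * (\<integral>y. y $ m * partial_deriv l \<phi> y \<partial>lborel))"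
      using i1 i2 by (simp add: Bochner_Integration.integral_diff Bochner_Integration.integral_sum)
    also have "(\<Sum>m\<in>UNIV. q m * (\<integral>y. y $ m * partial_deriv l \<phi> y \<partial>lborel)) = - (q l * (\<integral>y. \<phi> y \<partial>lborel))"
      by (simp add: integral_component_partial_deriv[OF \<phi>] if_distrib[of "\<lambda>x. - x"] if_distrib[of "(*) _"] cong: if_cong)
    also have "(\<integral>y. u y * partial_deriv l \<phi> y \<partial>lborel) = - (\<integral>y. g l y * \<phi> y \<partial>lborel)"
      using wg \<phi> by (simp add: weak_gradient_def)
    also have "- (\<integral>y. g l y * \<phi> y \<partial>lborel) - - (q l * (\<integral>y. \<phi> y \<partial>lborel)) = - (\<integral>y. (g l y - q l) * \<phi> y \<partial>lborel)"
      using i3 i4 by (simp add: left_diff_distrib Bochner_Integration.integral_diff)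
    finally show "(\<integral>y. (u y - (\<Sum>m\<in>UNIV. q m * y $ m)) * partial_deriv l \<phi> y \<partial>lborel) = - (\<integral>y. (g l y - q l) * \<phi> y \<partial>lborel)" .
  qed
  ultimately show ?thesis by (simp add: lorentz_gradient_def)
qed

section \<open>Comparison of cubes and balls, and differentiability\<close>

lemma norm_le_card_mult_sup:
  fixes x :: "real^'n"
  assumes "\<And>i. \<bar>x $ i\<bar> \<le> r" shows "norm x \<le> real CARD('n) * r"
  using norm_le_l1_cart[of x] sum_bounded_above[of UNIV "\<lambda>i. \<bar>x $ i\<bar>" r] assms by simp

lemma cube_subset_ball: "0 < r \<Longrightarrow> cube (y::real^'n) r \<subseteq> ball y ((real CARD('n) + 1) * r)"
proof
  fix x assume r: "0 < r" and x: "x \<in> cube y r"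
  have "norm (x - y) \<le> real CARD('n) * r" by (rule norm_le_card_mult_sup) (use x in \<open>auto simp: cube_def\<close>)
  also have "\<dots> < (real CARD('n) + 1) * r" using r by simp
  finally show "x \<in> ball y ((real CARD('n) + 1) * r)" by (simp add: dist_norm norm_minus_commute)
qed

lemma ball_subset_cube: "ball (y::real^'n) r \<subseteq> cube y r"
proof
  fix x assume x: "x \<in> ball y r"
  show "x \<in> cube y r" unfolding cube_def
  proof (intro CollectI allI)
    fix i
    have "\<bar>(x - y) $ i\<bar> \<le> norm (x - y)" by (rule component_le_norm_cart)
    also have "\<dots> \<le> r" using x by (simp add: dist_norm norm_minus_commute)
    finally show "\<bar>x $ i - y $ i\<bar> \<le> r" by simp
  qed
qed

text \<open>The weights belonging to \<open>u - q \<bullet> y\<close>, for rational vectors \<open>q\<close>, are small at the points where the weak gradient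
  is close to \<open>q\<close>, so by Lebesgue differentiation \<open>u\<close> is nearly affine with slope \<open>q\<close> on small cubes around such points.\<close>

lemma lorentz_gradient_differentiable:
  fixes u :: "real^'n \<Rightarrow> real"
  assumes u: "continuous_on UNIV u" and lg: "lorentz_gradient \<Omega> u g"
    and op: "open \<Omega>" and fin: "emeasure lborel \<Omega> < \<infinity>"
  shows "negligible {y\<in>\<Omega>. \<not> u differentiable (at y)}"
proof -
  define n where "n = CARD('n)"
  have n: "0 < n" by (simp add: n_def)
  have \<Omega>: "\<Omega> \<in> sets borel" using op by simp
  have g: "\<And>l. g l \<in> borel_measurable borel" and Lf: "\<And>l. lorentz_norm \<Omega> (g l) < \<infinity>"
    using lg by (auto simp: lorentz_gradient_def)
  define V where "V = measure lborel \<Omega> powr (1 / real n)"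
  have V: "V \<ge> 0" by (simp add: V_def)
  define C where "C = osc_const TYPE('n)"
  have C: "C > 0" by (simp add: C_def osc_const_pos)
  define Lg where "Lg l = enn2real (lorentz_norm \<Omega> (g l))" for l
  define \<Lambda> where "\<Lambda> q l = \<bar>q\<bar> * V + Lg l" for q l
  have \<Lambda>: "lorentz_norm \<Omega> (\<lambda>y. g l y - q) \<le> ennreal (\<Lambda> q l)" "0 \<le> \<Lambda> q l" for q l
  proof -
    have L: "ennreal (Lg l) = lorentz_norm \<Omega> (g l)" using Lf[of l] by (simp add: Lg_def less_top)
    have "ennreal (\<Lambda> q l) = ennreal (\<bar>q\<bar> * V) + ennreal (Lg l)"
      unfolding \<Lambda>_def by (rule ennreal_plus) (auto simp: V Lg_def)
    then show "lorentz_norm \<Omega> (\<lambda>y. g l y - q) \<le> ennreal (\<Lambda> q l)"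
      using lorentz_norm_minus_const[OF g \<Omega> fin, of l q] by (simp only: L V_def n_def)
    show "0 \<le> \<Lambda> q l" using V by (simp add: \<Lambda>_def Lg_def)
  qed
  define P where "P q l \<theta> \<longleftrightarrow> \<theta> \<in> borel_measurable borel \<and> (\<integral>\<^sup>+x. \<theta> x * indicator \<Omega> x \<partial>lborel) \<le> ennreal (\<Lambda> q l + 1)
    \<and> (\<forall>x. \<theta> x \<le> ennreal (\<bar>g l x - q\<bar> * (1 + \<bar>g l x - q\<bar>) ^ (2 * n)))
    \<and> (\<forall>A \<alpha>. A \<in> sets borel \<longrightarrow> A \<subseteq> \<Omega> \<longrightarrow> 0 < \<alpha> \<longrightarrow> lorentz_norm A (\<lambda>y. g l y - q) \<le>
        ennreal (\<alpha> ^ (n - 1)) * (\<integral>\<^sup>+x. \<theta> x * indicator A x \<partial>lborel) + ennreal ((\<Lambda> q l + 1) / \<alpha>))" for q l \<theta>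
  have "\<exists>\<theta>. P q l \<theta>" for q l
  proof -
    have "(\<lambda>y. g l y - q) \<in> borel_measurable borel" using g[of l] by measurable
    from lorentz_weight[OF this \<Omega> fin \<Lambda>] show ?thesis unfolding P_def n_def .
  qed
  then obtain \<theta> where P: "\<And>q l. P q l (\<theta> q l)" by metis
  define E where "E q l = {x\<in>\<Omega>. \<exists>c>0. \<theta> q l x < ennreal c \<and> (\<forall>d>0. \<exists>r. 0 < r \<and> r < d \<and>
     ennreal c * emeasure lborel (ball x r) < (\<integral>\<^sup>+y. \<theta> q l y * indicator (ball x r) y \<partial>lborel))}" for q l
  have "negligible (E q l)" for q l
    unfolding E_def
  proof (rule upper_lebesgue_differentiation[OF _ op fin])
    show "\<theta> q l \<in> borel_measurable borel" using P[of q l] by (simp add: P_def)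
    have "(\<integral>\<^sup>+x. \<theta> q l x * indicator \<Omega> x \<partial>lborel) \<le> ennreal (\<Lambda> q l + 1)" using P[of q l] by (simp add: P_def)
    then show "(\<integral>\<^sup>+x. \<theta> q l x * indicator \<Omega> x \<partial>lborel) < \<infinity>" by (rule order.strict_trans1) simp
  qed
  then have neg: "negligible (\<Union>(q, l)\<in>(UNIV :: (rat \<times> 'n) set). E (of_rat q) l)"
    by (intro negligible_countable_Union countable_image) auto
  have diff: "u differentiable (at y0)" if y0: "y0 \<in> \<Omega>" and good: "\<And>q l. y0 \<notin> E (of_rat q) l" for y0
  proof -
    define a where "a l = g l y0" for l
    \<comment> \<open>Bounds the constants \<Lambda> + 1 for all slopes within distance 1 of the
      gradient at once, so that the parameters below can be fixed before the slope.\<close>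
    define W where "W = (\<Sum>l\<in>UNIV. (\<bar>a l\<bar> + 1) * V + Lg l + 1)"
    have Wl: "\<Lambda> q l + 1 \<le> W" if "\<bar>a l - q\<bar> \<le> 1" for q l
    proof -
      have "\<bar>q\<bar> * V \<le> (\<bar>a l\<bar> + 1) * V" using that V by (intro mult_right_mono) auto
      then have "\<Lambda> q l + 1 \<le> (\<bar>a l\<bar> + 1) * V + Lg l + 1" by (simp add: \<Lambda>_def)
      also have "\<dots> \<le> W" unfolding W_def using V by (intro member_le_sum) (auto simp: Lg_def)
      finally show ?thesis .
    qed
    have W: "W > 0" using Wl[of l "a l" for l] \<Lambda>(2)[of "a undefined" undefined] by (smt (verit))
    define K where "K = real n + 1"
    have K: "K > 0" by (simp add: K_def)
    have "(u has_derivative (\<lambda>v. \<Sum>l\<in>UNIV. v $ l * a l)) (at y0)"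
      unfolding has_derivative_at_alt
    proof (intro conjI allI impI)
      show "bounded_linear (\<lambda>v. \<Sum>l\<in>UNIV. v $ l * a l)"
        by (intro bounded_linear_sum bounded_linear_mult_const bounded_linear_vec_nth)
      fix e :: real assume e: "e > 0"
      \<comment> \<open>The order of dependence is \<kappa>, \<open>B\<close>, \<eta>. The term W /
        \<alpha> fixes \<kappa>; the coefficient \<open>B\<close> of the weight depends on \<kappa>;
        the accuracy \<eta> of the rational slope comes last and is small against \<open>B\<close>.
        The budget is e/4 for each of the two terms and e/4 for replacing the slope by the
        gradient.\<close>
      define \<kappa> where "\<kappa> = e / (4 * (C * real n * W))"
      have \<kappa>: "\<kappa> > 0" using e C W n by (simp add: \<kappa>_def)
      define B where "B = C * real n * ((2 * K) ^ n / \<kappa> ^ (n - 1))"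
      have B: "B > 0" using C n K \<kappa> by (simp add: B_def)
      define \<eta> where "\<eta> = min 1 (min (e / (4 * real n)) (e / (4 * B * (2 * 4 ^ n))))"
      have \<eta>: "\<eta> > 0" "\<eta> \<le> 1" "\<eta> \<le> e / (4 * real n)" "\<eta> \<le> e / (4 * B * (2 * 4 ^ n))"
        using e n B by (auto simp: \<eta>_def)
      \<comment> \<open>2^(2 n) = 4^n bounds the power of 1 + |a - q| for |a - q| \<le> 1; the
        factor 2 makes the comparison with the weight strict, as the exceptional sets
        demand.\<close>
      define c where "c = 2 * 4 ^ n * \<eta>"
      have c: "c > 0" "B * c \<le> e / 4"
        using \<eta> B by (auto simp: c_def field_simps)
      have "\<exists>q. \<bar>a l - real_of_rat q\<bar> < \<eta>" for l
      proof -
        obtain q where "a l < real_of_rat q" "real_of_rat q < a l + \<eta>"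
          using of_rat_dense[of "a l" "a l + \<eta>"] \<eta>(1) by auto
        then show ?thesis by (intro exI[of _ q]) auto
      qed
      then obtain q' where q': "\<And>l. \<bar>a l - real_of_rat (q' l)\<bar> < \<eta>" by metis
      define q where "q l = real_of_rat (q' l)" for l
      have q: "\<bar>a l - q l\<bar> < \<eta>" for l using q' by (simp add: q_def)
      have "\<exists>d>0. \<forall>r. 0 < r \<longrightarrow> r < d \<longrightarrow>
          (\<integral>\<^sup>+y. \<theta> (q l) l y * indicator (ball y0 r) y \<partial>lborel) \<le> ennreal c * emeasure lborel (ball y0 r)" for l
      proof -
        have "\<theta> (q l) l y0 \<le> ennreal (\<bar>a l - q l\<bar> * (1 + \<bar>a l - q l\<bar>) ^ (2 * n))"
          using P[of "q l" l] by (simp add: P_def a_def)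
        also have "\<dots> \<le> ennreal (\<eta> * 2 ^ (2 * n))"
          using q[of l] \<eta> by (intro ennreal_leI mult_mono power_mono) auto
        also have "\<dots> < ennreal c"
          using \<eta> by (intro ennreal_lessI) (auto simp: c_def power_mult)
        finally have "\<theta> (q l) l y0 < ennreal c" .
        moreover have "y0 \<notin> E (q l) l" using good by (simp add: q_def)
        ultimately have "\<not> (\<forall>d>0. \<exists>r. 0 < r \<and> r < d \<and> ennreal c * emeasure lborel (ball y0 r)
            < (\<integral>\<^sup>+y. \<theta> (q l) l y * indicator (ball y0 r) y \<partial>lborel))"
          unfolding E_def using y0 c(1) by blast
        then show ?thesis by (meson not_less)
      qed
      then obtain d where d: "\<And>l. d l > 0" "\<And>l r. 0 < r \<Longrightarrow> r < d l \<Longrightarrow>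
          (\<integral>\<^sup>+y. \<theta> (q l) l y * indicator (ball y0 r) y \<partial>lborel) \<le> ennreal c * emeasure lborel (ball y0 r)"
        by metis
      obtain d0 where d0: "d0 > 0" "ball y0 d0 \<subseteq> \<Omega>" using op y0 by (meson open_contains_ball)
      define \<delta> where "\<delta> = min d0 (Min (range d)) / K"
      have \<delta>: "\<delta> > 0" using d(1) d0 K by (simp add: \<delta>_def)
      define v where "v y = u y - (\<Sum>m\<in>UNIV. q m * y $ m)" for y
      have v_lg: "lorentz_gradient \<Omega> v (\<lambda>l y. g l y - q l)"
        unfolding v_def[abs_def] by (rule lorentz_gradient_minus_linear[OF u lg \<Omega> fin])
      have v_cont: "continuous_on UNIV v" unfolding v_def[abs_def] by (intro continuous_intros u)
      have main: "\<bar>v x - v y0\<bar> \<le> e / 2 * r" if r: "0 < r" "r < \<delta>" and x: "x \<in> cube y0 r" for r x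
      proof -
        have Kr: "0 < K * r" "K * r < d0" "\<And>l. K * r < d l"
        proof -
          have "K * r < min d0 (Min (range d))" using r K by (simp add: \<delta>_def pos_less_divide_eq mult.commute)
          moreover have "Min (range d) \<le> d l" for l by simp
          ultimately show "K * r < d0" "\<And>l. K * r < d l" by (auto intro: order.strict_trans2)
          show "0 < K * r" using r K by simp
        qed
        have cb: "cube y0 r \<subseteq> ball y0 (K * r)" using cube_subset_ball[OF r(1)] by (simp add: K_def n_def)
        also have b\<Omega>: "ball y0 (K * r) \<subseteq> \<Omega>" using Kr(2) d0(2) subset_ball[of "K * r" d0 y0] by auto
        finally have c\<Omega>: "cube y0 r \<subseteq> \<Omega>" .
        have \<theta>c: "(\<integral>\<^sup>+y. \<theta> (q l) l y * indicator (cube y0 r) y \<partial>lborel) \<le> ennreal (c * (2 * (K * r)) ^ n)" for l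
        proof -
          have "(\<integral>\<^sup>+y. \<theta> (q l) l y * indicator (cube y0 r) y \<partial>lborel) \<le> (\<integral>\<^sup>+y. \<theta> (q l) l y * indicator (ball y0 (K * r)) y \<partial>lborel)"
            using cb by (intro nn_integral_mono) (auto simp: indicator_def)
          also have "\<dots> \<le> ennreal c * emeasure lborel (ball y0 (K * r))" by (rule d(2)[OF Kr(1) Kr(3)])
          also have "\<dots> \<le> ennreal c * emeasure lborel (cube y0 (K * r))"
            by (intro mult_left_mono emeasure_mono ball_subset_cube) auto
          also have "\<dots> = ennreal c * ennreal ((2 * (K * r)) ^ n)"
            using Kr(1) by (simp add: emeasure_cube n_def)
          also have "\<dots> = ennreal (c * (2 * (K * r)) ^ n)"
            by (rule ennreal_mult[symmetric]) (use c Kr in auto)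
          finally show ?thesis .
        qed
        \<comment> \<open>On a cube of half-side r the integral of the weight is at most of order
          r^n; this \<alpha> makes both terms of the Young bound proportional to r.\<close>
        define \<alpha> where "\<alpha> = 1 / (\<kappa> * r)"
        have \<alpha>: "\<alpha> > 0" using \<kappa> r by (simp add: \<alpha>_def)
        define S where "S = \<alpha> ^ (n - 1) * (c * (2 * (K * r)) ^ n) + W / \<alpha>"
        have S: "S \<ge> 0" using \<alpha> c Kr(1) W by (simp add: S_def)
        have "lorentz_norm (cube y0 r) (\<lambda>y. g l y - q l) \<le> ennreal S" for l
        proof -
          have "lorentz_norm (cube y0 r) (\<lambda>y. g l y - q l) \<le>
             ennreal (\<alpha> ^ (n - 1)) * (\<integral>\<^sup>+x. \<theta> (q l) l x * indicator (cube y0 r) x \<partial>lborel) + ennreal ((\<Lambda> (q l) l + 1) / \<alpha>)"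
            using P[of "q l" l] c\<Omega> \<alpha> borel_cube unfolding P_def by blast
          also have "\<dots> \<le> ennreal (\<alpha> ^ (n - 1)) * ennreal (c * (2 * (K * r)) ^ n) + ennreal (W / \<alpha>)"
            using Wl[of l "q l"] q[of l] \<eta>(2) \<alpha>
            by (intro add_mono mult_left_mono \<theta>c ennreal_leI divide_right_mono) auto
          also have "ennreal (\<alpha> ^ (n - 1)) * ennreal (c * (2 * (K * r)) ^ n) = ennreal (\<alpha> ^ (n - 1) * (c * (2 * (K * r)) ^ n))"
            by (rule ennreal_mult[symmetric]) (use \<alpha> c Kr in auto)
          also have "\<dots> + ennreal (W / \<alpha>) = ennreal S"
            unfolding S_def by (rule ennreal_plus[symmetric]) (use \<alpha> c Kr W in auto)
          finally show ?thesis .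
        qed
        then have "(\<Sum>l\<in>UNIV. lorentz_norm (cube y0 r) (\<lambda>y. g l y - q l)) \<le> (\<Sum>l\<in>(UNIV::'n set). ennreal S)"
          by (rule sum_mono)
        also have "\<dots> = ennreal (real n * S)"
          using S by (simp add: n_def ennreal_mult ennreal_of_nat_eq_real_of_nat)
        finally have sumS: "(\<Sum>l\<in>UNIV. lorentz_norm (cube y0 r) (\<lambda>y. g l y - q l)) \<le> ennreal (real n * S)" .
        have y0c: "y0 \<in> cube y0 r" using r by (simp add: cube_def)
        have "ennreal \<bar>v x - v y0\<bar> \<le> ennreal C * (\<Sum>l\<in>UNIV. lorentz_norm (cube y0 r) (\<lambda>y. g l y - q l))"
          unfolding C_def by (rule oscillation_le_lorentz_norm[OF v_cont _ _ c\<Omega> r(1) x y0c]) (use v_lg in \<open>auto simp: lorentz_gradient_def\<close>)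
        also have "\<dots> \<le> ennreal C * ennreal (real n * S)" by (intro mult_left_mono sumS) auto
        also have "\<dots> = ennreal (C * (real n * S))" by (rule ennreal_mult[symmetric]) (use C S in auto)
        finally have "\<bar>v x - v y0\<bar> \<le> C * (real n * S)"
          by (subst (asm) ennreal_le_iff) (use C S in auto)
        also have "\<dots> = (B * c + C * real n * W * \<kappa>) * r"
        proof -
          have "\<alpha> ^ (n - 1) * (2 * (K * r)) ^ n = (2 * K) ^ n / \<kappa> ^ (n - 1) * r"
          proof -
            have e1: "(2 * (K * r)) ^ n = (2 * K) ^ n * r ^ n" by (simp add: power_mult_distrib mult.assoc)
            have e2: "r ^ n = r ^ (n - 1) * r" using n by (simp only: power_minus_mult)
            have e3: "\<alpha> ^ (n - 1) = 1 / (\<kappa> ^ (n - 1) * r ^ (n - 1))"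
              by (simp add: \<alpha>_def power_divide power_mult_distrib)
            show ?thesis unfolding e1 e2 e3 using \<kappa> r by simp
          qed
          then have "S = c * ((2 * K) ^ n / \<kappa> ^ (n - 1) * r) + W * \<kappa> * r"
            unfolding S_def by (simp add: \<alpha>_def mult.left_commute mult.assoc)
          then show ?thesis by (simp add: B_def algebra_simps)
        qed
        also have "\<dots> \<le> (e / 4 + e / 4) * r"
        proof (intro mult_right_mono add_mono c)
          show "C * real n * W * \<kappa> \<le> e / 4" using C n W by (simp add: \<kappa>_def)
        qed (use r in auto)
        finally show ?thesis by simp
      qed
      have "norm (u x - u y0 - (\<Sum>l\<in>UNIV. (x - y0) $ l * a l)) \<le> e * norm (x - y0)" if x: "norm (x - y0) < \<delta>" for x
      proof (cases "x = y0")
        case False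
        define r where "r = norm (x - y0)"
        have r: "0 < r" "r < \<delta>" using False x by (auto simp: r_def)
        have "x \<in> cube y0 r" using component_le_norm_cart[of "x - y0"] by (auto simp: cube_def r_def)
        from main[OF r this] have 1: "\<bar>v x - v y0\<bar> \<le> e / 2 * r" .
        have "\<bar>\<Sum>l\<in>UNIV. (q l - a l) * (x - y0) $ l\<bar> \<le> (\<Sum>l\<in>(UNIV::'n set). \<eta> * r)"
        proof (rule order.trans[OF sum_abs sum_mono])
          fix l
          show "\<bar>(q l - a l) * (x - y0) $ l\<bar> \<le> \<eta> * r"
            unfolding abs_mult r_def using q[of l] \<eta>
            by (intro mult_mono component_le_norm_cart) (auto simp: abs_minus_commute)
        qed
        also have "\<dots> = real n * \<eta> * r" by (simp add: n_def)
        also have "\<dots> \<le> e / 4 * r"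
        proof (rule mult_right_mono)
          have "real n * \<eta> \<le> real n * (e / (4 * real n))" using \<eta>(3) by (intro mult_left_mono) auto
          then show "real n * \<eta> \<le> e / 4" using n by simp
        qed (use r in auto)
        finally have 2: "\<bar>\<Sum>l\<in>UNIV. (q l - a l) * (x - y0) $ l\<bar> \<le> e / 4 * r" .
        have "u x - u y0 - (\<Sum>l\<in>UNIV. (x - y0) $ l * a l) = (v x - v y0) + (\<Sum>l\<in>UNIV. (q l - a l) * (x - y0) $ l)"
          by (simp add: v_def sum_subtractf[symmetric] sum.distrib[symmetric] algebra_simps)
        then have "norm (u x - u y0 - (\<Sum>l\<in>UNIV. (x - y0) $ l * a l)) \<le> e / 2 * r + e / 4 * r"
          using 1 2 unfolding real_norm_def by linarith
        also have "\<dots> \<le> e * r" using e r by simp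
        finally show ?thesis by (simp add: r_def)
      qed simp
      then show "\<exists>d>0. \<forall>x. norm (x - y0) < d \<longrightarrow>
          norm (u x - u y0 - (\<Sum>l\<in>UNIV. (x - y0) $ l * a l)) \<le> e * norm (x - y0)"
        using \<delta> by blast
    qed
    then show ?thesis by (auto simp: differentiable_def)
  qed
  show ?thesis
    by (rule negligible_subset[OF neg]) (use diff in auto)
qed

section \<open>Images of null sets and of critical points\<close>

text \<open>The condition of Rado and Reichelderfer, with cubes in place of balls.\<close>

definition rr_bound :: "(real^'n) set \<Rightarrow> (real^'n \<Rightarrow> ennreal) \<Rightarrow> (real^'n \<Rightarrow> real^'n) \<Rightarrow> bool" where
  "rr_bound \<Omega> \<Theta> f \<longleftrightarrow> \<Theta> \<in> borel_measurable borel \<and> (\<integral>\<^sup>+x. \<Theta> x * indicator \<Omega> x \<partial>lborel) < \<infinity>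
    \<and> (\<forall>m R x z. cube m R \<subseteq> \<Omega> \<longrightarrow> 0 < R \<longrightarrow> x \<in> cube m R \<longrightarrow> z \<in> cube m R \<longrightarrow>
        ennreal (norm (f x - f z) ^ CARD('n)) \<le> (\<integral>\<^sup>+y. \<Theta> y * indicator (cube m R) y \<partial>lborel))"

lemma measure_cube: "0 \<le> R \<Longrightarrow> measure lebesgue (cube (m::real^'n) R) = (2 * R) ^ CARD('n)"
  using emeasure_cube[of R m] by (simp add: measure_def)

lemma lmeasurable_cube: "cube m R \<in> lmeasurable"
  by (intro lmeasurable_compact compact_cube)

lemma rr_bound_image_cube:
  fixes f :: "real^'n \<Rightarrow> real^'n"
  assumes rr: "rr_bound \<Omega> \<Theta> f" and sub: "cube m R \<subseteq> \<Omega>" and R: "0 < R"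
    and I: "(\<integral>\<^sup>+y. \<Theta> y * indicator (cube m R) y \<partial>lborel) = ennreal I" "0 \<le> I"
  shows "f ` cube m R \<subseteq> cube (f m) (root CARD('n) I)"
proof
  fix w assume "w \<in> f ` cube m R"
  then obtain x where x: "x \<in> cube m R" "w = f x" by blast
  have "m \<in> cube m R" using R by (simp add: cube_def)
  then have "ennreal (norm (f x - f m) ^ CARD('n)) \<le> ennreal I"
    using rr sub R x unfolding rr_bound_def I(1)[symmetric] by blast
  then have "norm (f x - f m) ^ CARD('n) \<le> I" using I(2) by simp
  then have "root CARD('n) (norm (f x - f m) ^ CARD('n)) \<le> root CARD('n) I" by simp
  then have "norm (f x - f m) \<le> root CARD('n) I" by (simp add: real_root_power_cancel)
  then show "w \<in> cube (f m) (root CARD('n) I)"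
    unfolding cube_def x(2) using component_le_norm_cart[of "f x - f m"] by (auto intro: order_trans)
qed

text \<open>A null set carries no \<Theta>-mass, hence has an open neighbourhood of small mass.
  Non-overlapping cubes inside this neighbourhood cover the set, and each has its image in a cube of
  volume 2^N times its mass.\<close>

lemma rr_bound_negligible_image:
  fixes f :: "real^'n \<Rightarrow> real^'n"
  assumes rr: "rr_bound \<Omega> \<Theta> f" and op: "open \<Omega>" and bd: "bounded \<Omega>" and Z: "negligible Z" "Z \<subseteq> \<Omega>"
  shows "negligible (f ` Z)"
  unfolding negligible_outer_le
proof (intro allI impI)
  fix e :: real assume e: "0 < e"
  define n where "n = CARD('n)"
  define e' where "e' = e / 2 ^ n"
  have e': "e' > 0" using e by (simp add: e'_def)
  have \<Theta> [measurable]: "\<Theta> \<in> borel_measurable borel" and fin: "(\<integral>\<^sup>+x. \<Theta> x * indicator \<Omega> x \<partial>lborel) < \<infinity>"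
    using rr by (auto simp: rr_bound_def)
  have [measurable]: "\<Omega> \<in> sets borel" using op by simp
  define M where "M = density lborel (\<lambda>y. \<Theta> y * indicator \<Omega> y)"
  have M: "emeasure M A = (\<integral>\<^sup>+y. \<Theta> y * indicator \<Omega> y * indicator A y \<partial>lborel)" if "A \<in> sets borel" for A
    unfolding M_def using that by (subst emeasure_density) auto
  have sM: "sets M = sets borel" "space M = UNIV" by (auto simp: M_def)
  have Mfin: "emeasure M (space M) \<noteq> \<infinity>" using fin M[of UNIV] by (simp add: sM)
  interpret M: finite_measure M by standard (use Mfin in simp)
  have Mnull: "emeasure M A = 0" if "A \<in> null_sets lborel" for A
    using absolutely_continuousI_density[of "\<lambda>y. \<Theta> y * indicator \<Omega> y" lborel] that
    unfolding M_def absolutely_continuous_def by (auto simp: null_sets_def)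
  obtain Z' where Z': "Z' \<in> null_sets lborel" "Z \<subseteq> Z'"
    using Z(1) unfolding negligible_iff_null_sets null_sets_completion_iff2 by blast
  have "emeasure M Z' = (INF S\<in>{S. Z' \<subseteq> S \<and> open S}. emeasure M S)"
    by (rule outer_regular) (use Mfin Z' in \<open>auto simp: sM\<close>)
  then have "(INF S\<in>{S. Z' \<subseteq> S \<and> open S}. emeasure M S) < ennreal e'" using Mnull[OF Z'(1)] e' by simp
  then obtain S where S: "Z' \<subseteq> S" "open S" "emeasure M S < ennreal e'" by (auto simp: INF_less_iff)
  define W where "W = S \<inter> \<Omega>"
  have W: "open W" "Z \<subseteq> W" "W \<subseteq> \<Omega>" using S op Z Z' by (auto simp: W_def)
  have MW: "measure M W \<le> e'"
  proof -
    have "emeasure M W \<le> emeasure M S" unfolding W_def using S by (intro emeasure_mono) (auto simp: sM)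
    then have "ennreal (measure M W) \<le> ennreal e'" using S(3) by (simp add: M.emeasure_eq_measure[symmetric])
    then show ?thesis using e' by simp
  qed
  obtain b where b: "b > 0" "\<And>x. x \<in> \<Omega> \<Longrightarrow> norm x \<le> b" using bd by (auto simp: bounded_pos)
  define a1 where "a1 = (0::real^'n) - (\<chi> i. b)"
  define b1 where "b1 = (0::real^'n) + (\<chi> i. b)"
  have Zbox: "Z \<subseteq> cbox a1 b1"
  proof
    fix z assume "z \<in> Z"
    then have "\<bar>z $ i\<bar> \<le> b" for i using b(2)[of z] Z(2) component_le_norm_cart[of z i] by auto
    then have "z \<in> cube 0 b" by (simp add: cube_def)
    then show "z \<in> cbox a1 b1" by (simp only: cube_eq_cbox a1_def b1_def)
  qed
  have box: "box a1 b1 \<noteq> {}" using b(1) by (auto simp: interval_ne_empty_cart a1_def b1_def)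
  \<comment> \<open>The gauge forces every piece of the decomposition, which meets Z by
    construction, to lie inside \<open>W\<close>.\<close>
  have gau: "gauge (\<lambda>x. if x \<in> W then W else UNIV)" using W(1) by (auto simp: gauge_def)
  obtain \<D> where cD: "countable \<D>"
    and D1: "\<And>K. K \<in> \<D> \<Longrightarrow> interior K \<noteq> {} \<and> (\<exists>c d. K = cbox c d)"
    and D2: "pairwise (\<lambda>A B. interior A \<inter> interior B = {}) \<D>"
    and D3: "\<And>K. K \<in> \<D> \<Longrightarrow> \<exists>x \<in> Z \<inter> K. K \<subseteq> (if x \<in> W then W else UNIV)"
    and D4: "\<And>u v. cbox u v \<in> \<D> \<Longrightarrow> \<exists>n. \<forall>i \<in> Basis. v \<bullet> i - u \<bullet> i = (b1 \<bullet> i - a1 \<bullet> i) / 2^n"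
    and D5: "Z \<subseteq> \<Union>\<D>"
    using covering_lemma[OF Zbox box gau] by metis
  have KW: "K \<subseteq> W" if "K \<in> \<D>" for K using D3[OF that] W(2) by (auto split: if_splits)
  \<comment> \<open>The pieces arise by repeated halving of a box that is itself a cube, so they are
    cubes.\<close>
  have Kcube: "\<exists>m R. 0 < R \<and> K = cube m R" if K: "K \<in> \<D>" for K
  proof -
    obtain c d where cd: "K = cbox c d" using D1[OF K] by blast
    obtain k where k: "\<forall>i \<in> Basis. d \<bullet> i - c \<bullet> i = (b1 \<bullet> i - a1 \<bullet> i) / 2^k" using D4 K cd by blast
    have dc: "d $ i - c $ i = 2 * b / 2 ^ k" for i
      using k[rule_format, of "axis i 1"] by (simp add: a1_def b1_def inner_axis)
    define R where "R = b / 2 ^ k"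
    have "d = (c + (\<chi> i. R)) + (\<chi> i. R)" "c = (c + (\<chi> i. R)) - (\<chi> i. R)"
      using dc by (auto simp: vec_eq_iff R_def algebra_simps)
    then have "K = cube (c + (\<chi> i. R)) R" unfolding cd cube_eq_cbox by metis
    then show ?thesis using b(1) by (intro exI[of _ "c + (\<chi> i. R)"] exI[of _ R]) (auto simp: R_def)
  qed
  then obtain m R where mR: "\<And>K. K \<in> \<D> \<Longrightarrow> 0 < R K \<and> K = cube (m K) (R K)" by metis
  define I where "I K = measure M K" for K
  define X where "X K = cube (f (m K)) (root n (I K))" for K
  have I: "(\<integral>\<^sup>+y. \<Theta> y * indicator (cube (m K) (R K)) y \<partial>lborel) = ennreal (I K)" if K: "K \<in> \<D>" for K
  proof -
    have KK: "K = cube (m K) (R K)" using mR[OF K] by blast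
    have "emeasure M K = (\<integral>\<^sup>+y. \<Theta> y * indicator K y \<partial>lborel)"
    proof -
      have "K \<subseteq> \<Omega>" using KW[OF K] W(3) by blast
      then have "\<Theta> y * indicator \<Omega> y * indicator K y = \<Theta> y * indicator K y" for y
        by (auto simp: indicator_def)
      moreover have "K \<in> sets borel" by (subst KK) (rule borel_cube)
      ultimately show ?thesis by (simp add: M)
    qed
    then show ?thesis using KK by (simp add: I_def M.emeasure_eq_measure)
  qed
  have img: "f ` K \<subseteq> X K" if K: "K \<in> \<D>" for K
  proof -
    have KK: "K = cube (m K) (R K)" "0 < R K" using mR[OF K] by auto
    have "cube (m K) (R K) \<subseteq> \<Omega>" using KW[OF K] W(3) KK(1) by auto
    from rr_bound_image_cube[OF rr this KK(2) I[OF K]] KK(1) show ?thesis by (simp add: X_def n_def I_def)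
  qed
  have Xm: "X K \<in> lmeasurable" "measure lebesgue (X K) = 2 ^ n * I K" for K
  proof -
    show "X K \<in> lmeasurable" unfolding X_def by (rule lmeasurable_cube)
    have "0 \<le> I K" by (simp add: I_def)
    then show "measure lebesgue (X K) = 2 ^ n * I K"
      unfolding X_def by (subst measure_cube) (auto simp: n_def power_mult_distrib)
  qed
  have fin_le: "measure lebesgue (\<Union>K\<in>D'. X K) \<le> e" if D': "D' \<subseteq> \<D>" "finite D'" for D'
  proof -
    have "measure lebesgue (\<Union>K\<in>D'. X K) \<le> (\<Sum>K\<in>D'. measure lebesgue (X K))"
      by (rule measure_UNION_le) (use D' Xm fmeasurableD in auto)
    also have "\<dots> = 2 ^ n * (\<Sum>K\<in>D'. I K)" by (simp add: Xm sum_distrib_left)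
    \<comment> \<open>The cubes are disjoint only in their interiors; the boundaries carry no mass
      because \<open>M\<close> has a density.\<close>
    also have "(\<Sum>K\<in>D'. I K) = (\<Sum>K\<in>D'. measure M (interior K))"
    proof (rule sum.cong[OF refl])
      fix K assume "K \<in> D'"
      then obtain c d where cd: "K = cbox c d" using D1 D' by blast
      have "K - interior K \<in> null_sets lborel"
      proof -
        have "negligible (cbox c d - box c d)" using negligible_frontier_interval by blast
        then show ?thesis unfolding cd interior_cbox
          by (auto simp: negligible_iff_null_sets null_sets_def emeasure_completion)
      qed
      then have "emeasure M (K - interior K) = 0" by (rule Mnull)
      then have "measure M (K - interior K) = 0" by (simp add: measure_def)
      moreover have "measure M (K - interior K) = measure M K - measure M (interior K)"
        by (rule M.finite_measure_Diff) (auto simp: sM cd intro: box_subset_cbox[THEN subsetD])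
      ultimately show "I K = measure M (interior K)" by (simp add: I_def)
    qed
    also have "\<dots> = measure M (\<Union>K\<in>D'. interior K)"
      by (rule M.finite_measure_finite_Union[symmetric])
        (use D' D2 in \<open>auto simp: sM disjoint_family_on_def pairwise_def subset_iff\<close>)
    also have "\<dots> \<le> measure M W"
    proof (rule M.finite_measure_mono)
      show "(\<Union>K\<in>D'. interior K) \<subseteq> W" using D' KW interior_subset by blast
    qed (use W in \<open>simp add: sM\<close>)
    finally have "measure lebesgue (\<Union>K\<in>D'. X K) \<le> 2 ^ n * measure M W" by simp
    also have "\<dots> \<le> 2 ^ n * e'" using MW by simp
    also have "\<dots> = e" by (simp add: e'_def)
    finally show ?thesis .
  qed
  have "f ` Z \<subseteq> (\<Union>K\<in>\<D>. X K)" using D5 img by blast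
  moreover have "(\<Union>K\<in>\<D>. X K) \<in> lmeasurable"
    by (rule fmeasurable_UN_bound[OF cD Xm(1) fin_le])
  moreover have "measure lebesgue (\<Union>K\<in>\<D>. X K) \<le> e"
    by (rule measure_UN_bound[OF cD Xm(1) fin_le])
  ultimately show "\<exists>T. f ` Z \<subseteq> T \<and> T \<in> lmeasurable \<and> measure lebesgue T \<le> e" by blast
qed

text \<open>The Vitali balls are disjoint and what they miss is null, hence has a null image by
  Lusin's property; no multiplicity constant is lost, so a sharp local factor c stays sharp
  globally. The images are only required to lie in measurable sets, one for each ball.\<close>

lemma measure_image_le_Vitali:
  fixes f :: "real^'n \<Rightarrow> real^'n"
  assumes lusin: "\<And>Z. negligible Z \<Longrightarrow> Z \<subseteq> W \<Longrightarrow> negligible (f ` Z)"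
    and W: "open W" "W \<in> lmeasurable" "S \<subseteq> W" and c: "0 \<le> c"
    and small: "\<And>x. x \<in> S \<Longrightarrow> \<exists>d>0. \<forall>r. 0 < r \<longrightarrow> r < d \<longrightarrow>
      (\<exists>X\<in>lmeasurable. f ` ball x r \<subseteq> X \<and> measure lebesgue X \<le> c * measure lebesgue (ball x r))"
  obtains T where "T \<in> lmeasurable" "f ` S \<subseteq> T" "measure lebesgue T \<le> c * measure lebesgue W"
proof -
  define K where "K = {(x, r). 0 < r \<and> ball x r \<subseteq> W \<and>
     (\<exists>X\<in>lmeasurable. f ` ball x r \<subseteq> X \<and> measure lebesgue X \<le> c * measure lebesgue (ball x r))}"
  have "\<exists>i. i \<in> K \<and> x \<in> ball (fst i) (snd i) \<and> snd i < d" if x: "x \<in> S" and d: "d > 0" for x d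
  proof -
    obtain d1 where d1: "d1 > 0" "\<And>r. 0 < r \<Longrightarrow> r < d1 \<Longrightarrow>
      (\<exists>X\<in>lmeasurable. f ` ball x r \<subseteq> X \<and> measure lebesgue X \<le> c * measure lebesgue (ball x r))"
      using small[OF x] by blast
    obtain d2 where d2: "d2 > 0" "ball x d2 \<subseteq> W" using W x by (meson open_contains_ball subsetD)
    define r where "r = min d (min d1 d2) / 2"
    have r: "0 < r" "r < d" "r < d1" "r \<le> d2" using d d1(1) d2(1) by (auto simp: r_def min_def)
    have "ball x r \<subseteq> W" using subset_ball[OF r(4), of x] d2(2) by auto
    then have "(x, r) \<in> K" using r d1(2)[OF r(1) r(3)] by (simp add: K_def)
    then show ?thesis using r by (intro exI[of _ "(x, r)"]) auto
  qed
  then obtain C where C: "countable C" "C \<subseteq> K"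
    "pairwise (\<lambda>i j. disjnt (ball (fst i) (snd i)) (ball (fst j) (snd j))) C"
    "negligible (S - (\<Union>i\<in>C. ball (fst i) (snd i)))"
    using Vitali_covering_theorem_balls[of S K fst snd] by blast
  define B where "B i = ball (fst i) (snd i)" for i :: "(real^'n) \<times> real"
  have "\<forall>i\<in>C. \<exists>X\<in>lmeasurable. f ` B i \<subseteq> X \<and> measure lebesgue X \<le> c * measure lebesgue (B i)"
    using C(2) by (auto simp: K_def B_def)
  then obtain X where X: "\<And>i. i \<in> C \<Longrightarrow> X i \<in> lmeasurable" "\<And>i. i \<in> C \<Longrightarrow> f ` B i \<subseteq> X i"
    "\<And>i. i \<in> C \<Longrightarrow> measure lebesgue (X i) \<le> c * measure lebesgue (B i)" by metis
  have fin_le: "measure lebesgue (\<Union>i\<in>I. X i) \<le> c * measure lebesgue W" if I: "I \<subseteq> C" "finite I" for I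
  proof -
    have "measure lebesgue (\<Union>i\<in>I. X i) \<le> (\<Sum>i\<in>I. measure lebesgue (X i))"
      by (rule measure_UNION_le) (use I X(1) fmeasurableD in auto)
    also have "\<dots> \<le> (\<Sum>i\<in>I. c * measure lebesgue (B i))" using I X(3) by (intro sum_mono) auto
    also have "\<dots> = c * (\<Sum>i\<in>I. measure lebesgue (B i))" by (simp add: sum_distrib_left)
    also have "(\<Sum>i\<in>I. measure lebesgue (B i)) = measure lebesgue (\<Union>i\<in>I. B i)"
    proof (rule measure_UNION'[symmetric])
      show "pairwise (\<lambda>i j. disjnt (B i) (B j)) I" using pairwise_subset[OF C(3) I(1)] by (simp add: B_def)
    qed (use I in \<open>auto simp: B_def\<close>)
    also have "\<dots> \<le> measure lebesgue W"
    proof (rule measure_mono_fmeasurable)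
      show "(\<Union>i\<in>I. B i) \<subseteq> W" using I C(2) by (fastforce simp: K_def B_def)
      show "(\<Union>i\<in>I. B i) \<in> sets lebesgue" using I by (intro sets.finite_UN) (auto simp: B_def)
    qed (use W in auto)
    finally show ?thesis using c by (simp add: mult_left_mono)
  qed
  define Z where "Z = S - (\<Union>i\<in>C. B i)"
  have Z: "negligible (f ` Z)" using C(4) W(3) by (intro lusin) (auto simp: Z_def B_def)
  have T: "(\<Union>i\<in>C. X i) \<in> lmeasurable" "measure lebesgue (\<Union>i\<in>C. X i) \<le> c * measure lebesgue W"
    by (rule fmeasurable_UN_bound[OF C(1) X(1) fin_le] measure_UN_bound[OF C(1) X(1) fin_le]; simp)+
  show thesis
  proof (rule that[of "(\<Union>i\<in>C. X i) \<union> f ` Z"])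
    have Zl: "f ` Z \<in> lmeasurable" using Z by (rule negligible_imp_measurable)
    show "(\<Union>i\<in>C. X i) \<union> f ` Z \<in> lmeasurable" by (rule fmeasurable.Un[OF T(1) Zl])
    show "f ` S \<subseteq> (\<Union>i\<in>C. X i) \<union> f ` Z" using X(2) by (fastforce simp: Z_def)
    have "measure lebesgue ((\<Union>i\<in>C. X i) \<union> f ` Z) \<le> measure lebesgue (\<Union>i\<in>C. X i) + measure lebesgue (f ` Z)"
      by (rule measure_Un_le) (use T Zl fmeasurableD in auto)
    then show "measure lebesgue ((\<Union>i\<in>C. X i) \<union> f ` Z) \<le> c * measure lebesgue W"
      using T(2) negligible_imp_measure0[OF Z] by simp
  qed
qed

text \<open>In place of a rotation: some coordinate of the unit normal is at least 1/n in absolute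
  value, so translates of the slab along that axis are disjoint once the step exceeds a multiple of
  its thickness. About L / s of them fit into a larger cube.\<close>

lemma measure_slab_le:
  fixes a :: "real^'n"
  assumes a: "norm a = 1" and \<epsilon>: "0 < \<epsilon>" "\<epsilon> \<le> L"
  shows "measure lebesgue {v \<in> cube p L. \<bar>a \<bullet> (v - p)\<bar> \<le> \<epsilon>}
    \<le> (2 * (2 + 3 * real CARD('n)) * L) ^ CARD('n) * (3 * real CARD('n)) * \<epsilon> / L"
proof -
  define n where "n = real CARD('n)"
  have n: "n \<ge> 1" unfolding n_def using zero_less_card_finite[where 'a = 'n] by linarith
  have L: "L > 0" using \<epsilon> by simp
  define S where "S = {v \<in> cube p L. \<bar>a \<bullet> (v - p)\<bar> \<le> \<epsilon>}"
  have Scl: "compact S"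
  proof -
    have "S = cube p L \<inter> {v. \<bar>a \<bullet> (v - p)\<bar> \<le> \<epsilon>}" by (auto simp: S_def)
    moreover have "closed {v. \<bar>a \<bullet> (v - p)\<bar> \<le> \<epsilon>}" by (intro closed_Collect_le continuous_intros)
    ultimately show ?thesis by (simp only: compact_Int_closed compact_cube)
  qed
  obtain k where k: "\<bar>a $ k\<bar> \<ge> 1 / n"
  proof (rule ccontr)
    assume "\<not> thesis"
    then have "\<bar>a $ k\<bar> < 1 / n" for k using that by (meson not_le)
    then have "(\<Sum>k\<in>UNIV. \<bar>a $ k\<bar>) < (\<Sum>k\<in>(UNIV::'n set). 1 / n)" by (intro sum_strict_mono) auto
    also have "\<dots> = 1" using n by (simp add: n_def)
    finally show False using norm_le_l1_cart[of a] a by simp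
  qed
  \<comment> \<open>A step s changes the inner product with the normal by at least s / n = 3
    \<epsilon>, while two points of the slab differ there by at most 2 \<epsilon>.\<close>
  define s where "s = 3 * \<epsilon> * n"
  have s: "s > 0" using \<epsilon> n by (simp add: s_def)
  \<comment> \<open>With the added 1 there are at least L / s translates, and yet the largest shift
    (J - 1) s is at most L.\<close>
  define J where "J = nat \<lfloor>L / s\<rfloor> + 1"
  have J: "L / s \<le> real J" "real J \<le> L / s + 1"
  proof -
    have "0 \<le> L / s" using L s by simp
    then show "L / s \<le> real J" "real J \<le> L / s + 1" unfolding J_def by linarith+
  qed
  define T where "T j = (+) ((real j * s) *\<^sub>R axis k 1) ` S" for j :: nat
  have T_lm: "T j \<in> lmeasurable" "measure lebesgue (T j) = measure lebesgue S" for j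
    unfolding T_def using Scl by (auto intro: lmeasurable_compact compact_translation measure_translation)
  have disj: "disjnt (T i) (T j)" if ij: "i \<noteq> j" for i j
    unfolding disjnt_iff
  proof (intro allI notI, elim conjE)
    fix x assume "x \<in> T i" "x \<in> T j"
    then obtain v w where v: "v \<in> S" "x = (real i * s) *\<^sub>R axis k 1 + v" and w: "w \<in> S" "x = (real j * s) *\<^sub>R axis k 1 + w"
      by (auto simp: T_def)
    have "v - w = ((real j - real i) * s) *\<^sub>R axis k 1" using v(2) w(2) by (simp add: algebra_simps)
    then have "a \<bullet> (v - w) = (real j - real i) * s * a $ k" by (simp add: inner_axis)
    moreover have "\<bar>real j - real i\<bar> \<ge> 1" using ij by linarith
    then have "1 * (s * (1 / n)) \<le> \<bar>real j - real i\<bar> * (s * \<bar>a $ k\<bar>)" using k s n by (intro mult_mono) auto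
    ultimately have "\<bar>a \<bullet> (v - w)\<bar> \<ge> 3 * \<epsilon>" using s n \<epsilon> by (simp add: abs_mult s_def)
    moreover have "\<bar>a \<bullet> (v - w)\<bar> \<le> \<bar>a \<bullet> (v - p)\<bar> + \<bar>a \<bullet> (w - p)\<bar>" by (simp add: inner_diff_right)
    ultimately show False using v(1) w(1) \<epsilon> by (simp add: S_def)
  qed
  have sub: "T j \<subseteq> cube p ((2 + 3 * n) * L)" if j: "j < J" for j
  proof
    fix x assume "x \<in> T j"
    then obtain v where v: "v \<in> S" "x = (real j * s) *\<^sub>R axis k 1 + v" by (auto simp: T_def)
    have js: "real j * s \<le> L"
    proof -
      have "real j \<le> L / s" using j J(2) by linarith
      then show ?thesis using s by (simp add: pos_le_divide_eq)
    qed
    have "\<bar>x $ i - p $ i\<bar> \<le> (2 + 3 * n) * L" for i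
    proof -
      have "x $ i - p $ i = (if i = k then real j * s else 0) + (v $ i - p $ i)"
        using v(2) by (simp add: axis_def)
      then have "\<bar>x $ i - p $ i\<bar> \<le> \<bar>if i = k then real j * s else 0\<bar> + \<bar>v $ i - p $ i\<bar>"
        by (simp only: abs_triangle_ineq)
      also have "\<bar>if i = k then real j * s else 0\<bar> \<le> \<bar>real j * s\<bar>" by simp
      finally have "\<bar>x $ i - p $ i\<bar> \<le> \<bar>real j * s\<bar> + \<bar>v $ i - p $ i\<bar>" by simp
      also have "\<dots> \<le> L + L" using js v(1) s by (intro add_mono) (auto simp: S_def cube_def)
      also have "\<dots> \<le> (2 + 3 * n) * L" using n L by (simp add: algebra_simps)
      finally show ?thesis .
    qed
    then show "x \<in> cube p ((2 + 3 * n) * L)" by (simp add: cube_def)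
  qed
  have "real J * measure lebesgue S = (\<Sum>j<J. measure lebesgue (T j))" by (simp add: T_lm)
  also have "\<dots> = measure lebesgue (\<Union>j<J. T j)"
    by (rule measure_UNION'[symmetric]) (use T_lm disj in \<open>auto simp: pairwise_def\<close>)
  also have "\<dots> \<le> measure lebesgue (cube p ((2 + 3 * n) * L))"
    by (rule measure_mono_fmeasurable) (use sub T_lm(1) lmeasurable_cube in \<open>auto intro!: sets.finite_UN\<close>)
  also have "\<dots> = (2 * (2 + 3 * n) * L) ^ CARD('n)" 
  proof -
    have "0 \<le> (2 + 3 * n) * L" using n L by simp
    from measure_cube[OF this, of p] show ?thesis by (simp only: mult.assoc)
  qed
  finally have 1: "real J * measure lebesgue S \<le> (2 * (2 + 3 * n) * L) ^ CARD('n)" .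
  have "L / s * measure lebesgue S \<le> real J * measure lebesgue S" using J by (intro mult_right_mono) auto
  then have "L / s * measure lebesgue S \<le> (2 * (2 + 3 * n) * L) ^ CARD('n)" using 1 by simp
  then have "measure lebesgue S \<le> (2 * (2 + 3 * n) * L) ^ CARD('n) * s / L" using L s by (simp add: field_simps)
  then show ?thesis by (simp add: S_def n_def s_def mult_ac)
qed

text \<open>A kernel vector of the transpose is orthogonal to the range.\<close>

lemma det_zero_normal:
  fixes A :: "real^'n^'n"
  assumes "det A = 0" obtains a where "norm a = 1" "\<And>v. a \<bullet> (A *v v) = 0"
proof -
  have "\<not> invertible (transpose A)" using assms by (simp add: invertible_det_nz det_transpose)
  then obtain b where b: "transpose A *v b = 0" "b \<noteq> 0"
    unfolding invertible_left_inverse matrix_left_invertible_ker by blast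
  define a where "a = b /\<^sub>R norm b"
  have "b \<bullet> (A *v v) = 0" for v
    using b(1) dot_lmul_matrix[of b A v] by (simp add: transpose_matrix_vector)
  then have "a \<bullet> (A *v v) = 0" for v by (simp add: a_def)
  moreover have "norm a = 1" using b(2) by (simp add: a_def)
  ultimately show ?thesis using that by blast
qed

text \<open>Where the derivative is singular, the image of a small ball lies in a thin slab.\<close>

lemma negligible_image_det_zero:
  fixes f :: "real^'n \<Rightarrow> real^'n"
  assumes lusin: "\<And>Z. negligible Z \<Longrightarrow> Z \<subseteq> W \<Longrightarrow> negligible (f ` Z)"
    and W: "open W" "W \<in> lmeasurable" "S \<subseteq> W"
    and der: "\<And>x. x \<in> S \<Longrightarrow> (f has_derivative f' x) (at x)" and det0: "\<And>x. x \<in> S \<Longrightarrow> det (matrix (f' x)) = 0"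
  shows "negligible (f ` S)"
  unfolding negligible_outer_le
proof (intro allI impI)
  fix e :: real assume e: "0 < e"
  \<comment> \<open>The added 1 covers the case in which \<open>W\<close> has measure 0.\<close>
  define c where "c = e / (measure lebesgue W + 1)"
  have cpos: "c > 0" and cW: "c * measure lebesgue W \<le> e"
  proof -
    have m: "measure lebesgue W + 1 > 0" using measure_nonneg[of lebesgue W] by linarith
    then show "c > 0" using e by (simp add: c_def)
    have "c * measure lebesgue W \<le> c * (measure lebesgue W + 1)" using \<open>c > 0\<close> by simp
    also have "\<dots> = e" using m by (simp add: c_def)
    finally show "c * measure lebesgue W \<le> e" .
  qed
  define n where "n = CARD('n)"
  define \<omega> where "\<omega> = measure lebesgue (ball (0::real^'n) 1)"
  have \<omega>: "\<omega> > 0" unfolding \<omega>_def using content_ball_pos[of 1 "0::real^'n"] by simp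
  have ball: "measure lebesgue (ball (x::real^'n) r) = r ^ n * \<omega>" if "0 < r" for x r
    using that content_ball[of r x] content_ball[of 1 "0::real^'n"] by (simp add: \<omega>_def n_def)
  obtain T where T: "T \<in> lmeasurable" "f ` S \<subseteq> T" "measure lebesgue T \<le> c * measure lebesgue W"
  proof (rule measure_image_le_Vitali[OF lusin W less_imp_le[OF cpos]])
    fix x assume x: "x \<in> S"
    define A where "A = matrix (f' x)"
    have lin: "linear (f' x)" using der[OF x] has_derivative_linear by blast
    have fA: "f' x v = A *v v" for v using lin by (simp add: A_def)
    obtain a where a: "norm a = 1" "\<And>v. a \<bullet> f' x v = 0"
      using det_zero_normal[of A] det0[OF x] unfolding A_def[symmetric] fA by metis
    define L where "L = onorm (f' x) + 1"
    have bl: "bounded_linear (f' x)" using der[OF x] by (rule has_derivative_bounded_linear)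
    have L: "L \<ge> 1" using onorm_pos_le[OF bl] by (simp add: L_def)
    define Q where "Q = (2 * (2 + 3 * real CARD('n)) * L) ^ CARD('n) * (3 * real CARD('n)) / L"
    have Q: "Q > 0" using L by (simp add: Q_def add_pos_nonneg)
    \<comment> \<open>At scale r the slab has measure at most Q \<epsilon> r^n, while c \<omega> r^n
      is allowed; the cap 1 keeps the image within distance L r.\<close>
    define \<epsilon> where "\<epsilon> = min 1 (c * \<omega> / Q)"
    have \<epsilon>: "0 < \<epsilon>" "\<epsilon> \<le> 1" "Q * \<epsilon> \<le> c * \<omega>"
      using cpos \<omega> Q by (auto simp: \<epsilon>_def min_def field_simps)
    obtain d where d: "d > 0" "\<And>y. norm (y - x) < d \<Longrightarrow> norm (f y - f x - f' x (y - x)) \<le> \<epsilon> * norm (y - x)"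
      using der[OF x] \<epsilon>(1) unfolding has_derivative_at_alt by blast
    have "\<exists>X\<in>lmeasurable. f ` ball x r \<subseteq> X \<and> measure lebesgue X \<le> c * measure lebesgue (ball x r)"
      if r: "0 < r" "r < d" for r
    proof -
      define X where "X = {v \<in> cube (f x) (L * r). \<bar>a \<bullet> (v - f x)\<bar> \<le> \<epsilon> * r}"
      have "compact X"
      proof -
        have "X = cube (f x) (L * r) \<inter> {v. \<bar>a \<bullet> (v - f x)\<bar> \<le> \<epsilon> * r}" by (auto simp: X_def)
        moreover have "closed {v. \<bar>a \<bullet> (v - f x)\<bar> \<le> \<epsilon> * r}" by (intro closed_Collect_le continuous_intros)
        ultimately show ?thesis by (simp only: compact_Int_closed compact_cube)
      qed
      then have "X \<in> lmeasurable" by (rule lmeasurable_compact)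
      moreover have "f ` ball x r \<subseteq> X"
      proof
        fix w assume "w \<in> f ` ball x r"
        then obtain y where "y \<in> ball x r" and wy: "w = f y" by blast
        then have y: "norm (y - x) < r" "w = f y" by (auto simp: dist_norm norm_minus_commute)
        have 1: "norm (w - f x - f' x (y - x)) \<le> \<epsilon> * norm (y - x)" using d(2)[of y] y r by auto
        also have "\<dots> \<le> \<epsilon> * r" using y \<epsilon> by (intro mult_left_mono) auto
        finally have 2: "norm (w - f x - f' x (y - x)) \<le> \<epsilon> * r" .
        have "\<bar>a \<bullet> (w - f x)\<bar> = \<bar>a \<bullet> (w - f x - f' x (y - x))\<bar>" using a(2) by (simp add: inner_diff_right)
        also have "\<dots> \<le> norm a * norm (w - f x - f' x (y - x))" by (rule Cauchy_Schwarz_ineq2)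
        finally have 3: "\<bar>a \<bullet> (w - f x)\<bar> \<le> \<epsilon> * r" using 2 a(1) by simp
        have "norm (w - f x) \<le> norm (f' x (y - x)) + norm (w - f x - f' x (y - x))"
          by (metis norm_triangle_sub add.commute)
        also have "\<dots> \<le> onorm (f' x) * norm (y - x) + \<epsilon> * norm (y - x)"
          by (intro add_mono onorm[OF bl] 1)
        also have "\<dots> \<le> onorm (f' x) * r + 1 * r"
          using y \<epsilon> onorm_pos_le[OF bl] by (intro add_mono mult_mono) auto
        finally have "norm (w - f x) \<le> L * r" by (simp add: L_def algebra_simps)
        then have "w \<in> cube (f x) (L * r)"
          unfolding cube_def using component_le_norm_cart[of "w - f x"] by (auto intro: order_trans)
        then show "w \<in> X" using 3 by (simp add: X_def)
      qed
      moreover have "measure lebesgue X \<le> c * measure lebesgue (ball x r)"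
      proof -
        have "measure lebesgue X \<le> (2 * (2 + 3 * real CARD('n)) * (L * r)) ^ CARD('n) * (3 * real CARD('n)) * (\<epsilon> * r) / (L * r)"
          unfolding X_def using \<epsilon> L r a(1) by (intro measure_slab_le) (auto intro: mult_right_mono)
        also have "\<dots> = (Q * \<epsilon>) * r ^ n"
        proof -
          have e1: "(2 * (2 + 3 * real CARD('n)) * (L * r)) ^ CARD('n) = (2 * (2 + 3 * real CARD('n)) * L) ^ CARD('n) * r ^ n"
            by (simp only: power_mult_distrib mult.assoc n_def)
          have e2: "(P * r ^ n) * q * (\<epsilon> * r) / (L * r) = (P * q / L * \<epsilon>) * r ^ n" for P q :: real
            using r L by simp
          show ?thesis unfolding e1 Q_def by (rule e2)
        qed
        also have "\<dots> \<le> (c * \<omega>) * r ^ n" using \<epsilon>(3) r by (intro mult_right_mono) auto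
        finally show ?thesis using ball[OF r(1)] by (simp add: mult_ac)
      qed
      ultimately show ?thesis by blast
    qed
    then show "\<exists>d>0. \<forall>r. 0 < r \<longrightarrow> r < d \<longrightarrow>
      (\<exists>X\<in>lmeasurable. f ` ball x r \<subseteq> X \<and> measure lebesgue X \<le> c * measure lebesgue (ball x r))"
      using d(1) by blast
  qed
  moreover have "measure lebesgue T \<le> e" using T(3) cW by linarith
  ultimately show "\<exists>T. f ` S \<subseteq> T \<and> T \<in> lmeasurable \<and> measure lebesgue T \<le> e" by blast
qed

section \<open>Area inequality and multiplicity of fibres\<close>

lemma ennreal_le_of_one_plus:
  fixes E I :: ennreal and n :: nat
  assumes le: "\<And>\<eta>. 0 < \<eta> \<Longrightarrow> E \<le> ennreal ((1 + 2 * \<eta>) ^ n) * I + ennreal \<eta>"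
  shows "E \<le> I"
proof (cases "I = \<infinity>")
  case False
  then obtain i where i: "I = ennreal i" "0 \<le> i" by (cases I rule: ennreal_cases) auto
  have le': "E \<le> ennreal ((1 + 2 * \<eta>) ^ n * i + \<eta>)" if "0 < \<eta>" for \<eta>
    using le[OF that] that i by (simp add: ennreal_mult ennreal_plus)
  then have "E < \<infinity>" using le'[of 1] by (auto intro: order.strict_trans1)
  then obtain e where e: "E = ennreal e" "0 \<le> e" by (cases E rule: ennreal_cases) auto
  have "e \<le> (1 + 2 * 0) ^ n * i + 0"
  proof (rule tendsto_lowerbound)
    show "((\<lambda>\<eta>::real. (1 + 2 * \<eta>) ^ n * i + \<eta>) \<longlongrightarrow> (1 + 2 * 0) ^ n * i + 0) (at_right 0)"
      by (intro tendsto_intros)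
    have "\<forall>\<^sub>F \<eta> in at_right (0::real). 0 < \<eta>" by (simp add: eventually_at_right_less)
    then show "\<forall>\<^sub>F \<eta> in at_right 0. e \<le> (1 + 2 * \<eta>) ^ n * i + \<eta>"
    proof eventually_elim
      case (elim \<eta>)
      show ?case using le'[OF elim] elim i unfolding e(1) by (subst (asm) ennreal_le_iff) auto
    qed
  qed simp
  then show ?thesis using e i by (simp add: ennreal_leI)
qed simp

text \<open>Slicing \<open>S\<close> by the values of \<open>\<nu>\<close> reduces the claim to the Vitali estimate with a constant Lipschitz bound.\<close>

lemma emeasure_image_le:
  fixes f :: "real^'n \<Rightarrow> real^'n"
  assumes lusin: "\<And>Z. negligible Z \<Longrightarrow> Z \<subseteq> \<Omega> \<Longrightarrow> negligible (f ` Z)"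
    and \<Omega>: "open \<Omega>" "\<Omega> \<in> lmeasurable" and S: "S \<in> sets lebesgue" "S \<subseteq> \<Omega>"
    and \<nu> [measurable]: "\<nu> \<in> borel_measurable lebesgue" and \<nu>1: "\<And>x. x \<in> S \<Longrightarrow> 1 \<le> \<nu> x"
    and lip: "\<And>x e. x \<in> S \<Longrightarrow> 0 < e \<Longrightarrow> \<exists>d>0. \<forall>z. norm (z - x) < d \<longrightarrow> norm (f z - f x) \<le> (\<nu> x + e) * norm (z - x)"
  shows "emeasure lebesgue (f ` S) \<le> (\<integral>\<^sup>+x. ennreal (\<nu> x ^ CARD('n)) * indicator S x \<partial>lebesgue)"
proof (cases "f ` S \<in> sets lebesgue")
  case False
  \<comment> \<open>By convention a non-measurable set has \<open>emeasure\<close> 0.\<close>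
  then show ?thesis by (simp add: emeasure_notin_sets)
next
  case fS: True
  define n where "n = CARD('n)"
  define I where "I = (\<integral>\<^sup>+x. ennreal (\<nu> x ^ n) * indicator S x \<partial>lebesgue)"
  have [measurable]: "S \<in> sets lebesgue" by (rule S)
  have ball: "measure lebesgue (cball (y::real^'n) (c * r)) = c ^ n * measure lebesgue (ball (x::real^'n) r)"
    if "0 < r" "0 \<le> c" for x y c r
    using that content_cball[of "c * r" y] content_ball[of r x] by (simp add: n_def power_mult_distrib)
  have "emeasure lebesgue (f ` S) \<le> ennreal ((1 + 2 * \<eta>) ^ n) * I + ennreal \<eta>" if \<eta>: "0 < \<eta>" for \<eta>
  proof -
    define A where "A k = {x \<in> space lebesgue. real k * \<eta> \<le> \<nu> x \<and> \<nu> x < real (k + 1) * \<eta>} \<inter> S" for k :: nat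
    have A [measurable]: "A k \<in> sets lebesgue" for k unfolding A_def by measurable
    have AS: "A k \<subseteq> S" for k by (auto simp: A_def)
    have Adisj: "disjoint_family A"
    proof -
      have "A i \<inter> A j = {}" if "i < j" for i j
      proof -
        have "real (i + 1) * \<eta> \<le> real j * \<eta>" using that \<eta> by (intro mult_right_mono) auto
        then show ?thesis by (auto simp: A_def)
      qed
      then show ?thesis unfolding disjoint_family_on_def by (metis inf_commute neqE)
    qed
    have Aun: "(\<Union>k. A k) = S"
    proof
      show "S \<subseteq> (\<Union>k. A k)"
      proof
        fix x assume x: "x \<in> S"
        define k where "k = nat \<lfloor>\<nu> x / \<eta>\<rfloor>"
        have "0 \<le> \<nu> x / \<eta>" using \<nu>1[OF x] \<eta> by simp
        then have "real k \<le> \<nu> x / \<eta>" "\<nu> x / \<eta> < real k + 1" unfolding k_def by linarith+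
        then have "x \<in> A k" using x \<eta> by (simp add: A_def field_simps)
        then show "x \<in> (\<Union>k. A k)" by blast
      qed
    qed (use AS in auto)
    \<comment> \<open>On the slice \<nu> is below (k + 1) \<eta>, and the local Lipschitz bound has
      a slack of another \<eta>; hence k + 2.\<close>
    define c where "c k = (real (k + 2) * \<eta>) ^ n" for k :: nat
    have c: "c k > 0" for k using \<eta> by (simp add: c_def)
    have "\<exists>T. T \<in> lmeasurable \<and> f ` A k \<subseteq> T \<and>
        emeasure lebesgue T \<le> ennreal (c k) * emeasure lebesgue (A k) + ennreal (\<eta> * (1/2) ^ Suc k)" for k
    proof -
      \<comment> \<open>The factor c k is divided out in advance, so that the errors of all slices
        sum to \<eta>.\<close>
      define e where "e = \<eta> * (1/2) ^ Suc k / c k"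
      have e: "e > 0" using \<eta> c[of k] by (simp add: e_def)
      obtain Q where Q: "open Q" "A k \<subseteq> Q" "emeasure lebesgue (Q - A k) < ennreal e"
        using sets_lebesgue_outer_open[OF A e] by metis
      define W where "W = Q \<inter> \<Omega>"
      have W: "open W" "A k \<subseteq> W" "W \<subseteq> \<Omega>" "W \<in> lmeasurable"
        using Q \<Omega> AS[of k] S(2) fmeasurable_Int_fmeasurable[OF \<Omega>(2), of Q]
        by (auto simp: W_def Int_commute)
      obtain T where T: "T \<in> lmeasurable" "f ` A k \<subseteq> T" "measure lebesgue T \<le> c k * measure lebesgue W"
      proof (rule measure_image_le_Vitali[where f = f and W = W and S = "A k" and c = "c k"])
        show "negligible (f ` Z)" if "negligible Z" "Z \<subseteq> W" for Z using lusin[OF that(1)] that(2) W(3) by blast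
        show "0 \<le> c k" using c[of k] by simp
        fix x assume x: "x \<in> A k"
        then have xS: "x \<in> S" using AS by blast
        obtain d where d: "d > 0" "\<And>z. norm (z - x) < d \<Longrightarrow> norm (f z - f x) \<le> (\<nu> x + \<eta>) * norm (z - x)"
          using lip[OF xS \<eta>] by blast
        have "f ` ball x r \<subseteq> cball (f x) (real (k + 2) * \<eta> * r)" if r: "0 < r" "r < d" for r
        proof
          fix w assume "w \<in> f ` ball x r"
          then obtain z where "z \<in> ball x r" and w: "w = f z" by blast
          then have z: "norm (z - x) < r" by (simp add: dist_norm norm_minus_commute)
          have "norm (f z - f x) \<le> (\<nu> x + \<eta>) * norm (z - x)" using d(2)[of z] z r by simp
          also have "\<dots> \<le> (real (k + 2) * \<eta>) * r"
            using x z \<eta> \<nu>1[OF xS] by (intro mult_mono) (auto simp: A_def algebra_simps)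
          finally show "w \<in> cball (f x) (real (k + 2) * \<eta> * r)" by (simp add: w dist_norm norm_minus_commute)
        qed
        then show "\<exists>d>0. \<forall>r. 0 < r \<longrightarrow> r < d \<longrightarrow>
            (\<exists>X\<in>lmeasurable. f ` ball x r \<subseteq> X \<and> measure lebesgue X \<le> c k * measure lebesgue (ball x r))"
          using d(1) \<eta> ball[of _ "real (k + 2) * \<eta>" "f x" x]
          by (intro exI[of _ d] conjI allI impI bexI[of _ "cball (f x) (real (k + 2) * \<eta> * r)" for r])
            (auto simp: c_def)
      qed (use W in auto)
      have WA: "emeasure lebesgue W \<le> emeasure lebesgue (A k) + ennreal e"
      proof -
        have "emeasure lebesgue W \<le> emeasure lebesgue (A k \<union> (Q - A k))"
          using Q by (intro emeasure_mono) (auto simp: W_def)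
        also have "\<dots> \<le> emeasure lebesgue (A k) + emeasure lebesgue (Q - A k)"
          using Q by (intro emeasure_subadditive) auto
        also have "\<dots> \<le> emeasure lebesgue (A k) + ennreal e" using Q(3) by (intro add_left_mono) auto
        finally show ?thesis .
      qed
      have "emeasure lebesgue T = ennreal (measure lebesgue T)" using T(1) by (rule emeasure_eq_measure2)
      also have "\<dots> \<le> ennreal (c k * measure lebesgue W)" using T(3) by (rule ennreal_leI)
      also have "\<dots> = ennreal (c k) * ennreal (measure lebesgue W)" by (rule ennreal_mult) (use c[of k] in auto)
      also have "ennreal (measure lebesgue W) = emeasure lebesgue W" using W(4) by (rule emeasure_eq_measure2[symmetric])
      also have "ennreal (c k) * emeasure lebesgue W \<le> ennreal (c k) * (emeasure lebesgue (A k) + ennreal e)"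
        by (intro mult_left_mono WA) auto
      also have "\<dots> = ennreal (c k) * emeasure lebesgue (A k) + ennreal (c k) * ennreal e" by (simp add: distrib_left)
      also have "ennreal (c k) * ennreal e = ennreal (c k * e)"
        by (rule ennreal_mult[symmetric]) (use c[of k] e in auto)
      also have "c k * e = \<eta> * (1/2) ^ Suc k" using c[of k] by (simp add: e_def)
      finally show ?thesis using T by blast
    qed
    then obtain T where T: "\<And>k. T k \<in> lmeasurable" "\<And>k. f ` A k \<subseteq> T k"
      "\<And>k. emeasure lebesgue (T k) \<le> ennreal (c k) * emeasure lebesgue (A k) + ennreal (\<eta> * (1/2) ^ Suc k)"
      by metis
    have Tl: "range T \<subseteq> sets lebesgue" using T(1) by auto
    have "f ` S \<subseteq> (\<Union>k. T k)" using T(2) Aun by blast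
    then have "emeasure lebesgue (f ` S) \<le> emeasure lebesgue (\<Union>k. T k)" by (rule emeasure_mono) (use Tl in auto)
    also have "\<dots> \<le> (\<Sum>k. emeasure lebesgue (T k))" by (rule emeasure_subadditive_countably[OF Tl])
    also have "\<dots> \<le> (\<Sum>k. ennreal ((1 + 2 * \<eta>) ^ n) * (\<integral>\<^sup>+x. ennreal (\<nu> x ^ n) * indicator (A k) x \<partial>lebesgue) + ennreal (\<eta> * (1/2) ^ Suc k))"
    proof (intro suminf_le order.trans[OF T(3)] add_right_mono)
      fix k
      have "ennreal (c k) * emeasure lebesgue (A k) = (\<integral>\<^sup>+x. ennreal (c k) * indicator (A k) x \<partial>lebesgue)"
        by (rule nn_integral_cmult_indicator[symmetric]) simp
      also have "\<dots> \<le> (\<integral>\<^sup>+x. ennreal ((1 + 2 * \<eta>) ^ n) * (ennreal (\<nu> x ^ n) * indicator (A k) x) \<partial>lebesgue)"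
      proof (rule nn_integral_mono)
        fix x
        \<comment> \<open>Here \<nu> \<ge> 1 turns the additive error 2 \<eta> into the
          multiplicative one 1 + 2 \<eta>.\<close>
        have "c k \<le> (1 + 2 * \<eta>) ^ n * \<nu> x ^ n" if x: "x \<in> A k"
        proof -
          have l: "1 \<le> \<nu> x" using x AS \<nu>1 by blast
          have "real (k + 2) * \<eta> \<le> \<nu> x + 2 * \<eta>" using x by (simp add: A_def algebra_simps)
          also have "\<dots> \<le> (1 + 2 * \<eta>) * \<nu> x" using mult_left_mono[OF l, of "2 * \<eta>"] \<eta> by (simp add: algebra_simps)
          finally have "c k \<le> ((1 + 2 * \<eta>) * \<nu> x) ^ n" unfolding c_def using \<eta> by (intro power_mono) auto
          then show ?thesis by (simp add: power_mult_distrib)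
        qed
        then show "ennreal (c k) * indicator (A k) x \<le> ennreal ((1 + 2 * \<eta>) ^ n) * (ennreal (\<nu> x ^ n) * indicator (A k) x)"
          using \<eta> by (cases "x \<in> A k") (auto simp: ennreal_mult'[symmetric] intro!: ennreal_leI)
      qed
      also have "\<dots> = ennreal ((1 + 2 * \<eta>) ^ n) * (\<integral>\<^sup>+x. ennreal (\<nu> x ^ n) * indicator (A k) x \<partial>lebesgue)"
        by (rule nn_integral_cmult) measurable
      finally show "ennreal (c k) * emeasure lebesgue (A k) \<le> ennreal ((1 + 2 * \<eta>) ^ n) * (\<integral>\<^sup>+x. ennreal (\<nu> x ^ n) * indicator (A k) x \<partial>lebesgue)" .
    qed auto
    also have "\<dots> = (\<Sum>k. ennreal ((1 + 2 * \<eta>) ^ n) * (\<integral>\<^sup>+x. ennreal (\<nu> x ^ n) * indicator (A k) x \<partial>lebesgue)) + (\<Sum>k. ennreal (\<eta> * (1/2) ^ Suc k))"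
      by (rule suminf_add[symmetric]) auto
    also have "(\<Sum>k. ennreal (\<eta> * (1/2) ^ Suc k)) = ennreal \<eta>"
    proof -
      have "(\<lambda>k. \<eta> * (1/2) ^ Suc k) sums (\<eta> * 1)" by (intro sums_mult power_half_series)
      then show ?thesis using \<eta> by (intro suminf_ennreal_eq) auto
    qed
    also have "(\<Sum>k. ennreal ((1 + 2 * \<eta>) ^ n) * (\<integral>\<^sup>+x. ennreal (\<nu> x ^ n) * indicator (A k) x \<partial>lebesgue)) = ennreal ((1 + 2 * \<eta>) ^ n) * I"
    proof -
      have "(\<Sum>k. (\<integral>\<^sup>+x. ennreal (\<nu> x ^ n) * indicator (A k) x \<partial>lebesgue)) = I"
      proof -
        define \<mu> where "\<mu> = density lebesgue (\<lambda>x. ennreal (\<nu> x ^ n))"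
        have \<mu>: "emeasure \<mu> B = (\<integral>\<^sup>+x. ennreal (\<nu> x ^ n) * indicator B x \<partial>lebesgue)" if "B \<in> sets lebesgue" for B
          unfolding \<mu>_def using that by (subst emeasure_density) auto
        have "(\<Sum>k. emeasure \<mu> (A k)) = emeasure \<mu> (\<Union>k. A k)"
          by (rule suminf_emeasure) (use Adisj in \<open>auto simp: \<mu>_def\<close>)
        then show ?thesis unfolding Aun by (simp add: \<mu> I_def)
      qed
      then show ?thesis by simp
    qed
    finally show ?thesis .
  qed
  then have "emeasure lebesgue (f ` S) \<le> I" by (rule ennreal_le_of_one_plus)
  then show ?thesis by (simp add: I_def n_def)
qed

section \<open>Counting the points of a fibre through grid cells\<close>

definition grid_index :: "nat \<Rightarrow> real^'n \<Rightarrow> 'n \<Rightarrow> int" where "grid_index k y = (\<lambda>i. \<lfloor>real (Suc k) * y $ i\<rfloor>)"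

lemma finite_grid_index: "finite (grid_index k ` cball 0 R)"
proof (rule finite_subset)
  show "grid_index k ` cball 0 R \<subseteq> PiE UNIV (\<lambda>_. {- \<lceil>real (Suc k) * R\<rceil> .. \<lceil>real (Suc k) * R\<rceil>})"
  proof
    fix z assume "z \<in> grid_index k ` cball 0 R"
    then obtain y where y: "norm y \<le> R" "z = grid_index k y" by auto
    have "z i \<in> {- \<lceil>real (Suc k) * R\<rceil> .. \<lceil>real (Suc k) * R\<rceil>}" for i
    proof -
      have "\<bar>y $ i\<bar> \<le> R" using component_le_norm_cart[of y i] y by linarith
      then have "\<bar>real (Suc k) * y $ i\<bar> \<le> real (Suc k) * R" unfolding abs_mult by (intro mult_mono) auto
      then have "real (Suc k) * y $ i \<le> real (Suc k) * R" "- (real (Suc k) * R) \<le> real (Suc k) * y $ i" by linarith+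
      then show ?thesis unfolding y(2) grid_index_def atLeastAtMost_iff by linarith
    qed
    then show "z \<in> PiE UNIV (\<lambda>_. {- \<lceil>real (Suc k) * R\<rceil> .. \<lceil>real (Suc k) * R\<rceil>})" by auto
  qed
qed (auto intro: finite_PiE)

lemma grid_index_separates: assumes "y \<noteq> z" shows "\<forall>\<^sub>F k in sequentially. grid_index k y \<noteq> grid_index k z"
proof -
  obtain i where i: "y $ i \<noteq> z $ i" using assms by (auto simp: vec_eq_iff)
  obtain K :: nat where K: "1 / \<bar>y $ i - z $ i\<bar> < real K" using reals_Archimedean2 by blast
  have "grid_index k y \<noteq> grid_index k z" if k: "k \<ge> K" for k
  proof
    assume "grid_index k y = grid_index k z"
    then have "\<lfloor>real (Suc k) * y $ i\<rfloor> = \<lfloor>real (Suc k) * z $ i\<rfloor>" by (auto simp: grid_index_def dest: fun_cong)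
    then have "\<bar>real (Suc k) * y $ i - real (Suc k) * z $ i\<bar> < 1" by linarith
    then have "real (Suc k) * \<bar>y $ i - z $ i\<bar> < 1" by (simp only: right_diff_distrib[symmetric] abs_mult abs_of_nat)
    moreover have "1 < real K * \<bar>y $ i - z $ i\<bar>" using K i by (simp add: field_simps)
    moreover have "real K * \<bar>y $ i - z $ i\<bar> \<le> real (Suc k) * \<bar>y $ i - z $ i\<bar>" using k by (intro mult_right_mono) auto
    ultimately show False by linarith
  qed
  then show ?thesis by (auto simp: eventually_sequentially)
qed

text \<open>What the area inequality uses: Lusin's property everywhere and, on a set
  \<open>D\<close> of full measure, a pointwise Lipschitz constant \<nu>. The derivative enters only
  through \<nu>, so the bound is in terms of \<nu>^N instead of a determinant.\<close>

locale area_map =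
  fixes f :: "real^'n \<Rightarrow> real^'n" and \<nu> :: "real^'n \<Rightarrow> real" and D :: "(real^'n) set"
  assumes cont: "continuous_on UNIV f" and lusin: "\<And>Z. negligible Z \<Longrightarrow> negligible (f ` Z)"
    and D: "negligible (- D)" and \<nu>_meas [measurable]: "\<nu> \<in> borel_measurable lebesgue" and \<nu>1: "\<And>x. 1 \<le> \<nu> x"
    and lip: "\<And>x e. x \<in> D \<Longrightarrow> 0 < e \<Longrightarrow> \<exists>d>0. \<forall>z. norm (z - x) < d \<longrightarrow> norm (f z - f x) \<le> (\<nu> x + e) * norm (z - x)"
begin

text \<open>A Lebesgue set is an F-sigma up to a null set; continuity takes care of the former and
  Lusin's property of the latter.\<close>

lemma image_sets:
  assumes X: "X \<in> sets lebesgue" "X \<subseteq> cball 0 R" shows "f ` X \<in> sets lebesgue"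
proof -
  have "f ` X \<in> sets (lebesgue_on (f ` cball 0 R))"
  proof (rule sets_lebesgue_on_continuous_image)
    show "X \<in> sets (lebesgue_on (cball 0 R))" using X by (simp add: sets_restrict_space_iff)
    show "continuous_on (cball 0 R) f" by (rule continuous_on_subset[OF cont]) simp
  qed (use lusin in auto)
  moreover have "f ` cball 0 R \<in> sets lebesgue"
    by (intro lmeasurable_compact[THEN fmeasurableD] compact_continuous_image continuous_on_subset[OF cont]) auto
  ultimately show ?thesis by (simp add: sets_restrict_space_iff)
qed

lemma emeasure_image:
  assumes X: "X \<in> sets lebesgue" "X \<subseteq> cball 0 R"
  shows "emeasure lebesgue (f ` X) \<le> (\<integral>\<^sup>+x. ennreal (\<nu> x ^ CARD('n)) * indicator X x \<partial>lebesgue)"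
proof -
  have "- D \<in> sets lebesgue" using D by (simp add: negligible_imp_sets)
  then have Ds: "D \<in> sets lebesgue" by (metis Compl_in_sets_lebesgue)
  have neg: "negligible (f ` (X - D))" by (intro lusin negligible_subset[OF D]) auto
  have sets: "f ` (X \<inter> D) \<in> sets lebesgue" using X Ds by (intro image_sets[where R = R]) auto
  have "emeasure lebesgue (f ` X) = emeasure lebesgue (f ` (X \<inter> D) \<union> f ` (X - D))"
    by (rule arg_cong[where f = "emeasure lebesgue"]) auto
  also have "\<dots> = emeasure lebesgue (f ` (X \<inter> D))"
    by (rule emeasure_Un_null_set) (use sets neg in \<open>auto simp: negligible_iff_null_sets\<close>)
  also have "\<dots> \<le> (\<integral>\<^sup>+x. ennreal (\<nu> x ^ CARD('n)) * indicator (X \<inter> D) x \<partial>lebesgue)"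
  proof (rule emeasure_image_le[where \<Omega> = "ball 0 (R + 1)"])
    show "X \<inter> D \<subseteq> ball 0 (R + 1)" using X(2) by auto
  qed (use lusin X Ds \<nu>1 lip in auto)
  also have "\<dots> \<le> (\<integral>\<^sup>+x. ennreal (\<nu> x ^ CARD('n)) * indicator X x \<partial>lebesgue)"
    by (intro nn_integral_mono) (auto simp: indicator_def)
  finally show ?thesis .
qed

definition count :: "real \<Rightarrow> real^'n \<Rightarrow> enat" where
  "count R x = (if finite (f -` {x} \<inter> cball 0 R) then enat (card (f -` {x} \<inter> cball 0 R)) else \<infinity>)"

definition I :: "real \<Rightarrow> ennreal" where
  "I R = (\<integral>\<^sup>+x. ennreal (\<nu> x ^ CARD('n)) * indicator (cball 0 R) x \<partial>lebesgue)"

text \<open>Points whose fibre meets at least n cells of the k-th grid, an approximation from below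
  of having n preimages. The grids of side 1 / (k+1) are not nested, so these sets need not increase
  with k; the multiplicity is recovered as a lower limit of sets.\<close>

definition A :: "nat \<Rightarrow> real \<Rightarrow> nat \<Rightarrow> (real^'n) set" where
  "A n R k = {x. n \<le> card (grid_index k ` (f -` {x} \<inter> cball 0 R))}"

definition Q :: "nat \<Rightarrow> real \<Rightarrow> ('n \<Rightarrow> int) \<Rightarrow> (real^'n) set" where
  "Q k R z = {y \<in> cball 0 R. grid_index k y = z}"

lemma Q_sets: "Q k R z \<in> sets lebesgue"
proof -
  have "Q k R z = cball 0 R \<inter> (\<Inter>i. {y. \<lfloor>real (Suc k) * y $ i\<rfloor> = z i})"
    by (auto simp: Q_def grid_index_def fun_eq_iff)
  moreover have "{y::real^'n. \<lfloor>real (Suc k) * y $ i\<rfloor> = z i} \<in> sets borel" for i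
  proof -
    have "{y::real^'n. \<lfloor>real (Suc k) * y $ i\<rfloor> = z i} = {y. of_int (z i) \<le> real (Suc k) * y $ i} \<inter> {y. real (Suc k) * y $ i < of_int (z i) + 1}"
      by (auto simp: floor_eq_iff)
    moreover have "closed {y::real^'n. of_int (z i) \<le> real (Suc k) * y $ i}" by (intro closed_Collect_le continuous_intros)
    moreover have "open {y::real^'n. real (Suc k) * y $ i < of_int (z i) + 1}" by (intro open_Collect_less continuous_intros)
    ultimately show ?thesis by auto
  qed
  ultimately have "Q k R z \<in> sets borel" by (auto intro!: sets.Int sets.countable_INT')
  then show ?thesis by simp
qed

lemma A_card: "card (grid_index k ` (f -` {x} \<inter> cball 0 R)) = (\<Sum>z\<in>grid_index k ` cball 0 R. indicator (f ` Q k R z) x)"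
proof -
  have "grid_index k ` (f -` {x} \<inter> cball 0 R) = {z \<in> grid_index k ` cball 0 R. x \<in> f ` Q k R z}"
  proof (intro set_eqI iffI)
    fix z assume "z \<in> grid_index k ` (f -` {x} \<inter> cball 0 R)"
    then obtain y where "f y = x" "y \<in> cball 0 R" "z = grid_index k y" by auto
    then have "y \<in> Q k R z" "z \<in> grid_index k ` cball 0 R" by (auto simp: Q_def)
    then show "z \<in> {z \<in> grid_index k ` cball 0 R. x \<in> f ` Q k R z}" using \<open>f y = x\<close> by blast
  next
    fix z assume "z \<in> {z \<in> grid_index k ` cball 0 R. x \<in> f ` Q k R z}"
    then obtain y where "y \<in> Q k R z" "f y = x" by auto
    then show "z \<in> grid_index k ` (f -` {x} \<inter> cball 0 R)" by (auto simp: Q_def)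
  qed
  then show ?thesis by (simp add: finite_grid_index indicator_def sum.If_cases Int_def flip: sum.inter_filter)
qed

lemma A_sets: "A n R k \<in> sets lebesgue"
proof -
  have [measurable]: "f ` Q k R z \<in> sets lebesgue" for z
    by (rule image_sets[OF Q_sets]) (auto simp: Q_def)
  have "A n R k = {x \<in> space lebesgue. real n \<le> (\<Sum>z\<in>grid_index k ` cball 0 R. indicator (f ` Q k R z) x)}"
  proof -
    have eq: "real (card (grid_index k ` (f -` {x} \<inter> cball 0 R))) = (\<Sum>z\<in>grid_index k ` cball 0 R. indicator (f ` Q k R z) x)" for x
      unfolding A_card by (simp add: indicator_def)
    show ?thesis unfolding A_def eq[symmetric] by simp
  qed
  also have "\<dots> \<in> sets lebesgue" by measurable
  finally show ?thesis .
qed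

text \<open>Chebyshev's inequality for the number of cells met by the fibre. This number is the sum
  of the indicators of the images of the cells, and the area inequality bounds the integral of each
  of them over its own cell.\<close>

lemma A_measure: "of_nat n * emeasure lebesgue (A n R k) \<le> I R"
proof -
  have fQ [measurable]: "f ` Q k R z \<in> sets lebesgue" for z
    by (rule image_sets[OF Q_sets]) (auto simp: Q_def)
  have "of_nat n * emeasure lebesgue (A n R k) = (\<integral>\<^sup>+x. of_nat n * indicator (A n R k) x \<partial>lebesgue)"
    by (rule nn_integral_cmult_indicator[symmetric]) (rule A_sets)
  also have "\<dots> \<le> (\<integral>\<^sup>+x. (\<Sum>z\<in>grid_index k ` cball 0 R. indicator (f ` Q k R z) x) \<partial>lebesgue)"
  proof (rule nn_integral_mono)
    fix x
    have "(of_nat n :: ennreal) \<le> of_nat (card (grid_index k ` (f -` {x} \<inter> cball 0 R)))" if "x \<in> A n R k"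
      using that by (simp add: A_def)
    moreover have "(of_nat (card (grid_index k ` (f -` {x} \<inter> cball 0 R))) :: ennreal) = (\<Sum>z\<in>grid_index k ` cball 0 R. indicator (f ` Q k R z) x)"
      unfolding A_card by (simp add: indicator_def)
    ultimately show "of_nat n * indicator (A n R k) x \<le> (\<Sum>z\<in>grid_index k ` cball 0 R. indicator (f ` Q k R z) x :: ennreal)"
      by (cases "x \<in> A n R k") auto
  qed
  also have "\<dots> = (\<Sum>z\<in>grid_index k ` cball 0 R. \<integral>\<^sup>+x. indicator (f ` Q k R z) x \<partial>lebesgue)"
    by (rule nn_integral_sum) measurable
  also have "\<dots> = (\<Sum>z\<in>grid_index k ` cball 0 R. emeasure lebesgue (f ` Q k R z))"
    by (intro sum.cong refl nn_integral_indicator fQ)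
  also have "\<dots> \<le> (\<Sum>z\<in>grid_index k ` cball 0 R. \<integral>\<^sup>+x. ennreal (\<nu> x ^ CARD('n)) * indicator (Q k R z) x \<partial>lebesgue)"
    by (intro sum_mono emeasure_image[OF Q_sets]) (auto simp: Q_def)
  also have "\<dots> = (\<integral>\<^sup>+x. (\<Sum>z\<in>grid_index k ` cball 0 R. ennreal (\<nu> x ^ CARD('n)) * indicator (Q k R z) x) \<partial>lebesgue)"
  proof (rule nn_integral_sum[symmetric])
    fix z
    have [measurable]: "Q k R z \<in> sets lebesgue" by (rule Q_sets)
    show "(\<lambda>x. ennreal (\<nu> x ^ CARD('n)) * indicator (Q k R z) x) \<in> borel_measurable lebesgue" by measurable
  qed
  also have "\<dots> \<le> I R"
    unfolding I_def
  proof (rule nn_integral_mono)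
    fix x
    show "(\<Sum>z\<in>grid_index k ` cball 0 R. ennreal (\<nu> x ^ CARD('n)) * indicator (Q k R z) x) \<le> ennreal (\<nu> x ^ CARD('n)) * indicator (cball 0 R) x"
    proof (cases "x \<in> cball 0 R")
      case True
      have "(\<Sum>z\<in>grid_index k ` cball 0 R. ennreal (\<nu> x ^ CARD('n)) * indicator (Q k R z) x)
          = (\<Sum>z\<in>grid_index k ` cball 0 R. if z = grid_index k x then ennreal (\<nu> x ^ CARD('n)) else 0)"
        using True by (intro sum.cong) (auto simp: Q_def indicator_def)
      also have "\<dots> = ennreal (\<nu> x ^ CARD('n))" using True by (simp add: finite_grid_index)
      finally show ?thesis using True by simp
    next
      case False
      then have "indicator (Q k R z) x = (0::ennreal)" for z by (auto simp: Q_def indicator_def)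
      then show ?thesis by simp
    qed
  qed
  finally show ?thesis .
qed

text \<open>Finitely many points of a fibre are separated by all sufficiently fine grids.\<close>

lemma count_ge_eq: "{x. enat n \<le> count R x} = (\<Union>K. \<Inter>k\<in>{K..}. A n R k)"
proof (intro set_eqI iffI)
  fix x assume x: "x \<in> {x. enat n \<le> count R x}"
  define S where "S = f -` {x} \<inter> cball 0 R"
  obtain T where T: "T \<subseteq> S" "finite T" "card T = n"
  proof (cases "finite S")
    case True
    then have "n \<le> card S" using x by (simp add: count_def S_def[symmetric])
    then show ?thesis using that obtain_subset_with_card_n[of n S] by metis
  next
    case False
    then show ?thesis using that infinite_arbitrarily_large[of S n] by metis
  qed
  have "\<forall>\<^sub>F k in sequentially. \<forall>y\<in>T. \<forall>z\<in>T. y \<noteq> z \<longrightarrow> grid_index k y \<noteq> grid_index k z"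
  proof (intro eventually_ball_finite ballI T(2))
    fix y z assume "y \<in> T" "z \<in> T"
    show "\<forall>\<^sub>F k in sequentially. y \<noteq> z \<longrightarrow> grid_index k y \<noteq> grid_index k z"
      using grid_index_separates[of y z] by (cases "y = z") auto
  qed
  then obtain K where K: "\<And>k. k \<ge> K \<Longrightarrow> inj_on (grid_index k) T"
    by (auto simp: eventually_sequentially inj_on_def)
  have "x \<in> A n R k" if "k \<ge> K" for k
  proof -
    have "n = card (grid_index k ` T)" using K[OF that] T by (simp add: card_image)
    also have "\<dots> \<le> card (grid_index k ` S)"
      using T(1) by (intro card_mono finite_subset[OF _ finite_grid_index[of k R]] image_mono) (auto simp: S_def)
    finally show ?thesis by (simp add: A_def S_def)
  qed
  then show "x \<in> (\<Union>K. \<Inter>k\<in>{K..}. A n R k)" by auto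
next
  fix x assume "x \<in> (\<Union>K. \<Inter>k\<in>{K..}. A n R k)"
  then obtain k where "x \<in> A n R k" by auto
  then have k: "n \<le> card (grid_index k ` (f -` {x} \<inter> cball 0 R))" by (simp add: A_def)
  have "n \<le> card (f -` {x} \<inter> cball 0 R)" if "finite (f -` {x} \<inter> cball 0 R)"
    using k card_image_le[OF that, of "grid_index k"] by simp
  then show "x \<in> {x. enat n \<le> count R x}" by (simp add: count_def)
qed

lemma count_ge_sets: "{x. enat n \<le> count R x} \<in> sets lebesgue"
  unfolding count_ge_eq by (intro sets.countable_UN'' sets.countable_INT'' A_sets) auto

text \<open>The sets \<open>B K\<close> increase to the set in question and each lies in the set of
  a single grid, so the uniform bound survives the limit.\<close>

lemma count_ge_measure: "of_nat n * emeasure lebesgue {x. enat n \<le> count R x} \<le> I R"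
proof (cases "n = 0")
  case False
  define B where "B K = (\<Inter>k\<in>{K..}. A n R k)" for K
  have B: "B K \<in> sets lebesgue" for K unfolding B_def by (intro sets.countable_INT'' A_sets) auto
  have "emeasure lebesgue {x. enat n \<le> count R x} = (SUP K. emeasure lebesgue (B K))"
    unfolding count_ge_eq B_def[symmetric]
    by (rule SUP_emeasure_incseq[symmetric]) (use B in \<open>auto simp: B_def incseq_def\<close>)
  then have "of_nat n * emeasure lebesgue {x. enat n \<le> count R x} = (SUP K. of_nat n * emeasure lebesgue (B K))"
    by (simp add: SUP_mult_left_ennreal)
  also have "\<dots> \<le> I R"
  proof (rule SUP_least)
    fix K
    have "emeasure lebesgue (B K) \<le> emeasure lebesgue (A n R K)"
      by (intro emeasure_mono A_sets) (auto simp: B_def)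
    then have "of_nat n * emeasure lebesgue (B K) \<le> of_nat n * emeasure lebesgue (A n R K)"
      by (rule mult_left_mono) simp
    also have "\<dots> \<le> I R" by (rule A_measure)
    finally show "of_nat n * emeasure lebesgue (B K) \<le> I R" .
  qed
  finally show ?thesis .
qed simp

lemma count_infinite_null:
  assumes fin: "I R < \<infinity>" shows "{x. infinite (f -` {x} \<inter> cball 0 R)} \<in> null_sets lebesgue"
proof -
  define S where "S = {x. infinite (f -` {x} \<inter> cball 0 R)}"
  have eq: "S = (\<Inter>n. {x. enat n \<le> count R x})"
  proof -
    have "infinite T \<longleftrightarrow> (\<forall>n. enat n \<le> (if finite T then enat (card T) else \<infinity>))" for T :: "(real^'n) set"
      by (auto intro: exI[of _ "Suc (card T)"])
    then show ?thesis unfolding S_def count_def by auto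
  qed
  have S: "S \<in> sets lebesgue" unfolding eq by (intro sets.countable_INT'' count_ge_sets) auto
  have le: "of_nat n * emeasure lebesgue S \<le> I R" for n
  proof -
    have "emeasure lebesgue S \<le> emeasure lebesgue {x. enat n \<le> count R x}"
      using eq by (intro emeasure_mono count_ge_sets) auto
    then have "of_nat n * emeasure lebesgue S \<le> of_nat n * emeasure lebesgue {x. enat n \<le> count R x}"
      by (rule mult_left_mono) simp
    also have "\<dots> \<le> I R" by (rule count_ge_measure)
    finally show ?thesis .
  qed
  have "emeasure lebesgue S = 0"
  proof (rule ccontr)
    assume ne: "emeasure lebesgue S \<noteq> 0"
    have "emeasure lebesgue S \<le> I R" using le[of 1] by simp
    then have "emeasure lebesgue S < \<infinity>" using fin by (rule order.strict_trans1)
    then obtain s where s: "emeasure lebesgue S = ennreal s" "0 < s"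
      using ne by (cases "emeasure lebesgue S" rule: ennreal_cases) (auto simp: less_le)
    obtain i where i: "I R = ennreal i" "0 \<le> i" using fin by (cases "I R" rule: ennreal_cases) auto
    obtain n :: nat where n: "i / s < real n" using reals_Archimedean2 by blast
    have "ennreal (real n * s) \<le> ennreal i"
      using le[of n] s i by (simp add: ennreal_mult ennreal_of_nat_eq_real_of_nat)
    then have "real n * s \<le> i" using i by (subst (asm) ennreal_le_iff) auto
    then show False using n s by (simp add: field_simps)
  qed
  then show ?thesis using S by (auto simp: S_def)
qed

end

section \<open>Measurability of the derivative\<close>

text \<open>The Leibniz expansion, each entry being at most the operator norm. The constant N! is
  crude but harmless for local integrability.\<close>

lemma abs_det_le_onorm:
  fixes A :: "real^'n^'n"
  shows "\<bar>det A\<bar> \<le> fact CARD('n) * onorm ((*v) A) ^ CARD('n)"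
proof -
  have entry: "\<bar>A $ i $ j\<bar> \<le> onorm ((*v) A)" for i j
  proof -
    have "\<bar>A $ i $ j\<bar> = \<bar>(A *v axis j 1) $ i\<bar>" by (simp add: matrix_vector_mult_basis column_def)
    also have "\<dots> \<le> norm (A *v axis j 1)" by (rule component_le_norm_cart)
    also have "\<dots> \<le> onorm ((*v) A) * norm (axis j (1::real))" by (rule onorm[OF matrix_vector_mul_bounded_linear])
    finally show ?thesis by simp
  qed
  have "\<bar>det A\<bar> \<le> (\<Sum>p\<in>{p. p permutes (UNIV::'n set)}. \<bar>of_int (sign p) * (\<Prod>i\<in>UNIV. A $ i $ p i)\<bar>)"
    unfolding det_def by (rule sum_abs)
  also have "\<dots> \<le> (\<Sum>p\<in>{p. p permutes (UNIV::'n set)}. onorm ((*v) A) ^ CARD('n))"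
  proof (rule sum_mono)
    fix p :: "'n \<Rightarrow> 'n"
    have "\<bar>of_int (sign p) * (\<Prod>i\<in>UNIV. A $ i $ p i)\<bar> = (\<Prod>i\<in>UNIV. \<bar>A $ i $ p i\<bar>)"
      by (simp add: abs_mult abs_prod sign_def)
    also have "\<dots> \<le> (\<Prod>i\<in>(UNIV::'n set). onorm ((*v) A))" by (intro prod_mono) (auto simp: entry)
    finally show "\<bar>of_int (sign p) * (\<Prod>i\<in>UNIV. A $ i $ p i)\<bar> \<le> onorm ((*v) A) ^ CARD('n)" by simp
  qed
  also have "\<dots> = fact CARD('n) * onorm ((*v) A) ^ CARD('n)"
    by (simp add: card_permutations[OF refl finite_class.finite_UNIV])
  finally show ?thesis .
qed

lemma frechet_derivative_direction_tendsto:
  fixes f :: "'a::euclidean_space \<Rightarrow> 'b::real_normed_vector"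
  assumes "f differentiable (at y)"
  shows "((\<lambda>s. (f (y + s *\<^sub>R v) - f y) /\<^sub>R s) \<longlongrightarrow> frechet_derivative f (at y) v) (at (0::real))"
proof -
  let ?D = "frechet_derivative f (at y)"
  have D: "(f has_derivative ?D) (at y)" using assms by (simp add: frechet_derivative_works)
  have 1: "((\<lambda>s::real. y + s *\<^sub>R v) has_derivative (\<lambda>s. s *\<^sub>R v)) (at 0)" by (auto intro!: derivative_eq_intros)
  have "((\<lambda>s. f (y + s *\<^sub>R v)) has_derivative (\<lambda>s. ?D (s *\<^sub>R v))) (at 0)"
    by (rule has_derivative_compose[OF 1]) (simp add: D)
  moreover have "(\<lambda>s. ?D (s *\<^sub>R v)) = (\<lambda>s. s *\<^sub>R ?D v)"
    using linear_scale[OF has_derivative_linear[OF D]] by auto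
  ultimately have "((\<lambda>s. f (y + s *\<^sub>R v)) has_derivative (\<lambda>s. s *\<^sub>R ?D v)) (at 0)" by simp
  then have L: "((\<lambda>s. norm (f (y + s *\<^sub>R v) - f y - s *\<^sub>R ?D v) / \<bar>s\<bar>) \<longlongrightarrow> 0) (at 0)"
    unfolding has_derivative_iff_norm by simp
  have "((\<lambda>s. norm ((f (y + s *\<^sub>R v) - f y) /\<^sub>R s - ?D v)) \<longlongrightarrow> 0) (at 0)"
  proof (rule Lim_transform_eventually[OF L])
    have "norm (f (y + s *\<^sub>R v) - f y - s *\<^sub>R ?D v) / \<bar>s\<bar> = norm ((f (y + s *\<^sub>R v) - f y) /\<^sub>R s - ?D v)"
      if "s \<noteq> 0" for s
    proof -
      have "(f (y + s *\<^sub>R v) - f y) /\<^sub>R s - ?D v = (f (y + s *\<^sub>R v) - f y - s *\<^sub>R ?D v) /\<^sub>R s"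
        using that by (simp add: scaleR_diff_right)
      then show ?thesis by (simp add: divide_inverse mult.commute)
    qed
    then show "\<forall>\<^sub>F s in at 0. norm (f (y + s *\<^sub>R v) - f y - s *\<^sub>R ?D v) / \<bar>s\<bar>
        = norm ((f (y + s *\<^sub>R v) - f y) /\<^sub>R s - ?D v)"
      by (simp add: eventually_at_filter)
  qed
  then show ?thesis by (simp add: tendsto_norm_zero_iff Lim_null[symmetric])
qed

text \<open>A pointwise limit of continuous difference quotients along the scales 1 / (k+1), cut off
  to \<open>D\<close>.\<close>

lemma frechet_derivative_direction_measurable:
  fixes f :: "real^'n \<Rightarrow> real^'n"
  assumes cont: "continuous_on UNIV f" and D: "D \<in> sets lebesgue" and diff: "\<And>y. y \<in> D \<Longrightarrow> f differentiable (at y)"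
  shows "(\<lambda>y. if y \<in> D then frechet_derivative f (at y) v else 0) \<in> borel_measurable lebesgue"
proof -
  define h where "h k = 1 / real (Suc k)" for k
  have h: "h k \<noteq> 0" for k by (simp add: h_def)
  have hlim: "h \<longlonglongrightarrow> 0" unfolding h_def using LIMSEQ_inverse_real_of_nat by (simp add: inverse_eq_divide)
  have [measurable]: "D \<in> sets lebesgue" by (rule D)
  have [measurable]: "(\<lambda>y. (f (y + h k *\<^sub>R v) - f y) /\<^sub>R h k) \<in> borel_measurable lebesgue" for k
  proof -
    have "(\<lambda>y. (f (y + h k *\<^sub>R v) - f y) /\<^sub>R h k) \<in> borel_measurable borel"
      by (intro borel_measurable_continuous_onI continuous_intros continuous_on_compose2[OF cont]) auto
    then show ?thesis by (intro measurable_completion) simp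
  qed
  show ?thesis
  proof (rule borel_measurable_LIMSEQ_metric)
    show "(\<lambda>y. if y \<in> D then (f (y + h k *\<^sub>R v) - f y) /\<^sub>R h k else 0) \<in> borel_measurable lebesgue" for k
      by measurable
    fix y
    have "filterlim h (at 0) sequentially" using hlim h by (simp add: filterlim_at)
    then show "(\<lambda>k. if y \<in> D then (f (y + h k *\<^sub>R v) - f y) /\<^sub>R h k else 0) \<longlonglongrightarrow>
        (if y \<in> D then frechet_derivative f (at y) v else 0)"
      using filterlim_compose[OF frechet_derivative_direction_tendsto[OF diff]] by (cases "y \<in> D") auto
  qed
qed

text \<open>Reduces a condition on all directions to countably many, which makes the operator norm
  of a measurable family of linear maps measurable.\<close>

lemma onorm_le_iff_dense:
  fixes f :: "'a::euclidean_space \<Rightarrow> 'b::real_normed_vector"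
  assumes f: "bounded_linear f" and Q: "\<And>X. open X \<Longrightarrow> X \<noteq> {} \<Longrightarrow> \<exists>d\<in>Q. d \<in> X" and c: "0 \<le> c"
  shows "onorm f \<le> c \<longleftrightarrow> (\<forall>v\<in>Q. norm (f v) \<le> c * norm v)"
proof
  assume "onorm f \<le> c"
  then show "\<forall>v\<in>Q. norm (f v) \<le> c * norm v"
    using onorm[OF f] by (meson mult_right_mono norm_ge_zero order_trans)
next
  assume *: "\<forall>v\<in>Q. norm (f v) \<le> c * norm v"
  have cont: "continuous_on UNIV f" by (rule linear_continuous_on[OF f])
  have "open {v. c * norm v < norm (f v)}" by (intro open_Collect_less continuous_intros cont)
  then have "{v. c * norm v < norm (f v)} = {}" using Q * by (metis (mono_tags, lifting) mem_Collect_eq not_le)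
  then show "onorm f \<le> c" by (intro onorm_bound c) (auto simp: not_less)
qed

lemma onorm_frechet_derivative_measurable:
  fixes f :: "real^'n \<Rightarrow> real^'n"
  assumes cont: "continuous_on UNIV f" and D: "D \<in> sets lebesgue" and diff: "\<And>y. y \<in> D \<Longrightarrow> f differentiable (at y)"
  shows "(\<lambda>y. if y \<in> D then onorm (frechet_derivative f (at y)) else 0) \<in> borel_measurable lebesgue"
  unfolding borel_measurable_iff_le
proof
  fix c :: real
  obtain Q :: "(real^'n) set" where Q: "countable Q" "\<And>X. open X \<Longrightarrow> X \<noteq> {} \<Longrightarrow> \<exists>d\<in>Q. d \<in> X"
    using countable_dense_exists by blast
  have bl: "bounded_linear (frechet_derivative f (at y))" if "y \<in> D" for y
    using diff[OF that] frechet_derivative_works has_derivative_bounded_linear by blast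
  show "{y \<in> space lebesgue. (if y \<in> D then onorm (frechet_derivative f (at y)) else 0) \<le> c} \<in> sets lebesgue"
  proof (cases "0 \<le> c")
    case True
    have "{y \<in> space lebesgue. (if y \<in> D then onorm (frechet_derivative f (at y)) else 0) \<le> c}
      = {y \<in> space lebesgue. \<forall>v\<in>Q. norm (if y \<in> D then frechet_derivative f (at y) v else 0) \<le> c * norm v}"
      using onorm_le_iff_dense[OF bl Q(2) True] True by auto
    also have "\<dots> \<in> sets lebesgue"
      using Q(1) frechet_derivative_direction_measurable[OF cont D diff] by measurable
    finally show ?thesis .
  next
    case False
    then have "{y \<in> space lebesgue. (if y \<in> D then onorm (frechet_derivative f (at y)) else 0) \<le> c} = {}"
      using onorm_pos_le[OF bl] by (auto simp: not_le intro: order.strict_trans2)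
    then show ?thesis by (simp only: sets.empty_sets)
  qed
qed

text \<open>Extending the weak derivative by 0 outside \<Omega> and changing it on a null set alters
  neither its distribution function nor its integrals against test functions. A Borel representative
  is what Tonelli's theorem on products of Borel spaces asks for.\<close>

lemma weak_deriv_borel_version:
  fixes U :: "real^'n \<Rightarrow> real^'n"
  assumes U: "continuous_on UNIV U" and op: "open \<Omega>" and bd: "bounded \<Omega>" and w: "weak_deriv_in_lorentz U k l \<Omega>"
  shows "\<exists>g. g \<in> borel_measurable borel \<and> lorentz_norm \<Omega> g < \<infinity> \<and>
    (\<forall>\<phi>. test_fun \<Omega> \<phi> \<longrightarrow> (\<integral>y. U y $ k * partial_deriv l \<phi> y \<partial>lborel) = - (\<integral>y. g y * \<phi> y \<partial>lborel))"
proof -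
  obtain g where g: "lorentz_N1 \<Omega> g" and wd: "\<And>\<phi>. test_fun \<Omega> \<phi> \<Longrightarrow>
     (\<integral>y. U y $ k * partial_deriv l \<phi> y \<partial>lebesgue) = - (\<integral>y. g y * \<phi> y \<partial>lebesgue)"
    using w unfolding weak_deriv_in_lorentz_def by blast
  have \<Omega>: "\<Omega> \<in> sets borel" "\<Omega> \<in> sets lebesgue" using op by auto
  define g0 where "g0 x = (if x \<in> \<Omega> then g x else 0)" for x
  have g0 [measurable]: "g0 \<in> borel_measurable lebesgue"
    using g borel_measurable_if[OF \<Omega>(2), of g] unfolding lorentz_N1_def g0_def[abs_def] by blast
  obtain g' where g' [measurable]: "g' \<in> borel_measurable lborel" and ae: "AE x in lborel. g0 x = g' x"
    using completion_ex_borel_measurable_real[OF g0] by blast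
  have g'b: "g' \<in> borel_measurable borel" using g' by simp
  have ae': "AE x in lebesgue. g0 x = g' x" using ae by (rule AE_completion)
  have superlevel_measure: "superlevel_measure g' \<Omega> s = measure lebesgue {x\<in>\<Omega>. \<bar>g x\<bar> \<ge> s}" for s
  proof -
    have "{y\<in>\<Omega>. s \<le> \<bar>g' y\<bar>} \<in> sets borel" by (rule superlevel_measure_sets[OF g'b \<Omega>(1)])
    then have "superlevel_measure g' \<Omega> s = measure lebesgue {y\<in>\<Omega>. s \<le> \<bar>g' y\<bar>}" by (simp add: superlevel_measure_def)
    also have "\<dots> = measure lebesgue {x\<in>\<Omega>. \<bar>g x\<bar> \<ge> s}"
    proof (rule measure_eq_AE)
      show "AE x in lebesgue. x \<in> {y \<in> \<Omega>. s \<le> \<bar>g' y\<bar>} \<longleftrightarrow> x \<in> {x \<in> \<Omega>. s \<le> \<bar>g x\<bar>}"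
        using ae' by eventually_elim (auto simp: g0_def)
      show "{y \<in> \<Omega>. s \<le> \<bar>g' y\<bar>} \<in> sets lebesgue" using superlevel_measure_sets[OF g'b \<Omega>(1)] by simp
      have "{x \<in> space lebesgue. s \<le> \<bar>g0 x\<bar>} \<inter> \<Omega> \<in> sets lebesgue" using \<Omega>(2) by measurable
      also have "{x \<in> space lebesgue. s \<le> \<bar>g0 x\<bar>} \<inter> \<Omega> = {x \<in> \<Omega>. s \<le> \<bar>g x\<bar>}" by (auto simp: g0_def)
      finally show "{x \<in> \<Omega>. s \<le> \<bar>g x\<bar>} \<in> sets lebesgue" .
    qed
    finally show ?thesis .
  qed
  have "lorentz_norm \<Omega> g' < \<infinity>" using g by (simp add: lorentz_norm_def lorentz_N1_def superlevel_measure)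
  moreover have "(\<integral>y. U y $ k * partial_deriv l \<phi> y \<partial>lborel) = - (\<integral>y. g' y * \<phi> y \<partial>lborel)" if \<phi>: "test_fun \<Omega> \<phi>" for \<phi>
  proof -
    have sm: "smooth_fun \<phi>" using \<phi> by (simp add: test_fun_def)
    have c1: "continuous_on UNIV \<phi>" and c2: "continuous_on UNIV (partial_deriv l \<phi>)"
      by (rule smooth_fun_continuous[OF sm], rule smooth_fun_continuous_partial[OF sm])
    have [measurable]: "\<phi> \<in> borel_measurable borel" using c1 by (rule borel_measurable_continuous_onI)
    have [measurable]: "(\<lambda>y. U y $ k * partial_deriv l \<phi> y) \<in> borel_measurable borel"
      by (intro borel_measurable_continuous_onI continuous_intros U c2)
    have zero: "g y * \<phi> y = g0 y * \<phi> y" for y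
    proof -
      have "y \<in> \<Omega>" if "\<phi> y \<noteq> 0"
      proof -
        have "y \<in> closure {y. \<phi> y \<noteq> 0}" by (rule subsetD[OF closure_subset]) (use that in simp)
        then show ?thesis using \<phi> by (auto simp: test_fun_def)
      qed
      then show ?thesis by (cases "\<phi> y = 0") (auto simp: g0_def)
    qed
    have "(\<integral>y. U y $ k * partial_deriv l \<phi> y \<partial>lborel) = (\<integral>y. U y $ k * partial_deriv l \<phi> y \<partial>lebesgue)"
      by (rule integral_completion[symmetric]) simp
    also have "\<dots> = - (\<integral>y. g y * \<phi> y \<partial>lebesgue)" by (rule wd[OF \<phi>])
    also have "(\<integral>y. g y * \<phi> y \<partial>lebesgue) = (\<integral>y. g' y * \<phi> y \<partial>lebesgue)"
      unfolding zero
    proof (rule integral_cong_AE)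
      show "AE y in lebesgue. g0 y * \<phi> y = g' y * \<phi> y" using ae' by eventually_elim simp
      have [measurable]: "\<phi> \<in> borel_measurable lebesgue" "g' \<in> borel_measurable lebesgue"
        by (auto intro: measurable_completion)
      show "(\<lambda>y. g0 y * \<phi> y) \<in> borel_measurable lebesgue" by measurable
      show "(\<lambda>y. g' y * \<phi> y) \<in> borel_measurable lebesgue" by measurable
    qed
    also have "\<dots> = (\<integral>y. g' y * \<phi> y \<partial>lborel)" by (rule integral_completion) simp
    finally show ?thesis .
  qed
  ultimately show ?thesis using g'b by blast
qed

lemma emeasure_bounded_open: "bounded \<Omega> \<Longrightarrow> open \<Omega> \<Longrightarrow> emeasure lborel \<Omega> < \<infinity>"
  using emeasure_bounded_finite by simp

text \<open>The N-th power of a difference quotient at scale s is at most s^(-N) times the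
  \<Theta>-mass of a cube of half-side s, and the density of that mass is at most \<Theta> y almost
  everywhere. The constant arises from the ball of radius (N + 1) s around the cube and the volume
  (2 (N + 1) s)^N of the cube around that ball.\<close>

lemma rr_bound_onorm_le:
  fixes f :: "real^'n \<Rightarrow> real^'n"
  assumes rr: "rr_bound \<Omega> \<Theta> f" and op: "open \<Omega>" and fin: "emeasure lborel \<Omega> < \<infinity>"
  shows "negligible {y\<in>\<Omega>. f differentiable (at y) \<and>
    \<not> ennreal (onorm (frechet_derivative f (at y)) ^ CARD('n)) \<le> ennreal ((2 * (real CARD('n) + 1)) ^ CARD('n)) * \<Theta> y}"
proof -
  define n where "n = CARD('n)"
  define K where "K = real n + 1"
  have K: "K > 0" by (simp add: K_def)
  have \<Theta>: "\<Theta> \<in> borel_measurable borel" "(\<integral>\<^sup>+x. \<Theta> x * indicator \<Omega> x \<partial>lborel) < \<infinity>"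
    using rr by (auto simp: rr_bound_def)
  define E where "E = {x\<in>\<Omega>. \<exists>c>0. \<Theta> x < ennreal c \<and> (\<forall>d>0. \<exists>r. 0 < r \<and> r < d \<and>
     ennreal c * emeasure lborel (ball x r) < (\<integral>\<^sup>+y. \<Theta> y * indicator (ball x r) y \<partial>lborel))}"
  have neg: "negligible E" unfolding E_def by (rule upper_lebesgue_differentiation[OF \<Theta>(1) op fin \<Theta>(2)])
  have main: "ennreal (onorm (frechet_derivative f (at y)) ^ n) \<le> ennreal ((2 * K) ^ n) * \<Theta> y"
    if y: "y \<in> \<Omega>" "y \<notin> E" and diff: "f differentiable (at y)" for y
  proof -
    let ?D = "frechet_derivative f (at y)"
    have D: "(f has_derivative ?D) (at y)" using diff by (simp add: frechet_derivative_works)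
    have bl: "bounded_linear ?D" by (rule has_derivative_bounded_linear[OF D])
    have step: "onorm ?D ^ n \<le> (2 * K) ^ n * c" if c: "0 < c" "\<Theta> y < ennreal c" for c
    proof -
      have "\<not> (\<forall>d>0. \<exists>r. 0 < r \<and> r < d \<and> ennreal c * emeasure lborel (ball y r) < (\<integral>\<^sup>+z. \<Theta> z * indicator (ball y r) z \<partial>lborel))"
        using y c unfolding E_def by blast
      then obtain d where d: "d > 0" "\<And>r. 0 < r \<Longrightarrow> r < d \<Longrightarrow>
          (\<integral>\<^sup>+z. \<Theta> z * indicator (ball y r) z \<partial>lborel) \<le> ennreal c * emeasure lborel (ball y r)"
        by (meson not_less)
      obtain d0 where d0: "d0 > 0" "ball y d0 \<subseteq> \<Omega>" using op y by (meson open_contains_ball)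
      define b where "b = root n ((2 * K) ^ n * c)"
      have n: "0 < n" by (simp add: n_def)
      have bn: "b ^ n = (2 * K) ^ n * c" using K c n by (simp add: b_def)
      have b: "b \<ge> 0" unfolding b_def by (rule real_root_ge_zero) (use K c in auto)
      have quot: "norm ((f (y + s *\<^sub>R v) - f y) /\<^sub>R s) \<le> b" if v: "norm v = 1" and s: "0 < s" "K * s < min d d0" for v s
      proof -
        have cb: "cube y s \<subseteq> ball y (K * s)" using cube_subset_ball[OF s(1)] by (simp add: K_def n_def)
        have b\<Omega>: "ball y (K * s) \<subseteq> \<Omega>" using s d0(2) subset_ball[of "K * s" d0 y] by auto
        have in1: "y + s *\<^sub>R v \<in> cube y s"
        proof -
          have "\<bar>v $ i\<bar> \<le> 1" for i using component_le_norm_cart[of v i] v by simp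
          then have "s * \<bar>v $ i\<bar> \<le> s * 1" for i using s by (intro mult_left_mono) auto
          then show ?thesis using s by (simp add: cube_def abs_mult)
        qed
        have in2: "y \<in> cube y s" using s by (simp add: cube_def)
        have "cube y s \<subseteq> \<Omega>" using cb b\<Omega> by blast
        then have "ennreal (norm (f (y + s *\<^sub>R v) - f y) ^ n) \<le> (\<integral>\<^sup>+z. \<Theta> z * indicator (cube y s) z \<partial>lborel)"
          using rr in1 in2 s unfolding rr_bound_def n_def by blast
        also have "\<dots> \<le> (\<integral>\<^sup>+z. \<Theta> z * indicator (ball y (K * s)) z \<partial>lborel)"
          using cb by (intro nn_integral_mono) (auto simp: indicator_def)
        also have "\<dots> \<le> ennreal c * emeasure lborel (ball y (K * s))" using s K by (intro d(2)) auto
        also have "\<dots> \<le> ennreal c * emeasure lborel (cube y (K * s))"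
          by (intro mult_left_mono emeasure_mono ball_subset_cube) auto
        also have "\<dots> = ennreal c * ennreal ((2 * (K * s)) ^ n)" using s K by (simp add: emeasure_cube n_def)
        also have "\<dots> = ennreal (c * (2 * (K * s)) ^ n)" by (rule ennreal_mult[symmetric]) (use c s K in auto)
        finally have "norm (f (y + s *\<^sub>R v) - f y) ^ n \<le> c * (2 * (K * s)) ^ n"
          by (subst (asm) ennreal_le_iff) (use c s K in auto)
        also have "\<dots> = (b * s) ^ n" by (simp add: power_mult_distrib bn mult_ac)
        finally have "norm (f (y + s *\<^sub>R v) - f y) \<le> b * s" using n b s by (simp add: power_mono_iff)
        then have "norm (f (y + s *\<^sub>R v) - f y) / s \<le> b" using s by (simp add: pos_divide_le_eq)
        then show ?thesis using s by (simp add: divide_inverse mult.commute)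
      qed
      have unit: "norm (?D v) \<le> b" if v: "norm v = 1" for v
      proof (rule tendsto_upperbound)
        show "((\<lambda>s. norm ((f (y + s *\<^sub>R v) - f y) /\<^sub>R s)) \<longlongrightarrow> norm (?D v)) (at_right 0)"
          by (intro tendsto_norm tendsto_mono[OF at_le frechet_derivative_direction_tendsto[OF diff]]) auto
        have "min d d0 / K > 0" using d d0 K by simp
        then have "\<forall>\<^sub>F s in at_right 0. 0 < s \<and> s < min d d0 / K" by (rule eventually_at_right_pos_less)
        then show "\<forall>\<^sub>F s in at_right 0. norm ((f (y + s *\<^sub>R v) - f y) /\<^sub>R s) \<le> b"
        proof eventually_elim
          case (elim s)
          then have "K * s < min d d0" using K by (simp add: pos_less_divide_eq mult.commute)
          then show ?case using quot[OF v] elim by blast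
        qed
      qed simp
      have "onorm ?D \<le> b"
      proof (rule onorm_bound[OF b])
        fix v
        show "norm (?D v) \<le> b * norm v"
        proof (cases "v = 0")
          case False
          then have "norm (?D (v /\<^sub>R norm v)) \<le> b" by (intro unit) simp
          then show ?thesis using False linear_scale[OF bounded_linear.linear[OF bl]]
            by (simp add: field_simps)
        qed (simp add: linear_0[OF bounded_linear.linear[OF bl]])
      qed
      then have "onorm ?D ^ n \<le> b ^ n" using onorm_pos_le[OF bl] by (intro power_mono) auto
      then show ?thesis by (simp add: bn)
    qed
    show ?thesis
    proof (cases "\<Theta> y" rule: ennreal_cases)
      case (real t)
      have "onorm ?D ^ n \<le> (2 * K) ^ n * t"
      proof (rule tendsto_lowerbound)
        show "((\<lambda>e. (2 * K) ^ n * (t + e)) \<longlongrightarrow> (2 * K) ^ n * t) (at_right 0)"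
          by (rule tendsto_eq_intros refl | simp)+
        have "\<forall>\<^sub>F e in at_right (0::real). 0 < e" by (simp add: eventually_at_right_less)
        then show "\<forall>\<^sub>F e in at_right 0. onorm ?D ^ n \<le> (2 * K) ^ n * (t + e)"
        proof eventually_elim
          case (elim e)
          have "\<Theta> y < ennreal (t + e)" using elim real by (auto intro: ennreal_lessI)
          then show ?case using elim real by (intro step) auto
        qed
      qed simp
      then have "ennreal (onorm ?D ^ n) \<le> ennreal ((2 * K) ^ n * t)" by (rule ennreal_leI)
      also have "\<dots> = ennreal ((2 * K) ^ n) * \<Theta> y" unfolding real(2) by (rule ennreal_mult) (use K real in auto)
      finally show ?thesis .
    next
      case top
      then show ?thesis using K by (simp add: ennreal_mult_top)
    qed
  qed
  show ?thesis by (rule negligible_subset[OF neg]) (use main in \<open>auto simp: n_def K_def\<close>)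
qed

section \<open>Transport of a field with Lorentz gradient\<close>

lemma power_add_le: "0 \<le> a \<Longrightarrow> 0 \<le> b \<Longrightarrow> (a + b) ^ n \<le> 2 ^ n * (a ^ n + b ^ n)" for a b :: real
proof -
  assume ab: "0 \<le> a" "0 \<le> b"
  have "(a + b) ^ n \<le> (2 * max a b) ^ n" using ab by (intro power_mono) auto
  also have "\<dots> = 2 ^ n * max a b ^ n" by (simp add: power_mult_distrib)
  also have "\<dots> \<le> 2 ^ n * (a ^ n + b ^ n)" using ab by (intro mult_left_mono) (auto simp: max_def)
  finally show ?thesis .
qed

locale lorentz_transport = hamiltonian_transport G DG \<kappa> h \<Phi> U F
  for G :: "(real^'n) \<times> (real^'n) \<Rightarrow> (real^'n) \<times> (real^'n)" and DG \<kappa> h \<Phi> and U :: "real^'n \<Rightarrow> real^'n" and F +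
  assumes weak: "\<And>\<Omega> k l. bounded \<Omega> \<Longrightarrow> open \<Omega> \<Longrightarrow> weak_deriv_in_lorentz U k l \<Omega>"
begin

lemma lorentz_gradient_ex:
  assumes "bounded \<Omega>" "open \<Omega>" shows "\<exists>g. lorentz_gradient \<Omega> (\<lambda>y. U y $ k) g"
proof -
  have "\<exists>g. g \<in> borel_measurable borel \<and> lorentz_norm \<Omega> g < \<infinity> \<and>
    (\<forall>\<phi>. test_fun \<Omega> \<phi> \<longrightarrow> (\<integral>y. U y $ k * partial_deriv l \<phi> y \<partial>lborel) = - (\<integral>y. g y * \<phi> y \<partial>lborel))" for l
    by (rule weak_deriv_borel_version[OF U_cont assms(2,1) weak[OF assms]])
  then have "\<exists>g. \<forall>l. g l \<in> borel_measurable borel \<and> lorentz_norm \<Omega> (g l) < \<infinity> \<and>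
    (\<forall>\<phi>. test_fun \<Omega> \<phi> \<longrightarrow> (\<integral>y. U y $ k * partial_deriv l \<phi> y \<partial>lborel) = - (\<integral>y. g l y * \<phi> y \<partial>lborel))"
    by (intro choice) auto
  then show ?thesis unfolding lorentz_gradient_def weak_gradient_def by blast
qed

lemma U_rr_bound:
  assumes "bounded \<Omega>" "open \<Omega>" shows "\<exists>\<Theta>. rr_bound \<Omega> \<Theta> U"
  unfolding rr_bound_def
  by (rule rado_reichelderfer[OF U_cont lorentz_gradient_ex[OF assms]])
    (use assms emeasure_bounded_open in auto)

text \<open>One density serves all times up to T. Differences in space cost the factor e^(\<kappa>
  T); differences in time are at most the side 2 R and cost V * 2 R. The resulting N-th powers of
  multiples of 2 R are volumes of the cube up to a constant, so they are absorbed by a constant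
  density.\<close>

lemma F_space_time:
  assumes \<Omega>: "bounded \<Omega>" "open \<Omega>"
  shows "\<exists>\<Theta>. \<Theta> \<in> borel_measurable borel \<and> (\<integral>\<^sup>+y. \<Theta> y * indicator \<Omega> y \<partial>lborel) < \<infinity> \<and>
    (\<forall>m R s t x z. cube m R \<subseteq> \<Omega> \<longrightarrow> 0 < R \<longrightarrow> \<bar>s\<bar> \<le> T \<longrightarrow> \<bar>t\<bar> \<le> T \<longrightarrow> \<bar>t - s\<bar> \<le> 2 * R \<longrightarrow>
      x \<in> cube m R \<longrightarrow> z \<in> cube m R \<longrightarrow>
      ennreal (norm (F t x - F s z) ^ CARD('n)) \<le> (\<integral>\<^sup>+y. \<Theta> y * indicator (cube m R) y \<partial>lborel))"
proof -
  obtain B where B: "\<And>y. y \<in> \<Omega> \<Longrightarrow> norm y \<le> B" using \<Omega>(1) by (auto simp: bounded_iff)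
  obtain V where V: "V \<ge> 0" "\<And>s t y. \<bar>s\<bar> \<le> T \<Longrightarrow> \<bar>t\<bar> \<le> T \<Longrightarrow> norm y \<le> B \<Longrightarrow> norm (F t y - F s y) \<le> V * \<bar>t - s\<bar>"
    using F_time_lipschitz[of T B] by blast
  define n where "n = CARD('n)"
  obtain \<Theta> where rr: "rr_bound \<Omega> \<Theta> U" using U_rr_bound[OF \<Omega>] by blast
  have [measurable]: "\<Theta> \<in> borel_measurable borel" "\<Omega> \<in> sets borel" using rr \<Omega> by (auto simp: rr_bound_def)
  have fin: "(\<integral>\<^sup>+x. \<Theta> x * indicator \<Omega> x \<partial>lborel) < \<infinity>" using rr by (auto simp: rr_bound_def)
  define b where "b = real n + V"
  have b: "b \<ge> 0" using V by (simp add: b_def)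
  define c where "c = exp (\<kappa> * \<bar>T\<bar>) ^ n * 2 ^ n"
  have c: "c > 0" by (simp add: c_def)
  define \<Theta>' where "\<Theta>' y = ennreal c * (ennreal (b ^ n) + \<Theta> y)" for y
  have \<Theta>'m: "\<Theta>' \<in> borel_measurable borel" unfolding \<Theta>'_def[abs_def] by measurable
  have int: "(\<integral>\<^sup>+y. \<Theta>' y * indicator A y \<partial>lborel) = ennreal c * (ennreal (b ^ n) * emeasure lborel A + (\<integral>\<^sup>+y. \<Theta> y * indicator A y \<partial>lborel))"
    if [measurable]: "A \<in> sets borel" for A
  proof -
    have "(\<integral>\<^sup>+y. \<Theta>' y * indicator A y \<partial>lborel) = (\<integral>\<^sup>+y. ennreal c * (ennreal (b ^ n) * indicator A y + \<Theta> y * indicator A y) \<partial>lborel)"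
      by (intro nn_integral_cong) (simp add: \<Theta>'_def distrib_right mult.assoc)
    also have "\<dots> = ennreal c * (\<integral>\<^sup>+y. ennreal (b ^ n) * indicator A y + \<Theta> y * indicator A y \<partial>lborel)"
      by (rule nn_integral_cmult) measurable
    also have "(\<integral>\<^sup>+y. ennreal (b ^ n) * indicator A y + \<Theta> y * indicator A y \<partial>lborel)
        = (\<integral>\<^sup>+y. ennreal (b ^ n) * indicator A y \<partial>lborel) + (\<integral>\<^sup>+y. \<Theta> y * indicator A y \<partial>lborel)"
      by (rule nn_integral_add) measurable
    also have "(\<integral>\<^sup>+y. ennreal (b ^ n) * indicator A y \<partial>lborel) = ennreal (b ^ n) * emeasure lborel A"
      by (rule nn_integral_cmult_indicator) simp
    finally show ?thesis .
  qed
  have "(\<integral>\<^sup>+y. \<Theta>' y * indicator \<Omega> y \<partial>lborel) < \<infinity>"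
    using fin emeasure_bounded_open[OF \<Omega>] \<Omega> by (simp add: int ennreal_mult_less_top)
  moreover have "ennreal (norm (F t x - F s z) ^ n) \<le> (\<integral>\<^sup>+y. \<Theta>' y * indicator (cube m R) y \<partial>lborel)"
    if sub: "cube m R \<subseteq> \<Omega>" and R: "0 < R" and T: "\<bar>s\<bar> \<le> T" "\<bar>t\<bar> \<le> T" and st: "\<bar>t - s\<bar> \<le> 2 * R"
      and x: "x \<in> cube m R" and z: "z \<in> cube m R" for m R s t x z
  proof -
    define E where "E = exp (\<kappa> * \<bar>T\<bar>)"
    have E1: "1 \<le> E" unfolding E_def using kappa_pos by simp
    have xz: "norm (x - z) \<le> real n * (2 * R)"
      unfolding n_def
    proof (rule norm_le_card_mult_sup)
      fix i
      have "\<bar>x $ i - m $ i\<bar> \<le> R" "\<bar>z $ i - m $ i\<bar> \<le> R" using x z by (auto simp: cube_def)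
      then show "\<bar>(x - z) $ i\<bar> \<le> 2 * R" unfolding vector_minus_component by linarith
    qed
    have "norm (F t x - F t z) \<le> exp (\<kappa> * \<bar>t\<bar>) * (norm (x - z) + norm (U x - U z))" by (rule F_diff_le)
    also have "\<dots> \<le> E * (norm (x - z) + norm (U x - U z))"
      unfolding E_def using T kappa_pos by (intro mult_right_mono) auto
    also have "\<dots> \<le> E * (real n * (2 * R) + norm (U x - U z))" using xz E1 by (intro mult_left_mono) auto
    finally have 1: "norm (F t x - F t z) \<le> E * (real n * (2 * R) + norm (U x - U z))" .
    have "norm (F t z - F s z) \<le> V * \<bar>t - s\<bar>" by (rule V(2)[OF T]) (use B sub z in blast)
    also have "\<dots> \<le> V * (2 * R)" using st V(1) by (rule mult_left_mono)
    also have "\<dots> \<le> E * (V * (2 * R))" using mult_right_mono[OF E1, of "V * (2 * R)"] V(1) R by simp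
    finally have 2: "norm (F t z - F s z) \<le> E * (V * (2 * R))" .
    have "norm (F t x - F s z) \<le> norm (F t x - F t z) + norm (F t z - F s z)"
      using norm_triangle_ineq[of "F t x - F t z" "F t z - F s z"] by simp
    also have "\<dots> \<le> E * (b * (2 * R) + norm (U x - U z))" using 1 2 by (simp add: b_def algebra_simps)
    finally have "norm (F t x - F s z) ^ n \<le> (E * (b * (2 * R) + norm (U x - U z))) ^ n"
      by (intro power_mono) auto
    also have "\<dots> = E ^ n * (b * (2 * R) + norm (U x - U z)) ^ n" by (rule power_mult_distrib)
    also have "\<dots> \<le> E ^ n * (2 ^ n * ((b * (2 * R)) ^ n + norm (U x - U z) ^ n))"
      using E1 b R by (intro mult_left_mono power_add_le) auto
    also have "\<dots> = c * ((b * (2 * R)) ^ n + norm (U x - U z) ^ n)" by (simp add: c_def E_def mult.assoc)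
    finally have "ennreal (norm (F t x - F s z) ^ n) \<le> ennreal (c * ((b * (2 * R)) ^ n + norm (U x - U z) ^ n))"
      by (rule ennreal_leI)
    also have "\<dots> = ennreal c * (ennreal ((b * (2 * R)) ^ n) + ennreal (norm (U x - U z) ^ n))"
      using c R b by (simp add: ennreal_mult'' del: ennreal_plus flip: ennreal_plus)
    also have "\<dots> \<le> ennreal c * (ennreal (b ^ n) * emeasure lborel (cube m R) + (\<integral>\<^sup>+y. \<Theta> y * indicator (cube m R) y \<partial>lborel))"
    proof (intro mult_left_mono add_mono)
      have "ennreal ((b * (2 * R)) ^ n) = ennreal (b ^ n) * ennreal ((2 * R) ^ n)"
        using R b by (subst ennreal_mult[symmetric]) (auto simp: power_mult_distrib)
      then show "ennreal ((b * (2 * R)) ^ n) \<le> ennreal (b ^ n) * emeasure lborel (cube m R)"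
        using R by (simp add: emeasure_cube n_def)
      show "ennreal (norm (U x - U z) ^ n) \<le> (\<integral>\<^sup>+y. \<Theta> y * indicator (cube m R) y \<partial>lborel)"
        using rr sub R x z unfolding rr_bound_def n_def by blast
    qed auto
    also have "\<dots> = (\<integral>\<^sup>+y. \<Theta>' y * indicator (cube m R) y \<partial>lborel)" by (rule int[OF borel_cube, symmetric])
    finally show ?thesis .
  qed
  ultimately show ?thesis unfolding n_def using \<Theta>'m by blast
qed

lemma F_rr_bound: assumes \<Omega>: "bounded \<Omega>" "open \<Omega>" shows "\<exists>\<Theta>. rr_bound \<Omega> \<Theta> (F t)"
proof -
  obtain \<Theta> where "\<Theta> \<in> borel_measurable borel" "(\<integral>\<^sup>+y. \<Theta> y * indicator \<Omega> y \<partial>lborel) < \<infinity>"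
    and le: "\<forall>m R s t' x z. cube m R \<subseteq> \<Omega> \<longrightarrow> 0 < R \<longrightarrow> \<bar>s\<bar> \<le> \<bar>t\<bar> \<longrightarrow> \<bar>t'\<bar> \<le> \<bar>t\<bar> \<longrightarrow> \<bar>t' - s\<bar> \<le> 2 * R \<longrightarrow>
      x \<in> cube m R \<longrightarrow> z \<in> cube m R \<longrightarrow>
      ennreal (norm (F t' x - F s z) ^ CARD('n)) \<le> (\<integral>\<^sup>+y. \<Theta> y * indicator (cube m R) y \<partial>lborel)"
    using F_space_time[OF \<Omega>, of "\<bar>t\<bar>"] by blast
  moreover have "ennreal (norm (F t x - F t z) ^ CARD('n)) \<le> (\<integral>\<^sup>+y. \<Theta> y * indicator (cube m R) y \<partial>lborel)"
    if "cube m R \<subseteq> \<Omega>" "0 < R" "x \<in> cube m R" "z \<in> cube m R" for m R x z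
    using le[rule_format, of m R t t x z] that by simp
  ultimately have "rr_bound \<Omega> \<Theta> (F t)" unfolding rr_bound_def by blast
  then show ?thesis by blast
qed

lemma F_lusin: assumes Z: "negligible Z" shows "negligible (F t ` Z)"
proof -
  have "F t ` Z = (\<Union>k::nat. F t ` (Z \<inter> ball 0 (real k)))"
  proof -
    have "Z = (\<Union>k::nat. Z \<inter> ball 0 (real k))" using reals_Archimedean2 by auto
    then show ?thesis by blast
  qed
  moreover have "negligible (F t ` (Z \<inter> ball 0 (real k)))" for k
  proof -
    obtain \<Theta> where "rr_bound (ball 0 (real k)) \<Theta> (F t)" using F_rr_bound by blast
    then show ?thesis
      by (rule rr_bound_negligible_image) (auto intro: negligible_subset[OF Z])
  qed
  ultimately show ?thesis by (simp only: negligible_Union_nat)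
qed

lemma nondiff_negligible: "negligible (nondiff_set U)"
proof -
  have "nondiff_set U \<subseteq> (\<Union>k::nat. \<Union>i. {y \<in> ball 0 (real k). \<not> (\<lambda>y. U y $ i) differentiable (at y)})"
  proof
    fix y assume "y \<in> nondiff_set U"
    then have "\<not> U differentiable (at y)" by (simp add: nondiff_set_def)
    then obtain b where b: "b \<in> Basis" "\<not> (\<lambda>y. U y \<bullet> b) differentiable (at y)"
      unfolding differentiable_componentwise_within[of U y UNIV] by blast
    then obtain i where "b = axis i 1" by (auto simp: Basis_vec_def)
    then have "\<not> (\<lambda>y. U y $ i) differentiable (at y)" using b(2) by (simp add: inner_axis)
    moreover obtain k :: nat where "norm y < real k" using reals_Archimedean2 by blast
    ultimately show "y \<in> (\<Union>k::nat. \<Union>i. {y \<in> ball 0 (real k). \<not> (\<lambda>y. U y $ i) differentiable (at y)})" by auto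
  qed
  moreover have "negligible {y \<in> ball 0 (real k). \<not> (\<lambda>y. U y $ i) differentiable (at y)}" for k i
  proof -
    obtain g where g: "lorentz_gradient (ball 0 (real k)) (\<lambda>y. U y $ i) g" using lorentz_gradient_ex by blast
    have "continuous_on UNIV (\<lambda>y. U y $ i)" by (intro continuous_intros U_cont)
    from lorentz_gradient_differentiable[OF this g] show ?thesis
      using emeasure_bounded_open[of "ball 0 (real k)"] by simp
  qed
  then have "negligible (\<Union>k::nat. \<Union>i. {y \<in> ball 0 (real k). \<not> (\<lambda>y. U y $ i) differentiable (at y)})"
    by (intro negligible_countable_Union countable_image) (auto intro!: negligible_Union)
  ultimately show ?thesis using negligible_subset by blast
qed

definition dU :: "real^'n \<Rightarrow> real" where
  "dU y = (if y \<in> - nondiff_set U then onorm (frechet_derivative U (at y)) else 0)"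

lemma diff_sets: "- nondiff_set U \<in> sets lebesgue"
  using negligible_imp_sets[OF nondiff_negligible] by (metis Compl_in_sets_lebesgue)

lemma dU_measurable [measurable]: "dU \<in> borel_measurable lebesgue"
  unfolding dU_def[abs_def]
  by (rule onorm_frechet_derivative_measurable[OF U_cont diff_sets]) (simp add: nondiff_set_def)

lemma frechet_bounded_linear: "y \<notin> nondiff_set U \<Longrightarrow> bounded_linear (frechet_derivative U (at y))"
  unfolding nondiff_set_def using frechet_derivative_works has_derivative_bounded_linear by blast

lemma dU_nonneg: "0 \<le> dU y"
  using onorm_pos_le[OF frechet_bounded_linear] by (simp add: dU_def)

text \<open>A bound for the local Lipschitz constant of F t, in the form whose N-th power integrates
  to the right-hand side of the multiplicity estimate.\<close>

definition \<nu> :: "real \<Rightarrow> real^'n \<Rightarrow> real" where "\<nu> t y = exp (\<kappa> * \<bar>t\<bar>) * (1 + dU y)"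

lemma F_local_lipschitz:
  assumes x: "x \<in> - nondiff_set U" and e: "0 < e"
  shows "\<exists>d>0. \<forall>z. norm (z - x) < d \<longrightarrow> norm (F t z - F t x) \<le> (\<nu> t x + e) * norm (z - x)"
proof -
  define e' where "e' = e / exp (\<kappa> * \<bar>t\<bar>)"
  have e': "e' > 0" using e by (simp add: e'_def)
  let ?D = "frechet_derivative U (at x)"
  have D: "(U has_derivative ?D) (at x)" using x by (simp add: nondiff_set_def frechet_derivative_works)
  obtain d where d: "d > 0" "\<And>z. norm (z - x) < d \<Longrightarrow> norm (U z - U x - ?D (z - x)) \<le> e' * norm (z - x)"
    using D e' unfolding has_derivative_at_alt by blast
  have "norm (F t z - F t x) \<le> (\<nu> t x + e) * norm (z - x)" if z: "norm (z - x) < d" for z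
  proof -
    have "norm (U z - U x) \<le> norm (?D (z - x)) + norm (U z - U x - ?D (z - x))"
      by (metis norm_triangle_sub add.commute)
    also have "\<dots> \<le> dU x * norm (z - x) + e' * norm (z - x)"
      using onorm[OF frechet_bounded_linear, of x "z - x"] x d(2)[OF z] by (intro add_mono) (auto simp: dU_def)
    finally have "norm (z - x) + norm (U z - U x) \<le> (1 + dU x + e') * norm (z - x)" by (simp add: algebra_simps)
    then have "exp (\<kappa> * \<bar>t\<bar>) * (norm (z - x) + norm (U z - U x)) \<le> exp (\<kappa> * \<bar>t\<bar>) * ((1 + dU x + e') * norm (z - x))"
      by (intro mult_left_mono) auto
    also have "\<dots> = (\<nu> t x + exp (\<kappa> * \<bar>t\<bar>) * e') * norm (z - x)" by (simp add: \<nu>_def algebra_simps)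
    also have "exp (\<kappa> * \<bar>t\<bar>) * e' = e" by (simp add: e'_def)
    finally show ?thesis using F_diff_le[of t z x] by linarith
  qed
  then show ?thesis using d(1) by blast
qed

lemma \<nu>_ge_1: "1 \<le> \<nu> t y"
proof -
  have "1 * 1 \<le> exp (\<kappa> * \<bar>t\<bar>) * (1 + dU y)"
    using dU_nonneg[of y] kappa_pos by (intro mult_mono) auto
  then show ?thesis by (simp add: \<nu>_def)
qed

sublocale area: area_map "F t" "\<nu> t" "- nondiff_set U" for t
proof
  show "negligible (- (- nondiff_set U))" using nondiff_negligible by simp
  show "\<nu> t \<in> borel_measurable lebesgue" unfolding \<nu>_def[abs_def] by measurable
qed (use F_continuous F_lusin F_local_lipschitz \<nu>_ge_1 in auto)

text \<open>Local integrability of |DU|^N is read off from the Rado--Reichelderfer density, which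
  dominates it almost everywhere; the pointwise derivative is not identified with the weak
  one.\<close>

lemma nn_integral_dU_finite:
  "(\<integral>\<^sup>+y. ennreal ((1 + dU y) ^ CARD('n)) * indicator (cball 0 R) y \<partial>lebesgue) < \<infinity>"
proof -
  define n where "n = CARD('n)"
  define \<Omega> where "\<Omega> = ball (0::real^'n) (\<bar>R\<bar> + 1)"
  have \<Omega>: "bounded \<Omega>" "open \<Omega>" by (auto simp: \<Omega>_def)
  obtain \<Theta> where rr: "rr_bound \<Omega> \<Theta> U" using U_rr_bound[OF \<Omega>] by blast
  have [measurable]: "\<Theta> \<in> borel_measurable borel" "\<Omega> \<in> sets borel" using rr \<Omega> by (auto simp: rr_bound_def)
  have fin: "(\<integral>\<^sup>+x. \<Theta> x * indicator \<Omega> x \<partial>lborel) < \<infinity>" using rr by (auto simp: rr_bound_def)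
  define c where "c = (2 * (real n + 1)) ^ n"
  define E where "E = {y\<in>\<Omega>. U differentiable (at y) \<and> \<not> ennreal (onorm (frechet_derivative U (at y)) ^ n) \<le> ennreal c * \<Theta> y}"
  have E: "negligible E"
    unfolding E_def c_def n_def by (rule rr_bound_onorm_le[OF rr \<Omega>(2) emeasure_bounded_open[OF \<Omega>]])
  have "AE y in lebesgue. y \<notin> E" using E by (simp add: negligible_iff_null_sets AE_not_in)
  then have ae: "AE y in lebesgue. ennreal ((1 + dU y) ^ n) * indicator (cball 0 R) y \<le>
      ennreal (2 ^ n) * indicator \<Omega> y + ennreal (2 ^ n * c) * (\<Theta> y * indicator \<Omega> y)"
  proof eventually_elim
    case (elim y)
    show ?case
    proof (cases "y \<in> cball 0 R")
      case True
      then have y: "y \<in> \<Omega>" by (auto simp: \<Omega>_def)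
      have c0: "c \<ge> 0" by (simp add: c_def)
      have "(1 + dU y) ^ n \<le> 2 ^ n * (1 ^ n + dU y ^ n)" by (intro power_add_le) (auto simp: dU_nonneg)
      then have "ennreal ((1 + dU y) ^ n) \<le> ennreal (2 ^ n + 2 ^ n * dU y ^ n)" by (intro ennreal_leI) (simp add: distrib_left)
      also have "\<dots> = ennreal (2 ^ n) + ennreal (2 ^ n) * ennreal (dU y ^ n)"
        using dU_nonneg[of y] by (subst ennreal_plus, simp_all, subst ennreal_mult, simp_all)
      also have "ennreal (dU y ^ n) \<le> ennreal c * \<Theta> y"
      proof (cases "y \<in> nondiff_set U")
        case True
        then have "dU y ^ n = 0" by (simp add: dU_def n_def)
        then show ?thesis by (simp only: ennreal_0 zero_le)
      next
        case False
        then show ?thesis using elim y by (simp add: E_def dU_def nondiff_set_def)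
      qed
      finally have "ennreal ((1 + dU y) ^ n) \<le> ennreal (2 ^ n) + ennreal (2 ^ n) * (ennreal c * \<Theta> y)"
        by (simp add: add_left_mono mult_left_mono)
      then show ?thesis using True y c0 by (simp add: ennreal_mult mult.assoc)
    qed simp
  qed
  have "(\<integral>\<^sup>+y. ennreal ((1 + dU y) ^ n) * indicator (cball 0 R) y \<partial>lebesgue)
      \<le> (\<integral>\<^sup>+y. ennreal (2 ^ n) * indicator \<Omega> y + ennreal (2 ^ n * c) * (\<Theta> y * indicator \<Omega> y) \<partial>lebesgue)"
    by (rule nn_integral_mono_AE[OF ae])
  also have "\<dots> = (\<integral>\<^sup>+y. ennreal (2 ^ n) * indicator \<Omega> y + ennreal (2 ^ n * c) * (\<Theta> y * indicator \<Omega> y) \<partial>lborel)"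
    by (rule nn_integral_completion) measurable
  also have "\<dots> = (\<integral>\<^sup>+y. ennreal (2 ^ n) * indicator \<Omega> y \<partial>lborel) + (\<integral>\<^sup>+y. ennreal (2 ^ n * c) * (\<Theta> y * indicator \<Omega> y) \<partial>lborel)"
    by (rule nn_integral_add) measurable
  also have "\<dots> = ennreal (2 ^ n) * emeasure lborel \<Omega> + ennreal (2 ^ n * c) * (\<integral>\<^sup>+y. \<Theta> y * indicator \<Omega> y \<partial>lborel)"
    by (subst nn_integral_cmult_indicator, simp, subst nn_integral_cmult, simp_all)
  also have "\<dots> < \<infinity>" using fin emeasure_bounded_open[OF \<Omega>] by (simp add: ennreal_mult_less_top)
  finally show ?thesis by (simp add: n_def)
qed

lemma area_I: "area.I t R = ennreal (exp (real CARD('n) * \<kappa> * \<bar>t\<bar>)) *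
    (\<integral>\<^sup>+y. ennreal ((1 + dU y) ^ CARD('n)) * indicator (cball 0 R) y \<partial>lebesgue)"
proof -
  have [measurable]: "cball 0 R \<in> sets (lebesgue :: (real^'n) measure)" by (rule lmeasurable_cball[THEN fmeasurableD])
  have "ennreal (\<nu> t y ^ CARD('n)) = ennreal (exp (real CARD('n) * \<kappa> * \<bar>t\<bar>)) * ennreal ((1 + dU y) ^ CARD('n))" for y
    using dU_nonneg[of y]
    by (subst ennreal_mult[symmetric]) (auto simp: \<nu>_def power_mult_distrib exp_of_nat_mult[symmetric] mult.assoc)
  then have "area.I t R = (\<integral>\<^sup>+y. ennreal (exp (real CARD('n) * \<kappa> * \<bar>t\<bar>)) * (ennreal ((1 + dU y) ^ CARD('n)) * indicator (cball 0 R) y) \<partial>lebesgue)"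
    unfolding area.I_def by (simp only: mult.assoc)
  also have "\<dots> = ennreal (exp (real CARD('n) * \<kappa> * \<bar>t\<bar>)) * (\<integral>\<^sup>+y. ennreal ((1 + dU y) ^ CARD('n)) * indicator (cball 0 R) y \<partial>lebesgue)"
    by (rule nn_integral_cmult) measurable
  finally show ?thesis .
qed

lemma area_I_finite: "area.I t R < \<infinity>"
  unfolding area_I using nn_integral_dU_finite by (simp add: ennreal_mult_less_top)

text \<open>The sphere and the non-differentiability set are null, so the closed ball may be opened
  and the default value 0 of \<open>dU\<close> replaced by whatever
  \<open>frechet_derivative\<close> returns there.\<close>

lemma area_I_ball: "area.I t R = ennreal (exp (real CARD('n) * \<kappa> * \<bar>t\<bar>)) *
    (\<integral>\<^sup>+y\<in>ball 0 R. ennreal ((1 + onorm (frechet_derivative U (at y))) ^ CARD('n)) \<partial>lebesgue)"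
proof -
  have "AE y in lebesgue. y \<notin> nondiff_set U"
    using nondiff_negligible by (simp add: negligible_iff_null_sets AE_not_in)
  moreover have "AE y in lebesgue. y \<notin> sphere (0::real^'n) R"
    by (rule AE_not_in) (simp only: negligible_iff_null_sets[symmetric] negligible_sphere)
  ultimately have "AE y in lebesgue. ennreal ((1 + dU y) ^ CARD('n)) * indicator (cball 0 R) y
      = ennreal ((1 + onorm (frechet_derivative U (at y))) ^ CARD('n)) * indicator (ball 0 R) y"
  proof eventually_elim
    case (elim y)
    then have "indicator (cball 0 R) y = (indicator (ball 0 R) y :: ennreal)" by (auto simp: indicator_def)
    then show ?case using elim(1) by (simp add: dU_def)
  qed
  then show ?thesis unfolding area_I by (intro arg_cong2[where f = "(*)"] refl nn_integral_cong_AE)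
qed

lemma count_R_eq: "count_R F R t = area.count t R"
  by (simp add: fun_eq_iff count_R_def area.count_def Let_def)

lemma count_measure:
  assumes n: "1 \<le> n"
  shows "{x. count_R F R t x \<ge> enat n} \<in> sets lebesgue"
    "emeasure lebesgue {x. count_R F R t x \<ge> enat n} \<le> ennreal (exp (real CARD('n) * \<kappa> * \<bar>t\<bar>) / real n) *
       (\<integral>\<^sup>+y\<in>ball 0 R. ennreal ((1 + onorm (frechet_derivative U (at y))) ^ CARD('n)) \<partial>lebesgue)"
proof -
  show "{x. count_R F R t x \<ge> enat n} \<in> sets lebesgue" unfolding count_R_eq by (rule area.count_ge_sets)
  define J where "J = (\<integral>\<^sup>+y\<in>ball 0 R. ennreal ((1 + onorm (frechet_derivative U (at y))) ^ CARD('n)) \<partial>lebesgue)"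
  define e where "e = emeasure lebesgue {x. count_R F R t x \<ge> enat n}"
  have "ennreal (real n) * e \<le> ennreal (exp (real CARD('n) * \<kappa> * \<bar>t\<bar>)) * J"
    using area.count_ge_measure[of n t R] unfolding area_I_ball e_def J_def count_R_eq
    by (simp add: ennreal_of_nat_eq_real_of_nat)
  then have "ennreal (1 / real n) * (ennreal (real n) * e) \<le> ennreal (1 / real n) * (ennreal (exp (real CARD('n) * \<kappa> * \<bar>t\<bar>)) * J)"
    by (rule mult_left_mono) simp
  moreover have "ennreal (1 / real n) * (ennreal (real n) * e) = e"
    using n by (subst mult.assoc[symmetric], subst ennreal_mult[symmetric]) auto
  moreover have "ennreal (1 / real n) * (ennreal (exp (real CARD('n) * \<kappa> * \<bar>t\<bar>)) * J) = ennreal (exp (real CARD('n) * \<kappa> * \<bar>t\<bar>) / real n) * J"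
    using n by (subst mult.assoc[symmetric], subst ennreal_mult[symmetric]) auto
  ultimately show "emeasure lebesgue {x. count_R F R t x \<ge> enat n} \<le> ennreal (exp (real CARD('n) * \<kappa> * \<bar>t\<bar>) / real n) * J"
    by (simp add: e_def)
qed

text \<open>Finiteness holds outside one null set for all balls of integer radius, and every fibre
  lies in one of them because F t is proper.\<close>

lemma fiber_finite_AE: "AE x in lebesgue. finite (F t -` {x})"
proof -
  have "AE x in lebesgue. \<forall>k::nat. finite (F t -` {x} \<inter> cball 0 (real k))"
    unfolding AE_all_countable
  proof
    fix k :: nat
    have "{x. infinite (F t -` {x} \<inter> cball 0 (real k))} \<in> null_sets lebesgue"
      by (rule area.count_infinite_null[OF area_I_finite])
    from AE_not_in[OF this] show "AE x in lebesgue. finite (F t -` {x} \<inter> cball 0 (real k))" by simp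
  qed
  then show ?thesis
  proof eventually_elim
    case (elim x)
    have "bounded (F t -` {x})" by (intro compact_imp_bounded F_proper) simp
    then obtain B where B: "\<And>y. y \<in> F t -` {x} \<Longrightarrow> norm y \<le> B" by (auto simp: bounded_iff)
    obtain k :: nat where "B \<le> real k" using real_arch_simple by blast
    then have "F t -` {x} \<inter> cball 0 (real k) = F t -` {x}" using B by (fastforce intro: order_trans)
    then show ?case using elim by metis
  qed
qed

section \<open>Jacobian determinant and caustic\<close>

lemma jacobian_entries:
  assumes "y \<in> - nondiff_set U"
  shows "jacobian (F t) (at y) $ i $ j = frechet_derivative (F t) (at y) (axis j 1) $ i"
  by (simp add: jacobian_def matrix_def)

lemma F_has_derivative:
  "y \<in> - nondiff_set U \<Longrightarrow> (F t has_derivative frechet_derivative (F t) (at y)) (at y)"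
  using F_differentiable by (simp add: nondiff_set_def frechet_derivative_works[symmetric])

lemma jac_det_measurable [measurable]: "jac_det U F t \<in> borel_measurable lebesgue"
proof -
  define D where "D = - nondiff_set U"
  define e where "e i j y = (if y \<in> D then frechet_derivative (F t) (at y) (axis j 1) else 0) $ i" for i j y
  have [measurable]: "e i j \<in> borel_measurable lebesgue" for i j
  proof -
    have "(\<lambda>y. if y \<in> D then frechet_derivative (F t) (at y) (axis j 1) else 0) \<in> borel_measurable lebesgue"
      unfolding D_def
      by (rule frechet_derivative_direction_measurable[OF F_continuous diff_sets]) (simp add: nondiff_set_def F_differentiable)
    moreover have "(\<lambda>v::real^'n. v $ i) \<in> borel_measurable borel"
      by (intro borel_measurable_continuous_onI continuous_intros)
    ultimately show ?thesis unfolding e_def[abs_def] by (rule measurable_compose)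
  qed
  have [measurable]: "D \<in> sets lebesgue" unfolding D_def by (rule diff_sets)
  have "jac_det U F t = (\<lambda>y. if y \<in> D then \<bar>\<Sum>p\<in>{p. p permutes UNIV}. of_int (sign p) * (\<Prod>i\<in>UNIV. e i (p i) y)\<bar> else 0)"
    by (auto simp: fun_eq_iff jac_det_def D_def e_def det_def jacobian_entries)
  also have "\<dots> \<in> borel_measurable lebesgue" by measurable
  finally show ?thesis .
qed

text \<open>The pointwise Lipschitz constant bounds every directional derivative, hence the operator
  norm, and with it the determinant.\<close>

lemma jac_det_le: "jac_det U F t y \<le> fact CARD('n) * \<nu> t y ^ CARD('n)"
proof (cases "y \<in> nondiff_set U")
  case True
  then show ?thesis using \<nu>_ge_1[of t y] by (simp add: jac_det_def)
next
  case False
  let ?D = "frechet_derivative (F t) (at y)"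
  have D: "(F t has_derivative ?D) (at y)" using False by (intro F_has_derivative) simp
  have lin: "linear ?D" by (rule has_derivative_linear[OF D])
  have "onorm ?D \<le> \<nu> t y"
  proof (rule onorm_bound)
    show "0 \<le> \<nu> t y" using \<nu>_ge_1[of t y] by simp
    fix v
    show "norm (?D v) \<le> \<nu> t y * norm v"
    proof (rule field_le_epsilon)
      fix e :: real assume e: "e > 0"
      \<comment> \<open>The added 1 covers v = 0.\<close>
      define e' where "e' = e / (norm v + 1)"
      have nv: "norm v + 1 > 0" by (simp add: add_nonneg_pos)
      have e': "e' > 0" using e nv by (simp add: e'_def)
      have "norm (?D v) \<le> (\<nu> t y + e') * norm v"
      proof (rule tendsto_upperbound)
        show "((\<lambda>s. norm ((F t (y + s *\<^sub>R v) - F t y) /\<^sub>R s)) \<longlongrightarrow> norm (?D v)) (at_right 0)"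
          using D by (intro tendsto_norm tendsto_mono[OF at_le frechet_derivative_direction_tendsto]) (auto simp: differentiable_def)
        obtain d where d: "d > 0" "\<And>z. norm (z - y) < d \<Longrightarrow> norm (F t z - F t y) \<le> (\<nu> t y + e') * norm (z - y)"
          using F_local_lipschitz[of y e' t] False e' by auto
        have "d / (norm v + 1) > 0" using d nv by simp
        then have "\<forall>\<^sub>F s in at_right 0. 0 < s \<and> s < d / (norm v + 1)" by (rule eventually_at_right_pos_less)
        then show "\<forall>\<^sub>F s in at_right 0. norm ((F t (y + s *\<^sub>R v) - F t y) /\<^sub>R s) \<le> (\<nu> t y + e') * norm v"
        proof eventually_elim
          case (elim s)
          have "s * (norm v + 1) < d" using elim nv by (simp add: pos_less_divide_eq)
          moreover have "s * norm v \<le> s * (norm v + 1)" using elim by simp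
          ultimately have "s * norm v < d" by linarith
          then have "norm ((y + s *\<^sub>R v) - y) < d" using elim by (simp only: add_diff_cancel_left' norm_scaleR abs_of_pos)
          from d(2)[OF this] have "norm (F t (y + s *\<^sub>R v) - F t y) \<le> (\<nu> t y + e') * (s * norm v)" using elim by simp
          then have "norm (F t (y + s *\<^sub>R v) - F t y) / s \<le> (\<nu> t y + e') * norm v"
            using elim by (simp add: pos_divide_le_eq mult_ac)
          then show ?case using elim by (simp add: divide_inverse mult.commute)
        qed
      qed simp
      also have "\<dots> = \<nu> t y * norm v + e' * norm v" by (simp add: algebra_simps)
      also have "e' * norm v \<le> e"
      proof -
        have "e' * norm v \<le> e' * (norm v + 1)" using e' by simp
        also have "\<dots> = e" using nv by (simp add: e'_def)
        finally show ?thesis .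
      qed
      finally show "norm (?D v) \<le> \<nu> t y * norm v + e" by simp
    qed
  qed
  moreover have "(*v) (matrix ?D) = ?D" using lin by (simp add: fun_eq_iff matrix_works linear_def scalar_mult_eq_scaleR[abs_def])
  ultimately have "fact CARD('n) * onorm ((*v) (matrix ?D)) ^ CARD('n) \<le> fact CARD('n) * \<nu> t y ^ CARD('n)"
    using onorm_pos_le[OF has_derivative_bounded_linear[OF D]] by (intro mult_left_mono power_mono) auto
  then have "\<bar>det (matrix ?D)\<bar> \<le> fact CARD('n) * \<nu> t y ^ CARD('n)" using abs_det_le_onorm[of "matrix ?D"] by (rule order_trans[rotated])
  then show ?thesis using False by (simp add: jac_det_def jacobian_def)
qed

lemma jac_det_integrable: assumes K: "compact K" shows "set_integrable lebesgue K (jac_det U F t)"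
proof -
  obtain R where R: "K \<subseteq> cball 0 R" using bounded_subset_ballD[OF compact_imp_bounded[OF K], of 0] ball_subset_cball by blast
  have [measurable]: "K \<in> sets lebesgue" using K by (simp add: borel_compact)
  have [measurable]: "cball 0 R \<in> sets (lebesgue :: (real^'n) measure)" by (rule lmeasurable_cball[THEN fmeasurableD])
  have nn: "0 \<le> jac_det U F t y" for y by (simp add: jac_det_def)
  have "(\<integral>\<^sup>+y. ennreal (norm (indicator K y *\<^sub>R jac_det U F t y)) \<partial>lebesgue)
      \<le> (\<integral>\<^sup>+y. ennreal (fact CARD('n)) * (ennreal (\<nu> t y ^ CARD('n)) * indicator (cball 0 R) y) \<partial>lebesgue)"
  proof (rule nn_integral_mono)
    fix y
    show "ennreal (norm (indicator K y *\<^sub>R jac_det U F t y)) \<le> ennreal (fact CARD('n)) * (ennreal (\<nu> t y ^ CARD('n)) * indicator (cball 0 R) y)"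
    proof (cases "y \<in> K")
      case True
      have "ennreal (jac_det U F t y) \<le> ennreal (fact CARD('n) * \<nu> t y ^ CARD('n))" by (rule ennreal_leI[OF jac_det_le])
      also have "\<dots> = ennreal (fact CARD('n)) * ennreal (\<nu> t y ^ CARD('n))"
        by (rule ennreal_mult) (use \<nu>_ge_1[of t y] in auto)
      finally show ?thesis using True R nn[of y] by auto
    qed simp
  qed
  also have "\<dots> = ennreal (fact CARD('n)) * area.I t R"
    unfolding area.I_def by (rule nn_integral_cmult) measurable
  also have "\<dots> < \<infinity>" using area_I_finite by (simp add: ennreal_mult_less_top)
  finally show ?thesis unfolding set_integrable_def by (intro integrableI_bounded) measurable
qed

text \<open>The image of the non-differentiability set is null by Lusin's property. The critical set
  is cut into bounded pieces because the slab argument works inside an open set of finite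
  measure.\<close>

lemma caustic_null: "caustic U F t \<in> null_sets lebesgue"
proof -
  have "caustic U F t = F t ` nondiff_set U \<union> (\<Union>k::nat. F t ` (zero_jac_set U F t \<inter> ball 0 (real k)))"
  proof -
    have "zero_jac_set U F t = (\<Union>k::nat. zero_jac_set U F t \<inter> ball 0 (real k))" using reals_Archimedean2 by auto
    then have "F t ` zero_jac_set U F t = (\<Union>k::nat. F t ` (zero_jac_set U F t \<inter> ball 0 (real k)))" by blast
    moreover have "caustic U F t = F t ` nondiff_set U \<union> F t ` zero_jac_set U F t" by (auto simp: caustic_def)
    ultimately show ?thesis by simp
  qed
  moreover have "negligible (F t ` (zero_jac_set U F t \<inter> ball 0 (real k)))" for k
  proof (rule negligible_image_det_zero[where W = "ball 0 (real k)"])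
    fix y assume "y \<in> zero_jac_set U F t \<inter> ball 0 (real k)"
    then have y: "y \<in> - nondiff_set U" "jac_det U F t y = 0" by (auto simp: zero_jac_set_def)
    show "(F t has_derivative frechet_derivative (F t) (at y)) (at y)" by (rule F_has_derivative[OF y(1)])
    show "det (matrix (frechet_derivative (F t) (at y))) = 0" using y by (simp add: jac_det_def jacobian_def)
  qed (auto intro: F_lusin)
  ultimately have "negligible (caustic U F t)"
    using F_lusin[OF nondiff_negligible] by (simp add: negligible_Un negligible_Union_nat)
  then show ?thesis by (simp add: negligible_iff_null_sets)
qed

end

section \<open>Hausdorff measure of space-time fibres\<close>

text \<open>For fixed \<delta> all sufficiently late covers are admissible, so the lower limit of
  their total diameters bounds the infimum at scale \<delta>, uniformly in \<delta>.\<close>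

lemma hausdorff1_le_liminf:
  fixes A :: "'a::metric_space set" and S :: "nat \<Rightarrow> 'i \<Rightarrow> 'a set"
  assumes fin: "\<And>k. finite (J k)"
    and cover: "\<And>k. A \<subseteq> (\<Union>i\<in>J k. S k i)"
    and small: "\<And>k i. i \<in> J k \<Longrightarrow> bounded (S k i) \<and> diameter (S k i) \<le> d k"
    and d: "d \<longlonglongrightarrow> 0"
  shows "hausdorff1 A \<le> liminf (\<lambda>k. \<Sum>i\<in>J k. ennreal (d k))"
  unfolding hausdorff1_def
proof (rule SUP_least)
  fix \<delta> :: real assume "\<delta> \<in> {0<..}"
  then have ev: "\<forall>\<^sub>F k in sequentially. d k < \<delta>" using order_tendstoD(2)[OF d] by simp
  let ?C = "{S :: nat \<Rightarrow> 'a set. A \<subseteq> (\<Union>i. S i) \<and> (\<forall>i. bounded (S i) \<and> diameter (S i) \<le> \<delta>)}"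
  show "(INF S\<in>?C. \<Sum>i. ennreal (diameter (S i))) \<le> liminf (\<lambda>k. \<Sum>i\<in>J k. ennreal (d k))"
  proof (rule Liminf_bounded)
    show "\<forall>\<^sub>F k in sequentially. (INF S\<in>?C. \<Sum>i. ennreal (diameter (S i))) \<le> (\<Sum>i\<in>J k. ennreal (d k))"
      using ev
    proof eventually_elim
      case (elim k)
      obtain b where b: "bij_betw b {0..<card (J k)} (J k)" using ex_bij_betw_nat_finite[OF fin[of k]] by blast
      \<comment> \<open>\<open>hausdorff1\<close> asks for sequences of sets; the empty set pads the
        finite family since its diameter is 0.\<close>
      define S' where "S' i = (if i < card (J k) then S k (b i) else {})" for i
      have bJ: "i < card (J k) \<Longrightarrow> b i \<in> J k" for i using b by (auto simp: bij_betw_def)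
      have "A \<subseteq> (\<Union>i. S' i)"
      proof
        fix a assume "a \<in> A"
        then obtain j where "j \<in> J k" "a \<in> S k j" using cover[of k] by blast
        moreover have "j \<in> b ` {0..<card (J k)}" using b \<open>j \<in> J k\<close> by (simp add: bij_betw_imp_surj_on)
        then obtain i where "i < card (J k)" "b i = j" by auto
        ultimately have "a \<in> S' i" by (simp add: S'_def)
        then show "a \<in> (\<Union>i. S' i)" by blast
      qed
      moreover have "bounded (S' i) \<and> diameter (S' i) \<le> \<delta>" for i
        using small[OF bJ, of i] elim \<open>\<delta> \<in> {0<..}\<close> by (auto simp: S'_def)
      ultimately have "S' \<in> ?C" by simp
      then have "(INF S\<in>?C. \<Sum>i. ennreal (diameter (S i))) \<le> (\<Sum>i. ennreal (diameter (S' i)))"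
        by (rule INF_lower)
      also have "\<dots> = (\<Sum>i<card (J k). ennreal (diameter (S' i)))"
        by (rule suminf_finite) (auto simp: S'_def)
      also have "\<dots> \<le> (\<Sum>i<card (J k). ennreal (d k))"
        using small[OF bJ] by (intro sum_mono ennreal_leI) (auto simp: S'_def)
      also have "\<dots> = (\<Sum>i\<in>J k. ennreal (d k))" by simp
      finally show ?case .
    qed
  qed
qed

text \<open>Fatou's lemma for the total diameter \<open>\<phi> k x\<close> of the pieces needed to cover the fibre over \<open>x\<close>.\<close>

lemma hausdorff1_fibre_finite_AE:
  fixes A :: "'a::metric_space set" and S :: "nat \<Rightarrow> 'i \<Rightarrow> 'a set" and W :: "nat \<Rightarrow> 'i \<Rightarrow> 'b set"
  assumes fin: "\<And>k. finite (J k)"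
    and cover: "\<And>k. A \<subseteq> (\<Union>i\<in>J k. S k i)"
    and small: "\<And>k i. i \<in> J k \<Longrightarrow> bounded (S k i) \<and> diameter (S k i) \<le> d k"
    and d: "d \<longlonglongrightarrow> 0"
    and W: "\<And>k i. i \<in> J k \<Longrightarrow> g ` S k i \<subseteq> W k i" "\<And>k i. i \<in> J k \<Longrightarrow> W k i \<in> sets M"
    and bound: "\<And>k. (\<Sum>i\<in>J k. ennreal (d k) * emeasure M (W k i)) \<le> B" "B < \<infinity>"
  shows "AE x in M. hausdorff1 (A \<inter> g -` {x}) < \<infinity>"
proof -
  define \<phi> where "\<phi> k x = (\<Sum>i\<in>J k. ennreal (d k) * indicator (W k i) x)" for k x
  have \<phi>m [measurable]: "\<phi> k \<in> borel_measurable M" for k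
    unfolding \<phi>_def[abs_def] using W(2) by (intro borel_measurable_sum borel_measurable_times borel_measurable_indicator) auto
  have "(\<integral>\<^sup>+x. liminf (\<lambda>k. \<phi> k x) \<partial>M) \<le> liminf (\<lambda>k. \<integral>\<^sup>+x. \<phi> k x \<partial>M)"
    by (rule nn_integral_liminf) measurable
  also have "\<dots> \<le> liminf (\<lambda>k::nat. B)"
  proof (intro Liminf_mono always_eventually allI)
    fix k
    have "(\<integral>\<^sup>+x. \<phi> k x \<partial>M) = (\<Sum>i\<in>J k. \<integral>\<^sup>+x. ennreal (d k) * indicator (W k i) x \<partial>M)"
      unfolding \<phi>_def using W(2) by (intro nn_integral_sum borel_measurable_times borel_measurable_indicator) auto
    also have "\<dots> = (\<Sum>i\<in>J k. ennreal (d k) * emeasure M (W k i))"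
      by (intro sum.cong refl nn_integral_cmult_indicator W(2))
    finally show "(\<integral>\<^sup>+x. \<phi> k x \<partial>M) \<le> B" using bound(1)[of k] by simp
  qed
  also have "\<dots> = B" by (simp add: Liminf_const)
  finally have "(\<integral>\<^sup>+x. liminf (\<lambda>k. \<phi> k x) \<partial>M) \<noteq> \<infinity>" using bound(2) by (auto simp: top_unique)
  moreover have "(\<lambda>x. liminf (\<lambda>k. \<phi> k x)) \<in> borel_measurable M" by measurable
  ultimately have "AE x in M. liminf (\<lambda>k. \<phi> k x) \<noteq> \<infinity>" by (intro nn_integral_PInf_AE)
  then show ?thesis
  proof eventually_elim
    case (elim x)
    \<comment> \<open>A piece can meet the fibre over x only if x lies in the measurable set
      \<open>W\<close> containing its image, so those pieces cover the fibre and \<phi> k x is the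
      sum of the bounds on their diameters.\<close>
    have "hausdorff1 (A \<inter> g -` {x}) \<le> liminf (\<lambda>k. \<Sum>i\<in>{i\<in>J k. x \<in> W k i}. ennreal (d k))"
    proof (rule hausdorff1_le_liminf[where S = S])
      fix k
      show "A \<inter> g -` {x} \<subseteq> (\<Union>i\<in>{i\<in>J k. x \<in> W k i}. S k i)"
      proof
        fix a assume a: "a \<in> A \<inter> g -` {x}"
        then obtain i where "i \<in> J k" "a \<in> S k i" using cover[of k] by blast
        then show "a \<in> (\<Union>i\<in>{i\<in>J k. x \<in> W k i}. S k i)" using W(1)[of i k] a by auto
      qed
    qed (use fin small d in auto)
    also have "(\<lambda>k. \<Sum>i\<in>{i\<in>J k. x \<in> W k i}. ennreal (d k)) = (\<lambda>k. \<phi> k x)"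
      unfolding \<phi>_def using fin by (auto simp: fun_eq_iff indicator_def sum.If_cases Int_def intro!: sum.cong)
    finally show ?case using elim by (auto simp: less_top)
  qed
qed

text \<open>The closure of the half-open cell with index z, written with centre and half-side so
  that the estimates on \<open>cube\<close> apply to it.\<close>

definition grid_cube :: "nat \<Rightarrow> ('n::finite \<Rightarrow> int) \<Rightarrow> (real^'n) set" where
  "grid_cube k z = cube (\<chi> i. (real_of_int (z i) + 1/2) / real (Suc k)) (1 / (2 * real (Suc k)))"

lemma mem_grid_cube: "y \<in> grid_cube k z \<longleftrightarrow> (\<forall>i. real_of_int (z i) \<le> real (Suc k) * y $ i \<and> real (Suc k) * y $ i \<le> real_of_int (z i) + 1)"
proof -
  have "\<bar>a - (b + 1/2) / c\<bar> \<le> 1 / (2 * c) \<longleftrightarrow> b \<le> c * a \<and> c * a \<le> b + 1" if "c > 0" for a b c :: real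
  proof -
    have "a - (b + 1/2) / c = (c * a - (b + 1/2)) / c" using that by (simp add: field_simps)
    then have "\<bar>a - (b + 1/2) / c\<bar> = \<bar>c * a - (b + 1/2)\<bar> / c" using that by (simp only: abs_divide abs_of_pos)
    also have "\<dots> \<le> 1 / (2 * c) \<longleftrightarrow> \<bar>c * a - (b + 1/2)\<bar> \<le> 1 / 2" using that by (simp add: field_simps)
    also have "\<dots> \<longleftrightarrow> b \<le> c * a \<and> c * a \<le> b + 1" by (smt (verit) field_sum_of_halves)
    finally show ?thesis .
  qed
  then show ?thesis unfolding grid_cube_def cube_def by (simp del: of_nat_Suc)
qed

lemma mem_grid_cube_grid_index: "y \<in> grid_cube k (grid_index k y)"
  unfolding mem_grid_cube grid_index_def by (auto intro: less_imp_le)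

lemma negligible_grid_lines: "negligible {y::real^'n. \<exists>i. real (Suc k) * y $ i \<in> \<int>}"
proof -
  have "{y::real^'n. \<exists>i. real (Suc k) * y $ i \<in> \<int>} = (\<Union>i. \<Union>m::int. {y. y $ i = real_of_int m / real (Suc k)})"
    by (auto simp: Ints_def field_simps)
  moreover have "negligible {y::real^'n. y $ i = a}" for i a
    using negligible_standard_hyperplane[of "axis i (1::real)" a] by (simp add: inner_axis axis_in_Basis_iff)
  then have "negligible (\<Union>i. \<Union>m::int. {y::real^'n. y $ i = real_of_int m / real (Suc k)})"
    by (intro negligible_countable_Union countable_image countableI_type) auto
  ultimately show ?thesis by simp
qed

text \<open>Closed grid cubes overlap only in the grid hyperplanes, a null set; off it a point lies
  in no grid cube but the one of its own index.\<close>

lemma sum_nn_integral_grid_cube_le: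
  fixes \<Theta> :: "real^'n \<Rightarrow> ennreal"
  assumes [measurable]: "\<Theta> \<in> borel_measurable borel" "\<Omega> \<in> sets borel"
    and Z: "finite Z" "\<And>z. z \<in> Z \<Longrightarrow> grid_cube k z \<subseteq> \<Omega>"
  shows "(\<Sum>z\<in>Z. \<integral>\<^sup>+y. \<Theta> y * indicator (grid_cube k z) y \<partial>lborel) \<le> (\<integral>\<^sup>+y. \<Theta> y * indicator \<Omega> y \<partial>lborel)"
proof -
  have [measurable]: "grid_cube k z \<in> sets borel" for z :: "'n \<Rightarrow> int" by (simp add: grid_cube_def borel_compact compact_cube)
  have "(\<Sum>z\<in>Z. \<integral>\<^sup>+y. \<Theta> y * indicator (grid_cube k z) y \<partial>lborel) = (\<integral>\<^sup>+y. (\<Sum>z\<in>Z. \<Theta> y * indicator (grid_cube k z) y) \<partial>lborel)"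
    by (rule nn_integral_sum[symmetric]) measurable
  also have "\<dots> = (\<integral>\<^sup>+y. (\<Sum>z\<in>Z. \<Theta> y * indicator (grid_cube k z) y) \<partial>lebesgue)"
    by (rule nn_integral_completion[symmetric]) measurable
  also have "\<dots> \<le> (\<integral>\<^sup>+y. \<Theta> y * indicator \<Omega> y \<partial>lebesgue)"
  proof (rule nn_integral_mono_AE)
    have "AE y in lebesgue. y \<notin> {y::real^'n. \<exists>i. real (Suc k) * y $ i \<in> \<int>}"
      using negligible_grid_lines by (intro AE_not_in) (simp only: negligible_iff_null_sets)
    then show "AE y in lebesgue. (\<Sum>z\<in>Z. \<Theta> y * indicator (grid_cube k z) y) \<le> \<Theta> y * indicator \<Omega> y"
    proof eventually_elim
      case (elim y)
      have uniq: "z = grid_index k y" if "y \<in> grid_cube k z" for z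
      proof
        fix i
        have "real_of_int (z i) \<le> real (Suc k) * y $ i" "real (Suc k) * y $ i \<le> real_of_int (z i) + 1"
          using that by (auto simp only: mem_grid_cube)
        moreover have "real (Suc k) * y $ i \<noteq> real_of_int (z i) + 1"
          using elim by (metis (mono_tags, lifting) Ints_1 Ints_add Ints_of_int mem_Collect_eq)
        ultimately show "z i = grid_index k y i" unfolding grid_index_def by linarith
      qed
      show ?case
      proof (cases "y \<in> grid_cube k (grid_index k y) \<and> grid_index k y \<in> Z")
        case True
        have "(\<Sum>z\<in>Z. \<Theta> y * indicator (grid_cube k z) y) = (\<Sum>z\<in>Z. if z = grid_index k y then \<Theta> y else 0)"
          using uniq True by (intro sum.cong) (auto simp: indicator_def)
        also have "\<dots> = \<Theta> y" using Z(1) True by simp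
        finally show ?thesis using True Z(2)[of "grid_index k y"] by (auto simp: indicator_def)
      next
        case False
        have "(\<Sum>z\<in>Z. \<Theta> y * indicator (grid_cube k z) y) = 0"
        proof (rule sum.neutral, rule ballI)
          fix z assume "z \<in> Z"
          then have "y \<notin> grid_cube k z" using uniq False by metis
          then show "\<Theta> y * indicator (grid_cube k z) y = 0" by simp
        qed
        then show ?thesis by simp
      qed
    qed
  qed
  also have "\<dots> = (\<integral>\<^sup>+y. \<Theta> y * indicator \<Omega> y \<partial>lborel)" by (rule nn_integral_completion) measurable
  finally show ?thesis .
qed

lemma norm_diff_grid_cube_le:
  fixes y w :: "real^'n"
  assumes "y \<in> grid_cube k z" "w \<in> grid_cube k z"
  shows "norm (y - w) \<le> real CARD('n) / real (Suc k)"
proof -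
  have "norm (y - w) \<le> real CARD('n) * (1 / real (Suc k))"
  proof (rule norm_le_card_mult_sup)
    fix i
    have "\<bar>real (Suc k) * y $ i - real (Suc k) * w $ i\<bar> \<le> 1" using assms unfolding mem_grid_cube by (smt (verit))
    then have "real (Suc k) * \<bar>y $ i - w $ i\<bar> \<le> 1" by (simp only: right_diff_distrib[symmetric] abs_mult abs_of_nat)
    then show "\<bar>(y - w) $ i\<bar> \<le> 1 / real (Suc k)" unfolding vector_minus_component
      by (subst pos_le_divide_eq) (auto simp: mult.commute)
  qed
  then show ?thesis by simp
qed

lemma card_floor_image_le:
  fixes T c :: real
  assumes "T > 0" "c > 0"
  shows "finite ((\<lambda>t. \<lfloor>c * t\<rfloor>) ` {-T..T})" "real (card ((\<lambda>t. \<lfloor>c * t\<rfloor>) ` {-T..T})) \<le> 2 * c * T + 2"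
proof -
  have sub: "(\<lambda>t. \<lfloor>c * t\<rfloor>) ` {-T..T} \<subseteq> {\<lfloor>- (c * T)\<rfloor>..\<lfloor>c * T\<rfloor>}"
  proof
    fix j assume "j \<in> (\<lambda>t. \<lfloor>c * t\<rfloor>) ` {-T..T}"
    then obtain t where t: "- T \<le> t" "t \<le> T" "j = \<lfloor>c * t\<rfloor>" by auto
    have "c * t \<le> c * T" "c * (- T) \<le> c * t" using t assms by (intro mult_left_mono; simp)+
    then have "c * t \<le> c * T" "- (c * T) \<le> c * t" by simp_all
    then show "j \<in> {\<lfloor>- (c * T)\<rfloor>..\<lfloor>c * T\<rfloor>}" using t by (auto intro: floor_mono)
  qed
  then show "finite ((\<lambda>t. \<lfloor>c * t\<rfloor>) ` {-T..T})" by (rule finite_subset) simp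
  have "card ((\<lambda>t. \<lfloor>c * t\<rfloor>) ` {-T..T}) \<le> card {\<lfloor>- (c * T)\<rfloor>..\<lfloor>c * T\<rfloor>}" by (rule card_mono[OF _ sub]) simp
  then have "real (card ((\<lambda>t. \<lfloor>c * t\<rfloor>) ` {-T..T})) \<le> real (nat (\<lfloor>c * T\<rfloor> - \<lfloor>- (c * T)\<rfloor> + 1))" by simp
  also have "\<dots> \<le> 2 * (c * T) + 2"
  proof -
    have "0 < c * T" using assms by simp
    then show ?thesis by linarith
  qed
  finally show "real (card ((\<lambda>t. \<lfloor>c * t\<rfloor>) ` {-T..T})) \<le> 2 * c * T + 2" by simp
qed

section \<open>Space-time fibres of the transport\<close>

context lorentz_transport
begin

lemma fibre_hausdorff1_finite_cball:
  assumes T: "T > 0"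
  shows "AE x in lborel. hausdorff1 (({-T..T} \<times> cball 0 R) \<inter> (\<lambda>(t, y). F t y) -` {x}) < \<infinity>"
proof -
  define n where "n = CARD('n)"
  have n: "0 < n" by (simp add: n_def)
  \<comment> \<open>A grid cube containing a point of the ball has diameter at most n / (k+1) \<le>
    n; the extra 1 keeps it inside the open ball.\<close>
  define \<Omega> where "\<Omega> = ball (0::real^'n) (\<bar>R\<bar> + real n + 1)"
  have \<Omega>: "bounded \<Omega>" "open \<Omega>" by (auto simp: \<Omega>_def)
  obtain \<Theta> where \<Theta>: "\<Theta> \<in> borel_measurable borel" "(\<integral>\<^sup>+y. \<Theta> y * indicator \<Omega> y \<partial>lborel) < \<infinity>"
    and le: "\<forall>m R s t x z. cube m R \<subseteq> \<Omega> \<longrightarrow> 0 < R \<longrightarrow> \<bar>s\<bar> \<le> T \<longrightarrow> \<bar>t\<bar> \<le> T \<longrightarrow> \<bar>t - s\<bar> \<le> 2 * R \<longrightarrow>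
      x \<in> cube m R \<longrightarrow> z \<in> cube m R \<longrightarrow>
      ennreal (norm (F t x - F s z) ^ CARD('n)) \<le> (\<integral>\<^sup>+y. \<Theta> y * indicator (cube m R) y \<partial>lborel)"
    using F_space_time[OF \<Omega>, of T] by blast
  define I where "I A = (\<integral>\<^sup>+y. \<Theta> y * indicator A y \<partial>lborel)" for A
  define \<tau> where "\<tau> k t = \<lfloor>real (Suc k) * t\<rfloor>" for k and t :: real
  \<comment> \<open>Duration 1 / (k+1) plus the bound n / (k+1) for the diameter of the spatial
    cube.\<close>
  define d where "d k = (1 + real n) / real (Suc k)" for k
  define S where "S k i = {t \<in> {-T..T}. \<tau> k t = fst i} \<times> {y \<in> cball 0 R. grid_index k y = snd i}" for k and i :: "int \<times> ('n \<Rightarrow> int)"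
  define J1 where "J1 k = \<tau> k ` {-T..T}" for k
  define J2 where "J2 k = (grid_index k ` cball 0 R :: ('n \<Rightarrow> int) set)" for k
  have J1: "finite (J1 k)" "real (card (J1 k)) \<le> 2 * real (Suc k) * T + 2" for k
    using card_floor_image_le[OF T, of "real (Suc k)"] by (simp_all add: J1_def \<tau>_def)
  have J2: "finite (J2 k)" for k unfolding J2_def by (rule finite_grid_index)
  have time: "\<bar>t - s\<bar> \<le> 1 / real (Suc k)" if "\<tau> k t = \<tau> k s" for k s t
  proof -
    have "\<bar>real (Suc k) * t - real (Suc k) * s\<bar> \<le> 1" using that unfolding \<tau>_def by linarith
    then have "real (Suc k) * \<bar>t - s\<bar> \<le> 1" by (simp only: right_diff_distrib[symmetric] abs_mult abs_of_nat)
    then show ?thesis by (subst pos_le_divide_eq) (auto simp: mult.commute)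
  qed
  have grid\<Omega>: "grid_cube k z \<subseteq> \<Omega>" if z: "z \<in> J2 k" for k z
  proof
    fix w assume w: "w \<in> grid_cube k z"
    obtain y where y: "norm y \<le> R" "z = grid_index k y" using z by (auto simp: J2_def)
    have "norm (w - y) \<le> real n / real (Suc k)"
      unfolding n_def by (rule norm_diff_grid_cube_le[OF w]) (simp add: y mem_grid_cube_grid_index)
    also have "\<dots> \<le> real n" by (simp add: divide_le_eq algebra_simps)
    finally show "w \<in> \<Omega>" using y norm_triangle_sub[of w y] by (simp add: \<Omega>_def)
  qed
  define P where "P k i W \<longleftrightarrow> W \<in> sets lborel \<and> (\<lambda>(t, y). F t y) ` S k i \<subseteq> W
      \<and> emeasure lborel W \<le> ennreal (2 ^ n) * I (grid_cube k (snd i))" for k i W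
  have "\<exists>W. W \<in> sets lborel \<and> (\<lambda>(t, y). F t y) ` S k i \<subseteq> W \<and> emeasure lborel W \<le> ennreal (2 ^ n) * I (grid_cube k (snd i))"
    if i: "i \<in> J1 k \<times> J2 k" for k i
  proof -
    have "fst i \<in> \<tau> k ` {-T..T}" "snd i \<in> grid_index k ` cball 0 R"
      using i by (simp_all only: J1_def J2_def mem_Times_iff)
    then obtain t0 y0 where "t0 \<in> {-T..T}" "\<tau> k t0 = fst i" "y0 \<in> cball 0 R" "grid_index k y0 = snd i"
      by (elim imageE) simp
    then have p0: "\<bar>t0\<bar> \<le> T" "\<tau> k t0 = fst i" "norm y0 \<le> R" "grid_index k y0 = snd i" by auto
    let ?Q = "grid_cube k (snd i)"
    have Q: "?Q \<subseteq> \<Omega>" using i by (intro grid\<Omega>) auto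
    have "I ?Q \<le> I \<Omega>" unfolding I_def using Q by (intro nn_integral_mono) (auto simp: indicator_def)
    then have "I ?Q < \<infinity>" using \<Theta>(2) unfolding I_def by (rule le_less_trans)
    then obtain a where a: "I ?Q = ennreal a" "0 \<le> a" by (cases "I ?Q" rule: ennreal_cases) auto
    \<comment> \<open>The times of a box differ by at most the side of its cube, as the space-time
      estimate demands, so its whole image is within root n a of the image of one chosen
      point.\<close>
    define W where "W = cube (F t0 y0) (root n a)"
    have r: "0 \<le> root n a" using a by (simp add: n)
    have "(\<lambda>(t, y). F t y) ` S k i \<subseteq> W"
    proof clarify
      fix t y assume p: "(t, y) \<in> S k i"
      have "ennreal (norm (F t y - F t0 y0) ^ n) \<le> I ?Q"
        unfolding I_def grid_cube_def n_def
      proof (rule le[rule_format])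
        show "cube (\<chi> j. (real_of_int (snd i j) + 1/2) / real (Suc k)) (1 / (2 * real (Suc k))) \<subseteq> \<Omega>"
          using Q by (simp only: grid_cube_def)
        show "\<bar>t - t0\<bar> \<le> 2 * (1 / (2 * real (Suc k)))" using time[of k t t0] p p0 by (simp add: S_def del: of_nat_Suc)
        show "y \<in> cube (\<chi> j. (real_of_int (snd i j) + 1/2) / real (Suc k)) (1 / (2 * real (Suc k)))"
          using mem_grid_cube_grid_index[of y k] p by (simp add: S_def grid_cube_def)
        show "y0 \<in> cube (\<chi> j. (real_of_int (snd i j) + 1/2) / real (Suc k)) (1 / (2 * real (Suc k)))"
          using mem_grid_cube_grid_index[of y0 k] p0 by (simp add: grid_cube_def)
      qed (use p p0 in \<open>auto simp: S_def\<close>)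
      then have "norm (F t y - F t0 y0) ^ n \<le> root n a ^ n" using a n by simp
      then have "norm (F t y - F t0 y0) \<le> root n a" using r n by (simp add: power_mono_iff)
      then have "\<bar>(F t y - F t0 y0) $ j\<bar> \<le> root n a" for j by (rule order_trans[OF component_le_norm_cart])
      then show "F t y \<in> W" by (simp add: W_def cube_def)
    qed
    moreover have "emeasure lborel W = ennreal (2 ^ n) * I ?Q"
    proof -
      have "(2 * root n a) ^ n = 2 ^ n * a" using a n by (simp add: power_mult_distrib)
      then show ?thesis using emeasure_cube[OF r, of "F t0 y0"] a by (simp add: W_def n_def ennreal_mult)
    qed
    moreover have "W \<in> sets lborel" by (simp add: W_def borel_compact compact_cube)
    ultimately show ?thesis by (intro exI[of _ W]) simp
  qed
  then have ex: "\<exists>W. P k i W" if "i \<in> J1 k \<times> J2 k" for k i using that unfolding P_def by blast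
  define W where "W k i = (SOME W. P k i W)" for k i
  have "P k i (W k i)" if "i \<in> J1 k \<times> J2 k" for k i unfolding W_def by (rule someI_ex[OF ex[OF that]])
  then have W: "i \<in> J1 k \<times> J2 k \<Longrightarrow> W k i \<in> sets lborel"
      "i \<in> J1 k \<times> J2 k \<Longrightarrow> (\<lambda>(t, y). F t y) ` S k i \<subseteq> W k i"
      "i \<in> J1 k \<times> J2 k \<Longrightarrow> emeasure lborel (W k i) \<le> ennreal (2 ^ n) * I (grid_cube k (snd i))" for k i
    unfolding P_def by blast+
  \<comment> \<open>There are at most 2 (k+1) T + 2 \<le> (k+1) (2 T + 2) time slots, and each
    diameter is at most (1 + n) / (k+1); the factor k + 1 cancels, which makes the bound uniform in
    k.\<close>
  define C where "C = (1 + real n) * (2 * T + 2)"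
  show ?thesis
  proof (rule hausdorff1_fibre_finite_AE[where J = "\<lambda>k. J1 k \<times> J2 k" and S = S and d = d and W = W])
    show "finite (J1 k \<times> J2 k)" for k using J1(1) J2 by simp
    show "{-T..T} \<times> cball 0 R \<subseteq> (\<Union>i\<in>J1 k \<times> J2 k. S k i)" for k
    proof clarify
      fix t and y :: "real^'n" assume "t \<in> {-T..T}" "y \<in> cball 0 R"
      then have "(\<tau> k t, grid_index k y) \<in> J1 k \<times> J2 k" "(t, y) \<in> S k (\<tau> k t, grid_index k y)" by (auto simp: J1_def J2_def S_def)
      then show "(t, y) \<in> (\<Union>i\<in>J1 k \<times> J2 k. S k i)" by blast
    qed
    show "bounded (S k i) \<and> diameter (S k i) \<le> d k" for k i
    proof
      have "bounded ({-T..T} \<times> cball (0::real^'n) R)" by (intro bounded_Times) auto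
      then show "bounded (S k i)" by (rule bounded_subset) (auto simp: S_def)
      show "diameter (S k i) \<le> d k"
      proof (rule diameter_le)
        show "S k i \<noteq> {} \<or> 0 \<le> d k" by (simp add: d_def)
        fix p q assume p: "p \<in> S k i" and q: "q \<in> S k i"
        have "norm (p - q) \<le> norm (fst (p - q)) + norm (snd (p - q))"
          by (metis norm_Pair_le prod.collapse)
        also have "norm (fst (p - q)) \<le> 1 / real (Suc k)" using time[of k "fst p" "fst q"] p q by (auto simp: S_def)
        also have "norm (snd (p - q)) \<le> real n / real (Suc k)"
        proof -
          have "snd p \<in> grid_cube k (snd i)" "snd q \<in> grid_cube k (snd i)"
            using p q mem_grid_cube_grid_index[of "snd p" k] mem_grid_cube_grid_index[of "snd q" k] by (auto simp: S_def)
          then show ?thesis unfolding n_def snd_diff by (rule norm_diff_grid_cube_le)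
        qed
        finally show "norm (p - q) \<le> d k" by (simp add: d_def add_divide_distrib)
      qed
    qed
    show "d \<longlonglongrightarrow> 0"
      using tendsto_mult[OF tendsto_const[of "1 + real n"] LIMSEQ_inverse_real_of_nat]
      by (simp add: d_def[abs_def] divide_inverse)
    show "(\<Sum>i\<in>J1 k \<times> J2 k. ennreal (d k) * emeasure lborel (W k i)) \<le> ennreal C * (ennreal (2 ^ n) * I \<Omega>)" for k
    proof -
      have d0: "0 \<le> d k" by (simp add: d_def)
      have "(\<Sum>i\<in>J1 k \<times> J2 k. ennreal (d k) * emeasure lborel (W k i))
          \<le> (\<Sum>i\<in>J1 k \<times> J2 k. ennreal (d k) * (ennreal (2 ^ n) * I (grid_cube k (snd i))))"
        by (intro sum_mono mult_left_mono W(3)) auto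
      also have "\<dots> = (\<Sum>j\<in>J1 k. \<Sum>z\<in>J2 k. ennreal (d k) * (ennreal (2 ^ n) * I (grid_cube k z)))"
        by (subst sum.cartesian_product) (auto intro!: sum.cong)
      also have "\<dots> = (\<Sum>j\<in>J1 k. ennreal (d k) * (ennreal (2 ^ n) * (\<Sum>z\<in>J2 k. I (grid_cube k z))))"
        by (simp only: sum_distrib_left)
      also have "\<dots> = of_nat (card (J1 k)) * (ennreal (d k) * (ennreal (2 ^ n) * (\<Sum>z\<in>J2 k. I (grid_cube k z))))"
        by (rule sum_constant)
      also have "\<dots> = ennreal (real (card (J1 k)) * d k) * (ennreal (2 ^ n) * (\<Sum>z\<in>J2 k. I (grid_cube k z)))"
        using d0 by (simp only: ennreal_mult[OF _ d0] of_nat_0_le_iff ennreal_of_nat_eq_real_of_nat mult.assoc)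
      also have "\<dots> \<le> ennreal C * (ennreal (2 ^ n) * I \<Omega>)"
      proof (intro mult_mono ennreal_leI order_refl)
        have "real (card (J1 k)) * d k \<le> (2 * real (Suc k) * T + 2) * d k" by (rule mult_right_mono[OF J1(2) d0])
        also have "\<dots> \<le> (real (Suc k) * (2 * T + 2)) * d k" using d0 by (intro mult_right_mono) (auto simp: algebra_simps)
        also have "\<dots> = C" by (simp add: d_def C_def)
        finally show "real (card (J1 k)) * d k \<le> C" .
        show "(\<Sum>z\<in>J2 k. I (grid_cube k z)) \<le> I \<Omega>"
          unfolding I_def by (rule sum_nn_integral_grid_cube_le) (use \<Theta>(1) J2 grid\<Omega> \<Omega>(2) in auto)
      qed auto
      finally show ?thesis .
    qed
    show "ennreal C * (ennreal (2 ^ n) * I \<Omega>) < \<infinity>"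
      using \<Theta>(2) by (simp add: I_def ennreal_mult_less_top)
  qed (use W in auto)
qed

text \<open>The displacement is at most |y| / 2 for large y, uniformly in |t| \<le> T, so the
  space-time fibre over x stays in a ball of radius max R0 (2 |x|). One null set handles all integer
  radii.\<close>

lemma fibre_hausdorff1_finite_AE:
  assumes T: "T > 0"
  shows "AE x in lebesgue. hausdorff1 {(t, y). t \<in> {-T..T} \<and> F t y = x} < \<infinity>"
proof -
  obtain R0 where R0: "\<And>y t. norm y \<ge> R0 \<Longrightarrow> \<bar>t\<bar> \<le> T \<Longrightarrow> norm (F t y - y) \<le> 1/2 * norm y"
    using F_near_identity[of T "1/2"] T by auto
  have "AE x in lborel. \<forall>k::nat. hausdorff1 (({-T..T} \<times> cball 0 (real k)) \<inter> (\<lambda>(t, y). F t y) -` {x}) < \<infinity>"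
    unfolding AE_all_countable by (intro allI fibre_hausdorff1_finite_cball[OF T])
  then have "AE x in lebesgue. \<forall>k::nat. hausdorff1 (({-T..T} \<times> cball 0 (real k)) \<inter> (\<lambda>(t, y). F t y) -` {x}) < \<infinity>"
    by (rule AE_completion)
  then show ?thesis
  proof eventually_elim
    case (elim x)
    obtain k :: nat where k: "max R0 (2 * norm x) \<le> real k" using real_arch_simple by blast
    have "norm y \<le> real k" if "t \<in> {-T..T}" "F t y = x" for t y
    proof (cases "norm y \<ge> R0")
      case True
      then have "norm (x - y) \<le> 1/2 * norm y" using R0[of y t] that by (auto simp: abs_le_iff)
      then show ?thesis using norm_triangle_sub[of y x] k by (simp add: norm_minus_commute)
    qed (use k in auto)
    then have eq: "{(t, y). t \<in> {-T..T} \<and> F t y = x} = ({-T..T} \<times> cball 0 (real k)) \<inter> (\<lambda>(t, y). F t y) -` {x}"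
      unfolding set_eq_iff split_paired_All by (simp del: atLeastAtMost_iff) blast
    show ?case unfolding eq using elim by (rule spec)
  qed
qed

end

text \<open>\<open>G\<close> is the gradient of \<open>H\<close> and \<open>DG\<close> its Hessian
  as a bounded linear map, so the norm in \<open>bound_hess\<close> is the operator norm. The
  multiplicity bound is written with a nonnegative integral, which makes sense without presupposing
  that the L^N norm is finite.\<close>

theorem theorem2p3:
  fixes H :: "(real^'n) \<times> (real^'n) \<Rightarrow> real"
    and G :: "(real^'n) \<times> (real^'n) \<Rightarrow> (real^'n) \<times> (real^'n)"
    and DG :: "(real^'n) \<times> (real^'n) \<Rightarrow> ((real^'n) \<times> (real^'n)) \<Rightarrow>\<^sub>L ((real^'n) \<times> (real^'n))"
    and \<kappa> :: real and h :: "real \<Rightarrow> real"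
    and \<Phi> :: "real \<Rightarrow> (real^'n) \<times> (real^'n) \<Rightarrow> (real^'n) \<times> (real^'n)"
    and U :: "real^'n \<Rightarrow> real^'n"
    and F :: "real \<Rightarrow> real^'n \<Rightarrow> real^'n"
  assumes H_grad: "\<And>p. (H has_derivative (\<lambda>v. G p \<bullet> v)) (at p)"
    and H_hess: "\<And>p. (G has_derivative blinfun_apply (DG p)) (at p)"
    and H_C2: "continuous_on UNIV DG"
    and kappa_pos: "\<kappa> > 0"
    and h_cont: "continuous_on UNIV h" and h_nonneg: "\<And>r. h r \<ge> 0"
    and h_sublin: "((\<lambda>r. h r / r) \<longlongrightarrow> 0) at_top"
    and bound_xi: "\<And>x \<xi>. norm (snd (G (x, \<xi>))) \<le> \<kappa> * (1 + norm \<xi>)"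
    and bound_x: "\<And>x \<xi>. norm (fst (G (x, \<xi>))) \<le> h (norm x) + \<kappa> * norm \<xi>"
    and bound_hess: "\<And>p. norm (DG p) \<le> \<kappa>"
    and flow_0: "\<And>p. \<Phi> 0 p = p"
    and flow_ode: "\<And>p t. ((\<lambda>s. \<Phi> s p) has_vector_derivative
                     (snd (G (\<Phi> t p)), - fst (G (\<Phi> t p)))) (at t)"
    and U_cont: "continuous_on UNIV U"
    and U_sublin: "((\<lambda>y. norm (U y) / norm y) \<longlongrightarrow> 0) at_infinity"
    and F_def: "\<And>t y. F t y = fst (\<Phi> t (y, U y))"
  shows
    "(\<forall>t. (\<forall>K. compact K \<longrightarrow> compact (F t -` K)) \<and> surj (F t))
     \<and> (\<forall>T>0. \<forall>\<epsilon>>0. \<exists>R. \<forall>y t. norm y \<ge> R \<and> \<bar>t\<bar> \<le> T \<longrightarrow>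
                               norm (F t y - y) \<le> \<epsilon> * norm y)
     \<and> ((\<forall>\<Omega>. bounded \<Omega> \<and> open \<Omega> \<longrightarrow> (\<forall>k l. weak_deriv_in_lorentz U k l \<Omega>)) \<longrightarrow>
          nondiff_set U \<in> null_sets lebesgue
        \<and> (\<forall>t. \<forall>K. compact K \<longrightarrow> set_integrable lebesgue K (jac_det U F t))
        \<and> (\<forall>t. AE x in lebesgue. finite (F t -` {x}))
        \<and> (\<forall>t R n. R > 0 \<and> n \<ge> 1 \<longrightarrow>
              {x. count_R F R t x \<ge> enat n} \<in> sets lebesgue \<and>
              emeasure lebesgue {x. count_R F R t x \<ge> enat n}
                \<le> ennreal (exp (real CARD('n) * \<kappa> * \<bar>t\<bar>) / real n) *
                   (\<integral>\<^sup>+ y\<in>ball 0 R. ennreal ((1 + onorm (frechet_derivative U (at y))) ^ CARD('n)) \<partial>lebesgue))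
        \<and> (\<forall>t. caustic U F t \<in> null_sets lebesgue)
        \<and> (\<forall>T>0. AE x in lebesgue.
              hausdorff1 {(t, y). t \<in> {-T..T} \<and> F t y = x} < \<infinity>))"
proof -
  interpret hamiltonian_transport G DG \<kappa> h \<Phi> U F
    by unfold_locales (fact assms)+
  show ?thesis
  proof (intro conjI allI impI)
    show "compact (F t -` K)" if "compact K" for t K using that by (rule F_proper)
    show "surj (F t)" for t by (rule F_surj)
    show "\<exists>R. \<forall>y t. norm y \<ge> R \<and> \<bar>t\<bar> \<le> T \<longrightarrow> norm (F t y - y) \<le> \<epsilon> * norm y" if "T > 0" "\<epsilon> > 0" for T \<epsilon>
      using that by (rule F_near_identity)
  next
    assume weak: "\<forall>\<Omega>. bounded \<Omega> \<and> open \<Omega> \<longrightarrow> (\<forall>k l. weak_deriv_in_lorentz U k l \<Omega>)"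
    interpret lorentz_transport G DG \<kappa> h \<Phi> U F
      by unfold_locales (use weak in blast)
    show "nondiff_set U \<in> null_sets lebesgue"
      using nondiff_negligible by (simp only: negligible_iff_null_sets)
    show "set_integrable lebesgue K (jac_det U F t)" if "compact K" for t K
      using that by (rule jac_det_integrable)
    show "AE x in lebesgue. finite (F t -` {x})" for t by (rule fiber_finite_AE)
    fix t R :: real and n :: nat
    assume n: "R > 0 \<and> n \<ge> 1"
    show "{x. count_R F R t x \<ge> enat n} \<in> sets lebesgue"
      using n by (intro count_measure) simp
    show "emeasure lebesgue {x. count_R F R t x \<ge> enat n} \<le> ennreal (exp (real CARD('n) * \<kappa> * \<bar>t\<bar>) / real n) *
        (\<integral>\<^sup>+ y\<in>ball 0 R. ennreal ((1 + onorm (frechet_derivative U (at y))) ^ CARD('n)) \<partial>lebesgue)"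
      using n by (intro count_measure) simp
  next
    assume weak: "\<forall>\<Omega>. bounded \<Omega> \<and> open \<Omega> \<longrightarrow> (\<forall>k l. weak_deriv_in_lorentz U k l \<Omega>)"
    interpret lorentz_transport G DG \<kappa> h \<Phi> U F
      by unfold_locales (use weak in blast)
    show "caustic U F t \<in> null_sets lebesgue" for t by (rule caustic_null)
    show "AE x in lebesgue. hausdorff1 {(t, y). t \<in> {-T..T} \<and> F t y = x} < \<infinity>" if "T > 0" for T
      using that by (rule fibre_hausdorff1_finite_AE)
  qed
qed

end
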